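(* Let $\{w_T\}_{T\in\mathcal F}$ be an $X$-inert family of functions $w_T(t_1,\dots,t_d)$, supported on $t_1\asymp Z$ and $t_i\asymp X_i$ for $i=2,\dots,d$. For each $T$ let $\phi=\phi_T$ be a smooth real-valued function on $\mathbb R^d$, and write $\phi',\phi''$ for the first and second partial derivatives of $\phi$ with respect to $t_1$. Suppose that on the support of $w_T$, for all integers $a_1,\dots,a_d\ge 0$, $$\frac{\partial^{a_1+a_2+\cdots+a_d}}{\partial t_1^{a_1}\cdots\partial t_d^{a_d}}\phi(t_1,t_2,\dots,t_d)\ll_{C_{\mathcal F}} \frac{Y}{Z^{a_1}}\,\frac{1}{X_2^{a_2}\cdots X_d^{a_d}} .$$ Suppose $\phi''(t_1,t_2,\dots,t_d)\gg Y/Z^2$ for all $t_1,t_2,\dots,t_d$ in the support of $w_T$, and that there exists $t_0\in\mathbb R$ (depending on $t_2,\dots,t_d$) such that $\phi'(t_0)=\phi'(t_0,t_2,\dots,t_d)=0$ (note $t_0$ is necessarily unique). Suppose that $Y/X^2\ge R\ge 1$. Then $$\int_{\mathbb R} e^{i\phi(t_1,\dots,t_d)}w_T(t_1,\dots,t_d)\,dt_1=\frac{Z}{\sqrt Y}\,e^{i\phi(t_0,t_2,\dots,t_d)}\,W_T(t_2,\dots,t_d)+O_A(ZR^{-A})$$ for some $X$-inert family of functions $W_T$, where $A>0$ may be taken to be arbitrarily large. The implied constant depends only on $A$ and $C_{\mathcal F}$.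
   Context: Inert families. Let $\mathcal F$ be an index set and $X=X_T:\mathcal F\to\mathbb R_{\ge1}$ a function of $T\in\mathcal F$. A family $\{w_T\}_{T\in\mathcal F}$ of smooth functions supported on a product of dyadic intervals in $\mathbb R_{>0}^d$ is called $X$-inert if for each $j=(j_1,\dots,j_d)\in\mathbb Z_{\ge0}^d$ $$C(j_1,\dots,j_d):=\sup_{T\in\mathcal F}\ \sup_{(x_1,\dots,x_d)\in\mathbb R_{>0}^d}X_T^{-j_1-\cdots-j_d}\left|x_1^{j_1}\cdots x_d^{j_d}\,w_T^{(j_1,\dots,j_d)}(x_1,\dots,x_d)\right|<\infty .$$ The collection of constants $C(j_1,\dots,j_d)$ is abbreviated $C_{\mathcal F}$. Conventions. The quantities $Z,Y,R,X_2,\dots,X_d,X$ are positive reals which may depend on $T$. Constants implied by $\ll$, $\gg$, $\asymp$ and $O(\cdot)$ are uniform with respect to $\mathcal F$ and depend only on $C_{\mathcal F}$; dependence on an additional parameter such as $A$ is indicated by a subscript.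
   Formalization: The uniqueness of t_0, which does not follow from φ''≫Y/Z² on the support alone (two critical points on disjoint pieces of the support break the claim), is assumed: any zero of φ' at a point of the support of w_T is t_0. *)

theory Defs
  imports "HOL-Analysis.Analysis"
begin

text \<open>
  A function of real variables indexed by a finite set \<open>I\<close> of naturals is represented as a function
  on \<open>nat \<Rightarrow> real\<close> that depends only on the coordinates in \<open>I\<close>.  For such functions, continuity
  and closure in the product topology of \<open>nat \<Rightarrow> real\<close> agree with those of the Euclidean space
  with coordinates \<open>I\<close>.  Thus functions of \<open>t\<^sub>1, \<dots>, t\<^sub>d\<close> use \<open>I = {1..d}\<close>, and functions of
  \<open>t\<^sub>2, \<dots>, t\<^sub>d\<close> use \<open>I = {2..d}\<close>, which is empty when \<open>d = 1\<close>.
\<close>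

definition depends_only_on :: "nat set \<Rightarrow> ((nat \<Rightarrow> real) \<Rightarrow> 'a) \<Rightarrow> bool" where
  "depends_only_on I f \<longleftrightarrow> (\<forall>x y. (\<forall>i\<in>I. x i = y i) \<longrightarrow> f x = f y)"

definition partial_deriv ::
    "nat \<Rightarrow> ((nat \<Rightarrow> real) \<Rightarrow> 'a::real_normed_vector) \<Rightarrow> (nat \<Rightarrow> real) \<Rightarrow> 'a" where
  "partial_deriv i f x = vector_derivative (\<lambda>s. f (x(i := s))) (at (x i))"

text \<open>
  Smoothness: the partial derivatives of all orders, taken in any order of the variables, exist and
  are continuous.
\<close>

definition smooth_fun :: "nat set \<Rightarrow> ((nat \<Rightarrow> real) \<Rightarrow> 'a::real_normed_vector) \<Rightarrow> bool" where
  "smooth_fun I f \<longleftrightarrow> depends_only_on I f \<and>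
     (\<forall>ks\<in>lists I. continuous_on UNIV (foldr partial_deriv ks f) \<and>
        (\<forall>i\<in>I. \<forall>x. (\<lambda>s. foldr partial_deriv ks f (x(i := s))) differentiable (at (x i))))"

definition mixed_deriv ::
    "nat set \<Rightarrow> (nat \<Rightarrow> nat) \<Rightarrow> ((nat \<Rightarrow> real) \<Rightarrow> 'a::real_normed_vector) \<Rightarrow> (nat \<Rightarrow> real) \<Rightarrow> 'a" where
  "mixed_deriv I j f = foldr (\<lambda>i. partial_deriv i ^^ j i) (sorted_list_of_set I) f"

definition fun_support :: "((nat \<Rightarrow> real) \<Rightarrow> 'a::zero) \<Rightarrow> (nat \<Rightarrow> real) set" where
  "fun_support f = closure {x. f x \<noteq> 0}"

text \<open>The constants \<open>C(j)\<close> whose collection is written \<open>C\<^sub>F\<close>.\<close>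

definition inert_const ::
    "nat set \<Rightarrow> 'i set \<Rightarrow> ('i \<Rightarrow> real) \<Rightarrow> ('i \<Rightarrow> (nat \<Rightarrow> real) \<Rightarrow> complex) \<Rightarrow> (nat \<Rightarrow> nat) \<Rightarrow> ennreal" where
  "inert_const I F X w j =
     (SUP T\<in>F. SUP x\<in>{x. \<forall>i\<in>I. 0 < x i}.
        ennreal (norm ((\<Prod>i\<in>I. x i ^ j i) *\<^sub>R mixed_deriv I j (w T) x) / X T ^ (\<Sum>i\<in>I. j i)))"

text \<open>A dyadic interval is an interval \<open>[a, 2a]\<close> with \<open>a > 0\<close>.\<close>

definition inert_family ::
    "nat set \<Rightarrow> 'i set \<Rightarrow> ('i \<Rightarrow> real) \<Rightarrow> ('i \<Rightarrow> (nat \<Rightarrow> real) \<Rightarrow> complex) \<Rightarrow> bool" where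
  "inert_family I F X w \<longleftrightarrow>
     (\<forall>T\<in>F. 1 \<le> X T) \<and>
     (\<forall>T\<in>F. smooth_fun I (w T)) \<and>
     (\<forall>T\<in>F. \<exists>a. (\<forall>i\<in>I. 0 < a i) \<and>
        fun_support (w T) \<subseteq> {x. \<forall>i\<in>I. a i \<le> x i \<and> x i \<le> 2 * a i}) \<and>
     (\<forall>j. inert_const I F X w j < \<infinity>)"

end

theory Submission
  imports Defs
begin

text \<open>
  Put \<open>\<kappa>\<^sup>1\<^sup>2 = Y / X\<^sup>2\<close>.  After rescaling \<open>t\<^sub>1\<close> by \<open>Z\<close>, repeated integration by parts shows that the
  part of the integral at distance at least \<open>\<kappa> / sqrt Y\<close> from the critical point is \<open>O(\<kappa>\<^sup>-\<^sup>N)\<close> for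
  every \<open>N\<close>; nearer to it, a Taylor expansion around the quadratic part of the phase gives an
  asymptotic series in powers of \<open>\<kappa>\<^sup>-\<^sup>2\<close> whose coefficients are functions on the critical graph
  \<open>t\<^sub>1 = t\<^sub>0(t\<^sub>2, \<dots>, t\<^sub>d)\<close>.  By implicit differentiation, a derivative in \<open>t\<^sub>i\<close> along this graph is a
  derivative of the same symbolic type on the full space, so every coefficient is inert.  A Borel
  summation, truncating the series at an index that grows slowly with \<open>\<kappa>\<close>, turns the series into a
  single inert function \<open>W\<close> with an error smaller than any power of \<open>\<kappa>\<close>.
\<close>

section \<open>Derivative sequences of products, exponentials and reciprocals\<close>

text \<open>The phase is controlled only on the support of the weight, and the critical point may
  lie outside that support or close to its edge. Integration by parts and the local expansion thus
  meet points where h' is small without a critical point at hand. Convexity resolves this: within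
  |h'(x)|/c of any x in the support lies either a zero of h' or a point outside the support, where
  the amplitude vanishes to infinite order; this flatness pays for every division by h'. The
  exponent 12 has its origin in y = sqrt Y = X \<kappa>^6: the length \<kappa>/y exceeds the
  Gaussian width 1/y by the factor \<kappa>, yet keeps the third-order part of the phase bounded,
  and 6 is the least exponent with y^2 \<le> (y/\<kappa>^2)^3. All estimates are made for fixed
  sequences of derivative bounds before any family is named, since the implied constants may depend
  on nothing else. The critical point t0 is merely a given function; its differentiability is
  derived where the critical graph meets the support. The Fresnel moments enter as limits that do
  not depend on the data.\<close>

text \<open>
  If \<open>a n\<close> and \<open>b n\<close> are the \<open>n\<close>-th derivatives of two functions at a point, then \<open>bconv a b n\<close>,
  \<open>exp_seq a n\<close> and \<open>inv_seq a n\<close> are those of the product, the exponential and the reciprocal.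
\<close>

definition bconv :: "(nat \<Rightarrow> complex) \<Rightarrow> (nat \<Rightarrow> complex) \<Rightarrow> nat \<Rightarrow> complex" where
  "bconv a b n = (\<Sum>k\<le>n. of_nat (n choose k) * a k * b (n - k))"

lemma bconv_0 [simp]: "bconv a b 0 = a 0 * b 0"
  by (simp add: bconv_def)

lemma bconv_Suc:
  "bconv a b (Suc n) = (\<Sum>k\<le>n. of_nat (n choose k) * (a (Suc k) * b (n - k) + a k * b (Suc n - k)))"
proof -
  have "bconv a b (Suc n) = a 0 * b (Suc n) + (\<Sum>k\<le>n. of_nat (Suc n choose Suc k) * a (Suc k) * b (n - k))"
    unfolding bconv_def by (subst sum.atMost_Suc_shift) simp
  also have "\<dots> = (\<Sum>k\<le>n. of_nat (n choose k) * (a (Suc k) * b (n - k))) +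
     (a 0 * b (Suc n) + (\<Sum>k\<le>n. of_nat (n choose Suc k) * a (Suc k) * b (n - k)))"
    by (simp add: algebra_simps sum.distrib)
  also have "a 0 * b (Suc n) + (\<Sum>k\<le>n. of_nat (n choose Suc k) * a (Suc k) * b (n - k))
      = (\<Sum>k\<le>Suc n. of_nat (n choose k) * a k * b (Suc n - k))"
    by (subst sum.atMost_Suc_shift) simp
  also have "\<dots> = (\<Sum>k\<le>n. of_nat (n choose k) * (a k * b (Suc n - k)))"
    by (simp add: mult.assoc)
  finally show ?thesis by (simp add: algebra_simps sum.distrib)
qed

lemma bconv_has_vector_derivative:
  assumes "\<And>k. k \<le> n \<Longrightarrow> ((\<lambda>x. a x k) has_vector_derivative a x (Suc k)) (at x)"
    and "\<And>k. k \<le> n \<Longrightarrow> ((\<lambda>x. b x k) has_vector_derivative b x (Suc k)) (at x)"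
  shows "((\<lambda>x. bconv (a x) (b x) n) has_vector_derivative bconv (a x) (b x) (Suc n)) (at x)"
  unfolding bconv_Suc unfolding bconv_def
proof (rule has_vector_derivative_sum)
  fix k assume "k \<in> {..n}"
  then have k: "k \<le> n" by simp
  have "((\<lambda>x. of_nat (n choose k) * (a x k * b x (n - k))) has_vector_derivative
        of_nat (n choose k) * (a x k * b x (Suc (n - k)) + a x (Suc k) * b x (n - k))) (at x)"
    by (intro has_vector_derivative_mult_right has_vector_derivative_mult assms) (use k in auto)
  then show "((\<lambda>x. of_nat (n choose k) * a x k * b x (n - k)) has_vector_derivative
        of_nat (n choose k) * (a x (Suc k) * b x (n - k) + a x k * b x (Suc n - k))) (at x)"
    using k by (simp add: Suc_diff_le algebra_simps)
qed

lemma norm_bconv_le: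
  fixes a b :: "nat \<Rightarrow> complex"
  assumes "\<And>k. k \<le> n \<Longrightarrow> norm (a k) \<le> A * \<theta> ^ k" and "\<And>k. k \<le> n \<Longrightarrow> norm (b k) \<le> B * \<theta> ^ k"
    and "0 \<le> \<theta>"
  shows "norm (bconv a b n) \<le> 2 ^ n * (A * B * \<theta> ^ n)"
proof -
  have "norm (bconv a b n) \<le> (\<Sum>k\<le>n. of_nat (n choose k) * (A * B * \<theta> ^ n))"
    unfolding bconv_def
  proof (rule sum_norm_le)
    fix k assume "k \<in> {..n}"
    then have k: "k \<le> n" by simp
    have "norm (a k) * norm (b (n - k)) \<le> (A * \<theta> ^ k) * (B * \<theta> ^ (n - k))"
      by (rule mult_mono) (use assms(1)[OF k] assms(2)[of "n - k"] in \<open>auto intro: order_trans[OF norm_ge_zero]\<close>)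
    also have "\<dots> = A * B * \<theta> ^ n" using k by (simp add: power_add [symmetric])
    finally show "norm (of_nat (n choose k) * a k * b (n - k)) \<le> of_nat (n choose k) * (A * B * \<theta> ^ n)"
      by (simp add: norm_mult mult.assoc mult_left_mono)
  qed
  also have "\<dots> = of_nat (\<Sum>k\<le>n. n choose k) * (A * B * \<theta> ^ n)"
    by (simp add: sum_distrib_right)
  also have "\<dots> = 2 ^ n * (A * B * \<theta> ^ n)" by (simp add: choose_row_sum)
  finally show ?thesis .
qed

fun exp_seq :: "(nat \<Rightarrow> complex) \<Rightarrow> nat \<Rightarrow> complex" where
  "exp_seq a 0 = exp (a 0)"
| "exp_seq a (Suc n) = (\<Sum>k\<le>n. of_nat (n choose k) * a (Suc k) * exp_seq a (n - k))"

lemma exp_seq_Suc: "exp_seq a (Suc n) = bconv (\<lambda>k. a (Suc k)) (exp_seq a) n"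
  by (simp add: bconv_def)

declare exp_seq.simps(2) [simp del]

lemma exp_seq_has_vector_derivative:
  assumes "\<And>k. ((\<lambda>x. a x k) has_vector_derivative a x (Suc k)) (at x)"
  shows "((\<lambda>x. exp_seq (a x) n) has_vector_derivative exp_seq (a x) (Suc n)) (at x)"
proof (induction n rule: less_induct)
  case (less n)
  show ?case
  proof (cases n)
    case 0
    have "((\<lambda>x. exp (a x 0)) has_vector_derivative a x 1 * exp (a x 0)) (at x)"
      using field_vector_diff_chain_at[OF assms[of 0] DERIV_exp[of "a x 0"]] by (simp add: o_def)
    then show ?thesis by (simp add: 0 exp_seq.simps(2))
  next
    case (Suc m)
    show ?thesis unfolding Suc exp_seq_Suc[of _ m] exp_seq_Suc[of _ "Suc m"]
      by (rule bconv_has_vector_derivative) (use less Suc assms in auto)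
  qed
qed

text \<open>A purely imaginary \<open>a 0\<close> makes the exponential itself of modulus one, so
  only derivatives of the exponent contribute. Counting weight k for \<open>a k\<close>, each step
  of the recursion preserves the total weight. \<open>C\<close> is chosen before \<open>a\<close>
  and \<theta>; the uniformity of later constants starts here.\<close>

lemma norm_exp_seq_le:
  assumes M: "\<And>k. 1 \<le> M k"
  shows "\<exists>C\<ge>1. \<forall>a \<theta>. 0 \<le> \<theta> \<longrightarrow> Re (a 0) = 0 \<longrightarrow> (\<forall>k. 1 \<le> k \<longrightarrow> k \<le> n \<longrightarrow> norm (a k) \<le> M k * \<theta> ^ k) \<longrightarrow>
           norm (exp_seq a n) \<le> C * \<theta> ^ n"
proof (induction n rule: less_induct)
  case (less n)
  show ?case
  proof (cases n)
    case 0
    show ?thesis by (rule exI[of _ 1]) (simp add: 0)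
  next
    case (Suc m)
    from less have "\<forall>j\<in>{..m}. \<exists>C\<ge>1. \<forall>a \<theta>. 0 \<le> \<theta> \<longrightarrow> Re (a 0) = 0 \<longrightarrow>
        (\<forall>k. 1 \<le> k \<longrightarrow> k \<le> j \<longrightarrow> norm (a k) \<le> M k * \<theta> ^ k) \<longrightarrow> norm (exp_seq a j) \<le> C * \<theta> ^ j"
      using Suc by (meson atMost_iff less_Suc_eq_le)
    from bchoice[OF this] obtain C where C: "\<And>j. j \<le> m \<Longrightarrow> C j \<ge> 1"
      "\<And>j a \<theta>. j \<le> m \<Longrightarrow> 0 \<le> \<theta> \<Longrightarrow> Re (a 0) = 0 \<Longrightarrow>
        (\<forall>k. 1 \<le> k \<longrightarrow> k \<le> j \<longrightarrow> norm (a k) \<le> M k * \<theta> ^ k) \<Longrightarrow> norm (exp_seq a j) \<le> C j * \<theta> ^ j"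
      by (metis atMost_iff)
    define D where "D = (\<Sum>j\<le>m. C j)"
    define E where "E = (\<Sum>j\<le>m. M (Suc j))"
    have CD: "C j \<le> D" if "j \<le> m" for j unfolding D_def
      by (rule member_le_sum) (use that C(1) in \<open>auto intro: order_trans[OF zero_le_one]\<close>)
    have ME: "M (Suc j) \<le> E" if "j \<le> m" for j unfolding E_def
      by (rule member_le_sum) (use that M in \<open>auto intro: order_trans[OF zero_le_one]\<close>)
    have "D \<ge> 1" using C(1)[of m] CD[of m] by simp
    have "E \<ge> 1" using M[of "Suc m"] ME[of m] by simp
    show ?thesis
    proof (rule exI[of _ "2 ^ m * E * D"], intro conjI allI impI)
      show "1 \<le> 2 ^ m * E * D" using \<open>D \<ge> 1\<close> \<open>E \<ge> 1\<close>
        by (intro mult_ge1_I) auto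
      fix a :: "nat \<Rightarrow> complex" and \<theta> :: real
      assume th: "0 \<le> \<theta>" and a0: "Re (a 0) = 0"
        and a: "\<forall>k. 1 \<le> k \<longrightarrow> k \<le> n \<longrightarrow> norm (a k) \<le> M k * \<theta> ^ k"
      have "norm (bconv (\<lambda>k. a (Suc k)) (exp_seq a) m) \<le> 2 ^ m * ((E * \<theta>) * D * \<theta> ^ m)"
      proof (rule norm_bconv_le)
        fix k assume k: "k \<le> m"
        have "norm (a (Suc k)) \<le> M (Suc k) * \<theta> ^ Suc k" using a k Suc by auto
        also have "\<dots> \<le> E * \<theta> ^ Suc k" using ME[OF k] th by (intro mult_right_mono) auto
        finally show "norm (a (Suc k)) \<le> E * \<theta> * \<theta> ^ k" by (simp add: mult.assoc)
        have "norm (exp_seq a k) \<le> C k * \<theta> ^ k" using a k Suc th a0 by (intro C(2)) auto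
        also have "\<dots> \<le> D * \<theta> ^ k" using CD[OF k] th by (intro mult_right_mono) auto
        finally show "norm (exp_seq a k) \<le> D * \<theta> ^ k" .
      qed (use th in auto)
      then show "norm (exp_seq a n) \<le> 2 ^ m * E * D * \<theta> ^ n"
        by (simp add: Suc exp_seq_Suc mult_ac)
    qed
  qed
qed

text \<open>The reciprocal r of a function f satisfies r' = - f' r^2, and the nested sums are the
  Leibniz expansion of the n-th derivative of the right-hand side. Hence only the base case
  divides.\<close>

fun inv_seq :: "(nat \<Rightarrow> complex) \<Rightarrow> nat \<Rightarrow> complex" where
  "inv_seq a 0 = inverse (a 0)"
| "inv_seq a (Suc n) = - (\<Sum>k\<le>n. of_nat (n choose k) * a (Suc k) *
      (\<Sum>j\<le>n - k. of_nat ((n - k) choose j) * inv_seq a j * inv_seq a (n - k - j)))"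

lemma inv_seq_Suc: "inv_seq a (Suc n) = - bconv (\<lambda>k. a (Suc k)) (bconv (inv_seq a) (inv_seq a)) n"
  by (simp add: bconv_def)

declare inv_seq.simps(2) [simp del]

lemma inv_seq_has_vector_derivative:
  assumes "\<And>k. ((\<lambda>x. a x k) has_vector_derivative a x (Suc k)) (at x)" and "a x 0 \<noteq> 0"
  shows "((\<lambda>x. inv_seq (a x) n) has_vector_derivative inv_seq (a x) (Suc n)) (at x)"
proof (induction n rule: less_induct)
  case (less n)
  show ?case
  proof (cases n)
    case 0
    have "((\<lambda>x. inverse (a x 0)) has_vector_derivative a x 1 * - (inverse (a x 0) ^ 2)) (at x)"
      using field_vector_diff_chain_at[OF assms(1)[of 0] DERIV_inverse[OF assms(2)]]
      by (simp add: o_def numeral_2_eq_2)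
    then show ?thesis by (simp add: 0 inv_seq_Suc power2_eq_square)
  next
    case (Suc m)
    show ?thesis unfolding Suc inv_seq_Suc[of _ m] inv_seq_Suc[of _ "Suc m"]
      by (intro has_vector_derivative_minus bconv_has_vector_derivative) (use less Suc assms in auto)
  qed
qed

text \<open>Each differentiation of 1/a produces one further factor 1/a while the derivatives of
  \<open>a\<close> stay bounded: one power of \<theta> per derivative, and one for the reciprocal
  itself.\<close>

lemma norm_inv_seq_le:
  assumes M: "\<And>k. 1 \<le> M k"
  shows "\<exists>C\<ge>1. \<forall>a \<theta>. 1 \<le> \<theta> \<longrightarrow> norm (inverse (a 0)) \<le> \<theta> \<longrightarrow> (\<forall>k\<ge>1. norm (a k) \<le> M k) \<longrightarrow>
           norm (inv_seq a n) \<le> C * \<theta> ^ Suc n"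
proof (induction n rule: less_induct)
  case (less n)
  show ?case
  proof (cases n)
    case 0
    show ?thesis by (rule exI[of _ 1]) (simp add: 0)
  next
    case (Suc m)
    from less have "\<forall>j\<in>{..m}. \<exists>C\<ge>1. \<forall>a \<theta>. 1 \<le> \<theta> \<longrightarrow> norm (inverse (a 0)) \<le> \<theta> \<longrightarrow>
        (\<forall>k\<ge>1. norm (a k) \<le> M k) \<longrightarrow> norm (inv_seq a j) \<le> C * \<theta> ^ Suc j"
      using Suc by (meson atMost_iff less_Suc_eq_le)
    from bchoice[OF this] obtain C where C: "\<And>j. j \<le> m \<Longrightarrow> C j \<ge> 1"
      "\<And>j a \<theta>. j \<le> m \<Longrightarrow> 1 \<le> \<theta> \<Longrightarrow> norm (inverse (a 0)) \<le> \<theta> \<Longrightarrow>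
        (\<forall>k\<ge>1. norm (a k) \<le> M k) \<Longrightarrow> norm (inv_seq a j) \<le> C j * \<theta> ^ Suc j"
      by (metis atMost_iff)
    define D where "D = (\<Sum>j\<le>m. C j)"
    define E where "E = (\<Sum>j\<le>m. M (Suc j))"
    have CD: "C j \<le> D" if "j \<le> m" for j unfolding D_def
      by (rule member_le_sum) (use that C(1) in \<open>auto intro: order_trans[OF zero_le_one]\<close>)
    have ME: "M (Suc j) \<le> E" if "j \<le> m" for j unfolding E_def
      by (rule member_le_sum) (use that M in \<open>auto intro: order_trans[OF zero_le_one]\<close>)
    have "D \<ge> 1" using C(1)[of m] CD[of m] by simp
    have "E \<ge> 1" using M[of "Suc m"] ME[of m] by simp
    have two: "2 ^ m * (2 ^ m * D * D) * E \<ge> (1::real)"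
      using \<open>D \<ge> 1\<close> \<open>E \<ge> 1\<close> by (intro mult_ge1_I) auto
    show ?thesis
    proof (rule exI[of _ "2 ^ m * (2 ^ m * D * D) * E"], intro conjI allI impI)
      show "1 \<le> 2 ^ m * (2 ^ m * D * D) * E" by (rule two)
      fix a :: "nat \<Rightarrow> complex" and \<theta> :: real
      assume th: "1 \<le> \<theta>" and a0: "norm (inverse (a 0)) \<le> \<theta>"
        and a: "\<forall>k\<ge>1. norm (a k) \<le> M k"
      have I: "norm (inv_seq a k) \<le> D * \<theta> * \<theta> ^ k" if k: "k \<le> m" for k
      proof -
        have "norm (inv_seq a k) \<le> C k * \<theta> ^ Suc k" using a k th a0 by (intro C(2)) auto
        also have "\<dots> \<le> D * \<theta> ^ Suc k" using CD[OF k] th by (intro mult_right_mono) auto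
        finally show ?thesis by (simp add: mult.assoc)
      qed
      have "norm (bconv (\<lambda>k. a (Suc k)) (bconv (inv_seq a) (inv_seq a)) m)
          \<le> 2 ^ m * (E * (2 ^ m * (D * \<theta>) * (D * \<theta>)) * \<theta> ^ m)"
      proof (rule norm_bconv_le)
        fix k assume k: "k \<le> m"
        have "norm (a (Suc k)) \<le> M (Suc k)" using a by auto
        also have "\<dots> \<le> E * 1" using ME[OF k] by simp
        also have "\<dots> \<le> E * \<theta> ^ k" using th \<open>E \<ge> 1\<close> by (intro mult_left_mono) auto
        finally show "norm (a (Suc k)) \<le> E * \<theta> ^ k" .
        \<comment> \<open>The squared reciprocal carries two extra powers of \<theta>; with
          \<theta>^m they make the exponent m + 2 = Suc n.\<close>
        have "norm (bconv (inv_seq a) (inv_seq a) k) \<le> 2 ^ k * ((D * \<theta>) * (D * \<theta>) * \<theta> ^ k)"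
          by (rule norm_bconv_le) (use I k th in auto)
        also have "\<dots> \<le> 2 ^ m * ((D * \<theta>) * (D * \<theta>) * \<theta> ^ k)"
          using k th \<open>D \<ge> 1\<close> by (intro mult_right_mono power_increasing) auto
        finally show "norm (bconv (inv_seq a) (inv_seq a) k) \<le> 2 ^ m * (D * \<theta>) * (D * \<theta>) * \<theta> ^ k"
          by (simp add: mult_ac)
      qed (use th in auto)
      then show "norm (inv_seq a n) \<le> 2 ^ m * (2 ^ m * D * D) * E * \<theta> ^ Suc n"
        by (simp add: Suc inv_seq_Suc mult_ac)
    qed
  qed
qed

text \<open>Complex values admit no Lagrange form, so the remainder is estimated by induction: its
  derivative is the remainder of lower order for the shifted family, and the mean value inequality
  carries the bound back, at the cost of the factorial.\<close>

lemma taylor_bound: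
  fixes u :: "nat \<Rightarrow> real \<Rightarrow> complex"
  assumes "\<And>n x. (u n has_vector_derivative u (Suc n) x) (at x)"
    and "\<And>z. z \<in> closed_segment x0 x \<Longrightarrow> norm (u N z) \<le> M"
  shows "norm (u 0 x - (\<Sum>n<N. u n x0 * of_real ((x - x0) ^ n) / fact n)) \<le> M * \<bar>x - x0\<bar> ^ N"
  using assms
proof (induction N arbitrary: u x)
  case 0
  then show ?case by simp
next
  case (Suc N)
  define D where "D z = u 0 z - (\<Sum>n<Suc N. u n x0 * of_real ((z - x0) ^ n) / fact n)" for z
  define D' where "D' z = u 1 z - (\<Sum>n<N. u (Suc n) x0 * of_real ((z - x0) ^ n) / fact n)" for z
  have der: "(D has_vector_derivative D' z) (at z)" for z
  proof -
    have 1: "((\<lambda>z. u (Suc n) x0 * of_real ((z - x0) ^ Suc n) / fact (Suc n)) has_vector_derivative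
       u (Suc n) x0 * of_real ((z - x0) ^ n) / fact n) (at z)" for n
    proof -
      have "((\<lambda>z. (z - x0) ^ Suc n) has_vector_derivative real (Suc n) * (z - x0) ^ n) (at z)"
        unfolding has_real_derivative_iff_has_vector_derivative[symmetric]
        by (rule derivative_eq_intros refl | simp)+
      then have "((\<lambda>z. complex_of_real ((z - x0) ^ Suc n)) has_vector_derivative of_real (real (Suc n) * (z - x0) ^ n)) (at z)"
        by (rule bounded_linear.has_vector_derivative[OF bounded_linear_of_real])
      from has_vector_derivative_mult_right[OF this, of "u (Suc n) x0 / fact (Suc n)"]
      show ?thesis by (simp add: field_simps del: of_nat_Suc power_Suc)
    qed
    have 2: "D = (\<lambda>z. u 0 z - (u 0 x0 + (\<Sum>n<N. u (Suc n) x0 * of_real ((z - x0) ^ Suc n) / fact (Suc n))))"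
      unfolding D_def by (subst sum.lessThan_Suc_shift) simp
    have "(D has_vector_derivative u (Suc 0) z - (0 + (\<Sum>n<N. u (Suc n) x0 * of_real ((z - x0) ^ n) / fact n))) (at z)"
      unfolding 2
      by (intro has_vector_derivative_diff has_vector_derivative_add has_vector_derivative_const
          has_vector_derivative_sum 1 Suc.prems)
    then show ?thesis by (simp add: D'_def)
  qed
  have D0: "D x0 = 0" unfolding D_def by (subst sum.lessThan_Suc_shift) simp
  have sub: "norm (D' z) \<le> M * \<bar>x - x0\<bar> ^ N" if z: "z \<in> closed_segment x0 x" for z
  proof -
    have "norm (D' z) \<le> M * \<bar>z - x0\<bar> ^ N"
      unfolding D'_def One_nat_def
    proof (rule Suc.IH)
      show "norm (u (Suc N) y) \<le> M" if "y \<in> closed_segment x0 z" for y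
      proof (rule Suc.prems(2))
        show "y \<in> closed_segment x0 x"
          using that z by (auto simp: closed_segment_eq_real_ivl split: if_splits)
      qed
    qed (rule Suc.prems(1))
    also have "\<dots> \<le> M * \<bar>x - x0\<bar> ^ N"
    proof (intro mult_left_mono power_mono)
      show "\<bar>z - x0\<bar> \<le> \<bar>x - x0\<bar>" using z by (auto simp: closed_segment_eq_real_ivl split: if_splits)
      show "0 \<le> M" using Suc.prems(2)[OF z] norm_ge_zero order_trans by blast
    qed auto
    finally show ?thesis .
  qed
  have "norm (D x - D x0) \<le> (M * \<bar>x - x0\<bar> ^ N) * norm (x - x0)"
  proof (rule differentiable_bound[where S = "closed_segment x0 x" and f' = "\<lambda>z h. h *\<^sub>R D' z"])
    fix z assume z: "z \<in> closed_segment x0 x"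
    show "(D has_derivative (\<lambda>h. h *\<^sub>R D' z)) (at z within closed_segment x0 x)"
      using der[of z] unfolding has_vector_derivative_def by (rule has_derivative_at_withinI)
    show "onorm (\<lambda>h. h *\<^sub>R D' z) \<le> M * \<bar>x - x0\<bar> ^ N"
      using sub[OF z] by (intro onorm_le) (simp add: mult.commute mult_left_mono)
  qed auto
  then have "norm (D x) \<le> M * \<bar>x - x0\<bar> ^ Suc N" by (simp add: D0 mult_ac)
  then show ?case unfolding D_def .
qed

section \<open>One-dimensional stationary phase\<close>

lemma vanishing_deriv_nhd:
  fixes S :: "real set" and f :: "real \<Rightarrow> complex"
  assumes "closed S" "x \<notin> S" and "\<And>y. y \<notin> S \<Longrightarrow> f y = 0"
  shows "(f has_vector_derivative 0) (at x)"
proof (rule has_vector_derivative_transform_within_open[where S = "- S" and f = "\<lambda>_. 0"])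
  show "0 = f y" if "y \<in> - S" for y using assms(3) that by simp
qed (use assms in auto)

text \<open>The family \<open>q\<close> collects the derivatives of u/h'. Written as a Leibniz
  convolution it vanishes off \<open>S\<close> together with all derivatives of \<open>u\<close>, so
  zeros of h' outside \<open>S\<close> do no harm and no boundary terms arise.\<close>

lemma integral_by_parts_phase:
  fixes h :: "nat \<Rightarrow> real \<Rightarrow> real" and u :: "nat \<Rightarrow> real \<Rightarrow> complex"
  assumes Y: "0 < Y" and ab: "a \<le> b"
    and h: "\<And>n x. (h n has_real_derivative h (Suc n) x) (at x)"
    and u: "\<And>n x. (u n has_vector_derivative u (Suc n) x) (at x)"
    and S: "closed S" "S \<subseteq> {a<..<b}" and u0: "\<And>n x. x \<notin> S \<Longrightarrow> u n x = 0"
    and h1: "\<And>x. x \<in> S \<Longrightarrow> h 1 x \<noteq> 0"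
  defines "q \<equiv> \<lambda>x. bconv (\<lambda>k. u k x) (inv_seq (\<lambda>k. of_real (h (Suc k) x)))"
  shows "((\<lambda>x. q x n) has_vector_derivative q x (Suc n)) (at x)"
    and "x \<notin> S \<Longrightarrow> q x n = 0"
    and "integral {a..b} (\<lambda>x. exp (\<i> * of_real (Y * h 0 x)) * u 0 x)
        = \<i> / of_real Y * integral {a..b} (\<lambda>x. exp (\<i> * of_real (Y * h 0 x)) * q x 1)"
proof -
  show q0: "q x n = 0" if "x \<notin> S" for x n
    unfolding q_def bconv_def using u0[OF that] by simp
  have hc: "((\<lambda>x. complex_of_real (h n x)) has_vector_derivative of_real (h (Suc n) x)) (at x)" for n x
    using h[of n x] unfolding has_real_derivative_iff_has_vector_derivative
    by (rule bounded_linear.has_vector_derivative[OF bounded_linear_of_real])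
  show q: "((\<lambda>x. q x n) has_vector_derivative q x (Suc n)) (at x)" for x n
  proof (cases "x \<in> S")
    case True
    show ?thesis unfolding q_def
      by (intro bconv_has_vector_derivative inv_seq_has_vector_derivative u hc) (use h1[OF True] in auto)
  next
    case False
    then show ?thesis using vanishing_deriv_nhd[OF S(1) False, of "\<lambda>x. q x n"] q0 by simp
  qed
  define e where "e x = exp (\<i> * complex_of_real (Y * h 0 x))" for x
  have e: "(e has_vector_derivative \<i> * of_real (Y * h 1 x) * e x) (at x)" for x
  proof -
    have "((\<lambda>x. \<i> * complex_of_real (Y * h 0 x)) has_vector_derivative \<i> * (of_real (Y * h 1 x))) (at x)"
      using has_vector_derivative_mult_right[OF hc[of 0 x], of "\<i> * of_real Y"] by (simp add: mult.assoc)
    from field_vector_diff_chain_at[OF this DERIV_exp]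
    show ?thesis by (simp add: o_def e_def[abs_def])
  qed
  have econt: "continuous_on {a..b} e"
    using e by (meson continuous_at_imp_continuous_on differentiableI_vector differentiable_imp_continuous_within)
  have qcont: "continuous_on {a..b} (\<lambda>x. q x n)" for n
    using q[of n] by (meson continuous_at_imp_continuous_on differentiableI_vector differentiable_imp_continuous_within)
  have ucont: "continuous_on {a..b} (u n)" for n
    using u[of n] by (meson continuous_at_imp_continuous_on differentiableI_vector differentiable_imp_continuous_within)
  have qu: "q x 0 * of_real (h 1 x) = u 0 x" for x
  proof (cases "x \<in> S")
    case True then show ?thesis using h1[OF True] by (simp add: q_def)
  next
    case False then show ?thesis using u0 q0 by simp
  qed
  have "((\<lambda>x. \<i> * of_real Y * (e x * u 0 x) + e x * q x 1) has_integral e b * q b 0 - e a * q a 0) {a..b}"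
  proof (rule fundamental_theorem_of_calculus[OF ab])
    fix x
    have "((\<lambda>x. e x * q x 0) has_vector_derivative e x * q x (Suc 0) + \<i> * of_real (Y * h 1 x) * e x * q x 0) (at x)"
      by (intro has_vector_derivative_mult e q)
    moreover have "e x * q x (Suc 0) + \<i> * of_real (Y * h 1 x) * e x * q x 0 = \<i> * of_real Y * (e x * u 0 x) + e x * q x 1"
      unfolding qu[symmetric] by (simp add: mult_ac)
    ultimately show "((\<lambda>x. e x * q x 0) has_vector_derivative \<i> * of_real Y * (e x * u 0 x) + e x * q x 1) (at x within {a..b})"
      using has_vector_derivative_at_within by metis
  qed
  moreover have "a \<notin> S" "b \<notin> S" using S(2) by auto
  ultimately have *: "integral {a..b} (\<lambda>x. \<i> * of_real Y * (e x * u 0 x) + e x * q x 1) = 0"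
    using q0 by (simp add: integral_unique)
  have "integral {a..b} (\<lambda>x. \<i> * of_real Y * (e x * u 0 x) + e x * q x 1)
      = \<i> * of_real Y * integral {a..b} (\<lambda>x. e x * u 0 x) + integral {a..b} (\<lambda>x. e x * q x 1)"
    by (subst integral_add) (auto intro!: integrable_continuous_interval continuous_intros econt qcont ucont)
  with * have "\<i> * of_real Y * integral {a..b} (\<lambda>x. e x * u 0 x) = - integral {a..b} (\<lambda>x. e x * q x 1)"
    by (simp add: eq_neg_iff_add_eq_0)
  then have "integral {a..b} (\<lambda>x. e x * u 0 x) = \<i> / of_real Y * integral {a..b} (\<lambda>x. e x * q x 1)"
    using Y by (auto simp: field_simps complex_eq_iff)
  then show "integral {a..b} (\<lambda>x. exp (\<i> * of_real (Y * h 0 x)) * u 0 x)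
        = \<i> / of_real Y * integral {a..b} (\<lambda>x. exp (\<i> * of_real (Y * h 0 x)) * q x 1)"
    by (simp add: e_def)
qed

lemma norm_integral_phase_le:
  fixes u :: "real \<Rightarrow> complex"
  assumes "a \<le> b" "continuous_on {a..b} h" "continuous_on {a..b} u" "\<And>x. x \<in> {a..b} \<Longrightarrow> norm (u x) \<le> M"
  shows "norm (integral {a..b} (\<lambda>x. exp (\<i> * of_real (Y * h x)) * u x)) \<le> M * (b - a)"
  using assms by (intro integral_bound continuous_intros) (auto simp: norm_mult)

text \<open>
  One integration by parts divides \<open>u\<close> by \<open>h'\<close> and differentiates, so it costs a factor \<open>\<theta>\<^sup>2\<close> as soon
  as \<open>\<theta>\<close> dominates both \<open>1 / \<bar>h'\<bar>\<close> and the cost of a derivative.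
\<close>

lemma nonstationary_phase:
  fixes B :: "nat \<Rightarrow> real"
  assumes B: "\<And>j. 1 \<le> B j"
  shows "\<exists>C\<ge>1. \<forall>(h :: nat \<Rightarrow> real \<Rightarrow> real) u S \<theta> \<sigma> Y a b V.
    0 < Y \<longrightarrow> a \<le> b \<longrightarrow> 0 \<le> V \<longrightarrow>
    (\<forall>n x. (h n has_real_derivative h (Suc n) x) (at x)) \<longrightarrow>
    (\<forall>n x. (u n has_vector_derivative u (Suc n) x) (at x)) \<longrightarrow>
    closed S \<longrightarrow> S \<subseteq> {a<..<b} \<longrightarrow> (\<forall>n x. x \<notin> S \<longrightarrow> u n x = 0) \<longrightarrow>
    (\<forall>x\<in>S. h 1 x \<noteq> 0 \<and> 1 \<le> \<theta> x \<and> 1 \<le> \<theta> x * \<bar>h 1 x\<bar> \<and> (\<forall>j\<ge>2. \<bar>h j x\<bar> \<le> B j)) \<longrightarrow>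
    (\<forall>x\<in>S. \<forall>j\<le>k. norm (u j x) \<le> \<sigma> x * \<theta> x ^ j) \<longrightarrow>
    (\<forall>x\<in>S. \<sigma> x * \<theta> x ^ (2 * k) \<le> V) \<longrightarrow>
    norm (integral {a..b} (\<lambda>x. exp (\<i> * of_real (Y * h 0 x)) * u 0 x)) \<le> C * V * (b - a) / Y ^ k"
proof (induction k)
  case 0
  show ?case
  proof (intro exI[of _ 1] conjI allI impI)
    fix h :: "nat \<Rightarrow> real \<Rightarrow> real" and u :: "nat \<Rightarrow> real \<Rightarrow> complex" and S \<theta> \<sigma> and Y a b V :: real
    assume V: "0 \<le> V" and ab: "a \<le> b" and h: "\<forall>n x. (h n has_real_derivative h (Suc n) x) (at x)"
      and u: "\<forall>n x. (u n has_vector_derivative u (Suc n) x) (at x)"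
      and u0: "\<forall>n x. x \<notin> S \<longrightarrow> u n x = 0" and us: "\<forall>x\<in>S. \<forall>j\<le>0. norm (u j x) \<le> \<sigma> x * \<theta> x ^ j"
      and s: "\<forall>x\<in>S. \<sigma> x * \<theta> x ^ (2 * 0) \<le> V"
    have "norm (u 0 x) \<le> V" for x using u0 us s V by (cases "x \<in> S") force+
    moreover have "continuous_on {a..b} (h 0)"
      using h by (meson DERIV_continuous_on has_field_derivative_at_within)
    moreover have "continuous_on {a..b} (u 0)"
      using u by (meson continuous_at_imp_continuous_on differentiableI_vector differentiable_imp_continuous_within)
    ultimately have "norm (integral {a..b} (\<lambda>x. exp (\<i> * of_real (Y * h 0 x)) * u 0 x)) \<le> V * (b - a)"
      by (intro norm_integral_phase_le ab)
    then show "norm (integral {a..b} (\<lambda>x. exp (\<i> * of_real (Y * h 0 x)) * u 0 x)) \<le> 1 * V * (b - a) / Y ^ 0"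
      by simp
  qed simp
next
  case (Suc k)
  then obtain C where C: "1 \<le> C" and IH: "\<And>(h :: nat \<Rightarrow> real \<Rightarrow> real) u S \<theta> \<sigma> Y a b V.
    0 < Y \<Longrightarrow> a \<le> b \<Longrightarrow> 0 \<le> V \<Longrightarrow>
    (\<forall>n x. (h n has_real_derivative h (Suc n) x) (at x)) \<Longrightarrow>
    (\<forall>n x. (u n has_vector_derivative u (Suc n) x) (at x)) \<Longrightarrow>
    closed S \<Longrightarrow> S \<subseteq> {a<..<b} \<Longrightarrow> (\<forall>n x. x \<notin> S \<longrightarrow> u n x = 0) \<Longrightarrow>
    (\<forall>x\<in>S. h 1 x \<noteq> 0 \<and> 1 \<le> \<theta> x \<and> 1 \<le> \<theta> x * \<bar>h 1 x\<bar> \<and> (\<forall>j\<ge>2. \<bar>h j x\<bar> \<le> B j)) \<Longrightarrow>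
    (\<forall>x\<in>S. \<forall>j\<le>k. norm (u j x) \<le> \<sigma> x * \<theta> x ^ j) \<Longrightarrow>
    (\<forall>x\<in>S. \<sigma> x * \<theta> x ^ (2 * k) \<le> V) \<Longrightarrow>
    norm (integral {a..b} (\<lambda>x. exp (\<i> * of_real (Y * h 0 x)) * u 0 x)) \<le> C * V * (b - a) / Y ^ k"
    by blast
  have "\<forall>n. \<exists>D\<ge>1. \<forall>a \<theta>. 1 \<le> \<theta> \<longrightarrow> norm (inverse (a 0)) \<le> \<theta> \<longrightarrow> (\<forall>j\<ge>1. norm (a j) \<le> B (Suc j)) \<longrightarrow>
           norm (inv_seq a n) \<le> D * \<theta> ^ Suc n"
    using norm_inv_seq_le[of "\<lambda>k. B (Suc k)"] B by blast
  from choice[OF this] obtain D where D1: "\<And>n. D n \<ge> 1" and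
    D: "\<And>n a \<theta>. 1 \<le> \<theta> \<Longrightarrow> norm (inverse (a 0)) \<le> \<theta> \<Longrightarrow> (\<forall>j\<ge>1. norm (a j) \<le> B (Suc j)) \<Longrightarrow>
           norm (inv_seq a n) \<le> D n * \<theta> ^ Suc n" by metis
  define E where "E = (\<Sum>n\<le>Suc k. D n)"
  have DE: "D n \<le> E" if "n \<le> Suc k" for n unfolding E_def
    by (rule member_le_sum) (use that D1 in \<open>auto intro: order_trans[OF zero_le_one]\<close>)
  have E: "1 \<le> E" using D1[of 0] DE[of 0] by simp
  \<comment> \<open>The power of 2 comes from the binomial sums of order at most k + 1,
    \<open>E\<close> from the derivatives of 1/h' up to that order.\<close>
  define G where "G = 2 ^ Suc k * E"
  have G: "1 \<le> G" unfolding G_def using E one_le_power[of "2::real" "Suc k"] by (intro mult_ge1_I) (auto simp del: power_Suc)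
  show ?case
  proof (intro exI[of _ "C * G"] conjI allI impI)
    show "1 \<le> C * G" using C G by (intro mult_ge1_I)
    fix h :: "nat \<Rightarrow> real \<Rightarrow> real" and u :: "nat \<Rightarrow> real \<Rightarrow> complex" and S \<theta> \<sigma> and Y a b V :: real
    assume Y: "0 < Y" and V: "0 \<le> V" and ab: "a \<le> b"
      and h: "\<forall>n x. (h n has_real_derivative h (Suc n) x) (at x)"
      and u: "\<forall>n x. (u n has_vector_derivative u (Suc n) x) (at x)"
      and S: "closed S" "S \<subseteq> {a<..<b}"
      and u0: "\<forall>n x. x \<notin> S \<longrightarrow> u n x = 0"
      and hS: "\<forall>x\<in>S. h 1 x \<noteq> 0 \<and> 1 \<le> \<theta> x \<and> 1 \<le> \<theta> x * \<bar>h 1 x\<bar> \<and> (\<forall>j\<ge>2. \<bar>h j x\<bar> \<le> B j)"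
      and us: "\<forall>x\<in>S. \<forall>j\<le>Suc k. norm (u j x) \<le> \<sigma> x * \<theta> x ^ j"
      and s: "\<forall>x\<in>S. \<sigma> x * \<theta> x ^ (2 * Suc k) \<le> V"
    define q where "q \<equiv> \<lambda>x. bconv (\<lambda>k. u k x) (inv_seq (\<lambda>k. of_real (h (Suc k) x)))"
    have h1: "h 1 x \<noteq> 0" if "x \<in> S" for x using hS that by blast
    note ibp = integral_by_parts_phase[where h = h and u = u and S = S,
        OF Y ab h[rule_format] u[rule_format] S u0[rule_format] h1]
    have q1: "((\<lambda>x. q x n) has_vector_derivative q x (Suc n)) (at x)" for x n
      using ibp(1) unfolding q_def .
    have q2: "q x n = 0" if "x \<notin> S" for x n using u0 that unfolding q_def bconv_def by simp
    have q3: "integral {a..b} (\<lambda>x. exp (\<i> * of_real (Y * h 0 x)) * u 0 x)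
        = \<i> / of_real Y * integral {a..b} (\<lambda>x. exp (\<i> * of_real (Y * h 0 x)) * q x 1)"
      using ibp(3) unfolding q_def .
    have "norm (integral {a..b} (\<lambda>x. exp (\<i> * of_real (Y * h 0 x)) * (\<lambda>n x. q x (Suc n)) 0 x)) \<le> C * (G * V) * (b - a) / Y ^ k"
    \<comment> \<open>The new amplitude is (u/h')'. Since \<sigma> and \<theta> remain functions of
      the point and only the product of \<sigma> with the power of \<theta> is bounded uniformly, an
      amplitude that is flat at a point can compensate a small h' there.\<close>
    proof (rule IH[where S = S and \<theta> = \<theta> and \<sigma> = "\<lambda>x. G * \<sigma> x * \<theta> x ^ 2"])
      show "\<forall>x\<in>S. \<forall>j\<le>k. norm (q x (Suc j)) \<le> G * \<sigma> x * (\<theta> x)\<^sup>2 * \<theta> x ^ j"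
      proof (intro ballI allI impI)
        fix x j assume x: "x \<in> S" and j: "j \<le> k"
        have th: "1 \<le> \<theta> x" and hx: "h 1 x \<noteq> 0" "1 \<le> \<theta> x * \<bar>h 1 x\<bar>" using hS x by auto
        have sg: "0 \<le> \<sigma> x" using us[rule_format, OF x, of 0] by (auto intro: order_trans[OF norm_ge_zero])
        have "norm (q x (Suc j)) \<le> 2 ^ Suc j * (\<sigma> x * (E * \<theta> x) * \<theta> x ^ Suc j)"
          unfolding q_def
        proof (rule norm_bconv_le)
          fix i assume i: "i \<le> Suc j"
          show "norm (u i x) \<le> \<sigma> x * \<theta> x ^ i" using us x i j by auto
          have "norm (inv_seq (\<lambda>k. complex_of_real (h (Suc k) x)) i) \<le> D i * \<theta> x ^ Suc i"
          proof (rule D[OF th])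
            show "norm (inverse (complex_of_real (h (Suc 0) x))) \<le> \<theta> x"
              using hx by (simp add: norm_divide field_simps)
            show "\<forall>j\<ge>1. norm (complex_of_real (h (Suc j) x)) \<le> B (Suc j)" using hS x by auto
          qed
          also have "\<dots> \<le> E * \<theta> x ^ Suc i" using DE[of i] i j th by (intro mult_right_mono) auto
          finally show "norm (inv_seq (\<lambda>k. complex_of_real (h (Suc k) x)) i) \<le> E * \<theta> x * \<theta> x ^ i"
            by (simp add: mult.assoc)
        qed (use th in auto)
        also have "\<dots> \<le> 2 ^ Suc k * (\<sigma> x * (E * \<theta> x) * \<theta> x ^ Suc j)"
          using j th E sg by (intro mult_right_mono power_increasing) auto
        finally show "norm (q x (Suc j)) \<le> G * \<sigma> x * (\<theta> x)\<^sup>2 * \<theta> x ^ j"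
          by (simp add: G_def power2_eq_square mult_ac)
      qed
      show "\<forall>x\<in>S. G * \<sigma> x * (\<theta> x)\<^sup>2 * \<theta> x ^ (2 * k) \<le> G * V"
        using s G by (auto simp: power2_eq_square mult_ac)
    qed (use Y ab V G h q1 q2 S hS in auto)
    then have "norm (integral {a..b} (\<lambda>x. exp (\<i> * of_real (Y * h 0 x)) * q x 1)) \<le> C * (G * V) * (b - a) / Y ^ k"
      by simp
    then have "norm (integral {a..b} (\<lambda>x. exp (\<i> * of_real (Y * h 0 x)) * u 0 x)) \<le> (C * (G * V) * (b - a) / Y ^ k) / Y"
      unfolding q3 norm_mult norm_divide using Y divide_right_mono by fastforce
    then show "norm (integral {a..b} (\<lambda>x. exp (\<i> * of_real (Y * h 0 x)) * u 0 x)) \<le> C * G * V * (b - a) / Y ^ Suc k"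
      by (simp add: field_simps)
  qed
qed

section \<open>Smooth cutoff functions\<close>

text \<open>The class P(1/x) exp(-1/x), extended by zero, is closed under differentiation: in u =
  1/x the polynomial P becomes u^2 (P - P'). One definition thus delivers all derivatives of the
  standard flat function exp(-1/x).\<close>

definition flat_poly :: "real poly \<Rightarrow> real \<Rightarrow> real" where
  "flat_poly P x = (if 0 < x then poly P (inverse x) * exp (- inverse x) else 0)"

lemma poly_over_exp_tendsto_0: "((\<lambda>y. poly P y * exp (- y)) \<longlongrightarrow> (0::real)) at_top"
proof -
  have "((\<lambda>y. \<Sum>i\<le>degree P. coeff P i * (y ^ i / exp y)) \<longlongrightarrow> (\<Sum>i\<le>degree P. coeff P i * 0)) at_top"
    by (intro tendsto_intros tendsto_power_div_exp_0)
  then show ?thesis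
    by (simp add: poly_altdef exp_minus field_simps sum_divide_distrib sum_distrib_left)
qed

lemma flat_poly_has_derivative:
  "(flat_poly P has_real_derivative flat_poly ([:0, 0, 1:] * (P - pderiv P)) x) (at x)"
proof -
  consider "x < 0" | "0 < x" | "x = 0" by linarith
  then show ?thesis
  proof cases
    case 1
    have "(flat_poly P has_real_derivative 0) (at x)"
      by (rule has_field_derivative_transform_within_open[where S = "{..<0}" and f = "\<lambda>_. 0"])
        (use 1 in \<open>auto simp: flat_poly_def\<close>)
    then show ?thesis using 1 by (simp add: flat_poly_def)
  next
    case 2
    have "((\<lambda>x. poly P (inverse x) * exp (- inverse x)) has_real_derivative
        flat_poly ([:0, 0, 1:] * (P - pderiv P)) x) (at x)"
    proof -
      have "((\<lambda>x. poly P (inverse x) * exp (- inverse x)) has_real_derivative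
         (poly (pderiv P) (inverse x) * (- (inverse x ^ Suc (Suc 0)))) * exp (- inverse x) +
         (exp (- inverse x) * (- (- (inverse x ^ Suc (Suc 0))))) * poly P (inverse x)) (at x)"
        by (intro DERIV_mult DERIV_chain2[OF poly_DERIV] DERIV_chain2[OF DERIV_exp] DERIV_minus DERIV_inverse)
          (use 2 in auto)
      then show ?thesis using 2 by (simp add: flat_poly_def algebra_simps)
    qed
    then show ?thesis
      by (rule has_field_derivative_transform_within_open[where S = "{0<..}"])
        (use 2 in \<open>auto simp: flat_poly_def\<close>)
  next
    case 3
    have "((\<lambda>h. flat_poly P h / h) \<longlongrightarrow> 0) (at 0)"
    proof (rule filterlim_split_at)
      show "((\<lambda>h. flat_poly P h / h) \<longlongrightarrow> 0) (at_left 0)"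
        by (rule tendsto_eventually) (simp add: flat_poly_def eventually_at_filter)
      \<comment> \<open>Dividing by h multiplies P by the variable u = 1/h, so the difference
        quotient at 0 is again a polynomial in u times exp(-u).\<close>
      have "((\<lambda>h. poly ([:0, 1:] * P) (inverse h) * exp (- inverse h)) \<longlongrightarrow> (0::real)) (at_right 0)"
        by (rule filterlim_compose[OF poly_over_exp_tendsto_0 filterlim_inverse_at_top_right])
      then show "((\<lambda>h. flat_poly P h / h) \<longlongrightarrow> 0) (at_right 0)"
        by (rule Lim_transform_eventually)
          (auto simp: flat_poly_def eventually_at_filter field_simps)
    qed
    then show ?thesis using 3 by (simp add: DERIV_def flat_poly_def)
  qed
qed

lemma deriv_family_continuous:
  fixes u :: "real \<Rightarrow> 'a::real_normed_vector"
  assumes "\<And>x. (u has_vector_derivative u' x) (at x)"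
  shows "continuous_on A u"
  using assms by (meson continuous_at_imp_continuous_on differentiableI_vector differentiable_imp_continuous_within)

lemma deriv_family_zero_on_open:
  fixes u :: "nat \<Rightarrow> real \<Rightarrow> complex"
  assumes "\<And>n x. (u n has_vector_derivative u (Suc n) x) (at x)"
    and "open A" "\<And>x. x \<in> A \<Longrightarrow> u 0 x = 0"
  shows "x \<in> A \<Longrightarrow> u n x = 0"
proof (induction n arbitrary: x)
  case 0
  then show ?case using assms by simp
next
  case (Suc n)
  have "(u n has_vector_derivative 0) (at x)"
    by (rule has_vector_derivative_transform_within_open[where S = A and f = "\<lambda>_. 0"])
      (use Suc assms in auto)
  then show ?case using vector_derivative_unique_at assms(1) by blast
qed

lemma has_vector_derivative_affine_family:
  fixes u :: "nat \<Rightarrow> real \<Rightarrow> complex"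
  assumes "\<And>n x. (u n has_vector_derivative u (Suc n) x) (at x)"
  shows "((\<lambda>x. of_real (c ^ n) * u n (c * x + d)) has_vector_derivative of_real (c ^ Suc n) * u (Suc n) (c * x + d)) (at x)"
proof -
  have "((\<lambda>x. c * x + d) has_vector_derivative c) (at x)"
    unfolding has_real_derivative_iff_has_vector_derivative[symmetric]
    by (rule derivative_eq_intros refl | simp)+
  from vector_diff_chain_at[OF this assms[of n "c * x + d"]]
  have "((\<lambda>x. u n (c * x + d)) has_vector_derivative c *\<^sub>R u (Suc n) (c * x + d)) (at x)" by (simp add: o_def)
  from has_vector_derivative_mult_right[OF this, of "of_real (c ^ n)"]
  show ?thesis by (simp add: scaleR_conv_of_real mult_ac)
qed

text \<open>With b(x) = exp(-1/x) for x > 0 and b(x) = 0 otherwise, f(x) = b(x) / (b(x) + b(1 - x))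
  is a smooth step from 0 to 1, and the cutoff is f(2 - 2x) f(2 + 2x). Working with derivative
  families gives each of its derivatives as an explicit term.\<close>

lemma smooth_cutoff:
  obtains \<psi> :: "nat \<Rightarrow> real \<Rightarrow> complex" and H :: "nat \<Rightarrow> real"
  where "\<And>n x. (\<psi> n has_vector_derivative \<psi> (Suc n) x) (at x)"
    and "\<And>x. \<bar>x\<bar> \<le> 1/2 \<Longrightarrow> \<psi> 0 x = 1" and "\<And>n x. 1 < \<bar>x\<bar> \<Longrightarrow> \<psi> n x = 0"
    and "\<And>n x. norm (\<psi> n x) \<le> H n" and "\<And>n. 1 \<le> H n"
proof -
  define \<beta> where "\<beta> n x = complex_of_real (flat_poly (((\<lambda>P. [:0, 0, 1:] * (P - pderiv P)) ^^ n) 1) x)" for n x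
  have \<beta>: "(\<beta> n has_vector_derivative \<beta> (Suc n) x) (at x)" for n x
    unfolding \<beta>_def using flat_poly_has_derivative unfolding has_real_derivative_iff_has_vector_derivative
    by (intro bounded_linear.has_vector_derivative[OF bounded_linear_of_real]) simp
  define \<beta>' where "\<beta>' n x = of_real ((-1) ^ n) * \<beta> n ((-1) * x + 1)" for n x
  have \<beta>': "(\<beta>' n has_vector_derivative \<beta>' (Suc n) x) (at x)" for n x
    unfolding \<beta>'_def by (rule has_vector_derivative_affine_family[where u = \<beta>, OF \<beta>])
  have b0: "\<beta> 0 x = of_real (if 0 < x then exp (- inverse x) else 0)" for x by (simp add: \<beta>_def flat_poly_def)
  have pos: "\<beta> 0 x + \<beta>' 0 x \<noteq> 0" for x
  proof -
    define s where "s = (if 0 < x then exp (- inverse x) else 0) + (if 0 < 1 - x then exp (- inverse (1 - x)) else 0)"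
    have "0 < s" unfolding s_def by (auto intro: add_pos_pos)
    moreover have "\<beta> 0 x + \<beta>' 0 x = of_real s" by (simp add: \<beta>'_def b0 s_def)
    ultimately show ?thesis by (metis less_irrefl of_real_eq_0_iff)
  qed
  define f where "f n x = bconv (\<lambda>k. \<beta> k x) (inv_seq (\<lambda>k. \<beta> k x + \<beta>' k x)) n" for n x
  have f: "(f n has_vector_derivative f (Suc n) x) (at x)" for n x unfolding f_def
    by (intro bconv_has_vector_derivative inv_seq_has_vector_derivative has_vector_derivative_add \<beta> \<beta>' pos)
  have f1: "f 0 x = 1" if "1 \<le> x" for x using that pos[of x] by (simp add: f_def \<beta>'_def b0)
  have f0: "f 0 x = 0" if "x \<le> 0" for x using that by (simp add: f_def b0)
  define g where "g n x = of_real ((-2) ^ n) * f n ((-2) * x + 2)" for n x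
  define g' where "g' n x = of_real (2 ^ n) * f n (2 * x + 2)" for n x
  define \<psi> where "\<psi> n x = bconv (\<lambda>k. g k x) (\<lambda>k. g' k x) n" for n x
  have \<psi>: "(\<psi> n has_vector_derivative \<psi> (Suc n) x) (at x)" for n x
    unfolding \<psi>_def g_def g'_def by (intro bconv_has_vector_derivative has_vector_derivative_affine_family[where u = f] f)
  have \<psi>1: "\<psi> 0 x = 1" if "\<bar>x\<bar> \<le> 1/2" for x using that by (simp add: \<psi>_def g_def g'_def f1)
  have \<psi>0: "\<psi> n x = 0" if "1 < \<bar>x\<bar>" for n x
  proof (rule deriv_family_zero_on_open[where u = \<psi> and A = "{..<-1} \<union> {1<..}"])
    show "\<psi> 0 x = 0" if "x \<in> {..<-1} \<union> {1<..}" for x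
      using that by (auto simp: \<psi>_def g_def g'_def f0)
  qed (use \<psi> that in auto)
  have "\<forall>n. \<exists>H\<ge>1. \<forall>x. norm (\<psi> n x) \<le> H"
  proof
    fix n
    have "bounded (\<psi> n ` {-1..1})"
      by (intro compact_imp_bounded compact_continuous_image deriv_family_continuous[OF \<psi>]) auto
    then obtain M where M: "\<forall>x\<in>{-1..1}. norm (\<psi> n x) \<le> M" by (auto simp: bounded_iff)
    show "\<exists>H\<ge>1. \<forall>x. norm (\<psi> n x) \<le> H"
    proof (intro exI[of _ "max 1 M"] conjI allI)
      show "norm (\<psi> n x) \<le> max 1 M" for x
      proof (cases "1 < \<bar>x\<bar>")
        case False then show ?thesis using M by (force simp: abs_le_iff le_max_iff_disj)
      qed (simp add: \<psi>0)
    qed simp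
  qed
  from choice[OF this] obtain H where "\<And>n. 1 \<le> H n" "\<And>n x. norm (\<psi> n x) \<le> H n" by blast
  with that \<psi> \<psi>1 \<psi>0 show thesis by blast
qed

section \<open>Truncated Fresnel moments\<close>

lemma lborel_integral_eq_integral_interval:
  fixes f :: "real \<Rightarrow> complex"
  assumes "continuous_on UNIV f" "\<And>x. x \<notin> {a..b} \<Longrightarrow> f x = 0"
  shows "(LINT x|lborel. f x) = integral {a..b} f"
proof -
  have "set_integrable lborel {a..b} f"
    using borel_integrable_compact[of "{a..b}" f] assms(1) continuous_on_subset
    unfolding set_integrable_def by (auto simp: indicator_scaleR_eq_if)
  from set_borel_integral_eq_integral(2)[OF this]
  have "(LINT x:{a..b}|lborel. f x) = integral {a..b} f" .
  moreover have "(\<lambda>x. indicat_real {a..b} x *\<^sub>R f x) = f" using assms(2) by (auto simp: indicator_def)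
  ultimately show ?thesis by (simp add: set_lebesgue_integral_def)
qed

lemma integral_rescale:
  fixes f :: "real \<Rightarrow> complex"
  assumes "continuous_on UNIV f" "\<And>x. x \<notin> {a..b} \<Longrightarrow> f x = 0" and "0 < c"
    and "\<And>x. x \<notin> {a'..b'} \<Longrightarrow> f ((x - x0) / c) = 0"
  shows "integral {a'..b'} (\<lambda>x. f ((x - x0) / c)) = of_real c * integral {a..b} f"
proof -
  have "integral {a'..b'} (\<lambda>x. f ((x - x0) / c)) = (LINT x|lborel. f ((x - x0) / c))"
  proof (rule lborel_integral_eq_integral_interval[symmetric])
    show "continuous_on UNIV (\<lambda>x. f ((x - x0) / c))"
      by (rule continuous_on_compose2[OF assms(1)]) (use assms(3) in \<open>auto intro!: continuous_intros\<close>)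
  qed (rule assms(4))
  also have "\<dots> = c *\<^sub>R (LINT x|lborel. f x)"
    using lborel_integral_real_affine[of c "\<lambda>x. f ((x - x0) / c)" x0] assms(3) by simp
  finally show ?thesis
    using lborel_integral_eq_integral_interval[OF assms(1,2)] by (simp add: scaleR_conv_of_real)
qed

lemma power_deriv_family:
  obtains p :: "nat \<Rightarrow> real \<Rightarrow> complex" and P :: "nat \<Rightarrow> real"
  where "\<And>j x. (p j has_vector_derivative p (Suc j) x) (at x)" "\<And>x. p 0 x = of_real (x ^ n)"
    "\<And>j x. \<bar>x\<bar> \<le> 2 \<Longrightarrow> norm (p j x) \<le> P j" "\<And>j. 1 \<le> P j"
proof -
  define p where "p j x = complex_of_real (poly ((pderiv ^^ j) (monom 1 n)) x)" for j x
  have p: "(p j has_vector_derivative p (Suc j) x) (at x)" for j x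
    unfolding p_def using poly_DERIV[of "(pderiv ^^ j) (monom 1 n)" x]
    unfolding has_real_derivative_iff_has_vector_derivative
    by (intro bounded_linear.has_vector_derivative[OF bounded_linear_of_real]) simp
  have "\<forall>j. \<exists>M\<ge>1. \<forall>x. \<bar>x\<bar> \<le> 2 \<longrightarrow> norm (p j x) \<le> M"
  proof
    fix j
    have "bounded (p j ` {-2..2})"
      by (intro compact_imp_bounded compact_continuous_image deriv_family_continuous[OF p]) auto
    then obtain M where "\<forall>x\<in>{-2..2}. norm (p j x) \<le> M" by (auto simp: bounded_iff)
    then show "\<exists>M\<ge>1. \<forall>x. \<bar>x\<bar> \<le> 2 \<longrightarrow> norm (p j x) \<le> M"
      by (intro exI[of _ "max 1 M"]) (force simp: abs_le_iff le_max_iff_disj)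
  qed
  from choice[OF this] obtain P where "\<And>j. 1 \<le> P j" "\<And>j x. \<bar>x\<bar> \<le> 2 \<Longrightarrow> norm (p j x) \<le> P j" by blast
  moreover have "p 0 x = of_real (x ^ n)" for x by (simp add: p_def poly_monom)
  ultimately show thesis using that p by blast
qed

text \<open>After x = u/L, \<open>J L\<close> is the integral of u^n exp(i u^2/2) with a smooth
  cutoff at |u| of size L. Cutoffs at comparable L differ only where |u| is of size L, and there the
  phase has no critical point; hence \<open>J\<close> converges faster than any power of 1/L. The
  limit is the n-th Fresnel moment.\<close>

lemma fresnel_moment:
  fixes \<psi> :: "nat \<Rightarrow> real \<Rightarrow> complex" and n :: nat
  assumes \<psi>: "\<And>n x. (\<psi> n has_vector_derivative \<psi> (Suc n) x) (at x)"
    and \<psi>1: "\<And>x. \<bar>x\<bar> \<le> 1/2 \<Longrightarrow> \<psi> 0 x = 1" and \<psi>0: "\<And>n x. 1 < \<bar>x\<bar> \<Longrightarrow> \<psi> n x = 0"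
    and H: "\<And>n x. norm (\<psi> n x) \<le> H n" "\<And>n. 1 \<le> H n"
  defines "J \<equiv> \<lambda>L. of_real (L ^ Suc n) * integral {-3..3} (\<lambda>x. exp (\<i> * of_real (L\<^sup>2 * (x\<^sup>2 / 2))) * (of_real (x ^ n) * \<psi> 0 x))"
  obtains m where "\<And>k. \<exists>C. \<forall>L>0. norm (J L - m) \<le> C / L ^ k"
proof -
  define h where "h j x = (if j = 0 then x\<^sup>2 / 2 else if j = 1 then x else if j = 2 then 1 else (0::real))" for j :: nat and x
  have h: "(h j has_real_derivative h (Suc j) x) (at x)" for j x
  proof -
    consider "j = 0" | "j = 1" | "j \<ge> 2" by linarith
    then show ?thesis
    proof cases
      case 1
      have "((\<lambda>x. x\<^sup>2 / 2) has_real_derivative x) (at x)" by (rule derivative_eq_intros refl | simp)+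
      then show ?thesis using 1 by (simp add: h_def[abs_def])
    next
      case 2
      have "((\<lambda>x. x) has_real_derivative 1) (at x)" by (rule derivative_eq_intros refl | simp)+
      then show ?thesis using 2 by (simp add: h_def[abs_def])
    next
      case 3
      then have "h j = (\<lambda>_. if j = 2 then 1 else 0)" by (auto simp: h_def)
      with 3 show ?thesis by (simp add: h_def)
    qed
  qed
  obtain p P where p: "\<And>j x. (p j has_vector_derivative p (Suc j) x) (at x)" "\<And>x. p 0 x = complex_of_real (x ^ n)"
    "\<And>j x. \<bar>x\<bar> \<le> 2 \<Longrightarrow> norm (p j x) \<le> P j" "\<And>j. 1 \<le> P j"
    by (rule power_deriv_family[of n]) (metis One_nat_def)
  have ccont: "continuous_on A (\<psi> 0)" for A by (rule deriv_family_continuous[OF \<psi>])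
  have step: "\<exists>C\<ge>1. \<forall>L \<tau>. 1 \<le> L \<longrightarrow> 1 \<le> \<tau> \<longrightarrow> \<tau> \<le> 2 \<longrightarrow> norm (J (\<tau> * L) - J L) \<le> C / L ^ k" for k
  proof -
    \<comment> \<open>K integrations by parts gain L^(-2K). Half of this pays for the factor
      L^(n+1), as n + 1 \<le> K, and the rest leaves at most L^(-k).\<close>
    define K where "K = k + Suc n"
    obtain C where C: "1 \<le> C" and ns: "\<And>(h :: nat \<Rightarrow> real \<Rightarrow> real) u S \<theta> \<sigma> Y a b V.
      0 < Y \<Longrightarrow> a \<le> b \<Longrightarrow> 0 \<le> V \<Longrightarrow>
      (\<forall>n x. (h n has_real_derivative h (Suc n) x) (at x)) \<Longrightarrow>
      (\<forall>n x. (u n has_vector_derivative u (Suc n) x) (at x)) \<Longrightarrow>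
      closed S \<Longrightarrow> S \<subseteq> {a<..<b} \<Longrightarrow> (\<forall>n x. x \<notin> S \<longrightarrow> u n x = 0) \<Longrightarrow>
      (\<forall>x\<in>S. h 1 x \<noteq> 0 \<and> 1 \<le> \<theta> x \<and> 1 \<le> \<theta> x * \<bar>h 1 x\<bar> \<and> (\<forall>j\<ge>2. \<bar>h j x\<bar> \<le> 1)) \<Longrightarrow>
      (\<forall>x\<in>S. \<forall>j\<le>K. norm (u j x) \<le> \<sigma> x * \<theta> x ^ j) \<Longrightarrow>
      (\<forall>x\<in>S. \<sigma> x * \<theta> x ^ (2 * K) \<le> V) \<Longrightarrow>
      norm (integral {a..b} (\<lambda>x. exp (\<i> * of_real (Y * h 0 x)) * u 0 x)) \<le> C * V * (b - a) / Y ^ K"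
      using nonstationary_phase[of "\<lambda>_. 1" K, OF order_refl] by blast
    define P' where "P' = (\<Sum>j\<le>K. P j)"
    define H' where "H' = (\<Sum>j\<le>K. H j)"
    have P': "P j \<le> P'" if "j \<le> K" for j unfolding P'_def
      by (rule member_le_sum) (use that p(4) in \<open>auto intro: order_trans[OF zero_le_one]\<close>)
    have H': "H j \<le> H'" if "j \<le> K" for j unfolding H'_def
      by (rule member_le_sum) (use that H(2) in \<open>auto intro: order_trans[OF zero_le_one]\<close>)
    have P'1: "1 \<le> P'" using P'[of 0] p(4)[of 0] by simp
    have H'1: "1 \<le> H'" using H'[of 0] H(2)[of 0] by simp
    define D where "D = C * (2 ^ K * (P' * (2 * H')) * 2 ^ (2 * K)) * 6"
    show ?thesis
    proof (intro exI[of _ D] conjI allI impI)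
      show "1 \<le> D" unfolding D_def using C P'1 H'1 by (intro mult_ge1_I) auto
      fix L \<tau> :: real assume L: "1 \<le> L" and \<tau>: "1 \<le> \<tau>" "\<tau> \<le> 2"
      \<comment> \<open>The difference of the two cutoffs in a common variable. It vanishes for |x|
        < 1/2, where both are 1, and for |x| > 2, where both are 0.\<close>
      define \<eta> where "\<eta> j x = of_real ((1 / \<tau>) ^ j) * \<psi> j (1 / \<tau> * x + 0) - \<psi> j x" for j x
      have \<eta>: "(\<eta> j has_vector_derivative \<eta> (Suc j) x) (at x)" for j x
        unfolding \<eta>_def by (intro has_vector_derivative_diff has_vector_derivative_affine_family[where u = \<psi>] \<psi>)
      define u where "u j x = bconv (\<lambda>k. p k x) (\<lambda>k. \<eta> k x) j" for j x
      have u: "(u j has_vector_derivative u (Suc j) x) (at x)" for j x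
        unfolding u_def by (intro bconv_has_vector_derivative p \<eta>)
      define S where "S = {x::real. 1/2 \<le> \<bar>x\<bar> \<and> \<bar>x\<bar> \<le> 2}"
      have \<eta>0: "\<eta> j x = 0" if "x \<notin> S" for j x
      proof (cases "\<bar>x\<bar> < 1/2")
        case True
        show ?thesis
        proof (rule deriv_family_zero_on_open[where A = "{-1/2<..<1/2}" and u = \<eta>])
          show "\<eta> 0 y = 0" if "y \<in> {- 1 / 2<..<1 / 2}" for y
          proof -
            have "\<bar>y\<bar> \<le> 1/2" using that by auto
            moreover from this have "\<bar>y / \<tau>\<bar> \<le> 1/2" using \<tau> by (simp add: field_simps)
            ultimately show ?thesis by (simp add: \<eta>_def \<psi>1)
          qed
        qed (use \<eta> True in auto)
      next
        case False
        then have "2 < \<bar>x\<bar>" using that by (auto simp: S_def)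
        moreover from this have "1 < \<bar>x / \<tau>\<bar>" using \<tau> by (simp add: field_simps)
        ultimately show ?thesis by (simp add: \<eta>_def \<psi>0)
      qed
      have \<eta>b: "norm (\<eta> j x) \<le> 2 * H'" if "j \<le> K" for j x
      proof -
        have "norm (of_real ((1 / \<tau>) ^ j) * \<psi> j (1 / \<tau> * x + 0)) \<le> 1 * H j"
          unfolding norm_mult by (intro mult_mono H) (use \<tau> in \<open>auto simp: norm_power norm_divide intro!: power_le_one\<close>)
        then have "norm (\<eta> j x) \<le> 1 * H j + H j"
          unfolding \<eta>_def by (intro order_trans[OF norm_triangle_ineq4] add_mono H)
        with H'[OF that] show ?thesis by simp
      qed
      have "norm (integral {-3..3} (\<lambda>x. exp (\<i> * of_real (L\<^sup>2 * h 0 x)) * u 0 x))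
         \<le> C * (2 ^ K * (P' * (2 * H')) * 2 ^ (2 * K)) * (3 - (-3)) / (L\<^sup>2) ^ K"
      \<comment> \<open>On \<open>S\<close> the derivative x of the phase has modulus at least 1/2,
        so the constant weight 2 serves.\<close>
      proof (rule ns[where S = S and \<theta> = "\<lambda>_. 2" and \<sigma> = "\<lambda>_. 2 ^ K * (P' * (2 * H'))"])
        show "\<forall>x\<in>S. \<forall>j\<le>K. norm (u j x) \<le> 2 ^ K * (P' * (2 * H')) * 2 ^ j"
        proof (intro ballI allI impI)
          fix x j assume x: "x \<in> S" and j: "j \<le> K"
          have "norm (u j x) \<le> 2 ^ j * (P' * (2 * H') * 1 ^ j)"
            unfolding u_def
          proof (rule norm_bconv_le)
            fix i assume i: "i \<le> j"
            show "norm (p i x) \<le> P' * 1 ^ i" using p(3)[of x i] P'[of i] x i j by (simp add: S_def)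
            show "norm (\<eta> i x) \<le> 2 * H' * 1 ^ i" using \<eta>b[of i x] i j by simp
          qed simp
          also have "\<dots> = P' * (2 * H') * 1 * 2 ^ j" by simp
          also have "\<dots> \<le> P' * (2 * H') * 2 ^ K * 2 ^ j"
            using P'1 H'1 by (intro mult_right_mono mult_left_mono) auto
          finally show "norm (u j x) \<le> 2 ^ K * (P' * (2 * H')) * 2 ^ j" by (simp add: mult_ac)
        qed
        have "S = {- 2..2} - {-1/2<..<1/2}" by (auto simp: S_def abs_if split: if_splits)
        then show "closed S" by (metis closed_Diff closed_atLeastAtMost open_greaterThanLessThan)
        show "\<forall>x\<in>S. h 1 x \<noteq> 0 \<and> 1 \<le> (2::real) \<and> 1 \<le> 2 * \<bar>h 1 x\<bar> \<and> (\<forall>j\<ge>2. \<bar>h j x\<bar> \<le> 1)"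
          by (auto simp: S_def h_def)
        show "\<forall>n x. x \<notin> S \<longrightarrow> u n x = 0" using \<eta>0 by (simp add: u_def bconv_def)
      qed (use L P'1 H'1 h u in \<open>auto simp: S_def\<close>)
      also have "\<dots> = D / L ^ (2 * K)" unfolding D_def by (simp add: power_mult)
      finally have 1: "norm (integral {-3..3} (\<lambda>x. exp (\<i> * of_real (L\<^sup>2 * h 0 x)) * u 0 x)) \<le> D / L ^ (2 * K)" .
      define f where "f x = exp (\<i> * of_real ((\<tau> * L)\<^sup>2 * (x\<^sup>2 / 2))) * (of_real (x ^ n) * \<psi> 0 x)" for x
      have "integral {-3..3} (\<lambda>x. f ((x - 0) / \<tau>)) = of_real \<tau> * integral {-3..3} f"
      proof (rule integral_rescale)
        show "continuous_on UNIV f" unfolding f_def by (intro continuous_intros ccont) auto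
        show "f x = 0" if "x \<notin> {- 3..3}" for x
        proof -
          have "1 < \<bar>x\<bar>" using that by auto
          then show ?thesis by (simp add: f_def \<psi>0)
        qed
        show "f ((x - 0) / \<tau>) = 0" if "x \<notin> {- 3..3}" for x
        proof -
          have "3 < \<bar>x\<bar>" using that by auto
          then have "1 < \<bar>x / \<tau>\<bar>" using \<tau> by (simp add: field_simps)
          then show ?thesis by (simp add: f_def \<psi>0)
        qed
      qed (use \<tau> in auto)
      then have "J (\<tau> * L) = of_real (L ^ Suc n * \<tau> ^ n) * integral {-3..3} (\<lambda>x. f (x / \<tau>))"
        unfolding J_def f_def[symmetric] by (simp add: power_mult_distrib mult_ac)
      also have "\<dots> = of_real (L ^ Suc n) * integral {-3..3} (\<lambda>x. of_real (\<tau> ^ n) * f (x / \<tau>))"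
        by simp
      also have "(\<lambda>x. of_real (\<tau> ^ n) * f (x / \<tau>)) =
          (\<lambda>x. exp (\<i> * of_real (L\<^sup>2 * (x\<^sup>2 / 2))) * (of_real (x ^ n) * \<psi> 0 (x / \<tau>)))"
        using \<tau> by (auto simp: f_def fun_eq_iff field_simps power_divide power_mult_distrib)
      finally have "J (\<tau> * L) - J L = of_real (L ^ Suc n) *
         (integral {-3..3} (\<lambda>x. exp (\<i> * of_real (L\<^sup>2 * (x\<^sup>2 / 2))) * (of_real (x ^ n) * \<psi> 0 (x / \<tau>)))
          - integral {-3..3} (\<lambda>x. exp (\<i> * of_real (L\<^sup>2 * (x\<^sup>2 / 2))) * (of_real (x ^ n) * \<psi> 0 x)))"
        by (simp add: J_def algebra_simps)
      also have "(integral {-3..3} (\<lambda>x. exp (\<i> * of_real (L\<^sup>2 * (x\<^sup>2 / 2))) * (of_real (x ^ n) * \<psi> 0 (x / \<tau>)))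
          - integral {-3..3} (\<lambda>x. exp (\<i> * of_real (L\<^sup>2 * (x\<^sup>2 / 2))) * (of_real (x ^ n) * \<psi> 0 x)))
          = integral {-3..3} (\<lambda>x. exp (\<i> * of_real (L\<^sup>2 * h 0 x)) * u 0 x)"
      proof -
        have c1: "continuous_on {-3..3} (\<lambda>x. \<psi> 0 (x / \<tau>))"
          by (rule continuous_on_compose2[OF ccont[of UNIV]]) (use \<tau> in \<open>auto intro!: continuous_intros\<close>)
        show ?thesis
          by (subst integral_diff[symmetric])
            (auto intro!: integrable_continuous_interval continuous_intros ccont c1 integral_cong
              simp: u_def \<eta>_def p h_def algebra_simps)
      qed
      finally have eq: "J (\<tau> * L) - J L = of_real (L ^ Suc n) * integral {-3..3} (\<lambda>x. exp (\<i> * of_real (L\<^sup>2 * h 0 x)) * u 0 x)" .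
      have "norm (J (\<tau> * L) - J L) = L ^ Suc n * norm (integral {-3..3} (\<lambda>x. exp (\<i> * of_real (L\<^sup>2 * h 0 x)) * u 0 x))"
        unfolding eq norm_mult norm_of_real using L by simp
      also have "\<dots> \<le> L ^ Suc n * (D / L ^ (2 * K))"
        using L by (intro mult_left_mono 1) auto
      also have "\<dots> \<le> L ^ K * (D / L ^ (2 * K))"
        using L \<open>1 \<le> D\<close> unfolding K_def by (intro mult_right_mono power_increasing) auto
      also have "\<dots> = D / L ^ K" using L by (simp add: power_add[symmetric] mult_2 mult_2_right field_simps)
      also have "\<dots> \<le> D / L ^ k"
        using L \<open>1 \<le> D\<close> unfolding K_def by (intro divide_left_mono power_increasing) auto
      finally show "norm (J (\<tau> * L) - J L) \<le> D / L ^ k" .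
    qed
  qed
  \<comment> \<open>Repeated doubling of L gives a geometric series of errors; k \<ge> 1 makes its
    ratio at most 1/2, hence the total 2C.\<close>
  have chain: "\<exists>C\<ge>1. \<forall>L L'. 1 \<le> L \<longrightarrow> L \<le> L' \<longrightarrow> norm (J L' - J L) \<le> C / L ^ k" if k: "1 \<le> k" for k
  proof -
    obtain C where C: "1 \<le> C" "\<And>L \<tau>. 1 \<le> L \<Longrightarrow> 1 \<le> \<tau> \<Longrightarrow> \<tau> \<le> 2 \<Longrightarrow> norm (J (\<tau> * L) - J L) \<le> C / L ^ k"
      using step[of k] by auto
    have *: "1 \<le> L \<Longrightarrow> L \<le> L' \<Longrightarrow> L' \<le> 2 ^ i * L \<Longrightarrow> norm (J L' - J L) \<le> 2 * C / L ^ k" for L L' and i :: nat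
    proof (induction i arbitrary: L)
      case 0
      then show ?case using C(1) by (auto intro!: divide_nonneg_nonneg)
    next
      case (Suc i)
      show ?case
      proof (cases "L' \<le> 2 * L")
        case True
        have "norm (J (L' / L * L) - J L) \<le> C / L ^ k"
          by (rule C(2)) (use Suc.prems True in \<open>auto simp: field_simps\<close>)
        also have "\<dots> \<le> 2 * C / L ^ k" using C(1) Suc.prems by (intro divide_right_mono) auto
        finally show ?thesis using Suc.prems by simp
      next
        case False
        have "norm (J L' - J (2 * L)) \<le> 2 * C / (2 * L) ^ k"
          by (rule Suc.IH) (use Suc.prems False in auto)
        also have "\<dots> \<le> C / L ^ k"
        proof -
          have "2 * L ^ k \<le> (2 * L) ^ k"
            using k Suc.prems power_increasing[of 1 k "2::real"] by (simp add: power_mult_distrib)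
          then show ?thesis using C(1) Suc.prems by (simp add: field_simps)
        qed
        finally have "norm (J L' - J (2 * L)) \<le> C / L ^ k" .
        moreover have "norm (J (2 * L) - J L) \<le> C / L ^ k" by (rule C(2)) (use Suc.prems in auto)
        ultimately show ?thesis using norm_triangle_ineq[of "J L' - J (2 * L)" "J (2 * L) - J L"] by simp
      qed
    qed
    show ?thesis
    proof (intro exI[of _ "2 * C"] conjI allI impI)
      fix L L' :: real assume L: "1 \<le> L" "L \<le> L'"
      obtain i where "L' < 2 ^ i" using real_arch_pow[of 2 L'] by auto
      also have "(2::real) ^ i \<le> 2 ^ i * L" using L by simp
      finally show "norm (J L' - J L) \<le> 2 * C / L ^ k" using *[OF L, of i] by simp
    qed (use C in simp)
  qed
  have "Cauchy (\<lambda>i. J (real (Suc i)))"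
  proof -
    obtain C where C: "1 \<le> C" "\<And>L L'. 1 \<le> L \<Longrightarrow> L \<le> L' \<Longrightarrow> norm (J L' - J L) \<le> C / L ^ 1"
      using chain[of 1] by auto
    show ?thesis
    proof (rule CauchyI')
      fix e :: real assume "0 < e"
      obtain N where N: "C / e < real N" using reals_Archimedean2 by blast
      show "\<exists>M. \<forall>m\<ge>M. \<forall>n>m. dist (J (real (Suc m))) (J (real (Suc n))) < e"
      proof (intro exI[of _ N] allI impI)
        fix m n assume mn: "N \<le> m" "m < n"
        have "norm (J (real (Suc n)) - J (real (Suc m))) \<le> C / real (Suc m)"
          using C(2)[of "real (Suc m)" "real (Suc n)"] mn by simp
        also have "\<dots> < e"
        proof -
          have "C / e < real (Suc m)" using N mn by simp
          then show ?thesis using \<open>0 < e\<close> by (simp add: field_simps)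
        qed
        finally show "dist (J (real (Suc m))) (J (real (Suc n))) < e" by (simp add: dist_norm norm_minus_commute)
      qed
    qed
  qed
  then obtain m where m: "(\<lambda>i. J (real (Suc i))) \<longlonglongrightarrow> m"
    using Cauchy_convergent convergent_def by blast
  show thesis
  proof (rule that[of m])
    fix k
    obtain C where C: "1 \<le> C" "\<And>L L'. 1 \<le> L \<Longrightarrow> L \<le> L' \<Longrightarrow> norm (J L' - J L) \<le> C / L ^ Suc k"
      using chain[of "Suc k"] by auto
    have big: "norm (J L - m) \<le> C / L ^ k" if L: "1 \<le> L" for L
    proof -
      have "norm (m - J L) \<le> C / L ^ Suc k"
      proof (rule Lim_bounded)
        show "(\<lambda>i. norm (J (real (Suc i)) - J L)) \<longlonglongrightarrow> norm (m - J L)" by (intro tendsto_intros m)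
        show "\<forall>i\<ge>nat \<lceil>L\<rceil>. norm (J (real (Suc i)) - J L) \<le> C / L ^ Suc k"
        proof (intro allI impI)
          fix i assume "nat \<lceil>L\<rceil> \<le> i"
          then have "L \<le> real (Suc i)" by linarith
          with L show "norm (J (real (Suc i)) - J L) \<le> C / L ^ Suc k" by (rule C(2))
        qed
      qed
      also have "\<dots> \<le> C / L ^ k" using L C(1) by (intro divide_left_mono power_increasing) auto
      finally show ?thesis by (simp add: norm_minus_commute)
    qed
    define E where "E = 3 ^ n * H 0 * 6 + norm m"
    have E: "0 \<le> E" using H(2)[of 0] by (simp add: E_def)
    \<comment> \<open>For L \<le> 1 no decay is asked for: \<open>J\<close> is bounded and 1/L^k is
      at least 1.\<close>
    have small: "norm (J L - m) \<le> E / L ^ k" if L: "0 < L" "L \<le> 1" for L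
    proof -
      have "norm (integral {-3..3} (\<lambda>x. exp (\<i> * of_real (L\<^sup>2 * (x\<^sup>2 / 2))) * (of_real (x ^ n) * \<psi> 0 x))) \<le> 3 ^ n * H 0 * (3 - (-3))"
      proof (rule norm_integral_phase_le)
        fix x :: real assume "x \<in> {-3..3}"
        then have "\<bar>x\<bar> ^ n \<le> 3 ^ n" by (intro power_mono) auto
        then show "norm (of_real (x ^ n) * \<psi> 0 x) \<le> 3 ^ n * H 0"
          unfolding norm_mult using H by (intro mult_mono) (auto simp: norm_power)
      qed (auto intro!: continuous_intros ccont)
      then have "norm (J L) \<le> 1 * (3 ^ n * H 0 * 6)"
        unfolding J_def norm_mult using L by (intro mult_mono) (auto simp: norm_power norm_mult intro!: mult_le_one power_le_one)
      then have "norm (J L - m) \<le> E" using norm_triangle_ineq4[of "J L" m] by (simp add: E_def)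
      also have "E \<le> E / L ^ k"
      proof -
        have "L ^ k \<le> 1" using L by (intro power_le_one) auto
        then have "E * L ^ k \<le> E * 1" using E by (intro mult_left_mono)
        then show ?thesis using L by (simp add: field_simps)
      qed
      finally show ?thesis .
    qed
    show "\<exists>C. \<forall>L>0. norm (J L - m) \<le> C / L ^ k"
    proof (intro exI[of _ "C + E"] allI impI)
      fix L :: real assume "0 < L"
      have "C / L ^ k \<le> (C + E) / L ^ k" "E / L ^ k \<le> (C + E) / L ^ k"
        using \<open>0 < L\<close> C(1) E by (auto intro!: divide_right_mono)
      then show "norm (J L - m) \<le> (C + E) / L ^ k"
        using big[of L] small[of L] \<open>0 < L\<close> by fastforce
    qed
  qed
qed

section \<open>Integration by parts off the stationary point\<close>

text \<open>A Newton step with the lower bound c in place of h'': the point z = x - h'(x)/c reaches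
  or overshoots the zero of h' as long as h'' \<ge> c along the way. Either the segment from x to z
  leaves \<open>K\<close>, or the intermediate value theorem finds a zero on it.\<close>

lemma deriv_gap_or_zero:
  fixes h :: "nat \<Rightarrow> real \<Rightarrow> real"
  assumes h: "\<And>n x. (h n has_real_derivative h (Suc n) x) (at x)"
    and c: "0 < c" "\<And>z. z \<in> K \<Longrightarrow> c \<le> h 2 z" and x: "x \<in> K"
  shows "\<exists>y. \<bar>x - y\<bar> \<le> \<bar>h 1 x\<bar> / c \<and> (y \<in> K \<longrightarrow> h 1 y = 0)"
proof -
  define z where "z = x - h 1 x / c"
  have zx: "\<bar>x - y\<bar> \<le> \<bar>h 1 x\<bar> / c" if "y \<in> closed_segment x z" for y
  proof -
    have "\<bar>x - y\<bar> \<le> \<bar>x - z\<bar>" using that by (auto simp: closed_segment_eq_real_ivl split: if_splits)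
    then show ?thesis using c by (simp add: z_def)
  qed
  show ?thesis
  proof (cases "closed_segment x z \<subseteq> K")
    case False
    then show ?thesis using zx by blast
  next
    case True
    have hc: "continuous_on A (h 1)" for A
      using h by (meson DERIV_continuous_on has_field_derivative_at_within)
    consider "h 1 x = 0" | "0 < h 1 x" | "h 1 x < 0" by linarith
    then have "\<exists>y\<in>closed_segment x z. h 1 y = 0"
    proof cases
      case 1 then show ?thesis by auto
    next
      case 2
      then have lt: "z < x" using c by (simp add: z_def)
      obtain \<xi> where \<xi>: "z < \<xi>" "\<xi> < x" "h 1 x - h 1 z = (x - z) * h 2 \<xi>"
        using MVT2[OF lt, of "h 1" "h 2"] h[of 1] by (metis Suc_1)
      have "\<xi> \<in> closed_segment x z" using \<xi> by (auto simp: closed_segment_eq_real_ivl)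
      with True have "\<xi> \<in> K" by blast
      then have "c \<le> h 2 \<xi>" by (rule c(2))
      then have "(x - z) * c \<le> h 1 x - h 1 z" unfolding \<xi>(3) using lt by (intro mult_left_mono) auto
      then have "h 1 z \<le> 0" using c by (simp add: z_def)
      then show ?thesis using IVT'[of "h 1" z 0 x] 2 lt hc by (auto simp: closed_segment_eq_real_ivl)
    next
      case 3
      then have lt: "x < z" using c by (simp add: z_def field_simps)
      obtain \<xi> where \<xi>: "x < \<xi>" "\<xi> < z" "h 1 z - h 1 x = (z - x) * h 2 \<xi>"
        using MVT2[OF lt, of "h 1" "h 2"] h[of 1] by (metis Suc_1)
      have "\<xi> \<in> closed_segment x z" using \<xi> by (auto simp: closed_segment_eq_real_ivl)
      with True have "\<xi> \<in> K" by blast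
      then have "c \<le> h 2 \<xi>" by (rule c(2))
      then have "(z - x) * c \<le> h 1 z - h 1 x" unfolding \<xi>(3) using lt by (intro mult_left_mono) auto
      then have "0 \<le> h 1 z" using c by (simp add: z_def)
      then show ?thesis using IVT'[of "h 1" x 0 z] 3 lt hc by (auto simp: closed_segment_eq_real_ivl)
    qed
    then show ?thesis using zx by blast
  qed
qed

text \<open>Taylor expansion of the a-th derivative about a point where everything vanishes: each
  power of the distance is bought with one more derivative, that is, one factor X.\<close>

lemma norm_le_of_flat_point:
  fixes v :: "nat \<Rightarrow> real \<Rightarrow> complex"
  assumes "\<And>n x. (v n has_vector_derivative v (Suc n) x) (at x)"
    and "\<And>n x. norm (v n x) \<le> A n * X ^ n" and "\<And>n. v n y = 0"
  shows "norm (v a x) \<le> A (a + m) * X ^ (a + m) * \<bar>x - y\<bar> ^ m"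
  using taylor_bound[of "\<lambda>n. v (a + n)" y x m "A (a + m) * X ^ (a + m)"] assms by simp

text \<open>One fibre of the problem in the rescaled variable, \<open>K\<close> being the fibre of
  the support. The amplitude is controlled on the whole line, the phase only on \<open>K\<close>.
  The sequences \<open>A\<close>, \<open>B\<close> and the number \<open>c\<close> are separate
  arguments so that constants can be chosen before \<open>h\<close>, \<open>v\<close>,
  \<open>K\<close> and \<open>X\<close>.\<close>

definition phase_data_1d ::
  "(nat \<Rightarrow> real) \<Rightarrow> (nat \<Rightarrow> real) \<Rightarrow> real \<Rightarrow> real \<Rightarrow> real \<Rightarrow> (nat \<Rightarrow> real \<Rightarrow> real) \<Rightarrow> (nat \<Rightarrow> real \<Rightarrow> complex)
    \<Rightarrow> real set \<Rightarrow> real \<Rightarrow> bool" where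
  "phase_data_1d A B c \<alpha> \<beta> h v K X \<longleftrightarrow> 1 \<le> X \<and> closed K \<and> K \<subseteq> {\<alpha>..\<beta>} \<and>
     (\<forall>n x. (h n has_real_derivative h (Suc n) x) (at x)) \<and>
     (\<forall>n x. (v n has_vector_derivative v (Suc n) x) (at x)) \<and>
     (\<forall>n x. x \<notin> K \<longrightarrow> v n x = 0) \<and> (\<forall>n x. norm (v n x) \<le> A n * X ^ n) \<and>
     (\<forall>x\<in>K. \<forall>j. \<bar>h j x\<bar> \<le> B j) \<and> (\<forall>x\<in>K. c \<le> h 2 x)"

text \<open>Here 1/\<mu> is the cost of a derivative of the cutoff \<eta>, and the weight is
  \<theta> = 1/g with g = min \<mu> |h'|. Where |h'| is below c \<mu>/2, a gap of \<open>K\<close>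
  lies within |h'|/c, and the flatness of \<open>v\<close> there supplies a factor (g/\<mu>)^(2k),
  which cancels the g^(-2k) lost in k integrations by parts. What remains is 1/(\<mu>^2 Y) per
  integration.\<close>

lemma phase_integral_off_stationary:
  fixes A B H :: "nat \<Rightarrow> real"
  assumes A: "\<And>j. 1 \<le> A j" and B: "\<And>j. 1 \<le> B j" and H: "\<And>j. 1 \<le> H j" and c: "0 < c" "c \<le> 1" and ab: "\<alpha> \<le> \<beta>"
  shows "\<exists>C\<ge>1. \<forall>h v K X \<eta> \<mu> S Y. phase_data_1d A B c \<alpha> \<beta> h v K X \<longrightarrow> 0 < Y \<longrightarrow> 0 < \<mu> \<longrightarrow> \<mu> * X \<le> 1 \<longrightarrow>
    (\<forall>n x. (\<eta> n has_vector_derivative \<eta> (Suc n) x) (at x)) \<longrightarrow>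
    (\<forall>n x. norm (\<eta> n x) \<le> H n * (1 / \<mu>) ^ n) \<longrightarrow> closed S \<longrightarrow> S \<subseteq> K \<longrightarrow> (\<forall>x\<in>K - S. \<forall>n. \<eta> n x = 0) \<longrightarrow>
    (\<forall>x\<in>S. h 1 x \<noteq> 0 \<and> (c * \<mu> / 2 \<le> \<bar>h 1 x\<bar> \<or> (\<exists>y. y \<notin> K \<and> \<bar>x - y\<bar> \<le> \<bar>h 1 x\<bar> / c))) \<longrightarrow>
    norm (integral {\<alpha>-1..\<beta>+1} (\<lambda>x. exp (\<i> * of_real (Y * h 0 x)) * (v 0 x * \<eta> 0 x))) \<le> C * (1 / (\<mu>\<^sup>2 * Y)) ^ k"
proof -
  obtain C where C: "1 \<le> C" and ns: "\<And>(h :: nat \<Rightarrow> real \<Rightarrow> real) u S \<theta> \<sigma> Y a b V.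
    0 < Y \<Longrightarrow> a \<le> b \<Longrightarrow> 0 \<le> V \<Longrightarrow>
    (\<forall>n x. (h n has_real_derivative h (Suc n) x) (at x)) \<Longrightarrow>
    (\<forall>n x. (u n has_vector_derivative u (Suc n) x) (at x)) \<Longrightarrow>
    closed S \<Longrightarrow> S \<subseteq> {a<..<b} \<Longrightarrow> (\<forall>n x. x \<notin> S \<longrightarrow> u n x = 0) \<Longrightarrow>
    (\<forall>x\<in>S. h 1 x \<noteq> 0 \<and> 1 \<le> \<theta> x \<and> 1 \<le> \<theta> x * \<bar>h 1 x\<bar> \<and> (\<forall>j\<ge>2. \<bar>h j x\<bar> \<le> B j)) \<Longrightarrow>
    (\<forall>x\<in>S. \<forall>j\<le>k. norm (u j x) \<le> \<sigma> x * \<theta> x ^ j) \<Longrightarrow>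
    (\<forall>x\<in>S. \<sigma> x * \<theta> x ^ (2 * k) \<le> V) \<Longrightarrow>
    norm (integral {a..b} (\<lambda>x. exp (\<i> * of_real (Y * h 0 x)) * u 0 x)) \<le> C * V * (b - a) / Y ^ k"
    using nonstationary_phase[of B k, OF B] by blast
  \<comment> \<open>Derivatives of order at most k, and 2k more for the flatness estimate.\<close>
  define A' where "A' = (\<Sum>j\<le>3 * k. A j)"
  define H' where "H' = (\<Sum>j\<le>k. H j)"
  have A': "A j \<le> A'" if "j \<le> 3 * k" for j unfolding A'_def
    by (rule member_le_sum) (use that A in \<open>auto intro: order_trans[OF zero_le_one]\<close>)
  have H': "H j \<le> H'" if "j \<le> k" for j unfolding H'_def
    by (rule member_le_sum) (use that H in \<open>auto intro: order_trans[OF zero_le_one]\<close>)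
  have A'1: "1 \<le> A'" using A'[of 0] A[of 0] by simp
  have H'1: "1 \<le> H'" using H'[of 0] H[of 0] by simp
  define P where "P = A' * (2 / c) ^ (2 * k)"
  define Q where "Q = 2 ^ k * (P * H')"
  have P1: "1 \<le> P" unfolding P_def using A'1 c by (intro mult_ge1_I one_le_power) auto
  have Q1: "1 \<le> Q" unfolding Q_def using P1 H'1 by (intro mult_ge1_I) auto
  show ?thesis
  proof (intro exI[of _ "C * Q * (\<beta> - \<alpha> + 2)"] conjI allI impI)
    show "1 \<le> C * Q * (\<beta> - \<alpha> + 2)" using C Q1 ab by (intro mult_ge1_I) auto
    fix h v K and X :: real and \<eta> :: "nat \<Rightarrow> real \<Rightarrow> complex" and \<mu> S and Y :: real
    assume D: "phase_data_1d A B c \<alpha> \<beta> h v K X" and Y: "0 < Y" and \<mu>: "0 < \<mu>" "\<mu> * X \<le> 1"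
      and \<eta>: "\<forall>n x. (\<eta> n has_vector_derivative \<eta> (Suc n) x) (at x)"
      and \<eta>b: "\<forall>n x. norm (\<eta> n x) \<le> H n * (1 / \<mu>) ^ n" and S: "closed S" "S \<subseteq> K"
      and \<eta>0: "\<forall>x\<in>K - S. \<forall>n. \<eta> n x = 0"
      and hS: "\<forall>x\<in>S. h 1 x \<noteq> 0 \<and> (c * \<mu> / 2 \<le> \<bar>h 1 x\<bar> \<or> (\<exists>y. y \<notin> K \<and> \<bar>x - y\<bar> \<le> \<bar>h 1 x\<bar> / c))"
    from D have X: "1 \<le> X" and K: "closed K" "K \<subseteq> {\<alpha>..\<beta>}"
      and h: "\<And>n x. (h n has_real_derivative h (Suc n) x) (at x)"
      and v: "\<And>n x. (v n has_vector_derivative v (Suc n) x) (at x)"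
      and v0: "\<And>n x. x \<notin> K \<Longrightarrow> v n x = 0" and vb: "\<And>n x. norm (v n x) \<le> A n * X ^ n"
      and hb: "\<And>x j. x \<in> K \<Longrightarrow> \<bar>h j x\<bar> \<le> B j"
      unfolding phase_data_1d_def by auto
    have X\<mu>: "X ^ n \<le> (1 / \<mu>) ^ n" for n using X \<mu> by (intro power_mono) (auto simp: field_simps)
    have \<mu>1: "\<mu> \<le> 1"
    proof -
      have "\<mu> * 1 \<le> \<mu> * X" using X \<mu> by (intro mult_left_mono) auto
      then show ?thesis using \<mu> by linarith
    qed
    define u where "u j x = bconv (\<lambda>k. v k x) (\<lambda>k. \<eta> k x) j" for j x
    have u: "(u j has_vector_derivative u (Suc j) x) (at x)" for j x
      unfolding u_def using \<eta> by (intro bconv_has_vector_derivative v) auto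
    have u0: "u j x = 0" if "x \<notin> S" for j x
      unfolding u_def bconv_def using v0 \<eta>0 that by (cases "x \<in> K") (auto intro!: sum.neutral)
    define g where "g x = min \<mu> \<bar>h 1 x\<bar>" for x
    have g: "0 < g x" "g x \<le> \<mu>" "g x \<le> \<bar>h 1 x\<bar>" if "x \<in> S" for x using hS that \<mu> by (auto simp: g_def)
    have vS: "norm (v j x) \<le> P * (g x / \<mu>) ^ (2 * k) * (1 / \<mu>) ^ j" if x: "x \<in> S" and j: "j \<le> k" for x j
    proof -
      have triv: "norm (v j x) \<le> A' * (1 / \<mu>) ^ j"
        using vb[of j x] A'[of j] A[of j] A'1 X\<mu>[of j] j X \<mu>
        by (intro order_trans[OF vb] mult_mono) auto
      have "norm (v j x) \<le> A' * (1 / \<mu>) ^ j * ((2 / c) * (g x / \<mu>)) ^ (2 * k)"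
      \<comment> \<open>Either g is comparable to \<mu> and the extra factor is at least 1, or g < c
        \<mu>/2 < \<mu>, so that g = |h'| and the gap alternative must hold.\<close>
      proof (cases "1 \<le> (2 / c) * (g x / \<mu>)")
        case True
        have "A' * (1 / \<mu>) ^ j * 1 \<le> A' * (1 / \<mu>) ^ j * ((2 / c) * (g x / \<mu>)) ^ (2 * k)"
          using True A'1 \<mu> by (intro mult_left_mono one_le_power) auto
        with triv show ?thesis by simp
      next
        case False
        then have gc: "g x < c * \<mu> / 2" using c \<mu> by (simp add: field_simps)
        also have "\<dots> < \<mu>"
        proof -
          have "c * \<mu> \<le> 1 * \<mu>" using c \<mu> by (intro mult_right_mono) auto
          then show ?thesis using \<mu> by simp
        qed
        finally have gh: "g x = \<bar>h 1 x\<bar>" by (auto simp: g_def min_def split: if_splits)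
        with gc hS x obtain y where y: "y \<notin> K" "\<bar>x - y\<bar> \<le> g x / c" by fastforce
        have "norm (v j x) \<le> A (j + 2 * k) * X ^ (j + 2 * k) * \<bar>x - y\<bar> ^ (2 * k)"
          by (rule norm_le_of_flat_point[OF v vb]) (use v0 y in auto)
        also have "\<dots> \<le> A' * (1 / \<mu>) ^ (j + 2 * k) * (g x / c) ^ (2 * k)"
          using j A'1 X \<mu>(1)
          by (intro mult_mono A' X\<mu> power_mono[OF y(2)]) (auto intro!: mult_nonneg_nonneg)
        also have "\<dots> = A' * (1 / \<mu>) ^ j * ((1 / c) * (g x / \<mu>)) ^ (2 * k)"
          by (simp add: power_add power_mult_distrib power_divide)
        also have "\<dots> \<le> A' * (1 / \<mu>) ^ j * ((2 / c) * (g x / \<mu>)) ^ (2 * k)"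
          using A'1 \<mu> c g[OF x] by (intro mult_left_mono power_mono mult_right_mono) (auto simp: field_simps)
        finally show ?thesis .
      qed
      then show ?thesis unfolding P_def power_mult_distrib[of "2 / c"] by (simp only: mult_ac)
    qed
    have "norm (integral {\<alpha>-1..\<beta>+1} (\<lambda>x. exp (\<i> * of_real (Y * h 0 x)) * u 0 x))
       \<le> C * (Q * (1 / \<mu>) ^ (2 * k)) * ((\<beta> + 1) - (\<alpha> - 1)) / Y ^ k"
    \<comment> \<open>The factor g^(2k) in \<sigma> and the \<theta>^(2k) spent by the integrations
      by parts cancel, leaving the constant \<mu>^(-2k).\<close>
    proof (rule ns[where S = S and \<theta> = "\<lambda>x. 1 / g x" and \<sigma> = "\<lambda>x. Q * (g x / \<mu>) ^ (2 * k)"])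
      show "\<forall>x\<in>S. \<forall>j\<le>k. norm (u j x) \<le> Q * (g x / \<mu>) ^ (2 * k) * (1 / g x) ^ j"
      proof (intro ballI allI impI)
        fix x j assume x: "x \<in> S" and j: "j \<le> k"
        have "norm (u j x) \<le> 2 ^ j * (P * (g x / \<mu>) ^ (2 * k) * H' * (1 / \<mu>) ^ j)"
          unfolding u_def
        proof (rule norm_bconv_le)
          fix i assume i: "i \<le> j"
          show "norm (v i x) \<le> P * (g x / \<mu>) ^ (2 * k) * (1 / \<mu>) ^ i" using vS[OF x, of i] i j by simp
          have "norm (\<eta> i x) \<le> H i * (1 / \<mu>) ^ i" using \<eta>b by blast
          also have "\<dots> \<le> H' * (1 / \<mu>) ^ i" using H'[of i] i j \<mu> by (intro mult_right_mono) auto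
          finally show "norm (\<eta> i x) \<le> H' * (1 / \<mu>) ^ i" .
        qed (use \<mu> in auto)
        also have "\<dots> \<le> 2 ^ k * (P * (g x / \<mu>) ^ (2 * k) * H' * (1 / g x) ^ j)"
          using j P1 H'1 g[OF x] \<mu> by (intro mult_mono power_increasing power_mono) (auto simp: field_simps)
        finally show "norm (u j x) \<le> Q * (g x / \<mu>) ^ (2 * k) * (1 / g x) ^ j"
          by (simp add: Q_def mult_ac)
      qed
      show "\<forall>x\<in>S. Q * (g x / \<mu>) ^ (2 * k) * (1 / g x) ^ (2 * k) \<le> Q * (1 / \<mu>) ^ (2 * k)"
      proof
        fix x assume "x \<in> S"
        then have "0 < g x" using g by blast
        then have "Q * (g x / \<mu>) ^ (2 * k) * (1 / g x) ^ (2 * k) = Q * (1 / \<mu>) ^ (2 * k)"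
          by (simp add: power_divide)
        then show "Q * (g x / \<mu>) ^ (2 * k) * (1 / g x) ^ (2 * k) \<le> Q * (1 / \<mu>) ^ (2 * k)" by (rule eq_refl)
      qed
      show "\<forall>x\<in>S. h 1 x \<noteq> 0 \<and> 1 \<le> 1 / g x \<and> 1 \<le> 1 / g x * \<bar>h 1 x\<bar> \<and> (\<forall>j\<ge>2. \<bar>h j x\<bar> \<le> B j)"
        using hS g \<mu>1 hb S(2) by (auto simp: field_simps intro: order_trans)
    qed (use Y ab Q1 \<mu> h u u0 S K in auto)
    also have "\<dots> = C * Q * (\<beta> - \<alpha> + 2) * ((1 / \<mu>) ^ (2 * k) / Y ^ k)" by simp
    also have "(1 / \<mu>) ^ (2 * k) / Y ^ k = (1 / (\<mu>\<^sup>2 * Y)) ^ k"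
      by (simp add: power_mult[symmetric] power_divide power_mult_distrib)
    finally show "norm (integral {\<alpha>-1..\<beta>+1} (\<lambda>x. exp (\<i> * of_real (Y * h 0 x)) * (v 0 x * \<eta> 0 x)))
       \<le> C * Q * (\<beta> - \<alpha> + 2) * (1 / (\<mu>\<^sup>2 * Y)) ^ k" by (simp add: u_def)
  qed
qed

text \<open>Take \<eta> = 1 and \<mu> = 1/X. As h' has no zero in \<open>K\<close>, the point found
  by \<open>deriv_gap_or_zero\<close> is always a gap of \<open>K\<close>.\<close>

lemma phase_integral_without_stationary_point:
  fixes A B :: "nat \<Rightarrow> real"
  assumes A: "\<And>j. 1 \<le> A j" and B: "\<And>j. 1 \<le> B j" and c: "0 < c" "c \<le> 1" and ab: "\<alpha> \<le> \<beta>"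
  shows "\<exists>C\<ge>1. \<forall>h v K X Y. phase_data_1d A B c \<alpha> \<beta> h v K X \<longrightarrow> 0 < Y \<longrightarrow> (\<forall>x\<in>K. h 1 x \<noteq> 0) \<longrightarrow>
    norm (integral {\<alpha>-1..\<beta>+1} (\<lambda>x. exp (\<i> * of_real (Y * h 0 x)) * v 0 x)) \<le> C * (X\<^sup>2 / Y) ^ k"
proof -
  obtain C where C: "1 \<le> C" and *: "\<And>h v K X \<eta> \<mu> S Y. phase_data_1d A B c \<alpha> \<beta> h v K X \<Longrightarrow> 0 < Y \<Longrightarrow> 0 < \<mu> \<Longrightarrow> \<mu> * X \<le> 1 \<Longrightarrow>
    (\<forall>n x. (\<eta> n has_vector_derivative \<eta> (Suc n) x) (at x)) \<Longrightarrow>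
    (\<forall>n x. norm (\<eta> n x) \<le> 1 * (1 / \<mu>) ^ n) \<Longrightarrow> closed S \<Longrightarrow> S \<subseteq> K \<Longrightarrow> (\<forall>x\<in>K - S. \<forall>n. \<eta> n x = 0) \<Longrightarrow>
    (\<forall>x\<in>S. h 1 x \<noteq> 0 \<and> (c * \<mu> / 2 \<le> \<bar>h 1 x\<bar> \<or> (\<exists>y. y \<notin> K \<and> \<bar>x - y\<bar> \<le> \<bar>h 1 x\<bar> / c))) \<Longrightarrow>
    norm (integral {\<alpha>-1..\<beta>+1} (\<lambda>x. exp (\<i> * of_real (Y * h 0 x)) * (v 0 x * \<eta> 0 x))) \<le> C * (1 / (\<mu>\<^sup>2 * Y)) ^ k"
    using phase_integral_off_stationary[of A B "\<lambda>_. 1" c \<alpha> \<beta> k, OF A B order_refl c ab] by blast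
  show ?thesis
  proof (intro exI[of _ C] conjI allI impI)
    fix h v K X and Y :: real
    assume D: "phase_data_1d A B c \<alpha> \<beta> h v K X" and Y: "0 < Y" and h1: "\<forall>x\<in>K. h 1 x \<noteq> 0"
    then have X: "1 \<le> X" and K: "closed K" and h: "\<And>n x. (h n has_real_derivative h (Suc n) x) (at x)"
      and h2: "\<And>x. x \<in> K \<Longrightarrow> c \<le> h 2 x"
      by (auto simp: phase_data_1d_def)
    define \<eta> :: "nat \<Rightarrow> real \<Rightarrow> complex" where "\<eta> n x = (if n = 0 then 1 else 0)" for n x
    have \<eta>: "(\<eta> n has_vector_derivative \<eta> (Suc n) x) (at x)" for n x
      by (simp add: \<eta>_def[abs_def])
    have "norm (integral {\<alpha>-1..\<beta>+1} (\<lambda>x. exp (\<i> * of_real (Y * h 0 x)) * (v 0 x * \<eta> 0 x))) \<le> C * (1 / ((1 / X)\<^sup>2 * Y)) ^ k"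
    proof (rule *[OF D Y, where S = K])
      show "\<forall>n x. norm (\<eta> n x) \<le> 1 * (1 / (1 / X)) ^ n" using X by (simp add: \<eta>_def)
      show "\<forall>x\<in>K. h 1 x \<noteq> 0 \<and> (c * (1 / X) / 2 \<le> \<bar>h 1 x\<bar> \<or> (\<exists>y. y \<notin> K \<and> \<bar>x - y\<bar> \<le> \<bar>h 1 x\<bar> / c))"
        using deriv_gap_or_zero[OF h c(1) h2] h1 by metis
    qed (use X \<eta> K in auto)
    then show "norm (integral {\<alpha>-1..\<beta>+1} (\<lambda>x. exp (\<i> * of_real (Y * h 0 x)) * v 0 x)) \<le> C * (X\<^sup>2 / Y) ^ k"
      using X by (simp add: \<eta>_def power_divide)
  qed (rule C)
qed

section \<open>Expansion near the stationary point\<close>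

text \<open>
  The quadratic Taylor polynomial of the phase \<open>y\<^sup>2 h\<close> at the critical point is split off; the \<open>n\<close>-th
  Taylor coefficient of the amplitude times the exponential of the rest is then integrated against
  the resulting Gaussian, whose \<open>n\<close>-th moment (Fresnel integral) is \<open>m n\<close>.
\<close>

definition stationary_term ::
  "(nat \<Rightarrow> complex) \<Rightarrow> real \<Rightarrow> (nat \<Rightarrow> real) \<Rightarrow> (nat \<Rightarrow> complex) \<Rightarrow> nat \<Rightarrow> complex" where
  "stationary_term m y h v n =
     m n / fact n * of_real ((1 / sqrt (h 2)) ^ Suc n * (1 / y) ^ n) *
     bconv v (exp_seq (\<lambda>j. if 3 \<le> j then \<i> * of_real (y\<^sup>2 * h j) else 0)) n"

text \<open>
  The scale \<open>\<kappa>\<^sup>2 / y\<close> is the largest one at which neither the amplitude nor the part of the phase of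
  order at least three varies by more than a bounded amount.
\<close>

lemma norm_taylor_coeff_le:
  fixes A B :: "nat \<Rightarrow> real"
  assumes B: "\<And>j. 1 \<le> B j"
  shows "\<exists>C\<ge>1. \<forall>v a V \<theta>. 0 \<le> \<theta> \<longrightarrow> 0 \<le> V \<longrightarrow> Re (a 0) = 0 \<longrightarrow> (\<forall>j. 1 \<le> j \<longrightarrow> j \<le> n \<longrightarrow> norm (a j) \<le> B j * \<theta> ^ j) \<longrightarrow>
      (\<forall>j\<le>n. norm (v j) \<le> V * \<theta> ^ j) \<longrightarrow> norm (bconv v (exp_seq a) n) \<le> C * V * \<theta> ^ n"
proof -
  have "\<forall>n. \<exists>C\<ge>1. \<forall>a \<theta>. 0 \<le> \<theta> \<longrightarrow> Re (a 0) = 0 \<longrightarrow> (\<forall>k. 1 \<le> k \<longrightarrow> k \<le> n \<longrightarrow> norm (a k) \<le> B k * \<theta> ^ k) \<longrightarrow>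
           norm (exp_seq a n) \<le> C * \<theta> ^ n"
    using norm_exp_seq_le[of B, OF B] by blast
  from choice[OF this] obtain D where D1: "\<And>n. D n \<ge> 1" and
    D: "\<And>n a \<theta>. 0 \<le> \<theta> \<Longrightarrow> Re (a 0) = 0 \<Longrightarrow> (\<forall>k. 1 \<le> k \<longrightarrow> k \<le> n \<longrightarrow> norm (a k) \<le> B k * \<theta> ^ k) \<Longrightarrow>
           norm (exp_seq a n) \<le> D n * \<theta> ^ n" by metis
  define E where "E = (\<Sum>j\<le>n. D j)"
  have DE: "D j \<le> E" if "j \<le> n" for j unfolding E_def
    by (rule member_le_sum) (use that D1 in \<open>auto intro: order_trans[OF zero_le_one]\<close>)
  have E: "1 \<le> E" using D1[of 0] DE[of 0] by simp
  show ?thesis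
  proof (intro exI[of _ "2 ^ n * E"] conjI allI impI)
    show "1 \<le> 2 ^ n * E" using E by (intro mult_ge1_I) auto
    fix v a :: "nat \<Rightarrow> complex" and V \<theta> :: real
    assume th: "0 \<le> \<theta>" and V: "0 \<le> V" and a0: "Re (a 0) = 0" and a: "\<forall>j. 1 \<le> j \<longrightarrow> j \<le> n \<longrightarrow> norm (a j) \<le> B j * \<theta> ^ j"
      and v: "\<forall>j\<le>n. norm (v j) \<le> V * \<theta> ^ j"
    have "norm (bconv v (exp_seq a) n) \<le> 2 ^ n * (V * E * \<theta> ^ n)"
    proof (rule norm_bconv_le)
      fix k assume k: "k \<le> n"
      show "norm (v k) \<le> V * \<theta> ^ k" using v k by auto
      have "norm (exp_seq a k) \<le> D k * \<theta> ^ k" using a k th a0 by (intro D) auto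
      also have "\<dots> \<le> E * \<theta> ^ k" using DE[OF k] th by (intro mult_right_mono) auto
      finally show "norm (exp_seq a k) \<le> E * \<theta> ^ k" .
    qed (rule th)
    then show "norm (bconv v (exp_seq a) n) \<le> 2 ^ n * E * V * \<theta> ^ n" by (simp add: mult_ac)
  qed
qed

text \<open>Origin of the exponent 6: for y = X \<kappa>^e, the cube of y/\<kappa>^2 dominates y^2
  for all X and \<kappa> from 1 on exactly when 3(e - 2) \<ge> 2e. Then \<theta> = y/\<kappa>^2 is a
  common cost per derivative for the amplitude and for the phase from order three on, while on a
  ball of radius \<kappa>/y each Taylor order gains \<theta> \<kappa>/y = 1/\<kappa>.\<close>

lemma phase_scale:
  fixes X \<kappa> y :: real
  assumes "1 \<le> X" "1 \<le> \<kappa>" "y = X * \<kappa> ^ 6"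
  shows "0 < y" "1 \<le> y" "\<kappa>\<^sup>2 / y \<le> 1" "X \<le> y / \<kappa>\<^sup>2" "X * (\<kappa> / y) \<le> 1 / \<kappa>" "\<kappa> / y \<le> \<kappa>\<^sup>2 / y"
    "3 \<le> j \<Longrightarrow> y\<^sup>2 \<le> (y / \<kappa>\<^sup>2) ^ j"
proof -
  have pk: "1 \<le> \<kappa> ^ n" for n using assms by simp
  show y1: "1 \<le> y" using assms mult_ge1_I[of X "\<kappa> ^ 6"] by simp
  then show y0: "0 < y" by simp
  have k0: "0 < \<kappa>" using assms by simp
  have yk: "y / \<kappa>\<^sup>2 = X * \<kappa> ^ 4" using assms k0 by (simp add: field_simps power_numeral_reduce)
  show X: "X \<le> y / \<kappa>\<^sup>2" unfolding yk using assms pk[of 4] by (simp add: mult_le_cancel_left1)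
  then have yk1: "1 \<le> y / \<kappa>\<^sup>2" using assms(1) by linarith
  then show "\<kappa>\<^sup>2 / y \<le> 1" using y0 k0 by (simp add: le_divide_eq divide_le_eq)
  have "X * (\<kappa> / y) = 1 / \<kappa> ^ 5" using assms k0 by (simp add: field_simps power_numeral_reduce)
  also have "\<dots> \<le> 1 / \<kappa>" using k0 power_increasing[of 1 5 \<kappa>] assms(2) by (intro divide_left_mono) auto
  finally show "X * (\<kappa> / y) \<le> 1 / \<kappa>" .
  show "\<kappa> / y \<le> \<kappa>\<^sup>2 / y" using y0 assms by (intro divide_right_mono) (auto simp: power2_eq_square)
  assume j: "3 \<le> j"
  have "y\<^sup>2 = X\<^sup>2 * \<kappa> ^ 12" using assms by (simp add: power_mult_distrib power_mult[symmetric])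
  also have "\<dots> \<le> X ^ 3 * \<kappa> ^ 12" using assms by (intro mult_right_mono power_increasing) auto
  also have "\<dots> = (y / \<kappa>\<^sup>2) ^ 3" unfolding yk by (simp add: power_mult_distrib power_mult[symmetric])
  also have "\<dots> \<le> (y / \<kappa>\<^sup>2) ^ j" using j yk1 by (intro power_increasing)
  finally show "y\<^sup>2 \<le> (y / \<kappa>\<^sup>2) ^ j" .
qed

text \<open>Apart from a power of s, the cutoff radius \<delta> and the frequency s enter only
  through \<delta> s. For \<delta> = \<kappa>/y and s = y sqrt h'' this product is \<kappa> sqrt
  h'', so the truncated moments approach their limits as \<kappa> grows, whatever y is.\<close>

lemma model_integral:
  fixes \<psi> :: "nat \<Rightarrow> real \<Rightarrow> complex" and n :: nat
  assumes \<psi>: "\<And>n x. (\<psi> n has_vector_derivative \<psi> (Suc n) x) (at x)"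
    and \<psi>0: "\<And>n x. 1 < \<bar>x\<bar> \<Longrightarrow> \<psi> n x = 0"
    and d: "0 < \<delta>" "a \<le> x0 - \<delta>" "x0 + \<delta> \<le> b" and s: "0 < s"
  defines "J \<equiv> \<lambda>L. of_real (L ^ Suc n) * integral {-3..3} (\<lambda>x. exp (\<i> * of_real (L\<^sup>2 * (x\<^sup>2 / 2))) * (of_real (x ^ n) * \<psi> 0 x))"
  shows "integral {a..b} (\<lambda>x. exp (\<i> * of_real (s\<^sup>2 * (x - x0)\<^sup>2 / 2)) * (of_real ((x - x0) ^ n) * \<psi> 0 ((x - x0) / \<delta>)))
     = of_real ((1 / s) ^ Suc n) * J (\<delta> * s)"
proof -
  have ccont: "continuous_on A (\<psi> 0)" for A by (rule deriv_family_continuous[OF \<psi>])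
  define f where "f x = exp (\<i> * of_real ((\<delta> * s)\<^sup>2 * (x\<^sup>2 / 2))) * (of_real (x ^ n) * \<psi> 0 x)" for x
  have "integral {a..b} (\<lambda>x. f ((x - x0) / \<delta>)) = of_real \<delta> * integral {-3..3} f"
  proof (rule integral_rescale)
    show "continuous_on UNIV f" unfolding f_def by (intro continuous_intros ccont) auto
    show "f x = 0" if "x \<notin> {- 3..3}" for x
    proof -
      have "1 < \<bar>x\<bar>" using that by auto
      then show ?thesis by (simp add: f_def \<psi>0)
    qed
    show "f ((x - x0) / \<delta>) = 0" if "x \<notin> {a..b}" for x
    proof -
      have "\<delta> < \<bar>x - x0\<bar>" using that d by auto
      then have "1 < \<bar>(x - x0) / \<delta>\<bar>" using d by (simp add: field_simps)
      then show ?thesis by (simp add: f_def \<psi>0)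
    qed
  qed (use d in auto)
  moreover have "(\<lambda>x. exp (\<i> * of_real (s\<^sup>2 * (x - x0)\<^sup>2 / 2)) * (of_real ((x - x0) ^ n) * \<psi> 0 ((x - x0) / \<delta>)))
     = (\<lambda>x. of_real (\<delta> ^ n) * f ((x - x0) / \<delta>))"
  proof
    fix x
    have e1: "(\<delta> * s)\<^sup>2 * (((x - x0) / \<delta>)\<^sup>2 / 2) = s\<^sup>2 * (x - x0)\<^sup>2 / 2"
      using d by (simp add: power_divide power_mult_distrib)
    have e2: "complex_of_real (\<delta> ^ n) * of_real (((x - x0) / \<delta>) ^ n) = of_real ((x - x0) ^ n)"
      unfolding of_real_mult[symmetric] using d by (simp add: power_divide)
    show "exp (\<i> * of_real (s\<^sup>2 * (x - x0)\<^sup>2 / 2)) * (of_real ((x - x0) ^ n) * \<psi> 0 ((x - x0) / \<delta>)) = of_real (\<delta> ^ n) * f ((x - x0) / \<delta>)"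
      unfolding f_def e1 e2[symmetric] by (simp only: mult_ac)
  qed
  ultimately have "integral {a..b} (\<lambda>x. exp (\<i> * of_real (s\<^sup>2 * (x - x0)\<^sup>2 / 2)) * (of_real ((x - x0) ^ n) * \<psi> 0 ((x - x0) / \<delta>)))
     = of_real (\<delta> ^ n) * (of_real \<delta> * integral {-3..3} f)" by simp
  also have "\<dots> = of_real ((1 / s) ^ Suc n) * J (\<delta> * s)"
    unfolding J_def f_def[symmetric] using s by (simp add: power_mult_distrib power_divide)
  finally show ?thesis .
qed

text \<open>Flatness at a point outside \<open>K\<close> gains (2 X \<kappa>/y)^N, at most 2^N
  \<kappa>^(-N). The radius 2 \<kappa>/y covers a ball of radius \<kappa>/y whose centre is within
  \<kappa>/y of the gap.\<close>

lemma norm_near_gap_le: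
  fixes A :: "nat \<Rightarrow> real"
  assumes A: "\<And>j. 1 \<le> A j" and D: "phase_data_1d A B c \<alpha> \<beta> h v K X" and k: "1 \<le> \<kappa>" "y = X * \<kappa> ^ 6"
    and z: "z \<notin> K" "\<bar>x - z\<bar> \<le> 2 * (\<kappa> / y)"
  shows "norm (v j x) \<le> A (j + N) * 2 ^ N / \<kappa> ^ N * (y / \<kappa>\<^sup>2) ^ j"
proof -
  from D have X: "1 \<le> X" and v: "\<And>n x. (v n has_vector_derivative v (Suc n) x) (at x)"
      and v0: "\<And>n x. x \<notin> K \<Longrightarrow> v n x = 0" and vb: "\<And>n x. norm (v n x) \<le> A n * X ^ n"
    unfolding phase_data_1d_def by auto
  note ps = phase_scale[OF X k]
  have "norm (v j x) \<le> A (j + N) * X ^ (j + N) * \<bar>x - z\<bar> ^ N"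
    by (rule norm_le_of_flat_point[OF v vb]) (use v0 z in auto)
  also have "\<dots> \<le> A (j + N) * X ^ (j + N) * (2 * (\<kappa> / y)) ^ N"
    using X A[of "j + N"] z by (intro mult_left_mono power_mono) auto
  also have "\<dots> = A (j + N) * 2 ^ N * (X * (\<kappa> / y)) ^ N * X ^ j"
    by (simp only: power_add power_mult_distrib mult_ac)
  also have "\<dots> \<le> A (j + N) * 2 ^ N * (1 / \<kappa>) ^ N * (y / \<kappa>\<^sup>2) ^ j"
    using X A[of "j + N"] k ps by (intro mult_mono power_mono mult_nonneg_nonneg) auto
  finally show ?thesis by (simp add: power_divide)
qed

lemma one_less_abs_divide: "0 < d \<Longrightarrow> d < \<bar>u\<bar> \<Longrightarrow> 1 < \<bar>u / d\<bar>" for d u :: real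
  by (simp add: field_simps)

text \<open>The Taylor coefficient costs (y/\<kappa>^2)^n and the Gaussian scaling returns y^(-n),
  leaving \<kappa>^(-2n) \<le> 1. Smallness is left to \<open>V\<close>, which near a gap of
  \<open>K\<close> is a high power of 1/\<kappa>.\<close>

lemma norm_stationary_term_le:
  fixes B :: "nat \<Rightarrow> real"
  assumes B: "\<And>j. 1 \<le> B j" and c: "0 < c" "c \<le> 1"
  shows "\<exists>C\<ge>1. \<forall>m h v y \<kappa> X V. 1 \<le> X \<longrightarrow> 1 \<le> \<kappa> \<longrightarrow> y = X * \<kappa> ^ 6 \<longrightarrow> 0 \<le> V \<longrightarrow> c \<le> h 2 \<longrightarrow> (\<forall>j. \<bar>h j\<bar> \<le> B j) \<longrightarrow>
      (\<forall>j\<le>n. norm (v j) \<le> V * (y / \<kappa>\<^sup>2) ^ j) \<longrightarrow> norm (stationary_term m y h v n) \<le> C * norm (m n) * V"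
proof -
  obtain C where C: "1 \<le> C" "\<And>v a V \<theta>. 0 \<le> \<theta> \<Longrightarrow> 0 \<le> V \<Longrightarrow> Re (a 0) = 0 \<Longrightarrow> (\<forall>j. 1 \<le> j \<longrightarrow> j \<le> n \<longrightarrow> norm (a j) \<le> B j * \<theta> ^ j) \<Longrightarrow>
      (\<forall>j\<le>n. norm (v j) \<le> V * \<theta> ^ j) \<Longrightarrow> norm (bconv v (exp_seq a) n) \<le> C * V * \<theta> ^ n"
    using norm_taylor_coeff_le[of B n, OF B] by blast
  show ?thesis
  proof (intro exI[of _ "(1 / sqrt c) ^ Suc n * C"] conjI allI impI)
    show "1 \<le> (1 / sqrt c) ^ Suc n * C" using C c by (intro mult_ge1_I one_le_power) auto
    fix m v :: "nat \<Rightarrow> complex" and h and y \<kappa> X V :: real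
    assume X: "1 \<le> X" and k: "1 \<le> \<kappa>" "y = X * \<kappa> ^ 6" and V: "0 \<le> V" and h2: "c \<le> h 2" and h: "\<forall>j. \<bar>h j\<bar> \<le> B j"
      and v: "\<forall>j\<le>n. norm (v j) \<le> V * (y / \<kappa>\<^sup>2) ^ j"
    note ps = phase_scale[OF X k]
    let ?a = "\<lambda>j. if 3 \<le> j then \<i> * complex_of_real (y\<^sup>2 * h j) else 0"
    have "norm (bconv v (exp_seq ?a) n) \<le> C * V * (y / \<kappa>\<^sup>2) ^ n"
    proof (rule C(2))
      show "\<forall>j. 1 \<le> j \<longrightarrow> j \<le> n \<longrightarrow> norm (?a j) \<le> B j * (y / \<kappa>\<^sup>2) ^ j"
      proof (intro allI impI)
        fix j
        show "norm (?a j) \<le> B j * (y / \<kappa>\<^sup>2) ^ j"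
        proof (cases "3 \<le> j")
          case True
          have "\<bar>h j\<bar> * y\<^sup>2 \<le> B j * (y / \<kappa>\<^sup>2) ^ j"
            using h ps(7)[OF True] B[of j] by (intro mult_mono) auto
          then show ?thesis using True by (simp add: norm_mult norm_power mult.commute)
        next
          case False
          then show ?thesis using B[of j] ps(1) by simp
        qed
      qed
    qed (use ps(1) V v in auto)
    moreover have "norm (of_real ((1 / sqrt (h 2)) ^ Suc n * (1 / y) ^ n) :: complex) \<le> (1 / sqrt c) ^ Suc n * (1 / y) ^ n"
    proof -
      have "1 / sqrt (h 2) \<le> 1 / sqrt c" using c h2 by (intro divide_left_mono) auto
      then have "(1 / sqrt (h 2)) ^ Suc n * (1 / y) ^ n \<le> (1 / sqrt c) ^ Suc n * (1 / y) ^ n"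
        using c h2 ps(1) by (intro mult_right_mono power_mono) auto
      moreover have "0 \<le> (1 / sqrt (h 2)) ^ Suc n * (1 / y) ^ n" using c h2 ps(1) by auto
      ultimately show ?thesis unfolding norm_of_real by linarith
    qed
    moreover have "norm (m n / fact n) \<le> norm (m n)"
      by (simp add: norm_divide divide_le_eq mult_le_cancel_left1)
    ultimately have "norm (stationary_term m y h v n) \<le> norm (m n) * ((1 / sqrt c) ^ Suc n * (1 / y) ^ n) * (C * V * (y / \<kappa>\<^sup>2) ^ n)"
      unfolding stationary_term_def norm_mult using c ps(1) by (intro mult_mono) auto
    also have "\<dots> = (1 / sqrt c) ^ Suc n * C * norm (m n) * V * ((1 / \<kappa>\<^sup>2) ^ n)"
      using ps(1) by (simp add: power_divide)
    also have "\<dots> \<le> (1 / sqrt c) ^ Suc n * C * norm (m n) * V * 1"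
      using C(1) c V k by (intro mult_left_mono power_le_one) auto
    finally show "norm (stationary_term m y h v n) \<le> (1 / sqrt c) ^ Suc n * C * norm (m n) * V" by simp
  qed
qed

text \<open>No cancellation is involved: the amplitude and its derivatives are so small on the ball
  that the integral and the partial sum of the expansion are each of size \<kappa>^(-N).\<close>

lemma near_integral_gap:
  fixes A B :: "nat \<Rightarrow> real" and \<psi> :: "nat \<Rightarrow> real \<Rightarrow> complex"
  assumes A: "\<And>j. 1 \<le> A j" and B: "\<And>j. 1 \<le> B j" and c: "0 < c" "c \<le> 1" and ab: "\<alpha> \<le> \<beta>"
    and \<psi>: "\<And>n x. (\<psi> n has_vector_derivative \<psi> (Suc n) x) (at x)"
    and \<psi>0: "\<And>n x. 1 < \<bar>x\<bar> \<Longrightarrow> \<psi> n x = 0" and H: "\<And>n x. norm (\<psi> n x) \<le> H n"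
  shows "\<exists>C\<ge>0. \<forall>h v K X \<kappa> y x0. phase_data_1d A B c \<alpha> \<beta> h v K X \<longrightarrow> 1 \<le> \<kappa> \<longrightarrow> y = X * \<kappa> ^ 6 \<longrightarrow> x0 \<in> K \<longrightarrow>
     (\<exists>z. z \<notin> K \<and> \<bar>x0 - z\<bar> \<le> \<kappa> / y) \<longrightarrow>
     norm (integral {\<alpha>-1..\<beta>+1} (\<lambda>x. exp (\<i> * of_real (y\<^sup>2 * h 0 x)) * (v 0 x * \<psi> 0 ((x - x0) / (\<kappa> / y)))) -
       exp (\<i> * of_real (y\<^sup>2 * h 0 x0)) / of_real y * (\<Sum>n<N. stationary_term m y (\<lambda>j. h j x0) (\<lambda>j. v j x0) n)) \<le> C / \<kappa> ^ N"
proof -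
  have "\<forall>n. \<exists>C\<ge>1. \<forall>m h v y \<kappa> X V. 1 \<le> X \<longrightarrow> 1 \<le> \<kappa> \<longrightarrow> y = X * \<kappa> ^ 6 \<longrightarrow> 0 \<le> V \<longrightarrow> c \<le> h 2 \<longrightarrow> (\<forall>j. \<bar>h j\<bar> \<le> B j) \<longrightarrow>
      (\<forall>j\<le>n. norm (v j) \<le> V * (y / \<kappa>\<^sup>2) ^ j) \<longrightarrow> norm (stationary_term m y h v n) \<le> C * norm (m n) * V"
    using norm_stationary_term_le[of B c, OF B c] by blast
  from choice[OF this] obtain G where G1: "\<And>n. 1 \<le> G n" and
    G: "\<And>n m h v y \<kappa> X V. 1 \<le> X \<Longrightarrow> 1 \<le> \<kappa> \<Longrightarrow> y = X * \<kappa> ^ 6 \<Longrightarrow> 0 \<le> V \<Longrightarrow> c \<le> h 2 \<Longrightarrow> (\<forall>j. \<bar>h j\<bar> \<le> B j) \<Longrightarrow>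
      (\<forall>j\<le>n. norm (v j) \<le> V * (y / \<kappa>\<^sup>2) ^ j) \<Longrightarrow> norm (stationary_term m y h v n) \<le> G n * norm (m n) * V"
    by metis
  \<comment> \<open>Orders up to N for the terms of the expansion, and N more for flatness.\<close>
  define A' where "A' = (\<Sum>j\<le>2 * N. A j)"
  have A': "A j \<le> A'" if "j \<le> 2 * N" for j unfolding A'_def
    by (rule member_le_sum) (use that A in \<open>auto intro: order_trans[OF zero_le_one]\<close>)
  have A'1: "1 \<le> A'" using A'[of 0] A[of 0] by simp
  have H0: "0 \<le> H 0" using H[of 0 0] norm_ge_zero order_trans by blast
  define E where "E = A' * 2 ^ N * H 0 * (\<beta> - \<alpha> + 2) + (\<Sum>n<N. G n * norm (m n) * (A' * 2 ^ N))"
  show ?thesis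
  proof (intro exI[of _ E] conjI allI impI)
    show "0 \<le> E" unfolding E_def using A'1 H0 ab G1
      by (intro add_nonneg_nonneg sum_nonneg mult_nonneg_nonneg) (auto intro: order_trans[OF zero_le_one])
    fix h v K X \<kappa> y x0
    assume D: "phase_data_1d A B c \<alpha> \<beta> h v K X" and k: "1 \<le> \<kappa>" "y = X * \<kappa> ^ 6" and x0: "x0 \<in> K"
      and "\<exists>z. z \<notin> K \<and> \<bar>x0 - z\<bar> \<le> \<kappa> / y"
    then obtain z where z: "z \<notin> K" "\<bar>x0 - z\<bar> \<le> \<kappa> / y" by blast
    from D have X: "1 \<le> X"
      and h: "\<And>n x. (h n has_real_derivative h (Suc n) x) (at x)"
      and v: "\<And>n x. (v n has_vector_derivative v (Suc n) x) (at x)"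
      and hb: "\<And>j x. x \<in> K \<Longrightarrow> \<bar>h j x\<bar> \<le> B j" and h2: "\<And>x. x \<in> K \<Longrightarrow> c \<le> h 2 x"
      unfolding phase_data_1d_def by auto
    note ps = phase_scale[OF X k]
    define V where "V = A' * 2 ^ N / \<kappa> ^ N"
    have V0: "0 \<le> V" using A'1 k by (simp add: V_def)
    have vV: "norm (v j x) \<le> V * (y / \<kappa>\<^sup>2) ^ j" if x: "\<bar>x - x0\<bar> \<le> \<kappa> / y" and j: "j \<le> N" for x j
    proof -
      have "\<bar>x - z\<bar> \<le> 2 * (\<kappa> / y)" using x z by linarith
      then have "norm (v j x) \<le> A (j + N) * 2 ^ N / \<kappa> ^ N * (y / \<kappa>\<^sup>2) ^ j"
        by (rule norm_near_gap_le[OF A D k z(1)])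
      also have "\<dots> \<le> V * (y / \<kappa>\<^sup>2) ^ j"
        unfolding V_def using A'[of "j + N"] j k ps(1) by (intro mult_right_mono divide_right_mono) auto
      finally show ?thesis .
    qed
    have dpos: "0 < \<kappa> / y" using k ps(1) by simp
    have "norm (integral {\<alpha>-1..\<beta>+1} (\<lambda>x. exp (\<i> * of_real (y\<^sup>2 * h 0 x)) * (v 0 x * \<psi> 0 ((x - x0) / (\<kappa> / y))))) \<le> V * H 0 * (\<beta> + 1 - (\<alpha> - 1))"
    proof (rule norm_integral_phase_le)
      show "continuous_on {\<alpha> - 1..\<beta> + 1} (h 0)"
        using h by (meson DERIV_continuous_on has_field_derivative_at_within)
      have "continuous_on {\<alpha> - 1..\<beta> + 1} (\<lambda>x. \<psi> 0 ((x - x0) / (\<kappa> / y)))"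
        by (rule continuous_on_compose2[OF deriv_family_continuous[OF \<psi>, of UNIV]])
          (use ps(1) k in \<open>auto intro!: continuous_intros\<close>)
      then show "continuous_on {\<alpha> - 1..\<beta> + 1} (\<lambda>x. v 0 x * \<psi> 0 ((x - x0) / (\<kappa> / y)))"
        by (intro continuous_intros deriv_family_continuous[OF v])
      fix x
      show "norm (v 0 x * \<psi> 0 ((x - x0) / (\<kappa> / y))) \<le> V * H 0"
      proof (cases "\<bar>x - x0\<bar> \<le> \<kappa> / y")
        case True
        show ?thesis unfolding norm_mult using vV[OF True, of 0] H V0 by (intro mult_mono) auto
      next
        case False
        then have "1 < \<bar>(x - x0) / (\<kappa> / y)\<bar>" using dpos by (intro one_less_abs_divide) auto
        then show ?thesis using \<psi>0 V0 H0 by simp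
      qed
    qed (use ab in simp)
    moreover have "norm (exp (\<i> * of_real (y\<^sup>2 * h 0 x0)) / of_real y * (\<Sum>n<N. stationary_term m y (\<lambda>j. h j x0) (\<lambda>j. v j x0) n))
       \<le> 1 * (\<Sum>n<N. G n * norm (m n) * V)"
      unfolding norm_mult
    proof (intro mult_mono)
      show "norm (exp (\<i> * of_real (y\<^sup>2 * h 0 x0)) / of_real y :: complex) \<le> 1"
        using ps(2) by (simp add: norm_divide)
      show "norm (\<Sum>n<N. stationary_term m y (\<lambda>j. h j x0) (\<lambda>j. v j x0) n) \<le> (\<Sum>n<N. G n * norm (m n) * V)"
      proof (rule sum_norm_le)
        fix n assume "n \<in> {..<N}"
        then have n: "n < N" by simp
        show "norm (stationary_term m y (\<lambda>j. h j x0) (\<lambda>j. v j x0) n) \<le> G n * norm (m n) * V"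
          by (rule G[OF X k V0]) (use hb h2 x0 vV[of x0] n dpos in auto)
      qed
    qed auto
    ultimately have "norm (integral {\<alpha>-1..\<beta>+1} (\<lambda>x. exp (\<i> * of_real (y\<^sup>2 * h 0 x)) * (v 0 x * \<psi> 0 ((x - x0) / (\<kappa> / y)))) -
       exp (\<i> * of_real (y\<^sup>2 * h 0 x0)) / of_real y * (\<Sum>n<N. stationary_term m y (\<lambda>j. h j x0) (\<lambda>j. v j x0) n))
       \<le> V * H 0 * (\<beta> + 1 - (\<alpha> - 1)) + 1 * (\<Sum>n<N. G n * norm (m n) * V)"
      by (intro order_trans[OF norm_triangle_ineq4] add_mono)
    also have "\<dots> = E / \<kappa> ^ N"
      by (simp add: E_def V_def add_divide_distrib sum_divide_distrib)
    finally show "norm (integral {\<alpha>-1..\<beta>+1} (\<lambda>x. exp (\<i> * of_real (y\<^sup>2 * h 0 x)) * (v 0 x * \<psi> 0 ((x - x0) / (\<kappa> / y)))) -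
       exp (\<i> * of_real (y\<^sup>2 * h 0 x0)) / of_real y * (\<Sum>n<N. stationary_term m y (\<lambda>j. h j x0) (\<lambda>j. v j x0) n)) \<le> E / \<kappa> ^ N" .
  qed
qed

text \<open>\<open>R\<close> lists the derivatives of the phase minus its quadratic Taylor
  polynomial at \<open>x0\<close>. The linear term is left out because \<open>x0\<close> is going to
  be a critical point, and from order three on the polynomial has disappeared.\<close>

lemma cubic_phase_family:
  fixes h :: "nat \<Rightarrow> real \<Rightarrow> real" and x0 :: real
  assumes h: "\<And>n x. (h n has_real_derivative h (Suc n) x) (at x)"
  defines "R \<equiv> \<lambda>j x. if j = 0 then h 0 x - h 0 x0 - h 2 x0 * (x - x0)\<^sup>2 / 2 else if j = 1 then h 1 x - h 2 x0 * (x - x0)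
      else if j = 2 then h 2 x - h 2 x0 else h j x"
  shows "(R j has_real_derivative R (Suc j) x) (at x)"
proof -
  consider "j = 0" | "j = 1" | "j = 2" | "3 \<le> j" by linarith
  then show ?thesis
  proof cases
    case 1
    have "((\<lambda>x. h 0 x - h 0 x0 - h 2 x0 * (x - x0)\<^sup>2 / 2) has_real_derivative h (Suc 0) x - h 2 x0 * (x - x0)) (at x)"
      by (rule derivative_eq_intros h refl | simp)+
    then show ?thesis using 1 by (simp add: R_def)
  next
    case 2
    have "((\<lambda>x. h 1 x - h 2 x0 * (x - x0)) has_real_derivative h (Suc 1) x - h 2 x0) (at x)"
      by (rule derivative_eq_intros h refl | simp)+
    then show ?thesis using 2 by (simp add: R_def numeral_2_eq_2)
  next
    case 3
    have "((\<lambda>x. h 2 x - h 2 x0) has_real_derivative h (Suc 2) x) (at x)"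
      by (rule derivative_eq_intros h refl | simp)+
    then show ?thesis using 3 by (simp add: R_def)
  next
    case 4
    then show ?thesis using h[of j x] by (simp add: R_def)
  qed
qed

text \<open>From order three on this is y^2 \<le> \<theta>^j. For j = 1, 2 the remainder vanishes to
  order 3 - j at \<open>x0\<close>, and y^2 \<delta>^(3-j) \<le> \<theta>^3 \<delta>^(3-j) =
  (\<theta> \<delta>)^(3-j) \<theta>^j with \<theta> \<delta> \<le> 1.\<close>

lemma cubic_phase_bound:
  fixes h :: "nat \<Rightarrow> real \<Rightarrow> real" and x0 :: real
  assumes h: "\<And>n x. (h n has_real_derivative h (Suc n) x) (at x)" and h1: "h 1 x0 = 0"
    and b: "\<And>j z. \<bar>z - x0\<bar> \<le> \<delta> \<Longrightarrow> \<bar>h j z\<bar> \<le> B j" and x: "\<bar>x - x0\<bar> \<le> \<delta>" and B: "\<And>j. 1 \<le> B j"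
    and y: "\<And>j. 3 \<le> j \<Longrightarrow> y\<^sup>2 \<le> \<theta> ^ j" and \<theta>: "0 < \<theta>" "\<theta> * \<delta> \<le> 1" and j: "1 \<le> j"
  defines "R \<equiv> \<lambda>j x. if j = 0 then h 0 x - h 0 x0 - h 2 x0 * (x - x0)\<^sup>2 / 2 else if j = 1 then h 1 x - h 2 x0 * (x - x0)
      else if j = 2 then h 2 x - h 2 x0 else h j x"
  shows "\<bar>y\<^sup>2 * R j x\<bar> \<le> (B j + B 3) * \<theta> ^ j"
proof -
  have d: "0 \<le> \<delta>" using x by linarith
  have hc: "((\<lambda>x. complex_of_real (h n x)) has_vector_derivative of_real (h (Suc n) x)) (at x)" for n x
    using h[of n x] unfolding has_real_derivative_iff_has_vector_derivative
    by (rule bounded_linear.has_vector_derivative[OF bounded_linear_of_real])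
  have seg: "\<bar>h j z\<bar> \<le> B j" if "z \<in> closed_segment x0 x" for j z
    by (rule b) (use that x in \<open>auto simp: closed_segment_eq_real_ivl split: if_splits\<close>)
  have low: "\<bar>R j x\<bar> \<le> B 3 * \<bar>x - x0\<bar> ^ (3 - j)" if "j < 3"
  proof -
    have "norm (complex_of_real (h (j + 0) x) - (\<Sum>n<3 - j. of_real (h (j + n) x0) * of_real ((x - x0) ^ n) / fact n))
        \<le> B 3 * \<bar>x - x0\<bar> ^ (3 - j)"
      using taylor_bound[of "\<lambda>n x. complex_of_real (h (j + n) x)" x0 x "3 - j" "B 3"] hc seg[of _ 3] that by simp
    moreover have "j = 1 \<or> j = 2" using that j by auto
    moreover have "norm (complex_of_real (h (Suc 0) x) - of_real (h 2 x0) * (of_real x - of_real x0)) = \<bar>h (Suc 0) x - h 2 x0 * (x - x0)\<bar>"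
      unfolding of_real_diff[symmetric] of_real_mult[symmetric] norm_of_real by simp
    moreover have "norm (complex_of_real (h 2 x) - of_real (h 2 x0)) = \<bar>h 2 x - h 2 x0\<bar>"
      unfolding of_real_diff[symmetric] norm_of_real by simp
    ultimately show ?thesis using h1 by (auto simp: R_def numeral_2_eq_2 numeral_3_eq_3)
  qed
  show ?thesis
  proof (cases "3 \<le> j")
    case True
    then have "\<bar>y\<^sup>2 * R j x\<bar> = y\<^sup>2 * \<bar>h j x\<bar>" by (simp add: R_def abs_mult)
    also have "\<dots> \<le> \<theta> ^ j * (B j + B 3)"
      using y[OF True] b[OF x, of j] B[of 3] \<theta> by (intro mult_mono) auto
    finally show ?thesis by (simp add: mult.commute)
  next
    case False
    have "\<bar>y\<^sup>2 * R j x\<bar> = y\<^sup>2 * \<bar>R j x\<bar>" by (simp add: abs_mult)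
    also have "\<dots> \<le> \<theta> ^ 3 * (B 3 * \<delta> ^ (3 - j))"
    proof (intro mult_mono y)
      have "\<bar>x - x0\<bar> ^ (3 - j) \<le> \<delta> ^ (3 - j)" using x by (intro power_mono) auto
      then have "B 3 * \<bar>x - x0\<bar> ^ (3 - j) \<le> B 3 * \<delta> ^ (3 - j)" using B[of 3] by (intro mult_left_mono) auto
      then show "\<bar>R j x\<bar> \<le> B 3 * \<delta> ^ (3 - j)" using low False by simp
    qed (use \<theta> in auto)
    also have "\<dots> = B 3 * (\<theta> * \<delta>) ^ (3 - j) * \<theta> ^ j"
    proof -
      have "\<theta> ^ 3 = \<theta> ^ (3 - j) * \<theta> ^ j" using False by (simp add: power_add[symmetric])
      then show ?thesis by (simp add: power_mult_distrib)
    qed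
    also have "\<dots> \<le> (B j + B 3) * 1 * \<theta> ^ j"
      using B[of j] B[of 3] \<theta> d by (intro mult_right_mono mult_mono power_le_one) auto
    finally show ?thesis by simp
  qed
qed

text \<open>On a ball inside \<open>K\<close> all bounds are available. The integrand is a constant
  phase times a Gaussian times U = v exp(i y^2 R), where the n-th derivative of U has size
  \<theta>^n with \<theta> = y/\<kappa>^2. The Taylor polynomial of U of degree below N is off by
  (\<theta> \<delta>)^N = \<kappa>^(-N), and it integrates to truncated Fresnel moments, which are
  close to \<open>m\<close>.\<close>

lemma near_integral_ball:
  fixes A B :: "nat \<Rightarrow> real" and \<psi> :: "nat \<Rightarrow> real \<Rightarrow> complex"
  assumes A: "\<And>j. 1 \<le> A j" and B: "\<And>j. 1 \<le> B j" and c: "0 < c" "c \<le> 1" and ab: "\<alpha> \<le> \<beta>"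
    and \<psi>: "\<And>n x. (\<psi> n has_vector_derivative \<psi> (Suc n) x) (at x)"
    and \<psi>0: "\<And>n x. 1 < \<bar>x\<bar> \<Longrightarrow> \<psi> n x = 0" and H: "\<And>n x. norm (\<psi> n x) \<le> H n"
    and m: "\<And>n k. \<exists>C. \<forall>L>0. norm (of_real (L ^ Suc n) * integral {-3..3} (\<lambda>x. exp (\<i> * of_real (L\<^sup>2 * (x\<^sup>2 / 2))) * (of_real (x ^ n) * \<psi> 0 x)) - m n) \<le> C / L ^ k"
  shows "\<exists>C\<ge>0. \<forall>h v K X \<kappa> y x0. phase_data_1d A B c \<alpha> \<beta> h v K X \<longrightarrow> 1 \<le> \<kappa> \<longrightarrow> y = X * \<kappa> ^ 6 \<longrightarrow> h 1 x0 = 0 \<longrightarrow>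
     cball x0 (\<kappa> / y) \<subseteq> K \<longrightarrow>
     norm (integral {\<alpha>-1..\<beta>+1} (\<lambda>x. exp (\<i> * of_real (y\<^sup>2 * h 0 x)) * (v 0 x * \<psi> 0 ((x - x0) / (\<kappa> / y)))) -
       exp (\<i> * of_real (y\<^sup>2 * h 0 x0)) / of_real y * (\<Sum>n<N. stationary_term m y (\<lambda>j. h j x0) (\<lambda>j. v j x0) n)) \<le> C / \<kappa> ^ N"
proof -
  define J where "J n L = of_real (L ^ Suc n) * integral {-3..3} (\<lambda>x. exp (\<i> * of_real (L\<^sup>2 * (x\<^sup>2 / 2))) * (of_real (x ^ n) * \<psi> 0 x))" for n and L :: real
  have "\<forall>n. \<exists>C. \<forall>L>0. norm (J n L - m n) \<le> C / L ^ N" using m unfolding J_def by blast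
  from choice[OF this] obtain M where M: "\<And>n L. 0 < L \<Longrightarrow> norm (J n L - m n) \<le> M n / L ^ N" by blast
  have M0: "0 \<le> M n" for n using order_trans[OF norm_ge_zero M[of 1 n]] by simp
  have B': "1 \<le> B j + B 3" for j using B[of j] B[of 3] by simp
  have "\<forall>n. \<exists>C\<ge>1. \<forall>v a V \<theta>. 0 \<le> \<theta> \<longrightarrow> 0 \<le> V \<longrightarrow> Re (a 0) = 0 \<longrightarrow> (\<forall>j. 1 \<le> j \<longrightarrow> j \<le> n \<longrightarrow> norm (a j) \<le> (B j + B 3) * \<theta> ^ j) \<longrightarrow>
      (\<forall>j\<le>n. norm (v j) \<le> V * \<theta> ^ j) \<longrightarrow> norm (bconv v (exp_seq a) n) \<le> C * V * \<theta> ^ n"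
    using norm_taylor_coeff_le[of "\<lambda>j. B j + B 3", OF B'] by blast
  from choice[OF this] obtain G where G1: "\<And>n. 1 \<le> G n" and
    G: "\<And>n v a V \<theta>. 0 \<le> \<theta> \<Longrightarrow> 0 \<le> V \<Longrightarrow> Re (a 0) = 0 \<Longrightarrow> (\<forall>j. 1 \<le> j \<longrightarrow> j \<le> n \<longrightarrow> norm (a j) \<le> (B j + B 3) * \<theta> ^ j) \<Longrightarrow>
      (\<forall>j\<le>n. norm (v j) \<le> V * \<theta> ^ j) \<Longrightarrow> norm (bconv v (exp_seq a) n) \<le> G n * V * \<theta> ^ n" by metis
  define A' where "A' = (\<Sum>j\<le>N. A j)"
  have A': "A j \<le> A'" if "j \<le> N" for j unfolding A'_def
    by (rule member_le_sum) (use that A in \<open>auto intro: order_trans[OF zero_le_one]\<close>)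
  have A'1: "1 \<le> A'" using A'[of 0] A[of 0] by simp
  have H0: "0 \<le> H 0" using H[of 0 0] norm_ge_zero order_trans by blast
  \<comment> \<open>\<open>E1\<close> accounts for the Taylor remainder of U, \<open>E2\<close> for
    replacing truncated moments by their limits.\<close>
  define E1 where "E1 = G N * A' * H 0 * (\<beta> - \<alpha> + 2)"
  define E2 where "E2 = (\<Sum>n<N. G n * A' * (1 / sqrt c) ^ Suc n * (M n * (1 / sqrt c) ^ N))"
  have "0 \<le> A'" "\<And>n. 0 \<le> G n" using A'1 order_trans[OF zero_le_one G1] by auto
  then have E: "0 \<le> E1" "0 \<le> E2" unfolding E1_def E2_def using H0 ab M0 c
    by (auto intro!: sum_nonneg mult_nonneg_nonneg divide_nonneg_nonneg)
  show ?thesis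
  proof (intro exI[of _ "E1 + E2"] conjI allI impI)
    show "0 \<le> E1 + E2" using E by simp
    fix h v K X \<kappa> y x0
    assume D: "phase_data_1d A B c \<alpha> \<beta> h v K X" and k: "1 \<le> \<kappa>" "y = X * \<kappa> ^ 6" and h1: "h 1 x0 = 0"
      and ball: "cball x0 (\<kappa> / y) \<subseteq> K"
    from D have X: "1 \<le> X" and K: "K \<subseteq> {\<alpha>..\<beta>}"
      and h: "\<And>n x. (h n has_real_derivative h (Suc n) x) (at x)"
      and v: "\<And>n x. (v n has_vector_derivative v (Suc n) x) (at x)" and vb: "\<And>n x. norm (v n x) \<le> A n * X ^ n"
      and hb: "\<And>j x. x \<in> K \<Longrightarrow> \<bar>h j x\<bar> \<le> B j" and h2: "\<And>x. x \<in> K \<Longrightarrow> c \<le> h 2 x"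
      unfolding phase_data_1d_def by auto
    note ps = phase_scale[OF X k]
    define \<delta> where "\<delta> = \<kappa> / y"
    define \<theta> where "\<theta> = y / \<kappa>\<^sup>2"
    have d: "0 < \<delta>" using k ps(1) by (simp add: \<delta>_def)
    have th: "0 < \<theta>" "\<theta> * \<delta> = 1 / \<kappa>" using k ps(1) by (auto simp: \<theta>_def \<delta>_def power2_eq_square)
    have thd: "\<theta> * \<delta> \<le> 1" unfolding th using k by simp
    have inK: "x \<in> K" if "\<bar>x - x0\<bar> \<le> \<delta>" for x using ball that by (auto simp: \<delta>_def dist_real_def abs_minus_commute)
    have x0: "x0 \<in> K" using inK[of x0] d by simp
    \<comment> \<open>The frequency of the Gaussian: s^2/2 is the coefficient of (x - x0)^2 in the
      phase y^2 h.\<close>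
    define s where "s = y * sqrt (h 2 x0)"
    have a2: "c \<le> h 2 x0" using h2 x0 by blast
    have a2': "0 < h 2 x0" using a2 c by linarith
    have s: "0 < s" "s\<^sup>2 = y\<^sup>2 * h 2 x0" unfolding s_def using ps(1) a2' by (auto simp: power_mult_distrib)
    have sq: "1 / sqrt (h 2 x0) \<le> 1 / sqrt c" using c a2 by (intro divide_left_mono) auto
    define R where "R = (\<lambda>j x. if j = 0 then h 0 x - h 0 x0 - h 2 x0 * (x - x0)\<^sup>2 / 2 else if j = 1 then h 1 x - h 2 x0 * (x - x0)
      else if j = 2 then h 2 x - h 2 x0 else h j x)"
    define r where "r x j = \<i> * complex_of_real (y\<^sup>2 * R j x)" for x j
    have r: "((\<lambda>x. r x j) has_vector_derivative r x (Suc j)) (at x)" for j x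
    proof -
      have "((\<lambda>x. y\<^sup>2 * R j x) has_real_derivative y\<^sup>2 * R (Suc j) x) (at x)"
        unfolding R_def by (intro DERIV_cmult cubic_phase_family[where h = h] h)
      then have "((\<lambda>x. complex_of_real (y\<^sup>2 * R j x)) has_vector_derivative of_real (y\<^sup>2 * R (Suc j) x)) (at x)"
        unfolding has_real_derivative_iff_has_vector_derivative
        by (rule bounded_linear.has_vector_derivative[OF bounded_linear_of_real])
      then show ?thesis unfolding r_def by (rule has_vector_derivative_mult_right)
    qed
    define U where "U n x = bconv (\<lambda>k. v k x) (exp_seq (r x)) n" for n x
    have U: "(U n has_vector_derivative U (Suc n) x) (at x)" for n x
      unfolding U_def by (intro bconv_has_vector_derivative v exp_seq_has_vector_derivative r)
    have Ub: "norm (U n x) \<le> G n * A' * \<theta> ^ n" if x: "\<bar>x - x0\<bar> \<le> \<delta>" and n: "n \<le> N" for n x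
      unfolding U_def
    proof (rule G)
      show "\<forall>j. 1 \<le> j \<longrightarrow> j \<le> n \<longrightarrow> norm (r x j) \<le> (B j + B 3) * \<theta> ^ j"
      proof (intro allI impI)
        fix j :: nat assume j: "1 \<le> j"
        have "\<bar>y\<^sup>2 * R j x\<bar> \<le> (B j + B 3) * \<theta> ^ j" unfolding R_def
          by (rule cubic_phase_bound[where h = h and \<delta> = \<delta>])
            (use h h1 hb inK x B ps(7)[folded \<theta>_def] th(1) thd j in auto)
        then show "norm (r x j) \<le> (B j + B 3) * \<theta> ^ j" unfolding r_def norm_mult norm_of_real by simp
      qed
      show "\<forall>j\<le>n. norm (v j x) \<le> A' * \<theta> ^ j"
      proof (intro allI impI)
        fix j assume "j \<le> n"
        have "norm (v j x) \<le> A j * X ^ j" by (rule vb)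
        also have "\<dots> \<le> A' * \<theta> ^ j" using A'[of j] n \<open>j \<le> n\<close> ps(4) X A'1 unfolding \<theta>_def
          by (intro mult_mono power_mono) auto
        finally show "norm (v j x) \<le> A' * \<theta> ^ j" .
      qed
    qed (use th A'1 in \<open>auto simp: r_def\<close>)
    \<comment> \<open>At \<open>x0\<close> itself the remainder phase has no nonzero derivative
      below order three, which accounts for the case distinction in
      \<open>stationary_term\<close>.\<close>
    have st: "stationary_term m y (\<lambda>j. h j x0) (\<lambda>j. v j x0) n / of_real y = m n * (U n x0 / fact n * of_real ((1 / s) ^ Suc n))" for n
    proof -
      have "r x0 = (\<lambda>j. if 3 \<le> j then \<i> * of_real (y\<^sup>2 * h j x0) else 0)"
        using h1 by (auto simp: r_def R_def fun_eq_iff)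
      then have eq1: "bconv (\<lambda>j. v j x0) (exp_seq (\<lambda>j. if 3 \<le> j then \<i> * of_real (y\<^sup>2 * h j x0) else 0)) n = U n x0"
        by (simp add: U_def)
      have eq2: "complex_of_real ((1 / s) ^ Suc n) = of_real ((1 / sqrt (h 2 x0)) ^ Suc n * (1 / y) ^ n) / of_real y"
        unfolding of_real_divide[symmetric] by (simp add: s_def power_divide power_mult_distrib)
      show ?thesis unfolding stationary_term_def eq1 eq2 by (simp only: divide_inverse mult_ac)
    qed
    define e0 where "e0 = exp (\<i> * complex_of_real (y\<^sup>2 * h 0 x0))"
    have e0: "norm e0 = 1" by (simp add: e0_def)
    define g where "g x = exp (\<i> * complex_of_real (s\<^sup>2 * (x - x0)\<^sup>2 / 2))" for x
    define p where "p x = \<psi> 0 ((x - x0) / \<delta>)" for x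
    have p0: "p x = 0" if "\<delta> < \<bar>x - x0\<bar>" for x
      unfolding p_def by (rule \<psi>0) (rule one_less_abs_divide[OF d that])
    have pc: "continuous_on S p" for S
      unfolding p_def by (rule continuous_on_compose2[OF deriv_family_continuous[OF \<psi>, of UNIV]])
          (use d in \<open>auto intro!: continuous_intros\<close>)
    have gc: "continuous_on S g" for S unfolding g_def by (intro continuous_intros) auto
    have Uc: "continuous_on S (U n)" for S n by (rule deriv_family_continuous[OF U])
    define P where "P x = (\<Sum>n<N. U n x0 * of_real ((x - x0) ^ n) / fact n)" for x
    have Pc: "continuous_on S P" for S unfolding P_def by (intro continuous_intros) auto
    let ?I = "{\<alpha>-1..\<beta>+1}"
    have e1: "exp (\<i> * of_real (y\<^sup>2 * h 0 x)) * (v 0 x * \<psi> 0 ((x - x0) / (\<kappa> / y))) = e0 * (g x * (U 0 x * p x))" for x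
    proof -
      have "y\<^sup>2 * h 0 x = y\<^sup>2 * h 0 x0 + s\<^sup>2 * (x - x0)\<^sup>2 / 2 + y\<^sup>2 * R 0 x"
        by (simp add: R_def s field_simps)
      then have "exp (\<i> * of_real (y\<^sup>2 * h 0 x)) = e0 * g x * exp (r x 0)"
        unfolding e0_def g_def r_def exp_add[symmetric] by (simp add: distrib_left)
      then show ?thesis by (simp add: U_def p_def \<delta>_def)
    qed
    have "integral ?I (\<lambda>x. e0 * (g x * (U 0 x * p x))) - e0 * integral ?I (\<lambda>x. g x * (P x * p x))
       = e0 * integral ?I (\<lambda>x. g x * ((U 0 x - P x) * p x))"
      unfolding integral_mult_right right_diff_distrib[symmetric]
      by (subst integral_diff[symmetric])
        (auto intro!: integrable_continuous_interval continuous_intros gc Uc pc Pc integral_cong simp: algebra_simps)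
    also have "norm \<dots> \<le> E1 / \<kappa> ^ N"
    proof -
      have "norm (integral ?I (\<lambda>x. g x * ((U 0 x - P x) * p x))) \<le> (G N * A' / \<kappa> ^ N * H 0) * (\<beta> + 1 - (\<alpha> - 1))"
        unfolding g_def
      proof (rule norm_integral_phase_le[where Y = 1, simplified])
        show "norm ((U 0 x - P x) * p x) \<le> G N * A' / \<kappa> ^ N * H 0" for x
        proof (cases "\<bar>x - x0\<bar> \<le> \<delta>")
          case True
          have "norm (U 0 x - P x) \<le> (G N * A' * \<theta> ^ N) * \<bar>x - x0\<bar> ^ N"
            unfolding P_def
          proof (rule taylor_bound[where u = U, OF U])
            show "norm (U N z) \<le> G N * A' * \<theta> ^ N" if "z \<in> closed_segment x0 x" for z
              by (rule Ub) (use that True in \<open>auto simp: closed_segment_eq_real_ivl split: if_splits\<close>)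
          qed
          also have "\<dots> \<le> (G N * A' * \<theta> ^ N) * \<delta> ^ N"
            using True A'1 G1[of N] th by (intro mult_left_mono power_mono) auto
          also have "\<dots> = G N * A' * (\<theta> * \<delta>) ^ N" by (simp add: power_mult_distrib)
          also have "\<dots> = G N * A' / \<kappa> ^ N" unfolding th by (simp add: power_divide)
          finally show ?thesis unfolding norm_mult p_def using H A'1 G1[of N] k by (intro mult_mono) auto
        next
          case False
          then show ?thesis using p0 A'1 G1[of N] k H0 by (auto intro!: mult_nonneg_nonneg)
        qed
      qed (use ab in \<open>auto intro!: continuous_intros Uc Pc pc\<close>)
      then show ?thesis unfolding norm_mult e0 by (simp add: E1_def add.commute)
    qed
    finally have 1: "norm (integral ?I (\<lambda>x. e0 * (g x * (U 0 x * p x))) - e0 * integral ?I (\<lambda>x. g x * (P x * p x))) \<le> E1 / \<kappa> ^ N" .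
    have gi: "(\<lambda>x. U n x0 / fact n * (g x * (of_real ((x - x0) ^ n) * p x))) integrable_on ?I" for n
      by (intro integrable_continuous_interval continuous_intros gc pc) auto
    have "integral ?I (\<lambda>x. g x * (P x * p x)) = integral ?I (\<lambda>x. \<Sum>n<N. U n x0 / fact n * (g x * (of_real ((x - x0) ^ n) * p x)))"
      unfolding P_def by (simp add: sum_distrib_left sum_distrib_right mult_ac)
    also have "\<dots> = (\<Sum>n<N. U n x0 / fact n * integral ?I (\<lambda>x. g x * (of_real ((x - x0) ^ n) * p x)))"
      by (subst integral_sum) (use gi in auto)
    also have "\<dots> = (\<Sum>n<N. U n x0 / fact n * (of_real ((1 / s) ^ Suc n) * J n (\<delta> * s)))"
    proof (intro sum.cong refl arg_cong2[where f = "(*)"])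
      fix n
      \<comment> \<open>The ball lies in \<open>K\<close>, hence in the interval from \<alpha> to
        \<beta>, so the cutoff does not reach the ends of the interval of integration.\<close>
      have "x0 - \<delta> \<in> K" "x0 + \<delta> \<in> K" using d by (auto intro!: inK)
      then have "\<alpha> - 1 \<le> x0 - \<delta>" "x0 + \<delta> \<le> \<beta> + 1" using K by force+
      from model_integral[where \<psi> = \<psi>, OF \<psi> \<psi>0 d this s(1), of n]
      show "integral ?I (\<lambda>x. g x * (of_real ((x - x0) ^ n) * p x)) = of_real ((1 / s) ^ Suc n) * J n (\<delta> * s)"
        unfolding g_def p_def J_def by simp
    qed
    finally have 2: "integral ?I (\<lambda>x. g x * (P x * p x)) = (\<Sum>n<N. U n x0 / fact n * (of_real ((1 / s) ^ Suc n) * J n (\<delta> * s)))" .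
    have 3: "e0 / of_real y * (\<Sum>n<N. stationary_term m y (\<lambda>j. h j x0) (\<lambda>j. v j x0) n)
       = e0 * (\<Sum>n<N. U n x0 / fact n * (of_real ((1 / s) ^ Suc n) * m n))"
    proof -
      have "e0 / of_real y * (\<Sum>n<N. stationary_term m y (\<lambda>j. h j x0) (\<lambda>j. v j x0) n)
        = e0 * (\<Sum>n<N. stationary_term m y (\<lambda>j. h j x0) (\<lambda>j. v j x0) n / of_real y)"
        by (simp add: sum_divide_distrib[symmetric])
      then show ?thesis unfolding st by (simp only: mult_ac)
    qed
    have "norm (e0 * (\<Sum>n<N. U n x0 / fact n * (of_real ((1 / s) ^ Suc n) * J n (\<delta> * s))) - e0 * (\<Sum>n<N. U n x0 / fact n * (of_real ((1 / s) ^ Suc n) * m n)))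
      = norm (\<Sum>n<N. U n x0 / fact n * of_real ((1 / s) ^ Suc n) * (J n (\<delta> * s) - m n))"
    proof -
      have "e0 * (\<Sum>n<N. U n x0 / fact n * (of_real ((1 / s) ^ Suc n) * J n (\<delta> * s))) - e0 * (\<Sum>n<N. U n x0 / fact n * (of_real ((1 / s) ^ Suc n) * m n))
         = e0 * (\<Sum>n<N. U n x0 / fact n * of_real ((1 / s) ^ Suc n) * (J n (\<delta> * s) - m n))"
        by (simp only: right_diff_distrib sum_subtractf mult.assoc)
      then show ?thesis by (simp only: norm_mult[of e0] e0 mult_1)
    qed
    also have "\<dots> \<le> (\<Sum>n<N. G n * A' * (1 / sqrt c) ^ Suc n * (M n * (1 / sqrt c) ^ N) / \<kappa> ^ N)"
    proof (rule sum_norm_le)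
      fix n assume "n \<in> {..<N}"
      then have n: "n \<le> N" by simp
      have ds: "\<delta> * s = \<kappa> * sqrt (h 2 x0)" using ps(1) by (simp add: \<delta>_def s_def)
      have "norm (J n (\<delta> * s) - m n) \<le> M n / (\<delta> * s) ^ N" by (rule M) (use d s in simp)
      also have "\<dots> = M n * (1 / sqrt (h 2 x0)) ^ N / \<kappa> ^ N"
        unfolding ds by (simp add: power_mult_distrib power_divide)
      also have "\<dots> \<le> M n * (1 / sqrt c) ^ N / \<kappa> ^ N"
        using sq M0 k a2' by (intro divide_right_mono mult_left_mono power_mono) auto
      finally have J: "norm (J n (\<delta> * s) - m n) \<le> M n * (1 / sqrt c) ^ N / \<kappa> ^ N" .
      have "norm (U n x0 / fact n) \<le> norm (U n x0)"
        by (simp add: norm_divide divide_le_eq mult_le_cancel_left1)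
      also have "\<dots> \<le> G n * A' * \<theta> ^ n" by (rule Ub) (use n d in auto)
      finally have "norm (U n x0 / fact n) \<le> G n * A' * \<theta> ^ n" .
      moreover have "norm (complex_of_real ((1 / s) ^ Suc n)) \<le> (1 / sqrt c) ^ Suc n * (1 / y) ^ n"
      proof -
        have "norm (complex_of_real ((1 / s) ^ Suc n)) = (1 / sqrt (h 2 x0)) ^ Suc n * (1 / y) ^ Suc n"
          unfolding norm_of_real s_def using ps(1) a2' by (simp add: power_divide power_mult_distrib abs_mult)
        also have "\<dots> \<le> (1 / sqrt c) ^ Suc n * (1 / y) ^ n"
        proof (intro mult_mono power_mono sq)
          show "(1 / y) ^ Suc n \<le> (1 / y) ^ n" using ps(1,2) by (intro power_decreasing) auto
        qed (use ps(1) a2' c in auto)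
        finally show ?thesis .
      qed
      ultimately have "norm (U n x0 / fact n * of_real ((1 / s) ^ Suc n)) \<le> G n * A' * \<theta> ^ n * ((1 / sqrt c) ^ Suc n * (1 / y) ^ n)"
        unfolding norm_mult using A'1 G1[of n] th by (intro mult_mono) auto
      also have "\<dots> = G n * A' * (1 / sqrt c) ^ Suc n * (\<theta> / y) ^ n" by (simp add: power_divide)
      also have "\<dots> \<le> G n * A' * (1 / sqrt c) ^ Suc n * 1"
      proof -
        have "\<theta> / y = 1 / \<kappa>\<^sup>2" using ps(1) by (simp add: \<theta>_def)
        then have "0 \<le> \<theta> / y" "\<theta> / y \<le> 1" using k(1) by auto
        then show ?thesis using A'1 G1[of n] c by (intro mult_left_mono power_le_one) auto
      qed
      finally have "norm (U n x0 / fact n * of_real ((1 / s) ^ Suc n)) \<le> G n * A' * (1 / sqrt c) ^ Suc n" by simp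
      from mult_mono[OF this J] A'1 G1[of n] c
      show "norm (U n x0 / fact n * of_real ((1 / s) ^ Suc n) * (J n (\<delta> * s) - m n)) \<le>
        G n * A' * (1 / sqrt c) ^ Suc n * (M n * (1 / sqrt c) ^ N) / \<kappa> ^ N"
        unfolding norm_mult by simp
    qed
    also have "\<dots> = E2 / \<kappa> ^ N" by (simp add: E2_def sum_divide_distrib)
    finally have 4: "norm (e0 * integral ?I (\<lambda>x. g x * (P x * p x)) - e0 / of_real y * (\<Sum>n<N. stationary_term m y (\<lambda>j. h j x0) (\<lambda>j. v j x0) n)) \<le> E2 / \<kappa> ^ N"
      unfolding 2 3 .
    have "norm (integral ?I (\<lambda>x. e0 * (g x * (U 0 x * p x))) - e0 / of_real y * (\<Sum>n<N. stationary_term m y (\<lambda>j. h j x0) (\<lambda>j. v j x0) n))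
      \<le> E1 / \<kappa> ^ N + E2 / \<kappa> ^ N"
      using norm_triangle_le[OF add_mono[OF 1 4]] by simp
    then show "norm (integral ?I (\<lambda>x. exp (\<i> * of_real (y\<^sup>2 * h 0 x)) * (v 0 x * \<psi> 0 ((x - x0) / (\<kappa> / y)))) -
       exp (\<i> * of_real (y\<^sup>2 * h 0 x0)) / of_real y * (\<Sum>n<N. stationary_term m y (\<lambda>j. h j x0) (\<lambda>j. v j x0) n)) \<le> (E1 + E2) / \<kappa> ^ N"
      unfolding e1 e0_def[symmetric] by (simp add: add_divide_distrib)
  qed
qed

text \<open>
  If the ball of radius \<open>\<kappa> / y\<close> around the stationary point is not contained in \<open>K\<close>, then the amplitude
  is negligible on the ball, so no information on the phase outside \<open>K\<close> is ever needed.
\<close>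

lemma stationary_phase_1d:
  obtains m :: "nat \<Rightarrow> complex"
  where "\<And>(A :: nat \<Rightarrow> real) (B :: nat \<Rightarrow> real) c \<alpha> \<beta> N. (\<And>j. 1 \<le> A j) \<Longrightarrow> (\<And>j. 1 \<le> B j) \<Longrightarrow> 0 < c \<Longrightarrow> c \<le> 1 \<Longrightarrow> \<alpha> \<le> \<beta> \<Longrightarrow>
    \<exists>C\<ge>0. \<forall>h v K X \<kappa> y x0. phase_data_1d A B c \<alpha> \<beta> h v K X \<longrightarrow> 1 \<le> \<kappa> \<longrightarrow> y = X * \<kappa> ^ 6 \<longrightarrow> x0 \<in> K \<longrightarrow> h 1 x0 = 0 \<longrightarrow>
     (\<forall>x\<in>K. h 1 x = 0 \<longrightarrow> x = x0) \<longrightarrow>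
     norm (integral {\<alpha>-1..\<beta>+1} (\<lambda>x. exp (\<i> * of_real (y\<^sup>2 * h 0 x)) * v 0 x) -
       exp (\<i> * of_real (y\<^sup>2 * h 0 x0)) / of_real y * (\<Sum>n<N. stationary_term m y (\<lambda>j. h j x0) (\<lambda>j. v j x0) n)) \<le> C / \<kappa> ^ N"
proof -
  obtain \<psi> H where \<psi>: "\<And>n x. (\<psi> n has_vector_derivative \<psi> (Suc n) x) (at x)"
    and \<psi>1: "\<And>x::real. \<bar>x\<bar> \<le> 1/2 \<Longrightarrow> \<psi> 0 x = (1::complex)" and \<psi>0: "\<And>n x. 1 < \<bar>x\<bar> \<Longrightarrow> \<psi> n x = 0"
    and H: "\<And>n x. norm (\<psi> n x) \<le> H n" and H1: "\<And>n. 1 \<le> H n"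
    by (rule smooth_cutoff) blast
  have "\<exists>m. \<forall>k. \<exists>C. \<forall>L>0. norm (of_real (L ^ Suc n) * integral {-3..3} (\<lambda>x. exp (\<i> * of_real (L\<^sup>2 * (x\<^sup>2 / 2))) * (of_real (x ^ n) * \<psi> 0 x)) - m) \<le> C / L ^ k" for n
  proof (rule fresnel_moment[where \<psi> = \<psi> and H = H and n = n])
    fix m
    assume "\<And>k. \<exists>C. \<forall>L>0. norm (of_real (L ^ Suc n) * integral {-3..3} (\<lambda>x. exp (\<i> * of_real (L\<^sup>2 * (x\<^sup>2 / 2))) * (of_real (x ^ n) * \<psi> 0 x)) - m) \<le> C / L ^ k"
    then show ?thesis by (intro exI[of _ m] allI)
  qed (use \<psi> \<psi>1 \<psi>0 H H1 in auto)
  then have "\<exists>m. \<forall>n. \<forall>k. \<exists>C. \<forall>L>0. norm (of_real (L ^ Suc n) * integral {-3..3} (\<lambda>x. exp (\<i> * of_real (L\<^sup>2 * (x\<^sup>2 / 2))) * (of_real (x ^ n) * \<psi> 0 x)) - m n) \<le> C / L ^ k"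
    by (intro choice allI)
  \<comment> \<open>The moments come from the cutoff alone, before any bounds or data are fixed, so
    the same \<open>m\<close> serves every order and every family.\<close>
  then obtain m where "\<forall>n. \<forall>k. \<exists>C. \<forall>L>0. norm (of_real (L ^ Suc n) * integral {-3..3} (\<lambda>x. exp (\<i> * of_real (L\<^sup>2 * (x\<^sup>2 / 2))) * (of_real (x ^ n) * \<psi> 0 x)) - m n) \<le> C / L ^ k" ..
  then have m: "\<exists>C. \<forall>L>0. norm (of_real (L ^ Suc n) * integral {-3..3} (\<lambda>x. exp (\<i> * of_real (L\<^sup>2 * (x\<^sup>2 / 2))) * (of_real (x ^ n) * \<psi> 0 x)) - m n) \<le> C / L ^ k" for n k by (elim allE)
  show thesis
  proof (rule that[of m])
    fix A B :: "nat \<Rightarrow> real" and c \<alpha> \<beta> :: real and N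
    assume A: "\<And>j. 1 \<le> A j" and B: "\<And>j. 1 \<le> B j" and c: "0 < c" "c \<le> 1" and ab: "\<alpha> \<le> \<beta>"
    obtain C1 where C1: "0 \<le> C1" and gap: "\<And>h v K X \<kappa> y x0. phase_data_1d A B c \<alpha> \<beta> h v K X \<Longrightarrow> 1 \<le> \<kappa> \<Longrightarrow> y = X * \<kappa> ^ 6 \<Longrightarrow> x0 \<in> K \<Longrightarrow>
     (\<exists>z. z \<notin> K \<and> \<bar>x0 - z\<bar> \<le> \<kappa> / y) \<Longrightarrow>
     norm (integral {\<alpha>-1..\<beta>+1} (\<lambda>x. exp (\<i> * of_real (y\<^sup>2 * h 0 x)) * (v 0 x * \<psi> 0 ((x - x0) / (\<kappa> / y)))) -
       exp (\<i> * of_real (y\<^sup>2 * h 0 x0)) / of_real y * (\<Sum>n<N. stationary_term m y (\<lambda>j. h j x0) (\<lambda>j. v j x0) n)) \<le> C1 / \<kappa> ^ N"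
      using near_integral_gap[where \<psi> = \<psi> and H = H and A = A and B = B and N = N and m = m, OF A B c ab \<psi> \<psi>0 H] by blast
    obtain C2 where C2: "0 \<le> C2" and ball: "\<And>h v K X \<kappa> y x0. phase_data_1d A B c \<alpha> \<beta> h v K X \<Longrightarrow> 1 \<le> \<kappa> \<Longrightarrow> y = X * \<kappa> ^ 6 \<Longrightarrow> h 1 x0 = 0 \<Longrightarrow>
     cball x0 (\<kappa> / y) \<subseteq> K \<Longrightarrow>
     norm (integral {\<alpha>-1..\<beta>+1} (\<lambda>x. exp (\<i> * of_real (y\<^sup>2 * h 0 x)) * (v 0 x * \<psi> 0 ((x - x0) / (\<kappa> / y)))) -
       exp (\<i> * of_real (y\<^sup>2 * h 0 x0)) / of_real y * (\<Sum>n<N. stationary_term m y (\<lambda>j. h j x0) (\<lambda>j. v j x0) n)) \<le> C2 / \<kappa> ^ N"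
      using near_integral_ball[where \<psi> = \<psi> and H = H and A = A and B = B and N = N and m = m, OF A B c ab \<psi> \<psi>0 H m] by blast
    have H1': "1 \<le> 1 + H n" for n using H1[of n] by simp
    obtain C3 where C3: "1 \<le> C3" and off: "\<And>h v K X \<eta> \<mu> S Y. phase_data_1d A B c \<alpha> \<beta> h v K X \<Longrightarrow> 0 < Y \<Longrightarrow> 0 < \<mu> \<Longrightarrow> \<mu> * X \<le> 1 \<Longrightarrow>
    (\<forall>n x. (\<eta> n has_vector_derivative \<eta> (Suc n) x) (at x)) \<Longrightarrow>
    (\<forall>n x. norm (\<eta> n x) \<le> (1 + H n) * (1 / \<mu>) ^ n) \<Longrightarrow> closed S \<Longrightarrow> S \<subseteq> K \<Longrightarrow> (\<forall>x\<in>K - S. \<forall>n. \<eta> n x = 0) \<Longrightarrow>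
    (\<forall>x\<in>S. h 1 x \<noteq> 0 \<and> (c * \<mu> / 2 \<le> \<bar>h 1 x\<bar> \<or> (\<exists>y. y \<notin> K \<and> \<bar>x - y\<bar> \<le> \<bar>h 1 x\<bar> / c))) \<Longrightarrow>
    norm (integral {\<alpha>-1..\<beta>+1} (\<lambda>x. exp (\<i> * of_real (Y * h 0 x)) * (v 0 x * \<eta> 0 x))) \<le> C3 * (1 / (\<mu>\<^sup>2 * Y)) ^ N"
      using phase_integral_off_stationary[of A B "\<lambda>n. 1 + H n" c \<alpha> \<beta> N, OF A B H1' c ab] by blast
    show "\<exists>C\<ge>0. \<forall>h v K X \<kappa> y x0. phase_data_1d A B c \<alpha> \<beta> h v K X \<longrightarrow> 1 \<le> \<kappa> \<longrightarrow> y = X * \<kappa> ^ 6 \<longrightarrow> x0 \<in> K \<longrightarrow> h 1 x0 = 0 \<longrightarrow>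
     (\<forall>x\<in>K. h 1 x = 0 \<longrightarrow> x = x0) \<longrightarrow>
     norm (integral {\<alpha>-1..\<beta>+1} (\<lambda>x. exp (\<i> * of_real (y\<^sup>2 * h 0 x)) * v 0 x) -
       exp (\<i> * of_real (y\<^sup>2 * h 0 x0)) / of_real y * (\<Sum>n<N. stationary_term m y (\<lambda>j. h j x0) (\<lambda>j. v j x0) n)) \<le> C / \<kappa> ^ N"
    proof (intro exI[of _ "C1 + C2 + C3"] conjI allI impI)
      show "0 \<le> C1 + C2 + C3" using C1 C2 C3 by simp
      fix h v K X \<kappa> y x0
      assume D: "phase_data_1d A B c \<alpha> \<beta> h v K X" and k: "1 \<le> \<kappa>" "y = X * \<kappa> ^ 6" and x0: "x0 \<in> K" and h1: "h 1 x0 = 0"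
        and uniq: "\<forall>x\<in>K. h 1 x = 0 \<longrightarrow> x = x0"
      from D have X: "1 \<le> X" and K: "closed K"
        and h: "\<And>n x. (h n has_real_derivative h (Suc n) x) (at x)"
        and v: "\<And>n x. (v n has_vector_derivative v (Suc n) x) (at x)"
        and h2: "\<And>x. x \<in> K \<Longrightarrow> c \<le> h 2 x"
        unfolding phase_data_1d_def by auto
      note ps = phase_scale[OF X k]
      define \<delta> where "\<delta> = \<kappa> / y"
      have d: "0 < \<delta>" using k(1) ps(1) by (simp add: \<delta>_def)
      define e where "e x = exp (\<i> * complex_of_real (y\<^sup>2 * h 0 x))" for x
      define T where "T = exp (\<i> * of_real (y\<^sup>2 * h 0 x0)) / of_real y * (\<Sum>n<N. stationary_term m y (\<lambda>j. h j x0) (\<lambda>j. v j x0) n)"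
      \<comment> \<open>The derivatives of one minus the cutoff at scale \<delta>; the constant
        contributes to order zero only.\<close>
      define \<eta> where "\<eta> n x = (if n = 0 then 1 else 0) - of_real ((1 / \<delta>) ^ n) * \<psi> n (1 / \<delta> * x + - x0 / \<delta>)" for n x
      have \<eta>: "(\<eta> n has_vector_derivative \<eta> (Suc n) x) (at x)" for n x
        using has_vector_derivative_diff[OF has_vector_derivative_const has_vector_derivative_affine_family[where u = \<psi>, OF \<psi>], of "if n = 0 then 1 else 0" "1 / \<delta>" n "- x0 / \<delta>" x]
        unfolding \<eta>_def by simp
      have hc: "continuous_on S' (h 0)" for S'
        using h by (meson DERIV_continuous_on has_field_derivative_at_within)
      have ec: "continuous_on S' e" for S' unfolding e_def by (intro continuous_intros hc)
      have \<psi>c: "continuous_on S' (\<lambda>x. \<psi> 0 ((x - x0) / \<delta>))" for S'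
        by (rule continuous_on_compose2[OF deriv_family_continuous[OF \<psi>, of UNIV]])
          (use d in \<open>auto intro!: continuous_intros\<close>)
      have \<eta>c: "continuous_on S' (\<eta> n)" for S' n by (rule deriv_family_continuous[OF \<eta>])
      have vc: "continuous_on S' (v n)" for S' n by (rule deriv_family_continuous[OF v])
      have \<eta>0: "\<eta> 0 x = 1 - \<psi> 0 ((x - x0) / \<delta>)" for x by (simp add: \<eta>_def diff_divide_distrib)
      have near: "norm (integral {\<alpha>-1..\<beta>+1} (\<lambda>x. e x * (v 0 x * \<psi> 0 ((x - x0) / \<delta>))) - T) \<le> (C1 + C2) / \<kappa> ^ N"
      proof (cases "cball x0 \<delta> \<subseteq> K")
        case True
        have "norm (integral {\<alpha>-1..\<beta>+1} (\<lambda>x. e x * (v 0 x * \<psi> 0 ((x - x0) / \<delta>))) - T) \<le> C2 / \<kappa> ^ N"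
          using ball[OF D k h1 True[unfolded \<delta>_def]] unfolding e_def T_def \<delta>_def .
        also have "\<dots> \<le> (C1 + C2) / \<kappa> ^ N" using C1 k(1) by (intro divide_right_mono) auto
        finally show ?thesis .
      next
        case False
        then have "\<exists>z. z \<notin> K \<and> \<bar>x0 - z\<bar> \<le> \<kappa> / y" by (auto simp: \<delta>_def dist_real_def)
        from gap[OF D k x0 this]
        have "norm (integral {\<alpha>-1..\<beta>+1} (\<lambda>x. e x * (v 0 x * \<psi> 0 ((x - x0) / \<delta>))) - T) \<le> C1 / \<kappa> ^ N"
          unfolding e_def T_def \<delta>_def .
        also have "\<dots> \<le> (C1 + C2) / \<kappa> ^ N" using C2 k(1) by (intro divide_right_mono) auto
        finally show ?thesis .
      qed
      have "norm (integral {\<alpha>-1..\<beta>+1} (\<lambda>x. exp (\<i> * of_real (y\<^sup>2 * h 0 x)) * (v 0 x * \<eta> 0 x))) \<le> C3 * (1 / (\<delta>\<^sup>2 * y\<^sup>2)) ^ N"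
      \<comment> \<open>Here \<mu> = \<delta>, so each integration by parts gains 1/(\<delta>^2 y^2)
        = \<kappa>^(-2).\<close>
      proof (rule off[OF D, where S = "K \<inter> {x. \<delta> / 2 \<le> \<bar>x - x0\<bar>}"])
        have "\<delta> * X \<le> 1 / \<kappa>" using ps(5) by (simp add: \<delta>_def mult.commute)
        also have "\<dots> \<le> 1" using k(1) by simp
        finally show "\<delta> * X \<le> 1" .
        show "\<forall>n x. norm (\<eta> n x) \<le> (1 + H n) * (1 / \<delta>) ^ n"
        proof (intro allI)
          fix n x
          have "norm (\<eta> n x) \<le> 1 * (1 / \<delta>) ^ n + (1 / \<delta>) ^ n * H n"
            unfolding \<eta>_def
          proof (intro order_trans[OF norm_triangle_ineq4] add_mono)
            show "norm (if n = 0 then 1 else 0 :: complex) \<le> 1 * (1 / \<delta>) ^ n" using d by simp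
            have "norm (complex_of_real ((1 / \<delta>) ^ n)) = (1 / \<delta>) ^ n" unfolding norm_of_real using d by simp
            then show "norm (of_real ((1 / \<delta>) ^ n) * \<psi> n (1 / \<delta> * x + - x0 / \<delta>)) \<le> (1 / \<delta>) ^ n * H n"
              unfolding norm_mult using d by (auto intro!: mult_left_mono H)
          qed
          then show "norm (\<eta> n x) \<le> (1 + H n) * (1 / \<delta>) ^ n" by (simp add: algebra_simps)
        qed
        show "closed (K \<inter> {x. \<delta> / 2 \<le> \<bar>x - x0\<bar>})"
          by (intro closed_Int K closed_Collect_le continuous_intros)
        show "\<forall>x\<in>K - K \<inter> {x. \<delta> / 2 \<le> \<bar>x - x0\<bar>}. \<forall>n. \<eta> n x = 0"
        proof (intro ballI allI)
          fix x n assume "x \<in> K - K \<inter> {x. \<delta> / 2 \<le> \<bar>x - x0\<bar>}"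
          then have x: "x \<in> ball x0 (\<delta> / 2)" by (auto simp: dist_real_def abs_minus_commute)
          show "\<eta> n x = 0"
          proof (rule deriv_family_zero_on_open[where u = \<eta>, OF \<eta> open_ball _ x])
            fix z assume "z \<in> ball x0 (\<delta> / 2)"
            then have "\<bar>z - x0\<bar> < \<delta> / 2" by (simp add: dist_real_def abs_minus_commute)
            then have "\<bar>(z - x0) / \<delta>\<bar> \<le> 1 / 2" using d by (simp add: field_simps)
            then show "\<eta> 0 z = 0" unfolding \<eta>0 by (simp add: \<psi>1)
          qed
        qed
        show "\<forall>x\<in>K \<inter> {x. \<delta> / 2 \<le> \<bar>x - x0\<bar>}. h 1 x \<noteq> 0 \<and> (c * \<delta> / 2 \<le> \<bar>h 1 x\<bar> \<or> (\<exists>z. z \<notin> K \<and> \<bar>x - z\<bar> \<le> \<bar>h 1 x\<bar> / c))"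
        proof
          fix x assume "x \<in> K \<inter> {x. \<delta> / 2 \<le> \<bar>x - x0\<bar>}"
          then have x: "x \<in> K" "\<delta> / 2 \<le> \<bar>x - x0\<bar>" by auto
          \<comment> \<open>A zero of h' found in \<open>K\<close> can only be \<open>x0\<close>, at
            distance at least \<delta>/2 from x, which forces |h'| \<ge> c \<delta>/2. Otherwise the
            point found is a gap of \<open>K\<close>.\<close>
          obtain z where z: "\<bar>x - z\<bar> \<le> \<bar>h 1 x\<bar> / c" "z \<in> K \<longrightarrow> h 1 z = 0"
            using deriv_gap_or_zero[where h = h and K = K, OF h c(1) h2 x(1)] by blast
          have "c * \<delta> / 2 \<le> \<bar>h 1 x\<bar>" if "z \<in> K"
          proof -
            have "z = x0" using z(2) uniq that by blast
            then have "\<delta> / 2 \<le> \<bar>h 1 x\<bar> / c" using z(1) x(2) by linarith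
            then show ?thesis using c(1) by (simp add: field_simps)
          qed
          moreover have "h 1 x \<noteq> 0" using uniq x d by auto
          ultimately show "h 1 x \<noteq> 0 \<and> (c * \<delta> / 2 \<le> \<bar>h 1 x\<bar> \<or> (\<exists>z. z \<notin> K \<and> \<bar>x - z\<bar> \<le> \<bar>h 1 x\<bar> / c))" using z by blast
        qed
      qed (use d \<eta> ps(1) in auto)
      also have "\<delta>\<^sup>2 * y\<^sup>2 = \<kappa>\<^sup>2" using ps(1) by (simp add: \<delta>_def power_divide)
      also have "C3 * (1 / \<kappa>\<^sup>2) ^ N \<le> C3 * (1 / \<kappa>) ^ N"
      proof -
        have "1 / \<kappa>\<^sup>2 \<le> 1 / \<kappa>" using k(1) by (simp add: field_simps power2_eq_square)
        then show ?thesis using C3 k(1) by (intro mult_left_mono power_mono) auto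
      qed
      also have "\<dots> = C3 / \<kappa> ^ N" by (simp add: power_divide)
      finally have far: "norm (integral {\<alpha>-1..\<beta>+1} (\<lambda>x. e x * (v 0 x * \<eta> 0 x))) \<le> C3 / \<kappa> ^ N" unfolding e_def .
      have "integral {\<alpha>-1..\<beta>+1} (\<lambda>x. e x * v 0 x) = integral {\<alpha>-1..\<beta>+1} (\<lambda>x. e x * (v 0 x * \<psi> 0 ((x - x0) / \<delta>)))
        + integral {\<alpha>-1..\<beta>+1} (\<lambda>x. e x * (v 0 x * \<eta> 0 x))"
        by (subst integral_add[symmetric])
          (auto intro!: integrable_continuous_interval continuous_intros ec \<psi>c \<eta>c vc integral_cong simp: \<eta>0 algebra_simps)
      then have eq: "integral {\<alpha>-1..\<beta>+1} (\<lambda>x. e x * v 0 x) - T =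
         (integral {\<alpha>-1..\<beta>+1} (\<lambda>x. e x * (v 0 x * \<psi> 0 ((x - x0) / \<delta>))) - T) + integral {\<alpha>-1..\<beta>+1} (\<lambda>x. e x * (v 0 x * \<eta> 0 x))"
        by simp
      have "norm (integral {\<alpha>-1..\<beta>+1} (\<lambda>x. e x * v 0 x) - T) \<le> (C1 + C2) / \<kappa> ^ N + C3 / \<kappa> ^ N"
        unfolding eq by (rule norm_triangle_le[OF add_mono[OF near far]])
      then show "norm (integral {\<alpha>-1..\<beta>+1} (\<lambda>x. exp (\<i> * of_real (y\<^sup>2 * h 0 x)) * v 0 x) -
       exp (\<i> * of_real (y\<^sup>2 * h 0 x0)) / of_real y * (\<Sum>n<N. stationary_term m y (\<lambda>j. h j x0) (\<lambda>j. v j x0) n)) \<le> (C1 + C2 + C3) / \<kappa> ^ N"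
        unfolding e_def T_def by (simp add: add_divide_distrib)
    qed
  qed
qed

section \<open>Partial derivatives in several variables\<close>

lemma norm_increment_le:
  fixes f :: "real \<Rightarrow> 'a::real_normed_vector"
  assumes "a \<le> b" "\<And>s. (f has_vector_derivative f' s) (at s)" "\<And>s. a \<le> s \<Longrightarrow> s \<le> b \<Longrightarrow> norm (f' s) \<le> B"
  shows "norm (f b - f a) \<le> B * (b - a)"
proof -
  have "norm (f b - f a) \<le> B * norm (b - a)"
  proof (rule differentiable_bound[where S = "{a..b}" and f' = "\<lambda>s h. h *\<^sub>R f' s"])
    fix s assume s: "s \<in> {a..b}"
    show "(f has_derivative (\<lambda>h. h *\<^sub>R f' s)) (at s within {a..b})"
      using assms(2)[of s] unfolding has_vector_derivative_def by (rule has_derivative_at_withinI)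
    show "onorm (\<lambda>h. h *\<^sub>R f' s) \<le> B"
      using assms(3)[of s] s by (intro onorm_le) (simp add: mult.commute[of B] mult_left_mono)
  qed (use assms in auto)
  then show ?thesis using assms(1) by simp
qed

lemma continuous_on_fun_upd:
  "continuous_on S f \<Longrightarrow> continuous_on S g \<Longrightarrow> continuous_on S (\<lambda>z. (f z)(i := g z))"
  for f :: "'b::topological_space \<Rightarrow> nat \<Rightarrow> real"
proof (rule continuous_on_coordinatewise_then_product)
  fix k assume f: "continuous_on S f" and g: "continuous_on S g"
  have "continuous_on S (\<lambda>z. f z k)" by (rule continuous_on_product_then_coordinatewise[OF f])
  then show "continuous_on S (\<lambda>z. ((f z)(i := g z)) k)" using g by (cases "k = i") auto
qed

lemma partial_deriv_line:
  assumes "(\<lambda>s. f ((x(i := s0))(i := s))) differentiable (at ((x(i := s0)) i))"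
  shows "((\<lambda>s. f (x(i := s))) has_vector_derivative partial_deriv i f (x(i := s0))) (at s0)"
  using assms[unfolded vector_derivative_works] by (simp add: partial_deriv_def)

lemma smooth_fun_line:
  assumes "smooth_fun I f" "i \<in> I"
  shows "((\<lambda>s. f (x(i := s))) has_vector_derivative partial_deriv i f (x(i := s0))) (at s0)"
proof (rule partial_deriv_line)
  have "(\<lambda>s. foldr partial_deriv [] f ((x(i := s0))(i := s))) differentiable (at ((x(i := s0)) i))"
    using assms unfolding smooth_fun_def by blast
  then show "(\<lambda>s. f ((x(i := s0))(i := s))) differentiable (at ((x(i := s0)) i))" by simp
qed

lemma smooth_fun_continuous: "smooth_fun I f \<Longrightarrow> continuous_on UNIV f"
  unfolding smooth_fun_def by (auto dest!: bspec[of _ _ "[]"])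

lemma depends_only_on_partial_deriv:
  assumes "depends_only_on I f" "i \<in> I"
  shows "depends_only_on I (partial_deriv i f)"
  unfolding depends_only_on_def
proof (intro allI impI)
  fix x y :: "nat \<Rightarrow> real" assume xy: "\<forall>k\<in>I. x k = y k"
  then have "f (x(i := s)) = f (y(i := s))" for s
    using assms(1) unfolding depends_only_on_def by simp
  then show "partial_deriv i f x = partial_deriv i f y" using xy assms(2) by (simp add: partial_deriv_def)
qed

lemma smooth_fun_partial_deriv:
  assumes "smooth_fun I f" "i \<in> I"
  shows "smooth_fun I (partial_deriv i f)"
proof -
  have "continuous_on UNIV (foldr partial_deriv ks (partial_deriv i f)) \<and>
        (\<forall>k\<in>I. \<forall>x. (\<lambda>s. foldr partial_deriv ks (partial_deriv i f) (x(k := s))) differentiable (at (x k)))"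
    if "ks \<in> lists I" for ks
  proof -
    have "ks @ [i] \<in> lists I" using that assms by auto
    then have "continuous_on UNIV (foldr partial_deriv (ks @ [i]) f) \<and>
        (\<forall>k\<in>I. \<forall>x. (\<lambda>s. foldr partial_deriv (ks @ [i]) f (x(k := s))) differentiable (at (x k)))"
      using assms unfolding smooth_fun_def by blast
    then show ?thesis by simp
  qed
  then show ?thesis using assms depends_only_on_partial_deriv unfolding smooth_fun_def by blast
qed

lemma smooth_fun_foldr: "smooth_fun I f \<Longrightarrow> ks \<in> lists I \<Longrightarrow> smooth_fun I (foldr partial_deriv ks f)"
  by (induction ks) (auto intro: smooth_fun_partial_deriv)

section \<open>Symmetry of mixed partial derivatives\<close>

text \<open>Two mean value inequalities, in coordinate i and inside it in j, each applied after
  subtracting the expected linear term. Joint continuity of the mixed derivative near x makes the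
  error small on the whole square.\<close>

lemma second_difference_bound:
  fixes f :: "(nat \<Rightarrow> real) \<Rightarrow> 'a::real_normed_vector"
  assumes f: "smooth_fun I f" and ij: "i \<in> I" "j \<in> I" "i \<noteq> j" and e: "0 < \<epsilon>"
  shows "\<exists>\<delta>>0. \<forall>h. 0 < h \<longrightarrow> h < \<delta> \<longrightarrow>
     norm (f (x(i := x i + h, j := x j + h)) - f (x(i := x i + h)) - f (x(j := x j + h)) + f x
       - (h * h) *\<^sub>R partial_deriv j (partial_deriv i f) x) \<le> \<epsilon> * (h * h)"
proof -
  define A where "A = partial_deriv j (partial_deriv i f) x"
  define F where "F = partial_deriv j (partial_deriv i f)"
  have fi: "smooth_fun I (partial_deriv i f)" and F: "smooth_fun I F"
    using f ij by (auto simp: F_def intro: smooth_fun_partial_deriv)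
  have "continuous_on UNIV (\<lambda>p. F (x(i := fst p, j := snd p)))"
    by (rule continuous_on_compose2[OF smooth_fun_continuous[OF F]
          continuous_on_fun_upd[OF continuous_on_fun_upd[OF continuous_on_const continuous_on_fst[OF continuous_on_id]]
            continuous_on_snd[OF continuous_on_id]]]) simp
  then have "continuous (at (x i, x j)) (\<lambda>p. F (x(i := fst p, j := snd p)))"
    by (simp add: continuous_on_eq_continuous_at)
  then have "\<exists>\<delta>>0. \<forall>p. dist p (x i, x j) < \<delta> \<longrightarrow> dist (F (x(i := fst p, j := snd p))) (F (x(i := fst (x i, x j), j := snd (x i, x j)))) < \<epsilon>"
    using e unfolding continuous_at_eps_delta by blast
  then obtain \<delta> where \<delta>: "0 < \<delta>" "\<And>p. dist p (x i, x j) < \<delta> \<Longrightarrow> dist (F (x(i := fst p, j := snd p))) A < \<epsilon>"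
    by (auto simp: F_def A_def)
  show ?thesis
  proof (intro exI[of _ "\<delta> / 2"] conjI allI impI)
    fix h :: real assume h: "0 < h" "h < \<delta> / 2"
    have near: "norm (F (x(i := s, j := t)) - A) \<le> \<epsilon>" if "x i \<le> s" "s \<le> x i + h" "x j \<le> t" "t \<le> x j + h" for s t
    proof -
      have "dist (s, t) (x i, x j) \<le> \<bar>s - x i\<bar> + \<bar>t - x j\<bar>"
        unfolding dist_Pair_Pair dist_real_def using sqrt_sum_squares_le_sum_abs[of "s - x i" "t - x j"] by simp
      also have "\<dots> < \<delta>" using that h by auto
      finally show ?thesis using \<delta>(2)[of "(s, t)"] by (simp add: dist_norm)
    qed
    define \<Phi> where "\<Phi> s = f (x(i := s, j := x j + h)) - f (x(i := s, j := x j)) - (s * h) *\<^sub>R A" for s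
    define \<Phi>' where "\<Phi>' s = partial_deriv i f (x(i := s, j := x j + h)) - partial_deriv i f (x(i := s, j := x j)) - h *\<^sub>R A" for s
    have d1: "((\<lambda>s. f (x(i := s, j := t))) has_vector_derivative partial_deriv i f (x(i := s, j := t))) (at s)" for s t
      using smooth_fun_line[OF f ij(1), of "x(j := t)" s] ij(3) by (simp add: fun_upd_twist)
    have d\<Phi>: "(\<Phi> has_vector_derivative \<Phi>' s) (at s)" for s
      unfolding \<Phi>_def \<Phi>'_def
    proof (intro has_vector_derivative_diff d1)
      have "((\<lambda>s. s * h) has_real_derivative h) (at s)" by (rule derivative_eq_intros refl | simp)+
      then show "((\<lambda>s. (s * h) *\<^sub>R A) has_vector_derivative h *\<^sub>R A) (at s)"
        by (rule has_vector_derivative_scaleR[OF _ has_vector_derivative_const, simplified])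
    qed
    have "norm (\<Phi> (x i + h) - \<Phi> (x i)) \<le> (\<epsilon> * h) * (x i + h - x i)"
    proof (rule norm_increment_le[OF _ d\<Phi>])
      fix s assume s: "x i \<le> s" "s \<le> x i + h"
      define \<Psi> where "\<Psi> t = partial_deriv i f (x(i := s, j := t)) - t *\<^sub>R A" for t
      have d\<Psi>: "(\<Psi> has_vector_derivative F (x(i := s, j := t)) - A) (at t)" for t
        unfolding \<Psi>_def F_def
      proof (intro has_vector_derivative_diff smooth_fun_line[OF fi ij(2)])
        show "((\<lambda>t. t *\<^sub>R A) has_vector_derivative A) (at t)"
          by (auto simp: has_vector_derivative_def intro!: derivative_eq_intros)
      qed
      have "norm (\<Psi> (x j + h) - \<Psi> (x j)) \<le> \<epsilon> * (x j + h - x j)"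
        by (rule norm_increment_le[OF _ d\<Psi>]) (use h near s in auto)
      then show "norm (\<Phi>' s) \<le> \<epsilon> * h" by (simp add: \<Psi>_def \<Phi>'_def algebra_simps)
    qed (use h in auto)
    then show "norm (f (x(i := x i + h, j := x j + h)) - f (x(i := x i + h)) - f (x(j := x j + h)) + f x
       - (h * h) *\<^sub>R partial_deriv j (partial_deriv i f) x) \<le> \<epsilon> * (h * h)"
      using ij(3) by (simp add: \<Phi>_def A_def[symmetric] algebra_simps fun_upd_twist[of i j])
  qed (use \<delta> in auto)
qed

text \<open>Schwarz's theorem: the second difference is symmetric in i and j, so both mixed
  derivatives are its limit after division by h^2.\<close>

lemma partial_deriv_commute:
  fixes f :: "(nat \<Rightarrow> real) \<Rightarrow> 'a::real_normed_vector"
  assumes f: "smooth_fun I f" and ij: "i \<in> I" "j \<in> I"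
  shows "partial_deriv i (partial_deriv j f) = partial_deriv j (partial_deriv i f)"
proof (cases "i = j")
  case False
  show ?thesis
  proof
    fix x
    let ?A = "partial_deriv j (partial_deriv i f) x" and ?A' = "partial_deriv i (partial_deriv j f) x"
    have le: "norm (?A' - ?A) \<le> \<epsilon>" if e: "0 < \<epsilon>" for \<epsilon>
    proof -
      define D where "D h = f (x(i := x i + h, j := x j + h)) - f (x(i := x i + h)) - f (x(j := x j + h)) + f x" for h
      obtain \<delta> where d: "0 < \<delta>" "\<And>h. 0 < h \<Longrightarrow> h < \<delta> \<Longrightarrow> norm (D h - (h * h) *\<^sub>R ?A) \<le> (\<epsilon> / 2) * (h * h)"
        using second_difference_bound[OF f ij False, of "\<epsilon> / 2" x] e unfolding D_def by auto
      have "D h = f (x(j := x j + h, i := x i + h)) - f (x(j := x j + h)) - f (x(i := x i + h)) + f x" for h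
        using False by (simp add: D_def fun_upd_twist[of i j])
      then obtain \<delta>' where d': "0 < \<delta>'" "\<And>h. 0 < h \<Longrightarrow> h < \<delta>' \<Longrightarrow> norm (D h - (h * h) *\<^sub>R ?A') \<le> (\<epsilon> / 2) * (h * h)"
        using second_difference_bound[OF f ij(2,1), of "\<epsilon> / 2" x] False e by auto
      obtain h where h: "0 < h" "h < \<delta>" "h < \<delta>'" using d(1) d'(1) field_lbound_gt_zero by blast
      have eq: "(h * h) *\<^sub>R (?A' - ?A) = (D h - (h * h) *\<^sub>R ?A) - (D h - (h * h) *\<^sub>R ?A')" by (simp add: scaleR_right_diff_distrib)
      have "norm ((h * h) *\<^sub>R (?A' - ?A)) \<le> (\<epsilon> / 2) * (h * h) + (\<epsilon> / 2) * (h * h)"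
        unfolding eq
        using d(2)[OF h(1,2)] d'(2)[OF h(1,3)]
          norm_triangle_ineq4[of "D h - (h * h) *\<^sub>R ?A" "D h - (h * h) *\<^sub>R ?A'"] by linarith
      then have "(h * h) * norm (?A' - ?A) \<le> (h * h) * \<epsilon>" unfolding norm_scaleR by (simp add: mult.commute)
      moreover have "0 < h * h" using h by simp
      ultimately show ?thesis by (simp only: mult_le_cancel_left_pos)
    qed
    show "?A' = ?A"
    proof (rule ccontr)
      assume "?A' \<noteq> ?A"
      then show False using le[of "norm (?A' - ?A) / 2"] by simp
    qed
  qed
qed simp

section \<open>Iterated derivatives: lists and multi-indices\<close>

lemma foldr_partial_deriv_move:
  assumes "smooth_fun I f" "i \<in> I" "ks \<in> lists I"
  shows "foldr partial_deriv (ks @ [i]) f = partial_deriv i (foldr partial_deriv ks f)"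
  using assms(3)
proof (induction ks)
  case (Cons k ks)
  then have "smooth_fun I (foldr partial_deriv ks f)" by (intro smooth_fun_foldr[OF assms(1)]) auto
  then have "partial_deriv k (partial_deriv i (foldr partial_deriv ks f)) = partial_deriv i (partial_deriv k (foldr partial_deriv ks f))"
    by (rule partial_deriv_commute) (use Cons assms in auto)
  then show ?case using Cons by simp
qed simp

lemma foldr_partial_deriv_cong_mset:
  assumes "smooth_fun I f" "ks \<in> lists I" "mset ks = mset ls"
  shows "foldr partial_deriv ks f = foldr partial_deriv ls f"
  using assms(2,3)
proof (induction ks arbitrary: ls rule: list.induct)
  case (Cons k ks)
  have "k \<in> set ls" using Cons.prems(2) by (metis list.set_intros(1) set_mset_mset)
  then obtain l1 l2 where ls: "ls = l1 @ k # l2" by (meson split_list)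
  have sets: "set ls \<subseteq> I" using Cons.prems by (metis in_listsD set_mset_mset subsetI)
  have "foldr partial_deriv ls f = foldr partial_deriv (l1 @ [k]) (foldr partial_deriv l2 f)" by (simp add: ls)
  also have "\<dots> = partial_deriv k (foldr partial_deriv l1 (foldr partial_deriv l2 f))"
    by (rule foldr_partial_deriv_move[where I = I]) (use sets ls in \<open>auto intro: smooth_fun_foldr[OF assms(1)]\<close>)
  also have "\<dots> = partial_deriv k (foldr partial_deriv (l1 @ l2) f)" by simp
  also have "foldr partial_deriv (l1 @ l2) f = foldr partial_deriv ks f"
    by (rule Cons.IH[symmetric]) (use Cons.prems ls in auto)
  finally show ?case by simp
qed simp

text \<open>Higher derivatives are handled as lists of variables, which grow by one differentiation
  at a time. This is the list belonging to a multi-index, in the order used by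
  \<open>mixed_deriv\<close>.\<close>

definition expand_index :: "nat set \<Rightarrow> (nat \<Rightarrow> nat) \<Rightarrow> nat list" where
  "expand_index I j = concat (map (\<lambda>i. replicate (j i) i) (sorted_list_of_set I))"

lemma mixed_deriv_eq_foldr: "mixed_deriv I j f = foldr partial_deriv (expand_index I j) f"
proof -
  have "foldr (\<lambda>i. partial_deriv i ^^ j i) L f = foldr partial_deriv (concat (map (\<lambda>i. replicate (j i) i) L)) f" for L
    by (induction L) (auto simp: foldr_replicate)
  then show ?thesis by (simp add: mixed_deriv_def expand_index_def)
qed

lemma expand_index_in_lists: "finite I \<Longrightarrow> expand_index I j \<in> lists I"
  by (auto simp: expand_index_def)

lemma count_expand_index: "finite I \<Longrightarrow> count (mset (expand_index I j)) i = (if i \<in> I then j i else 0)"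
proof -
  assume "finite I"
  have "distinct L \<Longrightarrow> count (mset (concat (map (\<lambda>i. replicate (j i) i) L))) i = (if i \<in> set L then j i else 0)" for L
    by (induction L) (auto simp: count_replicate_mset)
  from this[of "sorted_list_of_set I"] show ?thesis using \<open>finite I\<close> by (simp add: expand_index_def)
qed

lemma prod_list_map_eq_prod_count:
  fixes g :: "nat \<Rightarrow> 'a::comm_monoid_mult"
  assumes "finite I" "ks \<in> lists I"
  shows "prod_list (map g ks) = (\<Prod>i\<in>I. g i ^ count (mset ks) i)"
  using assms(2)
proof (induction ks)
  case (Cons k ks)
  have "(\<Prod>i\<in>I. g i ^ count (mset (k # ks)) i) = (\<Prod>i\<in>I. (if i = k then g i else 1) * g i ^ count (mset ks) i)"
    by (intro prod.cong) auto
  also have "\<dots> = g k * (\<Prod>i\<in>I. g i ^ count (mset ks) i)"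
    using Cons assms by (simp add: prod.distrib prod.delta)
  finally show ?case using Cons by simp
qed simp

lemma length_eq_sum_count:
  assumes "finite I" "ks \<in> lists I"
  shows "length ks = (\<Sum>i\<in>I. count (mset ks) i)"
  using assms(2)
proof (induction ks)
  case (Cons k ks)
  have "(\<Sum>i\<in>I. count (mset (k # ks)) i) = (\<Sum>i\<in>I. (if i = k then 1 else 0) + count (mset ks) i)"
    by (intro sum.cong) auto
  also have "\<dots> = 1 + (\<Sum>i\<in>I. count (mset ks) i)"
    using Cons assms by (simp add: sum.distrib)
  finally show ?case using Cons by simp
qed simp

lemma foldr_partial_deriv_eq_mixed_deriv:
  assumes "smooth_fun I f" "finite I" "ks \<in> lists I"
  shows "foldr partial_deriv ks f = mixed_deriv I (count (mset ks)) f"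
  unfolding mixed_deriv_eq_foldr
proof (rule foldr_partial_deriv_cong_mset[OF assms(1,3)])
  have "i \<notin># mset ks" if "i \<notin> I" for i using that assms(3) by auto
  then show "mset ks = mset (expand_index I (count (mset ks)))"
    by (intro multiset_eqI) (auto simp: count_expand_index[OF assms(2)] not_in_iff)
qed

lemma partial_derivI:
  "((\<lambda>s. f (t(i := s))) has_vector_derivative D) (at (t i)) \<Longrightarrow> partial_deriv i f t = D"
  unfolding partial_deriv_def by (rule vector_derivative_at)

lemma partial_derivD:
  "(\<lambda>s. f (t(i := s))) differentiable (at (t i)) \<Longrightarrow>
    ((\<lambda>s. f (t(i := s))) has_vector_derivative partial_deriv i f t) (at (t i))"
  unfolding partial_deriv_def vector_derivative_works .

lemma open_line_preimage:
  fixes t :: "nat \<Rightarrow> real"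
  assumes "open U"
  shows "open {s. t(i := s) \<in> U}"
proof -
  have "continuous_on UNIV (\<lambda>s. t(i := s))"
    by (rule continuous_on_fun_upd[OF continuous_on_const continuous_on_id])
  from open_vimage[OF assms this] show ?thesis by (simp add: vimage_def)
qed

lemma line_derivative_cong:
  fixes t :: "nat \<Rightarrow> real"
  assumes "open U" "t \<in> U" "\<And>t. t \<in> U \<Longrightarrow> f t = g t"
    and "((\<lambda>s. f (t(i := s))) has_vector_derivative D) (at (t i))"
  shows "((\<lambda>s. g (t(i := s))) has_vector_derivative D) (at (t i))"
  by (rule has_vector_derivative_transform_within_open[OF assms(4) open_line_preimage[OF assms(1), of t i]])
    (use assms in auto)

lemma partial_deriv_cong_open:
  assumes "open U" "t \<in> U" "\<And>t. t \<in> U \<Longrightarrow> f t = g t"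
    and "(\<lambda>s. f (t(i := s))) differentiable (at (t i))"
  shows "partial_deriv i g t = partial_deriv i f t" "(\<lambda>s. g (t(i := s))) differentiable (at (t i))"
proof -
  have d: "((\<lambda>s. g (t(i := s))) has_vector_derivative partial_deriv i f t) (at (t i))"
    by (rule line_derivative_cong[where U = U and f = f]) (use assms partial_derivD in auto)
  show "partial_deriv i g t = partial_deriv i f t" by (rule partial_derivI[OF d])
  show "(\<lambda>s. g (t(i := s))) differentiable (at (t i))" by (rule differentiableI_vector[OF d])
qed

section \<open>Symbol calculus\<close>

text \<open>Two sets are kept apart: estimates are known only on the support \<open>K\<close>, while
  taking partial derivatives requires an open domain. \<open>U\<close> is a neighbourhood of
  \<open>K\<close> for differentiability, without any bounds on it.\<close>

locale symbol_calculus =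
  fixes I :: "nat set" and F :: "'k set" and U K :: "'k \<Rightarrow> (nat \<Rightarrow> real) set"
    and X :: "'k \<Rightarrow> real" and L :: "'k \<Rightarrow> nat \<Rightarrow> real"
  assumes open_U: "T \<in> F \<Longrightarrow> open (U T)" and K_subset_U: "T \<in> F \<Longrightarrow> K T \<subseteq> U T"
    and X_ge_1: "T \<in> F \<Longrightarrow> 1 \<le> X T"
begin

definition sym_base :: "('k \<Rightarrow> real) \<Rightarrow> ('k \<Rightarrow> (nat \<Rightarrow> real) \<Rightarrow> complex) \<Rightarrow> bool" where
  "sym_base \<sigma> G \<longleftrightarrow> (\<forall>T\<in>F. continuous_on (U T) (G T)) \<and>
     (\<exists>M\<ge>0. \<forall>T\<in>F. \<forall>t\<in>K T. norm (G T t) \<le> M * \<sigma> T)"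

text \<open>
  \<open>sym n \<sigma> G\<close>: on \<open>K\<close>, the derivatives of order at most \<open>n\<close>, rescaled by the lengths \<open>L\<close>, are bounded
  by \<open>\<sigma>\<close> times one power of \<open>X\<close> per derivative, uniformly in the index.
\<close>

primrec sym :: "nat \<Rightarrow> ('k \<Rightarrow> real) \<Rightarrow> ('k \<Rightarrow> (nat \<Rightarrow> real) \<Rightarrow> complex) \<Rightarrow> bool" where
  "sym 0 \<sigma> G = sym_base \<sigma> G"
| "sym (Suc n) \<sigma> G = (sym_base \<sigma> G \<and> (\<forall>i\<in>I. (\<forall>T\<in>F. \<forall>t\<in>U T. (\<lambda>s. G T (t(i := s))) differentiable (at (t i))) \<and>
     sym n (\<lambda>T. X T * \<sigma> T) (\<lambda>T t. L T i *\<^sub>R partial_deriv i (G T) t)))"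

lemma sym_imp_base: "sym n \<sigma> G \<Longrightarrow> sym_base \<sigma> G"
  by (cases n) auto

lemma sym_continuous: "sym n \<sigma> G \<Longrightarrow> T \<in> F \<Longrightarrow> continuous_on (U T) (G T)"
  using sym_imp_base unfolding sym_base_def by blast

lemma sym_differentiable:
  "sym (Suc n) \<sigma> G \<Longrightarrow> i \<in> I \<Longrightarrow> T \<in> F \<Longrightarrow> t \<in> U T \<Longrightarrow> (\<lambda>s. G T (t(i := s))) differentiable (at (t i))"
  by simp

lemma sym_deriv: "sym (Suc n) \<sigma> G \<Longrightarrow> i \<in> I \<Longrightarrow> sym n (\<lambda>T. X T * \<sigma> T) (\<lambda>T t. L T i *\<^sub>R partial_deriv i (G T) t)"
  by simp

lemma sym_base_cong:
  assumes "sym_base \<sigma> G" "\<And>T t. T \<in> F \<Longrightarrow> t \<in> U T \<Longrightarrow> G T t = H T t"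
  shows "sym_base \<sigma> H"
  using assms K_subset_U unfolding sym_base_def by (metis (no_types, lifting) continuous_on_cong subsetD)

text \<open>Partial derivatives on the open set \<open>U\<close> are local, so identities valid only
  there, such as those that divide by the second derivative of the phase, may be
  substituted.\<close>

lemma sym_cong:
  assumes "sym n \<sigma> G" "\<And>T t. T \<in> F \<Longrightarrow> t \<in> U T \<Longrightarrow> G T t = H T t"
  shows "sym n \<sigma> H"
  using assms
proof (induction n arbitrary: \<sigma> G H)
  case 0
  then show ?case using sym_base_cong by simp
next
  case (Suc n)
  note pc = partial_deriv_cong_open[OF open_U _ Suc.prems(2) sym_differentiable[OF Suc.prems(1)]]
  have pc1: "partial_deriv i (H T) t = partial_deriv i (G T) t" if "i \<in> I" "T \<in> F" "t \<in> U T" for i T t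
    by (rule pc(1)) (rule that | assumption)+
  have pc2: "(\<lambda>s. H T (t(i := s))) differentiable (at (t i))" if "i \<in> I" "T \<in> F" "t \<in> U T" for i T t
    by (rule pc(2)) (rule that | assumption)+
  have "sym n (\<lambda>T. X T * \<sigma> T) (\<lambda>T t. L T i *\<^sub>R partial_deriv i (H T) t)" if "i \<in> I" for i
    by (rule Suc.IH[OF sym_deriv[OF Suc.prems(1) that]]) (simp add: pc1 that)
  then show ?case using pc2 sym_base_cong[OF sym_imp_base[OF Suc.prems(1)] Suc.prems(2)] unfolding sym.simps by blast
qed

lemma sym_mono:
  assumes "sym n \<sigma> G" "\<And>T. T \<in> F \<Longrightarrow> \<sigma> T \<le> \<tau> T"
  shows "sym n \<tau> G"
  using assms
proof (induction n arbitrary: \<sigma> \<tau> G)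
  have base: "sym_base \<tau> G" if b: "sym_base \<sigma> G" "\<And>T. T \<in> F \<Longrightarrow> \<sigma> T \<le> \<tau> T" for \<sigma> \<tau> G
  proof -
    obtain M where M: "0 \<le> M" "\<And>T t. T \<in> F \<Longrightarrow> t \<in> K T \<Longrightarrow> norm (G T t) \<le> M * \<sigma> T"
      using b(1) unfolding sym_base_def by blast
    have "norm (G T t) \<le> M * \<tau> T" if "T \<in> F" "t \<in> K T" for T t
      using M(2)[OF that] mult_left_mono[OF b(2)[OF that(1)] M(1)] by linarith
    then show ?thesis using b(1) M(1) unfolding sym_base_def by blast
  qed
  {
    case 0
    then show ?case using base by simp
  next
    case (Suc n)
    have "X T * \<sigma> T \<le> X T * \<tau> T" if "T \<in> F" for T
      using Suc.prems(2)[OF that] X_ge_1[OF that] by (intro mult_left_mono) auto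
    then show ?case using Suc base[of \<sigma> G \<tau>] by (auto intro: Suc.IH)
  }
qed

lemma sym_Suc_imp: "sym (Suc n) \<sigma> G \<Longrightarrow> sym n \<sigma> G"
  by (induction n arbitrary: \<sigma> G) auto

lemma sym_const:
  assumes "0 \<le> M" "\<And>T. T \<in> F \<Longrightarrow> norm (k T) \<le> M * \<sigma> T" "\<And>T. T \<in> F \<Longrightarrow> 0 \<le> \<sigma> T"
  shows "sym n \<sigma> (\<lambda>T t. k T)"
  using assms
proof (induction n arbitrary: \<sigma> k)
  case 0
  then show ?case by (auto simp: sym_base_def)
next
  case (Suc n)
  have "partial_deriv i (\<lambda>t. k T) t = 0" for i T t by (rule partial_derivI) simp
  moreover have "sym n (\<lambda>T. X T * \<sigma> T) (\<lambda>T t. 0)"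
    by (rule Suc.IH) (use Suc.prems X_ge_1 in \<open>auto intro!: mult_nonneg_nonneg intro: order_trans[OF zero_le_one]\<close>)
  ultimately show ?case using Suc.prems by (auto simp: sym_base_def)
qed

lemma sym_add:
  assumes "sym n \<sigma> G" "sym n \<sigma> H"
  shows "sym n \<sigma> (\<lambda>T t. G T t + H T t)"
  using assms
proof (induction n arbitrary: \<sigma> G H)
  have base: "sym_base \<sigma> (\<lambda>T t. G T t + H T t)" if b: "sym_base \<sigma> G" "sym_base \<sigma> H" for \<sigma> G H
  proof -
    obtain M M' where M: "0 \<le> M" "\<And>T t. T \<in> F \<Longrightarrow> t \<in> K T \<Longrightarrow> norm (G T t) \<le> M * \<sigma> T"
      "0 \<le> M'" "\<And>T t. T \<in> F \<Longrightarrow> t \<in> K T \<Longrightarrow> norm (H T t) \<le> M' * \<sigma> T"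
      using b unfolding sym_base_def by blast
    have "norm (G T t + H T t) \<le> (M + M') * \<sigma> T" if "T \<in> F" "t \<in> K T" for T t
      using norm_triangle_le[OF add_mono[OF M(2)[OF that] M(4)[OF that]]] by (simp add: algebra_simps)
    then show ?thesis using b M(1,3) unfolding sym_base_def
      by (intro conjI exI[of _ "M + M'"] ballI continuous_on_add) auto
  qed
  {
    case 0
    then show ?case using base by simp
  next
    case (Suc n)
    have "((\<lambda>s. G T (t(i := s)) + H T (t(i := s))) has_vector_derivative partial_deriv i (G T) t + partial_deriv i (H T) t) (at (t i))"
      if "i \<in> I" "T \<in> F" "t \<in> U T" for i T t
      by (intro has_vector_derivative_add partial_derivD sym_differentiable[OF Suc.prems(1) that] sym_differentiable[OF Suc.prems(2) that])
    note d = partial_derivI[OF this] differentiableI_vector[OF this]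
    have "sym n (\<lambda>T. X T * \<sigma> T) (\<lambda>T t. L T i *\<^sub>R partial_deriv i (\<lambda>t. G T t + H T t) t)" if i: "i \<in> I" for i
      by (rule sym_cong[OF Suc.IH[OF sym_deriv[OF Suc.prems(1) i] sym_deriv[OF Suc.prems(2) i]]])
        (simp add: d(1)[OF i] scaleR_add_right)
    then show ?case using base[OF sym_imp_base[OF Suc.prems(1)] sym_imp_base[OF Suc.prems(2)]] d(2) unfolding sym.simps by blast
  }
qed

text \<open>Leibniz rule, by induction on the order: in each summand one factor is differentiated
  and the other is lowered by \<open>sym_Suc_imp\<close>, so that both are symbols of order
  n.\<close>

lemma sym_mult:
  assumes "sym n \<sigma> G" "sym n \<tau> H"
  shows "sym n (\<lambda>T. \<sigma> T * \<tau> T) (\<lambda>T t. G T t * H T t)"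
  using assms
proof (induction n arbitrary: \<sigma> \<tau> G H)
  have base: "sym_base (\<lambda>T. \<sigma> T * \<tau> T) (\<lambda>T t. G T t * H T t)" if b: "sym_base \<sigma> G" "sym_base \<tau> H" for \<sigma> \<tau> G H
  proof -
    obtain M M' where M: "0 \<le> M" "\<And>T t. T \<in> F \<Longrightarrow> t \<in> K T \<Longrightarrow> norm (G T t) \<le> M * \<sigma> T"
      "0 \<le> M'" "\<And>T t. T \<in> F \<Longrightarrow> t \<in> K T \<Longrightarrow> norm (H T t) \<le> M' * \<tau> T"
      using b unfolding sym_base_def by blast
    have "norm (G T t * H T t) \<le> (M * M') * (\<sigma> T * \<tau> T)" if "T \<in> F" "t \<in> K T" for T t
    proof -
      have "norm (G T t) * norm (H T t) \<le> (M * \<sigma> T) * (M' * \<tau> T)"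
        by (intro mult_mono M that order_trans[OF norm_ge_zero M(2)[OF that]]) auto
      then show ?thesis by (simp add: norm_mult mult_ac)
    qed
    then show ?thesis using b M(1,3) unfolding sym_base_def
      by (intro conjI exI[of _ "M * M'"] ballI continuous_on_mult) auto
  qed
  {
    case 0
    then show ?case using base by simp
  next
    case (Suc n)
    have "((\<lambda>s. G T (t(i := s)) * H T (t(i := s))) has_vector_derivative G T t * partial_deriv i (H T) t + partial_deriv i (G T) t * H T t) (at (t i))"
      if "i \<in> I" "T \<in> F" "t \<in> U T" for i T t
      using has_vector_derivative_mult[OF partial_derivD[OF sym_differentiable[OF Suc.prems(1) that]]
          partial_derivD[OF sym_differentiable[OF Suc.prems(2) that]]] unfolding fun_upd_triv .
    note d = partial_derivI[OF this] differentiableI_vector[OF this]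
    have "sym n (\<lambda>T. X T * (\<sigma> T * \<tau> T)) (\<lambda>T t. L T i *\<^sub>R partial_deriv i (\<lambda>t. G T t * H T t) t)" if i: "i \<in> I" for i
    proof -
      have 1: "sym n (\<lambda>T. \<sigma> T * (X T * \<tau> T)) (\<lambda>T t. G T t * (L T i *\<^sub>R partial_deriv i (H T) t))"
        by (intro Suc.IH sym_Suc_imp[OF Suc.prems(1)] sym_deriv[OF Suc.prems(2) i])
      have 2: "sym n (\<lambda>T. (X T * \<sigma> T) * \<tau> T) (\<lambda>T t. (L T i *\<^sub>R partial_deriv i (G T) t) * H T t)"
        by (intro Suc.IH sym_Suc_imp[OF Suc.prems(2)] sym_deriv[OF Suc.prems(1) i])
      have b1: "sym n (\<lambda>T. X T * (\<sigma> T * \<tau> T)) (\<lambda>T t. G T t * (L T i *\<^sub>R partial_deriv i (H T) t))"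
        by (rule sym_mono[OF 1]) (simp add: mult_ac)
      have b2: "sym n (\<lambda>T. X T * (\<sigma> T * \<tau> T)) (\<lambda>T t. (L T i *\<^sub>R partial_deriv i (G T) t) * H T t)"
        by (rule sym_mono[OF 2]) (simp add: mult_ac)
      show ?thesis
        by (rule sym_cong[OF sym_add[OF b1 b2]]) (simp add: d(1)[OF i] scaleR_add_right)
    qed
    then show ?case using base[OF sym_imp_base[OF Suc.prems(1)] sym_imp_base[OF Suc.prems(2)]] d(2) unfolding sym.simps by blast
  }
qed

lemma sym_sum:
  assumes "finite A" "\<And>k. k \<in> A \<Longrightarrow> sym n \<sigma> (G k)" "\<And>T. T \<in> F \<Longrightarrow> 0 \<le> \<sigma> T"
  shows "sym n \<sigma> (\<lambda>T t. \<Sum>k\<in>A. G k T t)"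
  using assms(1,2)
proof (induction A rule: finite_induct)
  case empty
  then show ?case using sym_const[where M = 0 and k = "\<lambda>_. 0" and \<sigma> = \<sigma>] assms(3) by simp
next
  case (insert a A)
  then show ?case using sym_add[of n \<sigma> "G a" "\<lambda>T t. \<Sum>k\<in>A. G k T t"] by simp
qed

lemma sym_cmult:
  assumes "sym n \<sigma> G" "\<And>T. T \<in> F \<Longrightarrow> 0 \<le> \<sigma> T"
  shows "sym n \<sigma> (\<lambda>T t. c * G T t)"
proof -
  have "sym n (\<lambda>T. 1 * \<sigma> T) (\<lambda>T t. c * G T t)"
    by (rule sym_mult[OF sym_const[where M = "norm c"] assms(1)]) auto
  then show ?thesis by simp
qed

lemma sym_power:
  assumes "sym n (\<lambda>_. 1) G"
  shows "sym n (\<lambda>_. 1) (\<lambda>T t. G T t ^ k)"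
proof (induction k)
  case 0
  show ?case by (simp, rule sym_const[where M = 1]) auto
next
  case (Suc k)
  show ?case using sym_mult[OF assms Suc] by simp
qed

lemma sym_bconv:
  assumes "\<And>k. k \<le> m \<Longrightarrow> sym n (\<lambda>T. \<theta> T ^ k) (a k)" "\<And>k. k \<le> m \<Longrightarrow> sym n (\<lambda>T. \<theta> T ^ k) (b k)"
    and "\<And>T. T \<in> F \<Longrightarrow> 0 \<le> \<theta> T"
  shows "sym n (\<lambda>T. \<theta> T ^ m) (\<lambda>T t. bconv (\<lambda>k. a k T t) (\<lambda>k. b k T t) m)"
  unfolding bconv_def
proof (intro sym_sum)
  fix k assume "k \<in> {..m}"
  then have k: "k \<le> m" by simp
  have "sym n (\<lambda>T. \<theta> T ^ k * \<theta> T ^ (m - k)) (\<lambda>T t. a k T t * b (m - k) T t)"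
    using k by (intro sym_mult assms) auto
  then have "sym n (\<lambda>T. \<theta> T ^ m) (\<lambda>T t. a k T t * b (m - k) T t)"
    using k by (simp add: power_add[symmetric])
  from sym_cmult[OF this, of "of_nat (m choose k)"] assms(3)
  show "sym n (\<lambda>T. \<theta> T ^ m) (\<lambda>T t. of_nat (m choose k) * a k T t * b (m - k) T t)" by (simp add: mult.assoc)
qed (use assms(3) in auto)

text \<open>With \<open>a 0 = 0\<close> the leading factor is 1 and the sequence is polynomial in
  the remaining \<open>a k\<close>. An oscillating exponential, whose derivatives would exceed the
  symbol bounds, never occurs.\<close>

lemma sym_exp_seq:
  assumes "\<And>k. 1 \<le> k \<Longrightarrow> k \<le> m \<Longrightarrow> sym n (\<lambda>T. \<theta> T ^ k) (a k)" "a 0 = (\<lambda>T t. 0)"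
    and "\<And>T. T \<in> F \<Longrightarrow> 0 \<le> \<theta> T"
  shows "sym n (\<lambda>T. \<theta> T ^ m) (\<lambda>T t. exp_seq (\<lambda>k. a k T t) m)"
  using assms(1)
proof (induction m rule: less_induct)
  case (less m)
  show ?case
  proof (cases m)
    case 0
    then show ?thesis using sym_const[where M = 1 and k = "\<lambda>_. 1" and \<sigma> = "\<lambda>_. 1" and n = n] by (simp add: assms(2))
  next
    case (Suc j)
    show ?thesis unfolding Suc exp_seq.simps(2)
    proof (intro sym_sum)
      fix k assume "k \<in> {..j}"
      then have k: "k \<le> j" by simp
      have "sym n (\<lambda>T. \<theta> T ^ Suc k * \<theta> T ^ (j - k)) (\<lambda>T t. a (Suc k) T t * exp_seq (\<lambda>k. a k T t) (j - k))"
        using k Suc by (intro sym_mult less) auto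
      moreover have "\<theta> T ^ Suc k * \<theta> T ^ (j - k) = \<theta> T ^ Suc j" for T
        using k unfolding power_add[symmetric] by simp
      ultimately have "sym n (\<lambda>T. \<theta> T ^ Suc j) (\<lambda>T t. a (Suc k) T t * exp_seq (\<lambda>k. a k T t) (j - k))"
        by (simp only:)
      from sym_cmult[OF this, of "of_nat (j choose k)"] assms(3)
      show "sym n (\<lambda>T. \<theta> T ^ Suc j) (\<lambda>T t. of_nat (j choose k) * a (Suc k) T t * exp_seq (\<lambda>k. a k T t) (j - k))"
        by (simp add: mult.assoc)
    qed (use assms(3) in auto)
  qed
qed

text \<open>The derivative of G^(-1/2) is -G' (G^(-1/2))^3 / 2, a polynomial in G' and G^(-1/2)
  itself, so order n + 1 follows from order n. Powers of this one symbol provide both the Gaussian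
  widths of the expansion and division by G.\<close>

lemma sym_inverse_csqrt:
  assumes G: "\<And>n. sym n (\<lambda>_. 1) G" and U: "\<And>T t. T \<in> F \<Longrightarrow> t \<in> U T \<Longrightarrow> G T t \<notin> \<real>\<^sub>\<le>\<^sub>0"
    and M: "0 \<le> M" "\<And>T t. T \<in> F \<Longrightarrow> t \<in> K T \<Longrightarrow> norm (inverse (csqrt (G T t))) \<le> M"
  shows "sym n (\<lambda>_. 1) (\<lambda>T t. inverse (csqrt (G T t)))"
proof (induction n)
  have nz: "csqrt (G T t) \<noteq> 0" if "T \<in> F" "t \<in> U T" for T t using U[OF that] by auto
  have base: "sym_base (\<lambda>_. 1) (\<lambda>T t. inverse (csqrt (G T t)))"
    unfolding sym_base_def
  proof (intro conjI ballI)
    fix T assume T: "T \<in> F"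
    have "continuous_on (U T) (\<lambda>t. csqrt (G T t))"
      by (rule continuous_on_compose2[OF continuous_on_csqrt sym_continuous[OF G T]])
        (use U[OF T] in auto)
    then show "continuous_on (U T) (\<lambda>t. inverse (csqrt (G T t)))"
      using nz[OF T] by (intro continuous_intros) auto
  qed (use M in auto)
  {
    case 0
    then show ?case using base by simp
  next
    case (Suc n)
    have "((\<lambda>s. inverse (csqrt (G T (t(i := s))))) has_vector_derivative
        partial_deriv i (G T) t * (- 1 / 2 * inverse (csqrt (G T t)) ^ 3)) (at (t i))"
      if "i \<in> I" "T \<in> F" "t \<in> U T" for i T t
    proof -
      have "(csqrt has_field_derivative inverse (2 * csqrt (G T t))) (at (G T t))"
        by (rule has_field_derivative_csqrt[OF U[OF that(2,3)]])
      then have "((\<lambda>z. inverse (csqrt z)) has_field_derivative - (inverse (csqrt (G T t)) * inverse (2 * csqrt (G T t)) * inverse (csqrt (G T t)))) (at (G T t))"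
        by (rule DERIV_inverse') (rule nz[OF that(2,3)])
      then have "((\<lambda>z. inverse (csqrt z)) has_field_derivative - 1 / 2 * inverse (csqrt (G T t)) ^ 3) (at (G T t))"
        by (simp add: power3_eq_cube field_simps)
      then have "((\<lambda>z. inverse (csqrt z)) has_field_derivative - 1 / 2 * inverse (csqrt (G T t)) ^ 3) (at (G T (t(i := t i))))"
        unfolding fun_upd_triv .
      from field_vector_diff_chain_at[OF partial_derivD[OF sym_differentiable[OF G that]] this]
      show ?thesis unfolding o_def .
    qed
    note d = partial_derivI[OF this] differentiableI_vector[OF this]
    have "sym n (\<lambda>T. X T * 1) (\<lambda>T t. L T i *\<^sub>R partial_deriv i (\<lambda>t. inverse (csqrt (G T t))) t)" if i: "i \<in> I" for i
    proof -
      have "sym n (\<lambda>T. (X T * 1) * 1) (\<lambda>T t. (L T i *\<^sub>R partial_deriv i (G T) t) * (- 1 / 2 * inverse (csqrt (G T t)) ^ 3))"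
        by (intro sym_mult sym_deriv[OF G i] sym_cmult sym_power Suc) simp
      then have "sym n (\<lambda>T. X T * 1) (\<lambda>T t. (L T i *\<^sub>R partial_deriv i (G T) t) * (- 1 / 2 * inverse (csqrt (G T t)) ^ 3))"
        by simp
      then show ?thesis by (rule sym_cong) (simp add: d(1)[OF i])
    qed
    then show ?case using base d(2) unfolding sym.simps by blast
  }
qed

text \<open>Differentiating once prepends a variable to \<open>ks\<close>, so the induction on n
  consumes the bounds for all lists at once.\<close>

lemma sym_foldr:
  assumes f: "\<And>T. T \<in> F \<Longrightarrow> smooth_fun I (f T)" and ks: "ks \<in> lists I"
    and b: "\<And>ks. ks \<in> lists I \<Longrightarrow> \<exists>M\<ge>0. \<forall>T\<in>F. \<forall>t\<in>K T. prod_list (map (L T) ks) * norm (foldr partial_deriv ks (f T) t) \<le> M * (X T ^ length ks * \<sigma> T)"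
    and L: "\<And>T i. T \<in> F \<Longrightarrow> i \<in> I \<Longrightarrow> 0 < L T i"
  shows "sym n (\<lambda>T. X T ^ length ks * \<sigma> T) (\<lambda>T t. prod_list (map (L T) ks) *\<^sub>R foldr partial_deriv ks (f T) t)"
  using ks
proof (induction n arbitrary: ks)
  have base: "sym_base (\<lambda>T. X T ^ length ks * \<sigma> T) (\<lambda>T t. prod_list (map (L T) ks) *\<^sub>R foldr partial_deriv ks (f T) t)"
    if ks: "ks \<in> lists I" for ks
    unfolding sym_base_def
  proof (intro conjI ballI)
    fix T assume T: "T \<in> F"
    have "continuous_on UNIV (foldr partial_deriv ks (f T))"
      by (rule smooth_fun_continuous[OF smooth_fun_foldr[OF f[OF T] ks]])
    then show "continuous_on (U T) (\<lambda>t. prod_list (map (L T) ks) *\<^sub>R foldr partial_deriv ks (f T) t)"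
      by (intro continuous_on_scaleR continuous_on_const) (rule continuous_on_subset, auto)
  next
    have "0 \<le> prod_list (map (L T) ks)" if "T \<in> F" for T
      using ks L[OF that] by (intro prod_list_nonneg) (auto intro: less_imp_le)
    then show "\<exists>M\<ge>0. \<forall>T\<in>F. \<forall>t\<in>K T. norm (prod_list (map (L T) ks) *\<^sub>R foldr partial_deriv ks (f T) t) \<le> M * (X T ^ length ks * \<sigma> T)"
      using b[OF ks] by auto
  qed
  {
    case 0
    then show ?case using base by simp
  next
    case (Suc n)
    have "((\<lambda>s. prod_list (map (L T) ks) *\<^sub>R foldr partial_deriv ks (f T) (t(i := s))) has_vector_derivative
        prod_list (map (L T) ks) *\<^sub>R partial_deriv i (foldr partial_deriv ks (f T)) t) (at (t i))"
      if "i \<in> I" "T \<in> F" for i T t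
      using bounded_linear.has_vector_derivative[OF bounded_linear_scaleR_right smooth_fun_line[OF smooth_fun_foldr[OF f[OF that(2)] Suc.prems] that(1), of t "t i"]] unfolding fun_upd_triv .
    note d = partial_derivI[OF this] differentiableI_vector[OF this]
    have "sym n (\<lambda>T. X T * (X T ^ length ks * \<sigma> T)) (\<lambda>T t. L T i *\<^sub>R partial_deriv i (\<lambda>t. prod_list (map (L T) ks) *\<^sub>R foldr partial_deriv ks (f T) t) t)"
      if i: "i \<in> I" for i
    proof -
      have "i # ks \<in> lists I" using i Suc.prems by simp
      from Suc.IH[OF this] have "sym n (\<lambda>T. X T * (X T ^ length ks * \<sigma> T)) (\<lambda>T t. (L T i * prod_list (map (L T) ks)) *\<^sub>R partial_deriv i (foldr partial_deriv ks (f T)) t)"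
        by (simp add: mult.assoc)
      then show ?thesis by (rule sym_cong) (simp add: d(1)[OF i])
    qed
    then show ?case using base[OF Suc.prems] d(2) unfolding sym.simps by blast
  }
qed

end

section \<open>Functions restricted to the critical graph\<close>

lemma has_vector_derivative_eventually_iff:
  fixes f :: "real \<Rightarrow> 'a::real_normed_vector"
  shows "(f has_vector_derivative D) (at u0) \<longleftrightarrow>
     (\<forall>e>0. \<exists>d>0. \<forall>u. \<bar>u - u0\<bar> < d \<longrightarrow> norm (f u - f u0 - (u - u0) *\<^sub>R D) \<le> e * \<bar>u - u0\<bar>)"
  unfolding has_vector_derivative_def has_derivative_at_alt
  by (simp add: bounded_linear_scaleR_left)

text \<open>Mean value inequality in s on a ball around s0, uniformly in u. Continuity of
  \<open>gs\<close> in both variables takes the place of total differentiability of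
  \<open>g\<close>.\<close>

lemma partial_increment:
  fixes g :: "real \<Rightarrow> real \<Rightarrow> 'a::real_normed_vector"
  assumes V: "open V" "(u0, s0) \<in> V"
    and d: "\<And>u s. (u, s) \<in> V \<Longrightarrow> ((\<lambda>s. g u s) has_vector_derivative gs u s) (at s)"
    and c: "continuous_on V (\<lambda>p. gs (fst p) (snd p))"
    and \<tau>: "\<And>e. 0 < e \<Longrightarrow> \<exists>d>0. \<forall>u. \<bar>u - u0\<bar> < d \<longrightarrow> \<bar>\<tau> u - s0\<bar> < e" and e: "0 < e"
  shows "\<exists>d>0. \<forall>u. \<bar>u - u0\<bar> < d \<longrightarrow> norm (g u (\<tau> u) - g u s0 - (\<tau> u - s0) *\<^sub>R gs u0 s0) \<le> e * \<bar>\<tau> u - s0\<bar>"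
proof -
  let ?W = "{p \<in> V. dist (gs (fst p) (snd p)) (gs u0 s0) < e}"
  have "open ((\<lambda>p. gs (fst p) (snd p)) -` ball (gs u0 s0) e \<inter> V)"
    using c V(1) continuous_on_open_vimage by blast
  moreover have "(\<lambda>p. gs (fst p) (snd p)) -` ball (gs u0 s0) e \<inter> V = ?W" by (auto simp: dist_commute)
  ultimately have "open ?W" by simp
  moreover have "(u0, s0) \<in> ?W" using V e by simp
  ultimately obtain A B where AB: "open A" "open B" "(u0, s0) \<in> A \<times> B" "A \<times> B \<subseteq> ?W" by (rule open_prod_elim)
  obtain d1 where d1: "0 < d1" "ball u0 d1 \<subseteq> A" using AB openE by blast
  obtain d2 where d2: "0 < d2" "ball s0 d2 \<subseteq> B" using AB openE by blast
  obtain d3 where d3: "0 < d3" "\<And>u. \<bar>u - u0\<bar> < d3 \<Longrightarrow> \<bar>\<tau> u - s0\<bar> < d2" using \<tau>[OF d2(1)] by blast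
  show ?thesis
  proof (intro exI[of _ "min d1 d3"] conjI allI impI)
    fix u assume u: "\<bar>u - u0\<bar> < min d1 d3"
    then have uA: "u \<in> A" using d1(2) by (auto simp: dist_real_def abs_minus_commute)
    have seg: "(u, s) \<in> ?W" if "s \<in> ball s0 d2" for s using that uA d2(2) AB(4) by blast
    define f where "f s = g u s - s *\<^sub>R gs u0 s0" for s
    have "norm (f (\<tau> u) - f s0) \<le> e * norm (\<tau> u - s0)"
    proof (rule differentiable_bound[where S = "ball s0 d2" and f' = "\<lambda>s h. h *\<^sub>R (gs u s - gs u0 s0)"])
      fix s assume s: "s \<in> ball s0 d2"
      have "(f has_vector_derivative gs u s - gs u0 s0) (at s)"
        unfolding f_def
      proof (intro has_vector_derivative_diff d)
        show "(u, s) \<in> V" using seg[OF s] by simp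
        show "((\<lambda>s. s *\<^sub>R gs u0 s0) has_vector_derivative gs u0 s0) (at s)"
          by (auto simp: has_vector_derivative_def intro!: derivative_eq_intros)
      qed
      then show "(f has_derivative (\<lambda>h. h *\<^sub>R (gs u s - gs u0 s0))) (at s within ball s0 d2)"
        unfolding has_vector_derivative_def by (rule has_derivative_at_withinI)
      show "onorm (\<lambda>h. h *\<^sub>R (gs u s - gs u0 s0)) \<le> e"
        using seg[OF s] by (intro onorm_le) (simp add: dist_norm mult.commute[of e] mult_left_mono)
    next
      show "\<tau> u \<in> ball s0 d2" using d3(2)[of u] u by (simp add: dist_real_def abs_minus_commute)
    qed (use d2 in auto)
    then show "norm (g u (\<tau> u) - g u s0 - (\<tau> u - s0) *\<^sub>R gs u0 s0) \<le> e * \<bar>\<tau> u - s0\<bar>"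
      by (simp add: f_def scaleR_diff_left algebra_simps)
  qed (use d1 d3 in auto)
qed

lemma has_vector_derivative_lipschitz:
  fixes f :: "real \<Rightarrow> 'a::real_normed_vector"
  assumes "(f has_vector_derivative D) (at u0)"
  shows "\<exists>d>0. \<forall>u. \<bar>u - u0\<bar> < d \<longrightarrow> norm (f u - f u0) \<le> (norm D + 1) * \<bar>u - u0\<bar>"
proof -
  obtain d where d: "0 < d" "\<And>u. \<bar>u - u0\<bar> < d \<Longrightarrow> norm (f u - f u0 - (u - u0) *\<^sub>R D) \<le> 1 * \<bar>u - u0\<bar>"
    using assms unfolding has_vector_derivative_eventually_iff by (meson zero_less_one)
  have "norm (f u - f u0) \<le> (norm D + 1) * \<bar>u - u0\<bar>" if "\<bar>u - u0\<bar> < d" for u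
  proof -
    have "norm (f u - f u0) \<le> norm (f u - f u0 - (u - u0) *\<^sub>R D) + norm ((u - u0) *\<^sub>R D)"
      using norm_triangle_ineq2[of "f u - f u0" "(u - u0) *\<^sub>R D"] by linarith
    also have "\<dots> \<le> 1 * \<bar>u - u0\<bar> + \<bar>u - u0\<bar> * norm D" using d(2)[OF that] by simp
    finally show ?thesis by (simp add: algebra_simps)
  qed
  with d(1) show ?thesis by blast
qed

text \<open>Let a be the s-derivative of \<open>g\<close> at the base point. The increment estimate
  with error a/2 upgrades continuity of \<tau> at u0 to a Lipschitz bound there; fed back, this
  bound turns errors o(|\<tau> u - s0|) into o(|u - u0|).\<close>

lemma implicit_derivative:
  fixes g :: "real \<Rightarrow> real \<Rightarrow> real"
  assumes V: "open V" "(u0, s0) \<in> V"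
    and d: "\<And>u s. (u, s) \<in> V \<Longrightarrow> ((\<lambda>s. g u s) has_vector_derivative gs u s) (at s)"
    and c: "continuous_on V (\<lambda>p. gs (fst p) (snd p))"
    and \<tau>: "\<And>e. 0 < e \<Longrightarrow> \<exists>d>0. \<forall>u. \<bar>u - u0\<bar> < d \<longrightarrow> \<bar>\<tau> u - s0\<bar> < e"
    and gu: "((\<lambda>u. g u s0) has_vector_derivative gu) (at u0)" and pos: "0 < gs u0 s0"
    and z: "g u0 s0 = 0" "0 < r" "\<And>u. \<bar>u - u0\<bar> < r \<Longrightarrow> g u (\<tau> u) = 0"
  shows "(\<tau> has_vector_derivative - gu / gs u0 s0) (at u0)"
proof -
  define a where "a = gs u0 s0"
  have a: "0 < a" using pos by (simp add: a_def)
  have \<tau>0: "\<tau> u0 = s0"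
  proof (rule ccontr)
    assume "\<tau> u0 \<noteq> s0"
    then obtain d where "0 < d" "\<forall>u. \<bar>u - u0\<bar> < d \<longrightarrow> \<bar>\<tau> u - s0\<bar> < \<bar>\<tau> u0 - s0\<bar>" using \<tau>[of "\<bar>\<tau> u0 - s0\<bar>"] by auto
    then show False by force
  qed
  obtain d1 where d1: "0 < d1" "\<And>u. \<bar>u - u0\<bar> < d1 \<Longrightarrow> \<bar>g u s0\<bar> \<le> (\<bar>gu\<bar> + 1) * \<bar>u - u0\<bar>"
    using has_vector_derivative_lipschitz[OF gu] z(1) by auto
  have inc: "\<exists>d>0. \<forall>u. \<bar>u - u0\<bar> < d \<longrightarrow> \<bar>g u s0 + (\<tau> u - s0) * a\<bar> \<le> e * \<bar>\<tau> u - s0\<bar>" if e: "0 < e" for e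
  proof -
    obtain d where d: "0 < d" "\<forall>u. \<bar>u - u0\<bar> < d \<longrightarrow> norm (g u (\<tau> u) - g u s0 - (\<tau> u - s0) *\<^sub>R gs u0 s0) \<le> e * \<bar>\<tau> u - s0\<bar>"
      using partial_increment[OF V d c \<tau> e] by blast
    have "\<bar>g u s0 + (\<tau> u - s0) * a\<bar> \<le> e * \<bar>\<tau> u - s0\<bar>" if "\<bar>u - u0\<bar> < min d r" for u
    proof -
      have "norm (g u (\<tau> u) - g u s0 - (\<tau> u - s0) *\<^sub>R gs u0 s0) \<le> e * \<bar>\<tau> u - s0\<bar>" using d(2) that by simp
      moreover have "g u (\<tau> u) = 0" using z(3)[of u] that by simp
      ultimately show ?thesis by (simp add: a_def abs_if split: if_splits)
    qed
    then show ?thesis using d(1) z(2) by (intro exI[of _ "min d r"]) auto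
  qed
  obtain d2 where d2: "0 < d2" "\<And>u. \<bar>u - u0\<bar> < d2 \<Longrightarrow> \<bar>g u s0 + (\<tau> u - s0) * a\<bar> \<le> a / 2 * \<bar>\<tau> u - s0\<bar>"
    using inc[of "a / 2"] a by auto
  define Q where "Q = 2 * (\<bar>gu\<bar> + 1) / a"
  have Q: "0 < Q" using a by (simp add: Q_def)
  have lip: "\<bar>\<tau> u - s0\<bar> \<le> Q * \<bar>u - u0\<bar>" if "\<bar>u - u0\<bar> < d1" "\<bar>u - u0\<bar> < d2" for u
  proof -
    have "a * \<bar>\<tau> u - s0\<bar> = \<bar>(\<tau> u - s0) * a\<bar>" using a by (simp add: abs_mult)
    also have "\<dots> \<le> \<bar>g u s0 + (\<tau> u - s0) * a\<bar> + \<bar>g u s0\<bar>" by linarith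
    also have "\<dots> \<le> a / 2 * \<bar>\<tau> u - s0\<bar> + (\<bar>gu\<bar> + 1) * \<bar>u - u0\<bar>" using d1(2)[OF that(1)] d2(2)[OF that(2)] by linarith
    finally show ?thesis using a by (simp add: Q_def field_simps)
  qed
  \<comment> \<open>The deviation of \<tau> from its Newton prediction s0 - g u s0 / a; the
    derivative of the latter is the asserted one.\<close>
  define \<rho> where "\<rho> u = (g u s0 + (\<tau> u - s0) * a) / a" for u
  have "(\<rho> has_vector_derivative 0) (at u0)"
    unfolding has_vector_derivative_eventually_iff
  proof (intro allI impI)
    fix e :: real assume e: "0 < e"
    obtain d3 where d3: "0 < d3" "\<And>u. \<bar>u - u0\<bar> < d3 \<Longrightarrow> \<bar>g u s0 + (\<tau> u - s0) * a\<bar> \<le> (e * a / Q) * \<bar>\<tau> u - s0\<bar>"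
      using inc[of "e * a / Q"] e a Q by auto
    show "\<exists>d>0. \<forall>u. \<bar>u - u0\<bar> < d \<longrightarrow> norm (\<rho> u - \<rho> u0 - (u - u0) *\<^sub>R 0) \<le> e * \<bar>u - u0\<bar>"
    proof (intro exI[of _ "min d1 (min d2 d3)"] conjI allI impI)
      fix u assume u: "\<bar>u - u0\<bar> < min d1 (min d2 d3)"
      have "\<bar>g u s0 + (\<tau> u - s0) * a\<bar> \<le> (e * a / Q) * \<bar>\<tau> u - s0\<bar>" using d3(2) u by simp
      also have "\<dots> \<le> (e * a / Q) * (Q * \<bar>u - u0\<bar>)" using lip[of u] u e a Q by (intro mult_left_mono) auto
      also have "\<dots> = e * \<bar>u - u0\<bar> * a" using Q by simp
      finally show "norm (\<rho> u - \<rho> u0 - (u - u0) *\<^sub>R 0) \<le> e * \<bar>u - u0\<bar>"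
        using a z(1) \<tau>0 by (simp add: \<rho>_def field_simps)
    qed (use d1 d2 d3 in auto)
  qed
  then have "((\<lambda>u. s0 + \<rho> u - g u s0 / a) has_vector_derivative 0 + 0 - gu / a) (at u0)"
    by (intro has_vector_derivative_diff has_vector_derivative_add has_vector_derivative_const
        bounded_linear.has_vector_derivative[OF bounded_linear_divide gu])
  moreover have "(\<lambda>u. s0 + \<rho> u - g u s0 / a) = \<tau>" using a by (auto simp: \<rho>_def field_simps)
  ultimately show ?thesis by (simp add: a_def)
qed

text \<open>The increment splits into a move in s, controlled by \<open>partial_increment\<close>
  because \<open>gs\<close> is jointly continuous, and a move in u along the fixed s0, for which the
  derivative at one point suffices.\<close>

lemma chain_two_variables:
  fixes g :: "real \<Rightarrow> real \<Rightarrow> 'a::real_normed_vector"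
  assumes V: "open V" "(u0, s0) \<in> V"
    and d: "\<And>u s. (u, s) \<in> V \<Longrightarrow> ((\<lambda>s. g u s) has_vector_derivative gs u s) (at s)"
    and c: "continuous_on V (\<lambda>p. gs (fst p) (snd p))"
    and \<tau>0: "\<tau> u0 = s0" and \<tau>: "(\<tau> has_vector_derivative \<tau>') (at u0)"
    and gu: "((\<lambda>u. g u s0) has_vector_derivative gu) (at u0)"
  shows "((\<lambda>u. g u (\<tau> u)) has_vector_derivative gu + \<tau>' *\<^sub>R gs u0 s0) (at u0)"
proof -
  obtain d1 where d1: "0 < d1" "\<And>u. \<bar>u - u0\<bar> < d1 \<Longrightarrow> \<bar>\<tau> u - s0\<bar> \<le> (\<bar>\<tau>'\<bar> + 1) * \<bar>u - u0\<bar>"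
    using has_vector_derivative_lipschitz[OF \<tau>] \<tau>0 by auto
  define Q where "Q = \<bar>\<tau>'\<bar> + 1"
  have Q: "0 < Q" by (simp add: Q_def)
  have \<tau>c: "\<exists>d>0. \<forall>u. \<bar>u - u0\<bar> < d \<longrightarrow> \<bar>\<tau> u - s0\<bar> < e" if e: "0 < e" for e
  proof (intro exI[of _ "min d1 (e / Q)"] conjI allI impI)
    fix u assume u: "\<bar>u - u0\<bar> < min d1 (e / Q)"
    have "\<bar>\<tau> u - s0\<bar> \<le> Q * \<bar>u - u0\<bar>" using d1(2) u by (simp add: Q_def)
    also have "\<dots> < e" using u Q by (simp add: field_simps)
    finally show "\<bar>\<tau> u - s0\<bar> < e" .
  qed (use d1 e Q in auto)
  define \<rho> where "\<rho> u = g u (\<tau> u) - g u s0 - (\<tau> u - s0) *\<^sub>R gs u0 s0" for u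
  have "(\<rho> has_vector_derivative 0) (at u0)"
    unfolding has_vector_derivative_eventually_iff
  proof (intro allI impI)
    fix e :: real assume e: "0 < e"
    obtain d3 where d3: "0 < d3" "\<And>u. \<bar>u - u0\<bar> < d3 \<Longrightarrow> norm (\<rho> u) \<le> (e / Q) * \<bar>\<tau> u - s0\<bar>"
      using partial_increment[OF V d c \<tau>c, of "e / Q"] e Q unfolding \<rho>_def by auto
    show "\<exists>d>0. \<forall>u. \<bar>u - u0\<bar> < d \<longrightarrow> norm (\<rho> u - \<rho> u0 - (u - u0) *\<^sub>R 0) \<le> e * \<bar>u - u0\<bar>"
    proof (intro exI[of _ "min d1 d3"] conjI allI impI)
      fix u assume u: "\<bar>u - u0\<bar> < min d1 d3"
      have "norm (\<rho> u) \<le> (e / Q) * \<bar>\<tau> u - s0\<bar>" using d3(2) u by simp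
      also have "\<dots> \<le> (e / Q) * (Q * \<bar>u - u0\<bar>)" using d1(2)[of u] u e Q by (intro mult_left_mono) (auto simp: Q_def)
      finally show "norm (\<rho> u - \<rho> u0 - (u - u0) *\<^sub>R 0) \<le> e * \<bar>u - u0\<bar>"
        using Q \<tau>0 by (simp add: \<rho>_def)
    qed (use d1 d3 in auto)
  qed
  then have "((\<lambda>u. \<rho> u + g u s0 + (\<tau> u - s0) *\<^sub>R gs u0 s0) has_vector_derivative 0 + gu + (\<tau>' - 0) *\<^sub>R gs u0 s0) (at u0)"
    by (intro has_vector_derivative_diff has_vector_derivative_add has_vector_derivative_const gu \<tau>
        bounded_linear.has_vector_derivative[OF bounded_linear_scaleR_left])
  then show ?thesis by (simp add: \<rho>_def)
qed

section \<open>The critical graph and lifts to it\<close>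

text \<open>No regularity of \<open>t0\<close> is presupposed: it is the critical point over each
  fibre that meets \<open>K\<close>, and this point may itself lie outside \<open>K\<close>.
  Regularity where the graph meets \<open>K\<close> is derived from convexity, the closedness of
  \<open>K\<close> and the bounds on the first coordinate.\<close>

locale critical_graph =
  fixes I :: "nat set" and \<phi> :: "(nat \<Rightarrow> real) \<Rightarrow> real" and K :: "(nat \<Rightarrow> real) set"
    and a b :: real and t0 :: "(nat \<Rightarrow> real) \<Rightarrow> real"
  assumes one: "1 \<in> I" and smooth: "smooth_fun I \<phi>" and K_closed: "closed K"
    and K_bounds: "t \<in> K \<Longrightarrow> a \<le> t 1 \<and> t 1 \<le> b"
    and K_pos: "t \<in> K \<Longrightarrow> 0 < partial_deriv 1 (partial_deriv 1 \<phi>) t"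
    and crit: "t(1 := s) \<in> K \<Longrightarrow> partial_deriv 1 \<phi> (t(1 := t0 t)) = 0"
    and uniq: "t(1 := s) \<in> K \<Longrightarrow> partial_deriv 1 \<phi> (t(1 := s)) = 0 \<Longrightarrow> s = t0 t"
begin

abbreviation "\<phi>1 \<equiv> partial_deriv 1 \<phi>"
abbreviation "\<phi>11 \<equiv> partial_deriv 1 (partial_deriv 1 \<phi>)"

definition U :: "(nat \<Rightarrow> real) set" where "U = {t. 0 < \<phi>11 t}"

text \<open>Extension by zero fits functions that vanish on \<open>U\<close> outside
  \<open>K\<close>, and it makes the lift insensitive to the behaviour of \<open>t0\<close> where
  the graph has left \<open>K\<close>.\<close>

definition lift :: "((nat \<Rightarrow> real) \<Rightarrow> complex) \<Rightarrow> (nat \<Rightarrow> real) \<Rightarrow> complex" where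
  "lift G t = (if t(1 := t0 t) \<in> K then G (t(1 := t0 t)) else 0)"

lemma smooth1: "smooth_fun I \<phi>1" and smooth11: "smooth_fun I \<phi>11"
  using smooth one by (auto intro: smooth_fun_partial_deriv)

lemma open_U: "open U"
  unfolding U_def by (intro open_Collect_less continuous_on_const smooth_fun_continuous[OF smooth11])

lemma K_subset_U: "K \<subseteq> U"
  using K_pos by (auto simp: U_def)

lemma continuous_on_upd: "continuous_on A (\<lambda>p :: (nat \<Rightarrow> real) \<times> real. (fst p)(i := snd p))"
  by (intro continuous_on_fun_upd continuous_on_fst continuous_on_snd continuous_on_id)

text \<open>The critical points inside \<open>K\<close> form a closed set over a compact range of
  the first coordinate, so the tube lemma applies: over fibres near t they can only sit near the one
  over t, and there are none if the one over t is outside \<open>K\<close>.\<close>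

lemma near_or_empty:
  assumes e: "0 < \<epsilon>"
  obtains N where "open N" "t \<in> N" "\<And>t'. t' \<in> N \<Longrightarrow> t'(1 := t0 t') \<in> K \<Longrightarrow> t(1 := t0 t) \<in> K \<and> \<bar>t0 t' - t0 t\<bar> < \<epsilon>"
proof -
  define S where "S = K \<inter> {z. \<phi>1 z = 0}"
  have "closed S" unfolding S_def
    by (intro closed_Int K_closed closed_Collect_eq continuous_on_const smooth_fun_continuous[OF smooth1])
  \<comment> \<open>The first coordinates that critical points in \<open>K\<close> over nearby
    fibres must avoid; by uniqueness the fibre over t has none there.\<close>
  define A where "A = {a..b} - (if t(1 := t0 t) \<in> K then ball (t0 t) \<epsilon> else {})"
  have "compact A" unfolding A_def by (intro compact_diff) auto
  define W where "W = (\<lambda>p :: (nat \<Rightarrow> real) \<times> real. (fst p)(1 := snd p)) -` (- S)"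
  have "open W" unfolding W_def
    by (rule open_vimage) (use \<open>closed S\<close> continuous_on_upd in auto)
  have "{t} \<times> A \<subseteq> W"
  proof
    fix p assume "p \<in> {t} \<times> A"
    then obtain s where p: "p = (t, s)" "s \<in> A" by auto
    have False if "t(1 := s) \<in> S"
    proof -
      have "s = t0 t" using that uniq by (auto simp: S_def)
      then show False using p(2) that e by (auto simp: A_def S_def split: if_splits)
    qed
    then show "p \<in> W" by (auto simp: W_def p)
  qed
  from Elementary_Topology.tube_lemma[OF \<open>compact A\<close> \<open>open W\<close> this] obtain N where N: "t \<in> N" "open N" "N \<times> A \<subseteq> W" by blast
  show thesis
  proof (rule that[OF N(2,1)])
    fix t' assume t': "t' \<in> N" "t'(1 := t0 t') \<in> K"
    then have "t'(1 := t0 t') \<in> S" using crit by (auto simp: S_def)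
    then have "t0 t' \<notin> A" using N(3) t'(1) by (force simp: W_def)
    moreover have "t0 t' \<in> {a..b}" using K_bounds[OF t'(2)] by simp
    ultimately show "t(1 := t0 t) \<in> K \<and> \<bar>t0 t' - t0 t\<bar> < \<epsilon>"
      by (auto simp: A_def dist_real_def abs_minus_commute split: if_splits)
  qed
qed

lemma line_increasing:
  assumes "p < q" "\<And>s. p \<le> s \<Longrightarrow> s \<le> q \<Longrightarrow> t(1 := s) \<in> U"
  shows "\<phi>1 (t(1 := p)) < \<phi>1 (t(1 := q))"
proof (rule DERIV_pos_imp_increasing[OF assms(1)])
  fix s assume "p \<le> s" "s \<le> q"
  then have "0 < \<phi>11 (t(1 := s))" using assms(2) by (auto simp: U_def)
  moreover have "((\<lambda>s. \<phi>1 (t(1 := s))) has_real_derivative \<phi>11 (t(1 := s))) (at s)"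
    using smooth_fun_line[OF smooth1 one] unfolding has_real_derivative_iff_has_vector_derivative .
  ultimately show "\<exists>y. ((\<lambda>s. \<phi>1 (t(1 := s))) has_real_derivative y) (at s) \<and> 0 < y" by blast
qed

lemma sign_nhd:
  assumes "0 < e" "\<And>s. \<bar>s - s0\<bar> \<le> e \<Longrightarrow> t(1 := s) \<in> U" "\<phi>1 (t(1 := s0)) = 0"
  obtains N where "open N" "t \<in> N" "\<And>t'. t' \<in> N \<Longrightarrow> \<phi>1 (t'(1 := s0 - e)) < 0 \<and> 0 < \<phi>1 (t'(1 := s0 + e))"
proof -
  have c: "continuous_on UNIV (\<lambda>t. \<phi>1 (t(1 := s)))" for s
    by (rule continuous_on_compose2[OF smooth_fun_continuous[OF smooth1]])
      (auto intro: continuous_on_fun_upd[OF continuous_on_id continuous_on_const])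
  show thesis
  proof (rule that[of "{t'. \<phi>1 (t'(1 := s0 - e)) < 0} \<inter> {t'. 0 < \<phi>1 (t'(1 := s0 + e))}"])
    show "open ({t'. \<phi>1 (t'(1 := s0 - e)) < 0} \<inter> {t'. 0 < \<phi>1 (t'(1 := s0 + e))})"
      by (intro open_Int open_Collect_less continuous_on_const c)
    have "\<phi>1 (t(1 := s0 - e)) < \<phi>1 (t(1 := s0))" "\<phi>1 (t(1 := s0)) < \<phi>1 (t(1 := s0 + e))"
      by (rule line_increasing; use assms in auto)+
    then show "t \<in> {t'. \<phi>1 (t'(1 := s0 - e)) < 0} \<inter> {t'. 0 < \<phi>1 (t'(1 := s0 + e))}"
      using assms(3) by simp
  qed auto
qed

lemma zero_between:
  assumes "0 < e" "\<phi>1 (t(1 := s0 - e)) < 0" "0 < \<phi>1 (t(1 := s0 + e))"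
  shows "\<exists>s. \<bar>s - s0\<bar> < e \<and> \<phi>1 (t(1 := s)) = 0"
proof -
  have "continuous_on {s0 - e..s0 + e} (\<lambda>s. \<phi>1 (t(1 := s)))"
    by (rule deriv_family_continuous[OF smooth_fun_line[OF smooth1 one]])
  then obtain s where s: "s0 - e \<le> s" "s \<le> s0 + e" "\<phi>1 (t(1 := s)) = 0"
    using IVT'[of "\<lambda>s. \<phi>1 (t(1 := s))" "s0 - e" 0 "s0 + e"] assms by auto
  moreover have "s \<noteq> s0 - e" "s \<noteq> s0 + e" using s(3) assms by auto
  ultimately show ?thesis by (intro exI[of _ s]) (auto simp: abs_less_iff)
qed

text \<open>Where the graph meets \<open>K\<close>, \<phi>1 is strictly increasing across a strip
  inside \<open>U\<close> and changes sign there, so each nearby fibre has exactly one zero \<tau>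
  in the strip. The last clause identifies lifts with compositions along \<tau>, also where \<tau>
  has left \<open>K\<close>, both sides being 0 there; lifts can then be differentiated like
  ordinary compositions.\<close>

lemma local_graph:
  assumes t: "t(1 := t0 t) \<in> K"
  shows "\<exists>\<epsilon> N \<tau>. 0 < \<epsilon> \<and> open N \<and> t \<in> N \<and>
    (\<forall>t'\<in>N. \<forall>s. \<bar>s - t0 t\<bar> \<le> \<epsilon> \<longrightarrow> t'(1 := s) \<in> U) \<and>
    (\<forall>t'\<in>N. \<bar>\<tau> t' - t0 t\<bar> < \<epsilon> \<and> \<phi>1 (t'(1 := \<tau> t')) = 0) \<and>
    (\<forall>e>0. \<exists>N'. open N' \<and> t \<in> N' \<and> (\<forall>t'\<in>N'. \<bar>\<tau> t' - t0 t\<bar> < e)) \<and>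
    (\<forall>t'\<in>N. \<forall>G. (\<forall>z\<in>U - K. G z = 0) \<longrightarrow> lift G t' = G (t'(1 := \<tau> t')))"
proof -
  define s0 where "s0 = t0 t"
  have zero: "\<phi>1 (t(1 := s0)) = 0" using crit[OF t] by (simp add: s0_def)
  have "open {s. t(1 := s) \<in> U}" by (rule open_line_preimage[OF open_U])
  moreover have "s0 \<in> {s. t(1 := s) \<in> U}" using t K_subset_U by (auto simp: s0_def)
  ultimately obtain \<epsilon> where \<epsilon>: "0 < \<epsilon>" "cball s0 \<epsilon> \<subseteq> {s. t(1 := s) \<in> U}" using open_contains_cball by blast
  define W where "W = (\<lambda>p :: (nat \<Rightarrow> real) \<times> real. (fst p)(1 := snd p)) -` U"
  have "open W" unfolding W_def by (rule open_vimage[OF open_U continuous_on_upd])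
  have "{t} \<times> cball s0 \<epsilon> \<subseteq> W" using \<epsilon>(2) by (auto simp: W_def)
  from Elementary_Topology.tube_lemma[OF compact_cball \<open>open W\<close> this]
  obtain N1 where N1: "t \<in> N1" "open N1" "N1 \<times> cball s0 \<epsilon> \<subseteq> W" by (elim exE conjE)
  have inU: "t'(1 := s) \<in> U" if "t' \<in> N1" "\<bar>s - s0\<bar> \<le> \<epsilon>" for t' s
  proof -
    have "(t', s) \<in> N1 \<times> cball s0 \<epsilon>" using that by (simp add: dist_real_def abs_minus_commute)
    then have "(t', s) \<in> W" by (rule subsetD[OF N1(3)])
    then show ?thesis by (simp add: W_def)
  qed
  obtain N2 where N2: "open N2" "t \<in> N2" "\<And>t'. t' \<in> N2 \<Longrightarrow> t'(1 := t0 t') \<in> K \<Longrightarrow> t(1 := t0 t) \<in> K \<and> \<bar>t0 t' - t0 t\<bar> < \<epsilon>"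
    by (rule near_or_empty[OF \<epsilon>(1), of t]) (rule that; simp)
  obtain N3 where N3: "open N3" "t \<in> N3" "\<And>t'. t' \<in> N3 \<Longrightarrow> \<phi>1 (t'(1 := s0 - \<epsilon>)) < 0 \<and> 0 < \<phi>1 (t'(1 := s0 + \<epsilon>))"
    by (rule sign_nhd[of \<epsilon> s0 t]) (use \<epsilon> inU N1 zero in auto)
  define N where "N = N1 \<inter> N2 \<inter> N3"
  define \<tau> where "\<tau> t' = (SOME s. \<bar>s - s0\<bar> < \<epsilon> \<and> \<phi>1 (t'(1 := s)) = 0)" for t'
  have \<tau>: "\<bar>\<tau> t' - s0\<bar> < \<epsilon> \<and> \<phi>1 (t'(1 := \<tau> t')) = 0" if "t' \<in> N" for t'
    unfolding \<tau>_def by (rule someI_ex, rule zero_between) (use \<epsilon> N3 that in \<open>auto simp: N_def\<close>)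
  have uni: "s = \<tau> t'" if "t' \<in> N" "\<bar>s - s0\<bar> < \<epsilon>" "\<phi>1 (t'(1 := s)) = 0" for t' s
  proof (rule ccontr)
    assume ne: "s \<noteq> \<tau> t'"
    have less: "\<phi>1 (t'(1 := p)) < \<phi>1 (t'(1 := q))" if "p < q" "\<bar>p - s0\<bar> < \<epsilon>" "\<bar>q - s0\<bar> < \<epsilon>" for p q
    proof (rule line_increasing[OF that(1)])
      fix s assume "p \<le> s" "s \<le> q"
      then have "\<bar>s - s0\<bar> \<le> \<epsilon>" using that by linarith
      moreover have "t' \<in> N1" using \<open>t' \<in> N\<close> by (simp add: N_def)
      ultimately show "t'(1 := s) \<in> U" by (intro inU)
    qed
    show False using less[of s "\<tau> t'"] less[of "\<tau> t'" s] ne that \<tau>[OF that(1)] by (cases "s < \<tau> t'") auto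
  qed
  have N0: "open N" "t \<in> N" using N1 N2 N3 by (auto simp: N_def)
  show ?thesis
  proof (rule exI[of _ \<epsilon>], rule exI[of _ N], rule exI[of _ \<tau>], intro conjI ballI allI impI N0 \<epsilon>(1))
    show "t'(1 := s) \<in> U" if "t' \<in> N" "\<bar>s - t0 t\<bar> \<le> \<epsilon>" for t' s
      using inU that by (auto simp: N_def s0_def)
    show "\<bar>\<tau> t' - t0 t\<bar> < \<epsilon>" if "t' \<in> N" for t' using \<tau>[OF that] by (simp add: s0_def)
    show "\<phi>1 (t'(1 := \<tau> t')) = 0" if "t' \<in> N" for t' using \<tau>[OF that] by simp
    show "\<exists>N'. open N' \<and> t \<in> N' \<and> (\<forall>t'\<in>N'. \<bar>\<tau> t' - t0 t\<bar> < e)" if e: "0 < e" for e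
    proof -
      define e' where "e' = min e \<epsilon>"
      have e': "0 < e'" "e' \<le> \<epsilon>" "e' \<le> e" using e \<epsilon> by (auto simp: e'_def)
      obtain M where M: "open M" "t \<in> M" "\<And>t'. t' \<in> M \<Longrightarrow> \<phi>1 (t'(1 := s0 - e')) < 0 \<and> 0 < \<phi>1 (t'(1 := s0 + e'))"
        by (rule sign_nhd[of e' s0 t]) (use e' inU N1 zero in auto)
      have "\<bar>\<tau> t' - s0\<bar> < e" if t': "t' \<in> M \<inter> N" for t'
      proof -
        obtain s where s: "\<bar>s - s0\<bar> < e'" "\<phi>1 (t'(1 := s)) = 0"
          using zero_between[OF e'(1)] M(3) t' by blast
        have "s = \<tau> t'" by (rule uni) (use s t' e' in auto)
        then show ?thesis using s e' by simp
      qed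
      then show ?thesis using M N0 by (intro exI[of _ "M \<inter> N"]) (auto simp: s0_def)
    qed
    show "lift G t' = G (t'(1 := \<tau> t'))" if t': "t' \<in> N" and G: "\<forall>z\<in>U - K. G z = 0" for t' G
    proof (cases "t'(1 := \<tau> t') \<in> K")
      case True
      then have "\<tau> t' = t0 t'" using uniq \<tau>[OF t'] by blast
      with True show ?thesis by (simp add: lift_def)
    next
      case False
      \<comment> \<open>If the given critical point were in \<open>K\<close>,
        \<open>near_or_empty\<close> would place it in the strip, where the only zero is \<tau> t',
        which is outside \<open>K\<close>.\<close>
      have "t'(1 := t0 t') \<notin> K"
      proof
        assume k: "t'(1 := t0 t') \<in> K"
        have "t' \<in> N2" using t' by (simp add: N_def)
        from N2(3)[OF this k] have "\<bar>t0 t' - s0\<bar> < \<epsilon>" by (simp add: s0_def)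
        from uni[OF t' this crit[OF k]] have "t0 t' = \<tau> t'" .
        with False show False using k by (metis (no_types))
      qed
      moreover have "t'(1 := \<tau> t') \<in> U"
        by (rule inU) (use \<tau>[OF t'] t' in \<open>auto simp: N_def\<close>)
      with False have "t'(1 := \<tau> t') \<in> U - K" by (rule DiffI[rotated])
      with G have "G (t'(1 := \<tau> t')) = 0" by (rule bspec)
      ultimately show ?thesis by (simp add: lift_def)
    qed
  qed
qed

lemma lift_zero_nhd:
  assumes "t(1 := t0 t) \<notin> K"
  shows "\<exists>N. open N \<and> t \<in> N \<and> (\<forall>t'\<in>N. \<forall>G. lift G t' = 0)"
proof (rule near_or_empty[of 1 t])
  fix N assume N: "open N" "t \<in> N"
    and near: "\<And>t'. t' \<in> N \<Longrightarrow> t'(1 := t0 t') \<in> K \<Longrightarrow> t(1 := t0 t) \<in> K \<and> \<bar>t0 t' - t0 t\<bar> < 1"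
  have "lift G t' = 0" if "t' \<in> N" for t' G
  proof -
    have "t'(1 := t0 t') \<notin> K" using near[OF that] assms by blast
    then show ?thesis by (simp add: lift_def)
  qed
  then show ?thesis using N by blast
qed simp

lemma continuous_on_lift:
  assumes G: "continuous_on U G" "\<And>z. z \<in> U - K \<Longrightarrow> G z = 0"
  shows "continuous_on UNIV (lift G)"
proof -
  have "(lift G \<longlongrightarrow> lift G t) (at t)" for t
  proof (rule tendstoI)
    fix e :: real assume e: "0 < e"
    show "\<forall>\<^sub>F t' in at t. dist (lift G t') (lift G t) < e"
    proof (cases "t(1 := t0 t) \<in> K")
      case False
      obtain N where N: "open N" "t \<in> N" "\<And>t' G. t' \<in> N \<Longrightarrow> lift G t' = 0"
        using lift_zero_nhd[OF False] by blast
      then show ?thesis unfolding eventually_at_topological using e by (intro exI[of _ N]) auto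
    next
      case True
      obtain \<epsilon> N \<tau> where N: "0 < \<epsilon>" "open N" "t \<in> N"
        and \<tau>0: "\<forall>t'\<in>N. \<bar>\<tau> t' - t0 t\<bar> < \<epsilon> \<and> \<phi>1 (t'(1 := \<tau> t')) = 0"
        and \<tau>: "\<forall>e>0. \<exists>N'. open N' \<and> t \<in> N' \<and> (\<forall>t'\<in>N'. \<bar>\<tau> t' - t0 t\<bar> < e)"
        and lift': "\<forall>t'\<in>N. \<forall>G. (\<forall>z\<in>U - K. G z = 0) \<longrightarrow> lift G t' = G (t'(1 := \<tau> t'))"
        using local_graph[OF True] by blast
      have lift: "lift G t' = G (t'(1 := \<tau> t'))" if "t' \<in> N" for t' using lift' that G by blast
      define z where "z = t(1 := t0 t)"
      have zU: "z \<in> U" using True K_subset_U by (auto simp: z_def)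
      have liftt: "lift G t = G z" using True by (simp add: lift_def z_def)
      define B where "B = G -` ball (G z) e \<inter> U"
      have "open B" unfolding B_def using G(1) continuous_on_open_vimage[OF open_U] by blast
      define W where "W = (\<lambda>p :: (nat \<Rightarrow> real) \<times> real. (fst p)(1 := snd p)) -` B"
      have "open W" unfolding W_def by (rule open_vimage[OF \<open>open B\<close> continuous_on_upd])
      moreover have "(t, t0 t) \<in> W" using zU e by (simp add: W_def B_def z_def)
      ultimately obtain P Q where PQ: "open P" "open Q" "(t, t0 t) \<in> P \<times> Q" "P \<times> Q \<subseteq> W" by (rule open_prod_elim)
      obtain r where r: "0 < r" "ball (t0 t) r \<subseteq> Q" using PQ openE by blast
      from \<tau>[rule_format, OF r(1)] obtain N' where N': "open N'" "t \<in> N'" "\<forall>t'\<in>N'. \<bar>\<tau> t' - t0 t\<bar> < r"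
        by (elim exE conjE)
      have "dist (lift G t') (lift G t) < e" if t': "t' \<in> N \<inter> N' \<inter> P" for t'
      proof -
        have "\<tau> t' \<in> ball (t0 t) r" using bspec[OF N'(3), of t'] t' by (simp add: dist_real_def abs_minus_commute)
        then have "\<tau> t' \<in> Q" by (rule subsetD[OF r(2)])
        then have "(t', \<tau> t') \<in> P \<times> Q" using t' by simp
        then have "(t', \<tau> t') \<in> W" by (rule subsetD[OF PQ(4)])
        then have "dist (G z) (G (t'(1 := \<tau> t'))) < e" by (simp add: W_def B_def)
        moreover have "lift G t' = G (t'(1 := \<tau> t'))" using lift t' by simp
        ultimately show ?thesis by (simp add: liftt dist_commute)
      qed
      moreover have "open (N \<inter> N' \<inter> P)" "t \<in> N \<inter> N' \<inter> P" using N N' PQ by auto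
      ultimately show ?thesis unfolding eventually_at_topological by (intro exI[of _ "N \<inter> N' \<inter> P"]) auto
    qed
  qed
  then show ?thesis by (simp add: continuous_on)
qed

text \<open>Chain rule along the local zero \<tau>, whose derivative in the i-th coordinate is minus
  the quotient of \<open>partial_deriv i \<phi>1\<close> and \<phi>11. The result is again a lift,
  of a function that vanishes on the open set \<open>U - K\<close> if G does, so the step can be
  iterated.\<close>

lemma lift_has_line_derivative:
  assumes G: "\<And>z. z \<in> U - K \<Longrightarrow> G z = 0" and i: "i \<in> I" "i \<noteq> 1"
    and di: "\<And>z. z \<in> U \<Longrightarrow> (\<lambda>s. G (z(i := s))) differentiable (at (z i))"
    and d1: "\<And>z. z \<in> U \<Longrightarrow> (\<lambda>s. G (z(1 := s))) differentiable (at (z 1))"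
    and c1: "continuous_on U (partial_deriv 1 G)"
  shows "((\<lambda>s. lift G (t(i := s))) has_vector_derivative
     lift (\<lambda>z. partial_deriv i G z - (partial_deriv i \<phi>1 z / \<phi>11 z) *\<^sub>R partial_deriv 1 G z) t) (at (t i))"
proof (cases "t(1 := t0 t) \<in> K")
  case False
  obtain N where N: "open N" "t \<in> N" "\<And>t' G. t' \<in> N \<Longrightarrow> lift G t' = 0"
        using lift_zero_nhd[OF False] by blast
  have "((\<lambda>s. lift G (t(i := s))) has_vector_derivative 0) (at (t i))"
    by (rule has_vector_derivative_transform_within_open[where S = "{s. t(i := s) \<in> N}" and f = "\<lambda>_. 0"])
      (use N open_line_preimage[OF N(1)] in auto)
  then show ?thesis using False by (simp add: lift_def)
next
  case True
  obtain \<epsilon> N \<tau> where N: "0 < \<epsilon>" "open N" "t \<in> N"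
    and \<tau>0: "\<forall>t'\<in>N. \<bar>\<tau> t' - t0 t\<bar> < \<epsilon> \<and> \<phi>1 (t'(1 := \<tau> t')) = 0"
    and \<tau>: "\<forall>e>0. \<exists>N'. open N' \<and> t \<in> N' \<and> (\<forall>t'\<in>N'. \<bar>\<tau> t' - t0 t\<bar> < e)"
    and lift': "\<forall>t'\<in>N. \<forall>G. (\<forall>z\<in>U - K. G z = 0) \<longrightarrow> lift G t' = G (t'(1 := \<tau> t'))"
    using local_graph[OF True] by blast
  have lift: "lift G t' = G (t'(1 := \<tau> t'))" if "t' \<in> N" for t' using lift' that G by blast
  define s0 where "s0 = t0 t"
  define u0 where "u0 = t i"
  define z where "z = t(1 := s0)"
  have tu0: "t(i := u0) = t" by (simp add: u0_def)
  define V where "V = {p :: real \<times> real. t(i := fst p, 1 := snd p) \<in> U}"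
  have cV: "continuous_on A (\<lambda>p :: real \<times> real. t(i := fst p, 1 := snd p))" for A
    by (intro continuous_on_fun_upd continuous_on_const continuous_on_fst continuous_on_snd continuous_on_id)
  have "V = (\<lambda>p :: real \<times> real. t(i := fst p, 1 := snd p)) -` U" by (auto simp: V_def)
  then have V: "open V" using open_vimage[OF open_U cV] by simp
  have zU: "z \<in> U" using True K_subset_U by (auto simp: z_def s0_def)
  have V0: "(u0, s0) \<in> V" using zU by (simp add: V_def tu0 z_def)
  define \<tau>i where "\<tau>i u = \<tau> (t(i := u))" for u
  have line: "\<exists>d>0. \<forall>u. \<bar>u - u0\<bar> < d \<longrightarrow> t(i := u) \<in> N'" if N': "open N'" "t \<in> N'" for N'
  proof -
    have "u0 \<in> {u. t(i := u) \<in> N'}" using N' tu0 by simp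
    then obtain d where d: "0 < d" "ball u0 d \<subseteq> {u. t(i := u) \<in> N'}" using openE[OF open_line_preimage[OF N'(1), of t i]] by blast
    have "t(i := u) \<in> N'" if "\<bar>u - u0\<bar> < d" for u
    proof -
      have "u \<in> ball u0 d" using that by (simp add: dist_real_def abs_minus_commute)
      from subsetD[OF d(2) this] show ?thesis by simp
    qed
    then show ?thesis using d(1) by blast
  qed
  have \<tau>c: "\<exists>d>0. \<forall>u. \<bar>u - u0\<bar> < d \<longrightarrow> \<bar>\<tau>i u - s0\<bar> < e" if e: "0 < e" for e
  proof -
    obtain N' where N': "open N'" "t \<in> N'" "\<forall>t'\<in>N'. \<bar>\<tau> t' - t0 t\<bar> < e" using \<tau> e by blast
    from line[OF N'(1,2)] obtain d where "0 < d" "\<forall>u. \<bar>u - u0\<bar> < d \<longrightarrow> t(i := u) \<in> N'" by blast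
    then show ?thesis using N'(3) by (intro exI[of _ d]) (auto simp: \<tau>i_def s0_def)
  qed
  obtain r where r: "0 < r" "\<And>u. \<bar>u - u0\<bar> < r \<Longrightarrow> t(i := u) \<in> N" using line[OF N(2,3)] by blast
  have tw: "t(i := u, 1 := s) = (t(1 := s))(i := u)" for u s using i by (simp add: fun_upd_twist)
  have "(\<tau>i has_vector_derivative - partial_deriv i \<phi>1 (t(i := u0, 1 := s0)) / \<phi>11 (t(i := u0, 1 := s0))) (at u0)"
  proof (rule implicit_derivative[OF V V0 _ _ \<tau>c _ _ _ r(1), where g = "\<lambda>u s. \<phi>1 (t(i := u, 1 := s))" and gs = "\<lambda>u s. \<phi>11 (t(i := u, 1 := s))"])
    show "((\<lambda>s. \<phi>1 (t(i := u, 1 := s))) has_vector_derivative \<phi>11 (t(i := u, 1 := s))) (at s)" for u s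
      by (rule smooth_fun_line[OF smooth1 one])
    show "continuous_on V (\<lambda>p. \<phi>11 (t(i := fst p, 1 := snd p)))"
      by (rule continuous_on_compose2[OF smooth_fun_continuous[OF smooth11] cV]) auto
    show "((\<lambda>u. \<phi>1 (t(i := u, 1 := s0))) has_vector_derivative partial_deriv i \<phi>1 (t(i := u0, 1 := s0))) (at u0)"
      unfolding tw by (rule smooth_fun_line[OF smooth1 i(1)])
    show "0 < \<phi>11 (t(i := u0, 1 := s0))" using V0 by (simp add: V_def U_def)
    show "\<phi>1 (t(i := u0, 1 := s0)) = 0" using crit[OF True] by (simp add: tu0 s0_def)
    show "\<phi>1 (t(i := u, 1 := \<tau>i u)) = 0" if "\<bar>u - u0\<bar> < r" for u
      using \<tau>0 r(2)[OF that] by (simp add: \<tau>i_def)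
  qed
  then have \<tau>': "(\<tau>i has_vector_derivative - (partial_deriv i \<phi>1 z / \<phi>11 z)) (at u0)"
    by (simp add: tu0 z_def)
  have \<tau>i0: "\<tau>i u0 = s0"
  proof (rule ccontr)
    assume ne: "\<tau>i u0 \<noteq> s0"
    then obtain d where "0 < d" "\<forall>u. \<bar>u - u0\<bar> < d \<longrightarrow> \<bar>\<tau>i u - s0\<bar> < \<bar>\<tau>i u0 - s0\<bar>" using \<tau>c[of "\<bar>\<tau>i u0 - s0\<bar>"] by auto
    then show False by force
  qed
  have "((\<lambda>u. G (t(i := u, 1 := \<tau>i u))) has_vector_derivative
      partial_deriv i G z + (- (partial_deriv i \<phi>1 z / \<phi>11 z)) *\<^sub>R partial_deriv 1 G (t(i := u0, 1 := s0))) (at u0)"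
  proof (rule chain_two_variables[OF V V0, where g = "\<lambda>u s. G (t(i := u, 1 := s))" and gs = "\<lambda>u s. partial_deriv 1 G (t(i := u, 1 := s))", OF _ _ \<tau>i0 \<tau>'])
    show "((\<lambda>s. G (t(i := u, 1 := s))) has_vector_derivative partial_deriv 1 G (t(i := u, 1 := s))) (at s)" if "(u, s) \<in> V" for u s
    proof -
      have z: "t(i := u, 1 := s) \<in> U" using that by (simp add: V_def)
      show ?thesis by (rule partial_deriv_line, rule d1, rule z)
    qed
    show "continuous_on V (\<lambda>p. partial_deriv 1 G (t(i := fst p, 1 := snd p)))"
      by (rule continuous_on_compose2[OF c1 cV]) (auto simp: V_def)
    have "((\<lambda>u. G (z(i := u))) has_vector_derivative partial_deriv i G z) (at (z i))"
      by (rule partial_derivD, rule di, rule zU)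
    then show "((\<lambda>u. G (t(i := u, 1 := s0))) has_vector_derivative partial_deriv i G z) (at u0)"
      using i unfolding tw by (simp add: z_def u0_def)
  qed
  then have "((\<lambda>u. G (t(i := u, 1 := \<tau>i u))) has_vector_derivative
      partial_deriv i G z - (partial_deriv i \<phi>1 z / \<phi>11 z) *\<^sub>R partial_deriv 1 G z) (at u0)"
    by (simp add: tu0 z_def)
  then have "((\<lambda>u. lift G (t(i := u))) has_vector_derivative
      partial_deriv i G z - (partial_deriv i \<phi>1 z / \<phi>11 z) *\<^sub>R partial_deriv 1 G z) (at u0)"
    by (rule has_vector_derivative_transform_within_open[where S = "{u. t(i := u) \<in> N}"])
      (use open_line_preimage[OF N(2)] N(3) tu0 lift in \<open>auto simp: \<tau>i_def\<close>)
  then show ?thesis using True by (simp add: lift_def z_def s0_def u0_def)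
qed

end

lemma foldr_partial_deriv_zero_on_open:
  assumes "open A" "\<And>t. t \<in> A \<Longrightarrow> f t = 0"
  shows "t \<in> A \<Longrightarrow> foldr partial_deriv ks f t = 0"
proof (induction ks arbitrary: t)
  case Nil
  then show ?case using assms by simp
next
  case (Cons k ks)
  have "((\<lambda>s. foldr partial_deriv ks f (t(k := s))) has_vector_derivative 0) (at (t k))"
    by (rule has_vector_derivative_transform_within_open[OF _ open_line_preimage[OF assms(1), of t k], where f = "\<lambda>_. 0"])
      (use Cons in auto)
  then show ?case by (simp add: partial_derivI)
qed

lemma foldr_partial_deriv_linear:
  assumes "smooth_fun I f" "bounded_linear g" "ks \<in> lists I"
  shows "foldr partial_deriv ks (\<lambda>t. g (f t)) = (\<lambda>t. g (foldr partial_deriv ks f t))"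
  using assms(3)
proof (induction ks)
  case (Cons k ks)
  have "partial_deriv k (\<lambda>t. g (foldr partial_deriv ks f t)) t = g (partial_deriv k (foldr partial_deriv ks f) t)" for t
    using bounded_linear.has_vector_derivative[OF assms(2) smooth_fun_line[OF smooth_fun_foldr[OF assms(1)], of ks k t "t k"]] Cons
    by (intro partial_derivI) simp
  then have "partial_deriv k (\<lambda>t. g (foldr partial_deriv ks f t)) = (\<lambda>t. g (partial_deriv k (foldr partial_deriv ks f) t))" by (rule ext)
  then show ?case using Cons by simp
qed simp

lemma smooth_fun_linear:
  assumes "smooth_fun I f" "bounded_linear g"
  shows "smooth_fun I (\<lambda>t. g (f t))"
  unfolding smooth_fun_def
proof (intro conjI ballI allI)
  show "depends_only_on I (\<lambda>t. g (f t))"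
    using assms(1) unfolding smooth_fun_def depends_only_on_def by metis
  fix ks assume ks: "ks \<in> lists I"
  have s: "smooth_fun I (foldr partial_deriv ks f)" by (rule smooth_fun_foldr[OF assms(1) ks])
  show "continuous_on UNIV (foldr partial_deriv ks (\<lambda>t. g (f t)))"
    unfolding foldr_partial_deriv_linear[OF assms ks]
    by (rule bounded_linear.continuous_on[OF assms(2) smooth_fun_continuous[OF s]])
  fix i x assume i: "i \<in> I"
  have "((\<lambda>s. g (foldr partial_deriv ks f (x(i := s)))) has_vector_derivative g (partial_deriv i (foldr partial_deriv ks f) (x(i := x i)))) (at (x i))"
    by (rule bounded_linear.has_vector_derivative[OF assms(2) smooth_fun_line[OF s i]])
  then show "(\<lambda>s. foldr partial_deriv ks (\<lambda>t. g (f t)) (x(i := s))) differentiable at (x i)"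
    unfolding foldr_partial_deriv_linear[OF assms ks] by (rule differentiableI_vector)
qed

text \<open>Overwriting the coordinates outside \<open>I\<close> by those of y is continuous and
  leaves the values of f unchanged, so it maps the closure of the set of nonzeros into
  itself.\<close>

lemma fun_support_depends_only:
  assumes "depends_only_on I f" "\<forall>i\<in>I. x i = y i" "x \<in> fun_support f"
  shows "y \<in> fun_support f"
proof -
  define p where "p z = (\<lambda>k. if k \<in> I then z k else y k)" for z :: "nat \<Rightarrow> real"
  have "continuous_on UNIV p"
  proof (rule continuous_on_coordinatewise_then_product)
    show "continuous_on UNIV (\<lambda>z. p z i)" for i
      by (cases "i \<in> I") (auto simp: p_def intro: continuous_on_product_coordinates)
  qed
  then have "p ` closure {z. f z \<noteq> 0} \<subseteq> closure (fun_support f)"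
  proof (intro image_closure_subset)
    have "f (p z) = f z" for z
      using assms(1)[unfolded depends_only_on_def, rule_format, of "p z" z] by (simp add: p_def)
    then show "p ` {z. f z \<noteq> 0} \<subseteq> closure (fun_support f)"
      unfolding fun_support_def by (auto intro: closure_subset[THEN subsetD])
  qed (auto intro: continuous_on_subset)
  moreover have "p x = y" using assms(2) by (auto simp: p_def)
  ultimately show ?thesis using assms(3) by (auto simp: fun_support_def)
qed

lemma eq_0_off_support: "t \<notin> fun_support f \<Longrightarrow> f t = 0"
  unfolding fun_support_def using subsetD[OF closure_subset, of t "{x. f x \<noteq> 0}"] by auto

lemma foldr_partial_deriv_off_support: "t \<notin> fun_support f \<Longrightarrow> foldr partial_deriv ks f t = 0"
proof (rule foldr_partial_deriv_zero_on_open[where A = "- fun_support f"])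
  show "open (- fun_support f)" unfolding fun_support_def by (intro open_Compl closed_closure)
  show "f t = 0" if "t \<in> - fun_support f" for t by (rule eq_0_off_support) (use that in simp)
qed simp

declare foldr_replicate [simp del]

lemma phase_data_1dD:
  assumes "phase_data_1d A B c \<alpha> \<beta> h v K X"
  shows "K \<subseteq> {\<alpha>..\<beta>}" "(h n has_vector_derivative h (Suc n) x) (at x)" "(v n has_vector_derivative v (Suc n) x) (at x)"
  using assms unfolding phase_data_1d_def has_real_derivative_iff_has_vector_derivative by auto

section \<open>Stationary phase with parameters\<close>

text \<open>The problem in normalised form: \<open>L\<close> holds the lengths Z, X_2, ..., X_d, and
  \<kappa> is a parameter tied to Y by an equation instead of a root. The constants \<open>A\<close>
  and \<open>B\<close> are indexed by lists of variables. The weight is bounded everywhere, the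
  phase on the support of the weight only.\<close>

locale phase_family =
  fixes I :: "nat set" and F :: "'k set" and X Y \<kappa> :: "'k \<Rightarrow> real" and L :: "'k \<Rightarrow> nat \<Rightarrow> real"
    and w :: "'k \<Rightarrow> (nat \<Rightarrow> real) \<Rightarrow> complex" and \<phi> :: "'k \<Rightarrow> (nat \<Rightarrow> real) \<Rightarrow> real" and t0 :: "'k \<Rightarrow> (nat \<Rightarrow> real) \<Rightarrow> real"
    and A B :: "nat list \<Rightarrow> real" and \<alpha> \<beta> c :: real
  assumes finite_I: "finite I" and one: "1 \<in> I" and params: "\<alpha> \<le> \<beta>" "0 < c" "c \<le> 1" "\<And>ks. 1 \<le> A ks" "\<And>ks. 1 \<le> B ks"
    and X: "T \<in> F \<Longrightarrow> 1 \<le> X T" and \<kappa>: "T \<in> F \<Longrightarrow> 1 \<le> \<kappa> T" and Y: "T \<in> F \<Longrightarrow> Y T = (X T * \<kappa> T ^ 6)\<^sup>2"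
    and L: "T \<in> F \<Longrightarrow> i \<in> I \<Longrightarrow> 0 < L T i"
    and w_smooth: "T \<in> F \<Longrightarrow> smooth_fun I (w T)" and \<phi>_smooth: "T \<in> F \<Longrightarrow> smooth_fun I (\<phi> T)"
    and w_bound: "T \<in> F \<Longrightarrow> ks \<in> lists I \<Longrightarrow> prod_list (map (L T) ks) * norm (foldr partial_deriv ks (w T) t) \<le> A ks * X T ^ length ks"
    and \<phi>_bound: "T \<in> F \<Longrightarrow> ks \<in> lists I \<Longrightarrow> t \<in> fun_support (w T) \<Longrightarrow> prod_list (map (L T) ks) * \<bar>foldr partial_deriv ks (\<phi> T) t\<bar> \<le> B ks * Y T"
    and supp: "T \<in> F \<Longrightarrow> t \<in> fun_support (w T) \<Longrightarrow> \<alpha> * L T 1 \<le> t 1 \<and> t 1 \<le> \<beta> * L T 1"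
    and convex: "T \<in> F \<Longrightarrow> t \<in> fun_support (w T) \<Longrightarrow> c * Y T \<le> L T 1 ^ 2 * partial_deriv 1 (partial_deriv 1 (\<phi> T)) t"
    and crit: "T \<in> F \<Longrightarrow> t(1 := s) \<in> fun_support (w T) \<Longrightarrow> partial_deriv 1 (\<phi> T) (t(1 := t0 T t)) = 0"
    and uniq: "T \<in> F \<Longrightarrow> t(1 := s) \<in> fun_support (w T) \<Longrightarrow> partial_deriv 1 (\<phi> T) (t(1 := s)) = 0 \<Longrightarrow> s = t0 T t"
    and t0_depends: "T \<in> F \<Longrightarrow> depends_only_on (I - {1}) (t0 T)"
begin

abbreviation "K T \<equiv> fun_support (w T)"

definition H :: "'k \<Rightarrow> nat \<Rightarrow> (nat \<Rightarrow> real) \<Rightarrow> real" where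
  "H T j t = L T 1 ^ j * foldr partial_deriv (replicate j 1) (\<phi> T) t / Y T"

definition V :: "'k \<Rightarrow> nat \<Rightarrow> (nat \<Rightarrow> real) \<Rightarrow> complex" where
  "V T j t = of_real (L T 1 ^ j) * foldr partial_deriv (replicate j 1) (w T) t"

definition y :: "'k \<Rightarrow> real" where "y T = X T * \<kappa> T ^ 6"

definition coef :: "(nat \<Rightarrow> complex) \<Rightarrow> nat \<Rightarrow> 'k \<Rightarrow> (nat \<Rightarrow> real) \<Rightarrow> complex" where
  "coef m n T t = stationary_term m (y T) (\<lambda>j. H T j t) (\<lambda>j. V T j t) n"

text \<open>The same function as \<open>lift\<close> of \<open>critical_graph\<close>, in a form
  that makes sense before T is known to belong to the family.\<close>

definition lft :: "'k \<Rightarrow> ((nat \<Rightarrow> real) \<Rightarrow> complex) \<Rightarrow> (nat \<Rightarrow> real) \<Rightarrow> complex" where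
  "lft T G t = (if t(1 := t0 T t) \<in> K T then G (t(1 := t0 T t)) else 0)"

lemma Y_pos: "T \<in> F \<Longrightarrow> 0 < Y T" and y_ge_1: "T \<in> F \<Longrightarrow> 1 \<le> y T" and y_sq: "T \<in> F \<Longrightarrow> (y T)\<^sup>2 = Y T"
  and y_pos: "T \<in> F \<Longrightarrow> 0 < y T"
proof -
  assume T: "T \<in> F"
  note ps = phase_scale[OF X[OF T] \<kappa>[OF T] y_def]
  show "1 \<le> y T" by (rule ps(2))
  show "(y T)\<^sup>2 = Y T" using Y[OF T] by (simp add: y_def)
  show "0 < y T" by (rule ps(1))
  show "0 < Y T" using zero_less_power[OF ps(1), of 2] Y[OF T] by (simp only: y_def)
qed

lemma L1: "T \<in> F \<Longrightarrow> 0 < L T 1"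
  using L one by blast

lemma replicate_in_lists: "replicate j 1 \<in> lists I"
  using one by auto

lemma prod_list_replicate1: "prod_list (map f (replicate j 1)) = f (1::nat) ^ j" for f :: "nat \<Rightarrow> real"
  by (induction j) auto

text \<open>The substitution t_1 = L x reduces the fibre over t to the one-dimensional setting, with
  bounds that depend on neither T nor t.\<close>

lemma phase_data:
  assumes T: "T \<in> F"
  shows "phase_data_1d (\<lambda>j. A (replicate j 1)) (\<lambda>j. B (replicate j 1)) c \<alpha> \<beta>
     (\<lambda>j x. H T j (t(1 := L T 1 * x))) (\<lambda>j x. V T j (t(1 := L T 1 * x))) {x. t(1 := L T 1 * x) \<in> K T} (X T)"
proof -
  have lin: "((\<lambda>x. L T 1 * x) has_vector_derivative L T 1) (at x)" for x
    unfolding has_real_derivative_iff_has_vector_derivative[symmetric] by (rule derivative_eq_intros refl | simp)+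
  have "continuous_on UNIV (\<lambda>x. t(1 := L T 1 * x))"
    by (rule continuous_on_fun_upd[OF continuous_on_const]) (intro continuous_intros)
  then have "closed ((\<lambda>x. t(1 := L T 1 * x)) -` K T)"
    by (intro closed_vimage) (auto simp: fun_support_def)
  then have p1: "closed {x. t(1 := L T 1 * x) \<in> K T}" by (simp add: vimage_def)
  have p2: "{x. t(1 := L T 1 * x) \<in> K T} \<subseteq> {\<alpha>..\<beta>}"
    using supp[OF T] L1[OF T] by (fastforce simp: mult.commute)
  have p: "((\<lambda>s. foldr partial_deriv (replicate n 1) (\<phi> T) (t(1 := s))) has_vector_derivative
      foldr partial_deriv (replicate (Suc n) 1) (\<phi> T) (t(1 := s0))) (at s0)" for s0 n
    using smooth_fun_line[OF smooth_fun_foldr[OF \<phi>_smooth[OF T] replicate_in_lists] one] by simp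
  have "((\<lambda>x. L T 1 ^ n / Y T * foldr partial_deriv (replicate n 1) (\<phi> T) (t(1 := L T 1 * x))) has_vector_derivative
      L T 1 ^ n / Y T * (L T 1 *\<^sub>R foldr partial_deriv (replicate (Suc n) 1) (\<phi> T) (t(1 := L T 1 * x)))) (at x)" for x n
    using vector_diff_chain_at[OF lin p] unfolding o_def by (intro has_vector_derivative_mult_right)
  then have p3: "((\<lambda>x. H T n (t(1 := L T 1 * x))) has_real_derivative H T (Suc n) (t(1 := L T 1 * x))) (at x)" for x n
    unfolding has_real_derivative_iff_has_vector_derivative H_def by (simp add: mult_ac)
  have q: "((\<lambda>s. foldr partial_deriv (replicate n 1) (w T) (t(1 := s))) has_vector_derivative
      foldr partial_deriv (replicate (Suc n) 1) (w T) (t(1 := s0))) (at s0)" for s0 n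
    using smooth_fun_line[OF smooth_fun_foldr[OF w_smooth[OF T] replicate_in_lists] one] by simp
  have "((\<lambda>x. of_real (L T 1 ^ n) * foldr partial_deriv (replicate n 1) (w T) (t(1 := L T 1 * x))) has_vector_derivative
      of_real (L T 1 ^ n) * (L T 1 *\<^sub>R foldr partial_deriv (replicate (Suc n) 1) (w T) (t(1 := L T 1 * x)))) (at x)" for x n
    using vector_diff_chain_at[OF lin q] unfolding o_def by (intro has_vector_derivative_mult_right)
  then have p4: "((\<lambda>x. V T n (t(1 := L T 1 * x))) has_vector_derivative V T (Suc n) (t(1 := L T 1 * x))) (at x)" for x n
    unfolding V_def by (simp add: scaleR_conv_of_real mult_ac)
  have p5: "norm (V T n (t(1 := L T 1 * x))) \<le> A (replicate n 1) * X T ^ n" for x n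
    using w_bound[OF T replicate_in_lists, of n] L1[OF T] by (simp add: V_def norm_mult norm_power prod_list_replicate1)
  have p6: "V T n (t(1 := L T 1 * x)) = 0" if "x \<notin> {x. t(1 := L T 1 * x) \<in> K T}" for x n
  proof -
    have "foldr partial_deriv (replicate n 1) (w T) (t(1 := L T 1 * x)) = 0"
      by (rule foldr_partial_deriv_off_support) (use that in simp)
    then show ?thesis by (simp only: V_def mult_zero_right)
  qed
  have p7: "\<bar>H T j (t(1 := L T 1 * x))\<bar> \<le> B (replicate j 1)" if x: "x \<in> {x. t(1 := L T 1 * x) \<in> K T}" for x j
    using \<phi>_bound[OF T replicate_in_lists, of _ j] x L1[OF T] Y_pos[OF T]
    by (simp add: H_def abs_mult prod_list_replicate1 divide_le_eq)
  have p8: "c \<le> H T 2 (t(1 := L T 1 * x))" if x: "x \<in> {x. t(1 := L T 1 * x) \<in> K T}" for x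
    using convex[OF T, of "t(1 := L T 1 * x)"] x Y_pos[OF T] by (simp add: H_def numeral_2_eq_2 le_divide_eq)
  show ?thesis
    unfolding phase_data_1d_def
    by (intro conjI allI ballI impI; rule X[OF T] p1 p2 p3 p4 p5 p6 p7 p8; assumption)
qed

lemma integral_rescaled:
  assumes T: "T \<in> F"
  shows "(LINT s|lborel. exp (\<i> * complex_of_real (\<phi> T (t(1 := s)))) * w T (t(1 := s))) =
     of_real (L T 1) * integral {\<alpha>-1..\<beta>+1} (\<lambda>x. exp (\<i> * of_real ((y T)\<^sup>2 * H T 0 (t(1 := L T 1 * x)))) * V T 0 (t(1 := L T 1 * x)))"
proof -
  note D = phase_data_1dD[OF phase_data[OF T, of t]]
  define f where "f s = exp (\<i> * complex_of_real (\<phi> T (t(1 := s)))) * w T (t(1 := s))" for s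
  have f: "f (0 + L T 1 * x) = exp (\<i> * of_real ((y T)\<^sup>2 * H T 0 (t(1 := L T 1 * x)))) * V T 0 (t(1 := L T 1 * x))" for x
  proof -
    have "(y T)\<^sup>2 * H T 0 (t(1 := L T 1 * x)) = \<phi> T (t(1 := L T 1 * x))"
      using Y_pos[OF T] unfolding y_sq[OF T] H_def by simp
    moreover have "V T 0 (t(1 := L T 1 * x)) = w T (t(1 := L T 1 * x))" by (simp add: V_def)
    ultimately show ?thesis unfolding f_def by simp
  qed
  have "L T 1 \<noteq> 0" using L1[OF T] by simp
  from lborel_integral_real_affine[OF this, of f 0]
  have "(LINT s|lborel. f s) = of_real (L T 1) * (LINT x|lborel. f (0 + L T 1 * x))"
    unfolding scaleR_conv_of_real abs_of_pos[OF L1[OF T]] .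
  also have "(LINT x|lborel. f (0 + L T 1 * x)) = integral {\<alpha>-1..\<beta>+1} (\<lambda>x. f (0 + L T 1 * x))"
  proof (rule lborel_integral_eq_integral_interval)
    have "continuous_on UNIV (\<lambda>x. H T 0 (t(1 := L T 1 * x)))" "continuous_on UNIV (\<lambda>x. V T 0 (t(1 := L T 1 * x)))"
    proof -
      have "((\<lambda>x. H T 0 (t(1 := L T 1 * x))) has_vector_derivative H T (Suc 0) (t(1 := L T 1 * x))) (at x)" for x
        by (rule D(2))
      then show "continuous_on UNIV (\<lambda>x. H T 0 (t(1 := L T 1 * x)))" by (rule deriv_family_continuous)
      have "((\<lambda>x. V T 0 (t(1 := L T 1 * x))) has_vector_derivative V T (Suc 0) (t(1 := L T 1 * x))) (at x)" for x
        by (rule D(3))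
      then show "continuous_on UNIV (\<lambda>x. V T 0 (t(1 := L T 1 * x)))" by (rule deriv_family_continuous)
    qed
    then show "continuous_on UNIV (\<lambda>x. f (0 + L T 1 * x))" unfolding f by (intro continuous_intros)
    fix x assume "x \<notin> {\<alpha>-1..\<beta>+1}"
    moreover have "{x. t(1 := L T 1 * x) \<in> K T} \<subseteq> {\<alpha>..\<beta>}" by (rule D(1))
    ultimately have "t(1 := L T 1 * x) \<notin> K T" by fastforce
    then have "w T (t(1 := L T 1 * x)) = 0" by (rule eq_0_off_support)
    then show "f (0 + L T 1 * x) = 0" unfolding f by (simp add: V_def)
  qed
  finally show ?thesis unfolding f unfolding f_def .
qed

end

section \<open>Expansion of the fibre integral\<close>

text \<open>Names the conclusion of \<open>stationary_phase_1d\<close>, so that the moments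
  \<open>m\<close> can be quantified outside all bounds and orders.\<close>

definition has_expansion ::
  "(nat \<Rightarrow> complex) \<Rightarrow> (nat \<Rightarrow> real) \<Rightarrow> (nat \<Rightarrow> real) \<Rightarrow> real \<Rightarrow> real \<Rightarrow> real \<Rightarrow> nat \<Rightarrow> real \<Rightarrow> bool" where
  "has_expansion m A B c \<alpha> \<beta> N C \<longleftrightarrow> (\<forall>h v K X \<kappa> y x0. phase_data_1d A B c \<alpha> \<beta> h v K X \<longrightarrow> 1 \<le> \<kappa> \<longrightarrow> y = X * \<kappa> ^ 6 \<longrightarrow>
     x0 \<in> K \<longrightarrow> h 1 x0 = 0 \<longrightarrow> (\<forall>x\<in>K. h 1 x = 0 \<longrightarrow> x = x0) \<longrightarrow>
     norm (integral {\<alpha>-1..\<beta>+1} (\<lambda>x. exp (\<i> * of_real (y\<^sup>2 * h 0 x)) * v 0 x) -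
       exp (\<i> * of_real (y\<^sup>2 * h 0 x0)) / of_real y * (\<Sum>n<N. stationary_term m y (\<lambda>j. h j x0) (\<lambda>j. v j x0) n)) \<le> C / \<kappa> ^ N)"

lemma has_expansionD:
  assumes "has_expansion m A B c \<alpha> \<beta> N C" "phase_data_1d A B c \<alpha> \<beta> h v K X" "1 \<le> \<kappa>" "y = X * \<kappa> ^ 6"
    "x0 \<in> K" "h 1 x0 = 0" "\<And>x. x \<in> K \<Longrightarrow> h 1 x = 0 \<Longrightarrow> x = x0"
  shows "norm (integral {\<alpha>-1..\<beta>+1} (\<lambda>x. exp (\<i> * of_real (y\<^sup>2 * h 0 x)) * v 0 x) -
       exp (\<i> * of_real (y\<^sup>2 * h 0 x0)) / of_real y * (\<Sum>n<N. stationary_term m y (\<lambda>j. h j x0) (\<lambda>j. v j x0) n)) \<le> C / \<kappa> ^ N"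
  using assms unfolding has_expansion_def by blast

lemma ex_expansion:
  "\<exists>m. \<forall>A B c \<alpha> \<beta> N. (\<forall>j. 1 \<le> A j) \<longrightarrow> (\<forall>j. 1 \<le> B j) \<longrightarrow> 0 < c \<longrightarrow> c \<le> 1 \<longrightarrow> \<alpha> \<le> \<beta> \<longrightarrow>
     (\<exists>C\<ge>0. has_expansion m A B c \<alpha> \<beta> N C)"
proof (rule stationary_phase_1d, fold has_expansion_def)
  fix m
  assume m: "\<And>(A :: nat \<Rightarrow> real) (B :: nat \<Rightarrow> real) c \<alpha> \<beta> N. (\<And>j. 1 \<le> A j) \<Longrightarrow> (\<And>j. 1 \<le> B j) \<Longrightarrow> 0 < c \<Longrightarrow> c \<le> 1 \<Longrightarrow> \<alpha> \<le> \<beta> \<Longrightarrow>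
    \<exists>C\<ge>0. has_expansion m A B c \<alpha> \<beta> N C"
  show ?thesis by (intro exI[of _ m] allI impI m) auto
qed

context phase_family
begin

text \<open>Over fibres whose critical point lies in \<open>K\<close> this is the one-dimensional
  expansion. Over the others h' has no zero in \<open>K\<close>: the integral is negligible, and the
  lifted terms are 0 by extension.\<close>

lemma expansion:
  obtains m where "\<And>N. \<exists>E\<ge>0. \<forall>T\<in>F. \<forall>t.
     norm ((LINT s|lborel. exp (\<i> * complex_of_real (\<phi> T (t(1 := s)))) * w T (t(1 := s)))
        - complex_of_real (L T 1 / y T) * exp (\<i> * complex_of_real (\<phi> T (t(1 := t0 T t)))) * (\<Sum>n<N. lft T (coef m n T) t))
     \<le> E * L T 1 / \<kappa> T ^ N"
proof -
  obtain m where m: "\<forall>A B c \<alpha> \<beta> N. (\<forall>j. 1 \<le> A j) \<longrightarrow> (\<forall>j. 1 \<le> B j) \<longrightarrow> 0 < c \<longrightarrow> c \<le> 1 \<longrightarrow> \<alpha> \<le> \<beta> \<longrightarrow>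
     (\<exists>C\<ge>0. has_expansion m A B c \<alpha> \<beta> N C)"
    using ex_expansion ..
  show thesis
  proof (rule that[of m])
    fix N
    let ?A = "\<lambda>j. A (replicate j 1)" and ?B = "\<lambda>j. B (replicate j 1)"
    have A1: "\<And>j. 1 \<le> ?A j" and B1: "\<And>j. 1 \<le> ?B j" using params by auto
    then have "\<exists>C\<ge>0. has_expansion m ?A ?B c \<alpha> \<beta> N C" using m params(1,2,3) by auto
    then obtain C1 where C1: "0 \<le> C1" and st: "has_expansion m ?A ?B c \<alpha> \<beta> N C1" by auto
    have "\<exists>C\<ge>1. \<forall>h v K X Y. phase_data_1d ?A ?B c \<alpha> \<beta> h v K X \<longrightarrow> 0 < Y \<longrightarrow> (\<forall>x\<in>K. h 1 x \<noteq> 0) \<longrightarrow>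
      norm (integral {\<alpha>-1..\<beta>+1} (\<lambda>x. exp (\<i> * of_real (Y * h 0 x)) * v 0 x)) \<le> C * (X\<^sup>2 / Y) ^ N"
      by (rule phase_integral_without_stationary_point[where A = ?A and B = ?B, OF A1 B1 params(2,3,1)])
    then obtain C2 where C2: "1 \<le> C2" and ns: "\<forall>h v K X Y. phase_data_1d ?A ?B c \<alpha> \<beta> h v K X \<longrightarrow> 0 < Y \<longrightarrow> (\<forall>x\<in>K. h 1 x \<noteq> 0) \<longrightarrow>
      norm (integral {\<alpha>-1..\<beta>+1} (\<lambda>x. exp (\<i> * of_real (Y * h 0 x)) * v 0 x)) \<le> C2 * (X\<^sup>2 / Y) ^ N"
      by (elim exE conjE)
    show "\<exists>E\<ge>0. \<forall>T\<in>F. \<forall>t.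
     norm ((LINT s|lborel. exp (\<i> * complex_of_real (\<phi> T (t(1 := s)))) * w T (t(1 := s)))
        - complex_of_real (L T 1 / y T) * exp (\<i> * complex_of_real (\<phi> T (t(1 := t0 T t)))) * (\<Sum>n<N. lft T (coef m n T) t))
     \<le> E * L T 1 / \<kappa> T ^ N"
    proof (intro exI[of _ "C1 + C2"] conjI ballI allI)
      show "0 \<le> C1 + C2" using C1 C2 by simp
      fix T t assume T: "T \<in> F"
      define J where "J = integral {\<alpha>-1..\<beta>+1} (\<lambda>x. exp (\<i> * of_real ((y T)\<^sup>2 * H T 0 (t(1 := L T 1 * x)))) * V T 0 (t(1 := L T 1 * x)))"
      define S where "S = exp (\<i> * complex_of_real (\<phi> T (t(1 := t0 T t)))) / of_real (y T) * (\<Sum>n<N. lft T (coef m n T) t)"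
      have h1: "H T 1 (t(1 := L T 1 * x)) = 0 \<longleftrightarrow> partial_deriv 1 (\<phi> T) (t(1 := L T 1 * x)) = 0" for x
        using L1[OF T] Y_pos[OF T] by (simp add: H_def)
      have kp: "0 < \<kappa> T ^ N" using \<kappa>[OF T] by simp
      have "norm (J - S) \<le> (C1 + C2) / \<kappa> T ^ N"
      proof (cases "t(1 := t0 T t) \<in> K T")
        case True
        define x0 where "x0 = t0 T t / L T 1"
        have x0: "L T 1 * x0 = t0 T t" using L1[OF T] by (simp add: x0_def)
        have "norm (J - exp (\<i> * of_real ((y T)\<^sup>2 * H T 0 (t(1 := L T 1 * x0)))) / of_real (y T) *
           (\<Sum>n<N. stationary_term m (y T) (\<lambda>j. H T j (t(1 := L T 1 * x0))) (\<lambda>j. V T j (t(1 := L T 1 * x0))) n)) \<le> C1 / \<kappa> T ^ N"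
          unfolding J_def
        proof (rule has_expansionD[OF st phase_data[OF T] \<kappa>[OF T] y_def])
          show "x0 \<in> {x. t(1 := L T 1 * x) \<in> K T}" unfolding mem_Collect_eq x0 by (rule True)
          have "partial_deriv 1 (\<phi> T) (t(1 := L T 1 * x0)) = 0" unfolding x0 by (rule crit[OF T True])
          then show "H T 1 (t(1 := L T 1 * x0)) = 0" by (rule h1[THEN iffD2])
          show "x = x0" if "x \<in> {x. t(1 := L T 1 * x) \<in> K T}" "H T 1 (t(1 := L T 1 * x)) = 0" for x
          proof -
            have "L T 1 * x = t0 T t" using that unfolding h1 using uniq[OF T, of t "L T 1 * x"] by blast
            then show "x = x0" using L1[OF T] by (simp add: x0_def field_simps)
          qed
        qed
        moreover have "(y T)\<^sup>2 * H T 0 (t(1 := L T 1 * x0)) = \<phi> T (t(1 := t0 T t))"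
          unfolding x0 H_def y_sq[OF T] using Y_pos[OF T] by simp
        moreover have "lft T (coef m n T) t = stationary_term m (y T) (\<lambda>j. H T j (t(1 := L T 1 * x0))) (\<lambda>j. V T j (t(1 := L T 1 * x0))) n" for n
          using True unfolding x0 lft_def coef_def by simp
        ultimately have "norm (J - S) \<le> C1 / \<kappa> T ^ N" unfolding S_def by (simp only:)
        also have "\<dots> \<le> (C1 + C2) / \<kappa> T ^ N" using C2 kp by (intro divide_right_mono) auto
        finally show ?thesis .
      next
        case False
        have "norm J \<le> C2 * ((X T)\<^sup>2 / (y T)\<^sup>2) ^ N"
          unfolding J_def
        proof (rule ns[rule_format, OF phase_data[OF T]])
          show "0 < (y T)\<^sup>2" using y_pos[OF T] by simp
          show "H T 1 (t(1 := L T 1 * x)) \<noteq> 0" if x: "x \<in> {x. t(1 := L T 1 * x) \<in> K T}" for x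
          proof
              assume "H T 1 (t(1 := L T 1 * x)) = 0"
              then have eq: "L T 1 * x = t0 T t" unfolding h1 using uniq[OF T, of t "L T 1 * x"] x by blast
              from x have "t(1 := t0 T t) \<in> K T" unfolding mem_Collect_eq eq .
              with False show False ..
          qed
        qed
        \<comment> \<open>Each integration by parts gains \<kappa>^(-12) here, of which
          \<kappa>^(-1) is kept to match the other case.\<close>
        also have "(X T)\<^sup>2 / (y T)\<^sup>2 = (1 / \<kappa> T) ^ 12"
          using X[OF T] \<kappa>[OF T] by (simp add: y_def power_mult_distrib power_divide power_mult[symmetric])
        also have "C2 * ((1 / \<kappa> T) ^ 12) ^ N \<le> C2 * ((1 / \<kappa> T) ^ 1) ^ N"
          using \<kappa>[OF T] C2 by (intro mult_left_mono power_mono power_decreasing) auto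
        also have "\<dots> = C2 / \<kappa> T ^ N" by (simp add: power_divide)
        also have "\<dots> \<le> (C1 + C2) / \<kappa> T ^ N" using C1 kp by (intro divide_right_mono) auto
        finally show ?thesis using False by (simp add: S_def lft_def)
      qed
      then have "L T 1 * norm (J - S) \<le> L T 1 * ((C1 + C2) / \<kappa> T ^ N)" using L1[OF T] by (intro mult_left_mono) auto
      moreover have "L T 1 * norm (J - S) = norm (of_real (L T 1) * (J - S))" using L1[OF T] by (simp add: norm_mult)
      moreover have "of_real (L T 1) * (J - S) = (LINT s|lborel. exp (\<i> * complex_of_real (\<phi> T (t(1 := s)))) * w T (t(1 := s)))
        - complex_of_real (L T 1 / y T) * exp (\<i> * complex_of_real (\<phi> T (t(1 := t0 T t)))) * (\<Sum>n<N. lft T (coef m n T) t)"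
        unfolding integral_rescaled[OF T] J_def[symmetric] S_def by (simp add: algebra_simps)
      ultimately show "norm ((LINT s|lborel. exp (\<i> * complex_of_real (\<phi> T (t(1 := s)))) * w T (t(1 := s)))
        - complex_of_real (L T 1 / y T) * exp (\<i> * complex_of_real (\<phi> T (t(1 := t0 T t)))) * (\<Sum>n<N. lft T (coef m n T) t))
        \<le> (C1 + C2) * L T 1 / \<kappa> T ^ N" by (simp add: mult.commute)
    qed
  qed
qed

section \<open>Symbols lifted to the critical graph\<close>

abbreviation "convex_set T \<equiv> {t. 0 < partial_deriv 1 (partial_deriv 1 (\<phi> T)) t}"

lemma K_pos: "T \<in> F \<Longrightarrow> t \<in> K T \<Longrightarrow> 0 < partial_deriv 1 (partial_deriv 1 (\<phi> T)) t"
proof -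
  assume T: "T \<in> F" and t: "t \<in> K T"
  have "0 < c * Y T" using params Y_pos[OF T] by simp
  also have "\<dots> \<le> L T 1 ^ 2 * partial_deriv 1 (partial_deriv 1 (\<phi> T)) t" by (rule convex[OF T t])
  finally show ?thesis by (simp add: zero_less_mult_iff)
qed

lemma critical_graph: "T \<in> F \<Longrightarrow> critical_graph I (\<phi> T) (K T) (\<alpha> * L T 1) (\<beta> * L T 1) (t0 T)"
proof
  assume T: "T \<in> F"
  show "1 \<in> I" by (rule one)
  show "smooth_fun I (\<phi> T)" by (rule \<phi>_smooth[OF T])
  show "closed (K T)" unfolding fun_support_def by (rule closed_closure)
  show "\<alpha> * L T 1 \<le> t 1 \<and> t 1 \<le> \<beta> * L T 1" if "t \<in> K T" for t by (rule supp[OF T that])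
  show "0 < partial_deriv 1 (partial_deriv 1 (\<phi> T)) t" if "t \<in> K T" for t by (rule K_pos[OF T that])
  show "partial_deriv 1 (\<phi> T) (t(1 := t0 T t)) = 0" if "t(1 := s) \<in> K T" for t s by (rule crit[OF T that])
  show "s = t0 T t" if "t(1 := s) \<in> K T" "partial_deriv 1 (\<phi> T) (t(1 := s)) = 0" for t s by (rule uniq[OF T that])
qed

lemma lft_eq_lift: "T \<in> F \<Longrightarrow> lft T G t = critical_graph.lift (K T) (t0 T) G t"
  using critical_graph.lift_def[OF critical_graph] by (simp add: lft_def)

lemma U_eq: "T \<in> F \<Longrightarrow> critical_graph.U (\<phi> T) = convex_set T"
  using critical_graph.U_def[OF critical_graph] by simp

sublocale symbol_calculus I F convex_set "\<lambda>T. K T" X L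
proof
  fix T assume T: "T \<in> F"
  show "open (convex_set T)" using critical_graph.open_U[OF critical_graph[OF T]] by (simp add: U_eq[OF T])
  show "K T \<subseteq> convex_set T" using K_pos[OF T] by blast
  show "1 \<le> X T" by (rule X[OF T])
qed

text \<open>Vanishing on the open set outside \<open>K\<close> belongs to the notion because the
  lift extends by zero: it is what makes the extension differentiable where the graph leaves
  \<open>K\<close>.\<close>

definition symbol :: "('k \<Rightarrow> real) \<Rightarrow> ('k \<Rightarrow> (nat \<Rightarrow> real) \<Rightarrow> complex) \<Rightarrow> bool" where
  "symbol \<sigma> G \<longleftrightarrow> (\<forall>n. sym n \<sigma> G) \<and> (\<forall>T\<in>F. \<forall>z\<in>convex_set T - K T. G T z = 0)"

lemma symbol_sym: "symbol \<sigma> G \<Longrightarrow> sym n \<sigma> G"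
  and symbol_zero: "symbol \<sigma> G \<Longrightarrow> T \<in> F \<Longrightarrow> z \<in> convex_set T - K T \<Longrightarrow> G T z = 0"
  by (auto simp: symbol_def)

text \<open>The phase loses no X per derivative, whereas the symbol class allows one, so X \<ge> 1
  closes the gap. The lists \<open>ks\<close> and \<open>rs\<close> concatenate into a single list
  to which the hypothesis on \<phi> applies.\<close>

lemma sym_\<phi>:
  assumes rs: "rs \<in> lists I"
  shows "sym n Y (\<lambda>T t. of_real (prod_list (map (L T) rs) * foldr partial_deriv rs (\<phi> T) t))"
proof -
  let ?g = "\<lambda>T x. complex_of_real (prod_list (map (L T) rs) * x)"
  have bl: "bounded_linear (?g T)" for T
    by (intro bounded_linear_compose[OF bounded_linear_of_real] bounded_linear_mult_right)
  have s: "smooth_fun I (foldr partial_deriv rs (\<phi> T))" if "T \<in> F" for T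
    by (rule smooth_fun_foldr[OF \<phi>_smooth[OF that] rs])
  have "sym n (\<lambda>T. X T ^ length ([] :: nat list) * Y T) (\<lambda>T t. prod_list (map (L T) []) *\<^sub>R foldr partial_deriv [] (\<lambda>t. ?g T (foldr partial_deriv rs (\<phi> T) t)) t)"
  proof (rule sym_foldr[where f = "\<lambda>T t. ?g T (foldr partial_deriv rs (\<phi> T) t)" and ks = "[]" and \<sigma> = Y])
    show "smooth_fun I (\<lambda>t. ?g T (foldr partial_deriv rs (\<phi> T) t))" if "T \<in> F" for T
      by (rule smooth_fun_linear[OF s[OF that] bl])
    fix ks assume ks: "ks \<in> lists I"
    show "\<exists>M\<ge>0. \<forall>T\<in>F. \<forall>t\<in>K T. prod_list (map (L T) ks) * norm (foldr partial_deriv ks (\<lambda>t. ?g T (foldr partial_deriv rs (\<phi> T) t)) t) \<le> M * (X T ^ length ks * Y T)"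
    proof (intro exI[of _ "B (ks @ rs)"] conjI ballI)
      show "0 \<le> B (ks @ rs)" using params(5)[of "ks @ rs"] by linarith
      fix T t assume T: "T \<in> F" and t: "t \<in> K T"
      have pos: "0 \<le> prod_list (map (L T) rs)"
        using rs L[OF T] by (intro prod_list_nonneg) (auto intro: less_imp_le)
      have "prod_list (map (L T) ks) * norm (foldr partial_deriv ks (\<lambda>t. ?g T (foldr partial_deriv rs (\<phi> T) t)) t)
        = prod_list (map (L T) (ks @ rs)) * \<bar>foldr partial_deriv (ks @ rs) (\<phi> T) t\<bar>"
        unfolding foldr_partial_deriv_linear[OF s[OF T] bl ks] norm_of_real using pos by (simp add: abs_mult)
      also have "\<dots> \<le> B (ks @ rs) * Y T" by (rule \<phi>_bound[OF T _ t]) (use ks rs in auto)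
      also have "\<dots> \<le> B (ks @ rs) * (X T ^ length ks * Y T)"
        using params(5)[of "ks @ rs"] X[OF T] Y_pos[OF T] by (intro mult_left_mono) (auto simp: mult_le_cancel_right1)
      finally show "prod_list (map (L T) ks) * norm (foldr partial_deriv ks (\<lambda>t. ?g T (foldr partial_deriv rs (\<phi> T) t)) t) \<le> B (ks @ rs) * (X T ^ length ks * Y T)" .
    qed
  qed (use L in \<open>auto simp del: foldr.simps\<close>)
  then show ?thesis by simp
qed

lemma sym_scaled_\<phi>:
  assumes rs: "rs \<in> lists I"
  shows "sym n (\<lambda>_. 1) (\<lambda>T t. of_real (prod_list (map (L T) rs) * foldr partial_deriv rs (\<phi> T) t / Y T))"
proof -
  have "sym n (\<lambda>T. 1 / Y T * Y T) (\<lambda>T t. of_real (1 / Y T) * of_real (prod_list (map (L T) rs) * foldr partial_deriv rs (\<phi> T) t))"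
    by (intro sym_mult sym_\<phi>[OF rs] sym_const[where M = 1]) (simp_all add: norm_divide Y_pos less_imp_le[OF Y_pos])
  then have "sym n (\<lambda>_. 1) (\<lambda>T t. of_real (1 / Y T) * of_real (prod_list (map (L T) rs) * foldr partial_deriv rs (\<phi> T) t))"
    by (rule sym_mono) (use Y_pos in force)
  then show ?thesis by (rule sym_cong) simp
qed

lemma sym_H: "sym n (\<lambda>_. 1) (\<lambda>T t. of_real (H T j t))"
  using sym_scaled_\<phi>[OF replicate_in_lists, of n j] by (simp add: prod_list_replicate1 H_def)

lemma sym_V: "sym n (\<lambda>T. X T ^ j) (\<lambda>T t. V T j t)"
proof -
  have "sym n (\<lambda>T. X T ^ length (replicate j (1::nat)) * 1) (\<lambda>T t. prod_list (map (L T) (replicate j 1)) *\<^sub>R foldr partial_deriv (replicate j 1) (w T) t)"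
  proof (rule sym_foldr[OF w_smooth replicate_in_lists _ L])
    fix ks assume ks: "ks \<in> lists I"
    show "\<exists>M\<ge>0. \<forall>T\<in>F. \<forall>t\<in>K T. prod_list (map (L T) ks) * norm (foldr partial_deriv ks (w T) t) \<le> M * (X T ^ length ks * 1)"
      using w_bound[OF _ ks] params(4)[of ks] by (intro exI[of _ "A ks"]) (auto intro: order_trans[OF zero_le_one])
  qed
  then show ?thesis by (simp add: prod_list_replicate1 V_def scaleR_conv_of_real)
qed

lemma H2_pos: "T \<in> F \<Longrightarrow> z \<in> convex_set T \<Longrightarrow> 0 < H T 2 z"
  using L1[of T] Y_pos[of T] by (simp add: H_def numeral_2_eq_2)

lemma sym_inverse_sqrt: "sym n (\<lambda>_. 1) (\<lambda>T t. inverse (csqrt (of_real (H T 2 t))))"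
proof (rule sym_inverse_csqrt[OF sym_H, where M = "1 / sqrt c"])
  show "complex_of_real (H T 2 t) \<notin> \<real>\<^sub>\<le>\<^sub>0" if "T \<in> F" "t \<in> convex_set T" for T t
    using H2_pos[OF that] by (simp add: complex_nonpos_Reals_iff)
  show "norm (inverse (csqrt (complex_of_real (H T 2 t)))) \<le> 1 / sqrt c" if "T \<in> F" "t \<in> K T" for T t
  proof -
    have c: "c \<le> H T 2 t"
      using convex[OF that] Y_pos[OF that(1)] by (simp add: H_def numeral_2_eq_2 le_divide_eq)
    then have "norm (inverse (csqrt (complex_of_real (H T 2 t)))) = 1 / sqrt (H T 2 t)"
      using params by (simp add: norm_inverse norm_divide divide_simps)
    also have "\<dots> \<le> 1 / sqrt c" using c params by (intro divide_left_mono) auto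
    finally show ?thesis .
  qed
qed (use params in auto)

text \<open>Differentiation along the critical graph, L_i (d_i - (\<phi>_1i / \<phi>_11) d_1), each
  factor being rescaled. The quotient 1/\<phi>_11 appears as the square of the inverse root of
  \<open>H T 2\<close>, so that \<open>sym_inverse_sqrt\<close> applies, and the sign as a factor
  for \<open>sym_cmult\<close>.\<close>

definition DL :: "nat \<Rightarrow> ('k \<Rightarrow> (nat \<Rightarrow> real) \<Rightarrow> complex) \<Rightarrow> 'k \<Rightarrow> (nat \<Rightarrow> real) \<Rightarrow> complex" where
  "DL i G T z = L T i *\<^sub>R partial_deriv i (G T) z +
     - 1 * ((of_real (L T i * L T 1 * partial_deriv i (partial_deriv 1 (\<phi> T)) z / Y T) * inverse (csqrt (of_real (H T 2 z))) ^ 2)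
        * (L T 1 *\<^sub>R partial_deriv 1 (G T) z))"

lemma partial_deriv_zero_outside:
  assumes T: "T \<in> F" and z: "\<forall>z\<in>convex_set T - K T. G z = 0" and x: "x \<in> convex_set T - K T"
  shows "partial_deriv i G x = 0"
proof -
  have "open (convex_set T - K T)" using open_U[OF T] by (intro open_Diff) (auto simp: fun_support_def)
  then have "foldr partial_deriv [i] G x = 0"
    by (rule foldr_partial_deriv_zero_on_open) (use z x in auto)
  then show ?thesis by simp
qed

text \<open>The coefficient in front of the derivative in t_1 is a symbol of size 1, free of X, so
  moving along the graph costs the same single X as an ordinary derivative.\<close>

lemma symbol_DL:
  assumes i: "i \<in> I" and G: "symbol \<sigma> G" and \<sigma>: "\<And>T. T \<in> F \<Longrightarrow> 0 \<le> \<sigma> T"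
  shows "symbol (\<lambda>T. X T * \<sigma> T) (DL i G)"
  unfolding symbol_def
proof (intro conjI allI ballI)
  fix n
  have pos: "0 \<le> X T * \<sigma> T" if "T \<in> F" for T using \<sigma>[OF that] X[OF that] by simp
  have p: "sym n (\<lambda>T. X T * \<sigma> T) (\<lambda>T t. L T i *\<^sub>R partial_deriv i (G T) t)" if "i \<in> I" for i
    by (rule sym_deriv[OF symbol_sym[OF G] that])
  have "sym n (\<lambda>_. 1) (\<lambda>T t. of_real (prod_list (map (L T) [i, 1]) * foldr partial_deriv [i, 1] (\<phi> T) t / Y T))"
    by (rule sym_scaled_\<phi>) (use i one in auto)
  then have f: "sym n (\<lambda>_. 1) (\<lambda>T t. of_real (L T i * L T 1 * partial_deriv i (partial_deriv 1 (\<phi> T)) t / Y T))" by (simp add: mult.assoc)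
  have "sym n (\<lambda>T. (1 * 1) * (X T * \<sigma> T)) (\<lambda>T z. (of_real (L T i * L T 1 * partial_deriv i (partial_deriv 1 (\<phi> T)) z / Y T) * inverse (csqrt (of_real (H T 2 z))) ^ 2)
        * (L T 1 *\<^sub>R partial_deriv 1 (G T) z))"
    by (intro sym_mult f sym_power sym_inverse_sqrt p one)
  then have "sym n (\<lambda>T. X T * \<sigma> T) (\<lambda>T z. (of_real (L T i * L T 1 * partial_deriv i (partial_deriv 1 (\<phi> T)) z / Y T) * inverse (csqrt (of_real (H T 2 z))) ^ 2)
        * (L T 1 *\<^sub>R partial_deriv 1 (G T) z))" by simp
  then show "sym n (\<lambda>T. X T * \<sigma> T) (DL i G)"
    unfolding DL_def by (intro sym_add p i sym_cmult pos)
next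
  fix T z assume T: "T \<in> F" and z: "z \<in> convex_set T - K T"
  have "partial_deriv j (G T) z = 0" for j
    by (rule partial_deriv_zero_outside[OF T _ z]) (use symbol_zero[OF G T] in blast)
  then show "DL i G T z = 0" by (simp add: DL_def)
qed

lemma lft_continuous:
  assumes G: "symbol \<sigma> G" and T: "T \<in> F"
  shows "continuous_on UNIV (lft T (G T))"
proof -
  have "continuous_on UNIV (critical_graph.lift (K T) (t0 T) (G T))"
    by (rule critical_graph.continuous_on_lift[OF critical_graph[OF T]])
      (use sym_continuous[OF symbol_sym[OF G] T] symbol_zero[OF G T] U_eq[OF T] in auto)
  moreover have "critical_graph.lift (K T) (t0 T) (G T) = lft T (G T)" using lft_eq_lift[OF T] by auto
  ultimately show ?thesis by simp
qed

lemma lft_line_derivative: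
  assumes G: "symbol \<sigma> G" and T: "T \<in> F" and i: "i \<in> I" "i \<noteq> 1"
  shows "((\<lambda>s. lft T (G T) (t(i := s))) has_vector_derivative (1 / L T i) *\<^sub>R lft T (DL i G T) t) (at (t i))"
proof -
  note cg = critical_graph[OF T]
  have diff: "(\<lambda>s. G T (z(k := s))) differentiable at (z k)" if "k \<in> I" "z \<in> convex_set T" for k z
    by (rule sym_differentiable[OF symbol_sym[OF G, of "Suc 0"] that(1) T that(2)])
  have "continuous_on (convex_set T) (\<lambda>t. L T 1 *\<^sub>R partial_deriv 1 (G T) t)"
    by (rule sym_continuous[OF sym_deriv[OF symbol_sym[OF G, of "Suc 0"] one] T])
  then have "continuous_on (convex_set T) (\<lambda>t. (1 / L T 1) *\<^sub>R (L T 1 *\<^sub>R partial_deriv 1 (G T) t))"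
    by (rule continuous_on_scaleR[OF continuous_on_const])
  moreover have "(\<lambda>t. (1 / L T 1) *\<^sub>R (L T 1 *\<^sub>R partial_deriv 1 (G T) t)) = partial_deriv 1 (G T)"
    using L1[OF T] unfolding scaleR_scaleR by (intro ext) simp
  ultimately have c1: "continuous_on (convex_set T) (partial_deriv 1 (G T))" by (simp only:)
  have "((\<lambda>s. critical_graph.lift (K T) (t0 T) (G T) (t(i := s))) has_vector_derivative
      critical_graph.lift (K T) (t0 T) (\<lambda>z. partial_deriv i (G T) z -
        (partial_deriv i (partial_deriv 1 (\<phi> T)) z / partial_deriv 1 (partial_deriv 1 (\<phi> T)) z) *\<^sub>R partial_deriv 1 (G T) z) t) (at (t i))"
    by (rule critical_graph.lift_has_line_derivative[OF cg])
      (use i one c1 diff symbol_zero[OF G T] in \<open>simp_all only: U_eq[OF T] not_False_eq_True\<close>)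
  then have d: "((\<lambda>s. lft T (G T) (t(i := s))) has_vector_derivative
      lft T (\<lambda>z. partial_deriv i (G T) z -
        (partial_deriv i (partial_deriv 1 (\<phi> T)) z / partial_deriv 1 (partial_deriv 1 (\<phi> T)) z) *\<^sub>R partial_deriv 1 (G T) z) t) (at (t i))"
    unfolding lft_eq_lift[OF T] .
  \<comment> \<open>This is required on \<open>K\<close> only, lifts being 0 where the graph is
    outside \<open>K\<close>.\<close>
  have eq: "partial_deriv i (G T) z - (partial_deriv i (partial_deriv 1 (\<phi> T)) z / partial_deriv 1 (partial_deriv 1 (\<phi> T)) z) *\<^sub>R partial_deriv 1 (G T) z
     = (1 / L T i) *\<^sub>R DL i G T z" if z: "z \<in> K T" for z
  proof -
    have h: "0 < partial_deriv 1 (partial_deriv 1 (\<phi> T)) z" by (rule K_pos[OF T z])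
    have H2: "H T 2 z = L T 1 ^ 2 * partial_deriv 1 (partial_deriv 1 (\<phi> T)) z / Y T"
      by (simp add: H_def numeral_2_eq_2)
    have "0 < H T 2 z" by (rule H2_pos[OF T]) (use h in simp)
    then have "inverse (csqrt (complex_of_real (H T 2 z))) ^ 2 = of_real (1 / H T 2 z)"
      by (simp add: power_inverse divide_inverse of_real_power[symmetric] del: of_real_power)
    then have "of_real (L T i * L T 1 * partial_deriv i (partial_deriv 1 (\<phi> T)) z / Y T) * inverse (csqrt (complex_of_real (H T 2 z))) ^ 2
       = of_real (L T i * L T 1 * partial_deriv i (partial_deriv 1 (\<phi> T)) z / Y T * (1 / H T 2 z))" by (simp only: of_real_mult)
    also have "L T i * L T 1 * partial_deriv i (partial_deriv 1 (\<phi> T)) z / Y T * (1 / H T 2 z)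
       = L T i * (partial_deriv i (partial_deriv 1 (\<phi> T)) z / partial_deriv 1 (partial_deriv 1 (\<phi> T)) z) / L T 1"
      unfolding H2 using Y_pos[OF T] L1[OF T] h by (simp add: power2_eq_square)
    finally show ?thesis
      using L[OF T i(1)] L1[OF T] unfolding DL_def by (simp add: scaleR_conv_of_real field_simps)
  qed
  have "lft T (\<lambda>z. partial_deriv i (G T) z -
        (partial_deriv i (partial_deriv 1 (\<phi> T)) z / partial_deriv 1 (partial_deriv 1 (\<phi> T)) z) *\<^sub>R partial_deriv 1 (G T) z) t
     = (1 / L T i) *\<^sub>R lft T (DL i G T) t"
    by (cases "t(1 := t0 T t) \<in> K T") (simp_all only: lft_def if_True if_False eq scaleR_zero_right)
  with d show ?thesis by simp
qed

text \<open>Iterating \<open>DL\<close> writes every derivative of a lift as the lift of a symbol; a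
  bound on \<open>K\<close> then becomes a bound for all t.\<close>

lemma lft_derivs:
  assumes "ks \<in> lists (I - {1})" and "symbol \<sigma> G" and "\<And>T. T \<in> F \<Longrightarrow> 0 \<le> \<sigma> T"
  shows "\<exists>G'. symbol (\<lambda>T. X T ^ length ks * \<sigma> T) G' \<and>
     (\<forall>T\<in>F. foldr partial_deriv ks (lft T (G T)) = (\<lambda>t. (1 / prod_list (map (L T) ks)) *\<^sub>R lft T (G' T) t))"
  using assms(1)
proof (induction ks)
  case Nil
  then show ?case using assms(2) by (intro exI[of _ G]) simp
next
  case (Cons k ks)
  then obtain G' where G': "symbol (\<lambda>T. X T ^ length ks * \<sigma> T) G'"
    and eq: "\<And>T. T \<in> F \<Longrightarrow> foldr partial_deriv ks (lft T (G T)) = (\<lambda>t. (1 / prod_list (map (L T) ks)) *\<^sub>R lft T (G' T) t)"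
    by blast
  have k: "k \<in> I" "k \<noteq> 1" using Cons by auto
  have s: "symbol (\<lambda>T. X T * (X T ^ length ks * \<sigma> T)) (DL k G')"
    by (rule symbol_DL[OF k(1) G']) (use assms(3) X in \<open>auto intro!: mult_nonneg_nonneg intro: order_trans[OF zero_le_one]\<close>)
  have "foldr partial_deriv (k # ks) (lft T (G T)) = (\<lambda>t. (1 / prod_list (map (L T) (k # ks))) *\<^sub>R lft T (DL k G' T) t)"
    if T: "T \<in> F" for T
  proof
    fix t
    have "partial_deriv k (\<lambda>t. (1 / prod_list (map (L T) ks)) *\<^sub>R lft T (G' T) t) t
       = (1 / prod_list (map (L T) ks)) *\<^sub>R ((1 / L T k) *\<^sub>R lft T (DL k G' T) t)"
      by (intro partial_derivI bounded_linear.has_vector_derivative[OF bounded_linear_scaleR_right] lft_line_derivative[OF G' T k])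
    then show "foldr partial_deriv (k # ks) (lft T (G T)) t = (1 / prod_list (map (L T) (k # ks))) *\<^sub>R lft T (DL k G' T) t"
      by (simp add: eq[OF T] mult.commute)
  qed
  with s show ?case by (intro exI[of _ "DL k G'"]) (simp add: mult.assoc)
qed

lemma lft_bound:
  assumes G: "symbol \<sigma> G" and \<sigma>: "\<And>T. T \<in> F \<Longrightarrow> 0 \<le> \<sigma> T"
  shows "\<exists>M\<ge>0. \<forall>T\<in>F. \<forall>t. norm (lft T (G T) t) \<le> M * \<sigma> T"
proof -
  obtain M where M: "0 \<le> M" "\<And>T t. T \<in> F \<Longrightarrow> t \<in> K T \<Longrightarrow> norm (G T t) \<le> M * \<sigma> T"
    using sym_imp_base[OF symbol_sym[OF G, of 0]] unfolding sym_base_def by blast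
  have "norm (lft T (G T) t) \<le> M * \<sigma> T" if T: "T \<in> F" for T t
    using M(2)[OF T] M(1) \<sigma>[OF T] by (simp add: lft_def)
  with M(1) show ?thesis by blast
qed

lemma prod_list_L_pos: "T \<in> F \<Longrightarrow> ks \<in> lists I \<Longrightarrow> 0 < prod_list (map (L T) ks)"
  using L by (induction ks) auto

lemma lft_derivs_bound:
  assumes ks: "ks \<in> lists (I - {1})" and G: "symbol \<sigma> G" and \<sigma>: "\<And>T. T \<in> F \<Longrightarrow> 0 \<le> \<sigma> T"
  shows "\<exists>M\<ge>0. \<forall>T\<in>F. \<forall>t. prod_list (map (L T) ks) * norm (foldr partial_deriv ks (lft T (G T)) t) \<le> M * (X T ^ length ks * \<sigma> T)"
proof -
  obtain G' where G': "symbol (\<lambda>T. X T ^ length ks * \<sigma> T) G'"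
    and eq: "\<And>T. T \<in> F \<Longrightarrow> foldr partial_deriv ks (lft T (G T)) = (\<lambda>t. (1 / prod_list (map (L T) ks)) *\<^sub>R lft T (G' T) t)"
    using lft_derivs[OF ks G \<sigma>] by blast
  have pos: "0 \<le> X T ^ length ks * \<sigma> T" if "T \<in> F" for T using \<sigma>[OF that] X[OF that] by simp
  obtain M where M: "0 \<le> M" "\<And>T t. T \<in> F \<Longrightarrow> norm (lft T (G' T) t) \<le> M * (X T ^ length ks * \<sigma> T)"
    using lft_bound[OF G' pos] by blast
  have "prod_list (map (L T) ks) * norm (foldr partial_deriv ks (lft T (G T)) t) = norm (lft T (G' T) t)" if T: "T \<in> F" for T t
  proof -
    have "0 < prod_list (map (L T) ks)" by (rule prod_list_L_pos[OF T]) (use ks in auto)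
    then show ?thesis by (simp add: eq[OF T])
  qed
  with M show ?thesis by (intro exI[of _ M]) simp
qed

lemma lft_smooth:
  assumes G: "symbol \<sigma> G" and \<sigma>: "\<And>T. T \<in> F \<Longrightarrow> 0 \<le> \<sigma> T" and T: "T \<in> F" and dep: "depends_only_on I (G T)"
  shows "smooth_fun (I - {1}) (lft T (G T))"
  unfolding smooth_fun_def
proof (intro conjI ballI allI)
  show "depends_only_on (I - {1}) (lft T (G T))"
    unfolding depends_only_on_def
  proof (intro allI impI)
    fix x y :: "nat \<Rightarrow> real" assume xy: "\<forall>i\<in>I - {1}. x i = y i"
    then have t: "t0 T x = t0 T y" using t0_depends[OF T] unfolding depends_only_on_def by blast
    have e: "\<forall>i\<in>I. (x(1 := t0 T x)) i = (y(1 := t0 T y)) i" using xy t by auto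
    have "depends_only_on I (w T)" using w_smooth[OF T] by (simp add: smooth_fun_def)
    then have "x(1 := t0 T x) \<in> K T \<longleftrightarrow> y(1 := t0 T y) \<in> K T"
      using fun_support_depends_only[of I "w T"] e by metis
    moreover have "G T (x(1 := t0 T x)) = G T (y(1 := t0 T y))" using dep e unfolding depends_only_on_def by blast
    ultimately show "lft T (G T) x = lft T (G T) y" unfolding lft_def by simp
  qed
  fix ks assume ks: "ks \<in> lists (I - {1})"
  obtain G' where G': "symbol (\<lambda>T. X T ^ length ks * \<sigma> T) G'"
    and eq: "foldr partial_deriv ks (lft T (G T)) = (\<lambda>t. (1 / prod_list (map (L T) ks)) *\<^sub>R lft T (G' T) t)"
    using lft_derivs[OF ks G \<sigma>] T by blast
  show "continuous_on UNIV (foldr partial_deriv ks (lft T (G T)))"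
    unfolding eq by (intro continuous_on_scaleR continuous_on_const lft_continuous[OF G' T])
  fix i x assume i: "i \<in> I - {1}"
  have "((\<lambda>s. (1 / prod_list (map (L T) ks)) *\<^sub>R lft T (G' T) (x(i := s))) has_vector_derivative
      (1 / prod_list (map (L T) ks)) *\<^sub>R ((1 / L T i) *\<^sub>R lft T (DL i G' T) x)) (at (x i))"
    by (intro bounded_linear.has_vector_derivative[OF bounded_linear_scaleR_right] lft_line_derivative[OF G' T]) (use i in auto)
  then show "(\<lambda>s. foldr partial_deriv ks (lft T (G T)) (x(i := s))) differentiable at (x i)"
    unfolding eq by (rule differentiableI_vector)
qed

lemma depends_only_on_coef: "T \<in> F \<Longrightarrow> depends_only_on I (coef m n T)"
proof -
  assume T: "T \<in> F"
  have "smooth_fun I (foldr partial_deriv (replicate j 1) (w T))" "smooth_fun I (foldr partial_deriv (replicate j 1) (\<phi> T))" for j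
    by (intro smooth_fun_foldr replicate_in_lists w_smooth[OF T] \<phi>_smooth[OF T])+
  then have "depends_only_on I (foldr partial_deriv (replicate j 1) (w T))" "depends_only_on I (foldr partial_deriv (replicate j 1) (\<phi> T))" for j
    by (simp_all add: smooth_fun_def)
  then have eq: "H T j u = H T j v" "V T j u = V T j v" if "\<forall>i\<in>I. u i = v i" for j u v
    using that unfolding H_def V_def depends_only_on_def by metis+
  show ?thesis
    unfolding depends_only_on_def coef_def
  proof (intro allI impI)
    fix u v :: "nat \<Rightarrow> real" assume "\<forall>i\<in>I. u i = v i"
    from eq[OF this] show "stationary_term m (y T) (\<lambda>j. H T j u) (\<lambda>j. V T j u) n = stationary_term m (y T) (\<lambda>j. H T j v) (\<lambda>j. V T j v) n"
      by (simp only:)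
  qed
qed

text \<open>At the cost \<theta> = y/\<kappa>^2 per order in t_1, the amplitude has size X^j \<le>
  \<theta>^j, and the phase has size y^2 \<le> \<theta>^j from order three on. The factor y^(-n)
  turns \<theta>^n into \<kappa>^(-2n). Further derivatives in any variable cost just X each, which
  is the inertness of the coefficient.\<close>

lemma symbol_coef: "symbol (\<lambda>T. (1 / \<kappa> T ^ 2) ^ n) (coef m n)"
  unfolding symbol_def
proof (intro conjI allI ballI)
  fix l
  define \<theta> where "\<theta> T = y T / (\<kappa> T)\<^sup>2" for T
  have th: "0 \<le> \<theta> T" "X T \<le> \<theta> T" if "T \<in> F" for T
    using phase_scale(4)[OF X[OF that] \<kappa>[OF that] y_def] X[OF that] by (auto simp: \<theta>_def)
  have a: "sym l (\<lambda>T. \<theta> T ^ j) (\<lambda>T t. if 3 \<le> j then \<i> * of_real ((y T)\<^sup>2 * H T j t) else 0)" for j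
  proof (cases "3 \<le> j")
    case True
    have "sym l Y (\<lambda>T t. \<i> * of_real (prod_list (map (L T) (replicate j 1)) * foldr partial_deriv (replicate j 1) (\<phi> T) t))"
      by (intro sym_cmult sym_\<phi> replicate_in_lists) (use Y_pos in \<open>auto intro: less_imp_le\<close>)
    then have "sym l (\<lambda>T. \<theta> T ^ j) (\<lambda>T t. \<i> * of_real (prod_list (map (L T) (replicate j 1)) * foldr partial_deriv (replicate j 1) (\<phi> T) t))"
      by (rule sym_mono) (use phase_scale(7)[OF X \<kappa> y_def True] y_sq in \<open>auto simp: \<theta>_def\<close>)
    moreover have "(y T)\<^sup>2 * H T j t = prod_list (map (L T) (replicate j 1)) * foldr partial_deriv (replicate j 1) (\<phi> T) t" if "T \<in> F" for T t
      unfolding y_sq[OF that] H_def prod_list_replicate1 using Y_pos[OF that] by simp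
    ultimately have "sym l (\<lambda>T. \<theta> T ^ j) (\<lambda>T t. \<i> * of_real ((y T)\<^sup>2 * H T j t))"
      by (elim sym_cong) simp
    then show ?thesis using True by simp
  next
    case False
    then show ?thesis using sym_const[where M = 0 and k = "\<lambda>_. 0" and \<sigma> = "\<lambda>T. \<theta> T ^ j"] th by simp
  qed
  have v: "sym l (\<lambda>T. \<theta> T ^ j) (\<lambda>T t. V T j t)" for j
    by (rule sym_mono[OF sym_V]) (use th X in \<open>auto intro!: power_mono intro: order_trans[OF zero_le_one]\<close>)
  have e: "sym l (\<lambda>T. \<theta> T ^ k) (\<lambda>T t. exp_seq (\<lambda>j. if 3 \<le> j then \<i> * of_real ((y T)\<^sup>2 * H T j t) else 0) k)" for k
    by (rule sym_exp_seq[where a = "\<lambda>j T t. if 3 \<le> j then \<i> * of_real ((y T)\<^sup>2 * H T j t) else 0"]) (use a th in auto)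
  have b: "sym l (\<lambda>T. \<theta> T ^ n) (\<lambda>T t. bconv (\<lambda>j. V T j t) (exp_seq (\<lambda>j. if 3 \<le> j then \<i> * of_real ((y T)\<^sup>2 * H T j t) else 0)) n)"
    by (rule sym_bconv[where a = "\<lambda>j T t. V T j t" and b = "\<lambda>k T t. exp_seq (\<lambda>j. if 3 \<le> j then \<i> * of_real ((y T)\<^sup>2 * H T j t) else 0) k"])
      (use v e th in auto)
  have yc: "sym l (\<lambda>T. (1 / y T) ^ n) (\<lambda>T t. of_real ((1 / y T) ^ n))"
    by (rule sym_const[where M = 1]) (simp_all add: norm_power norm_divide power_divide y_pos less_imp_le[OF y_pos])
  have "sym l (\<lambda>T. (1 * (1 / y T) ^ n) * \<theta> T ^ n) (\<lambda>T t. ((m n / fact n * inverse (csqrt (of_real (H T 2 t))) ^ Suc n) * of_real ((1 / y T) ^ n)) *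
     bconv (\<lambda>j. V T j t) (exp_seq (\<lambda>j. if 3 \<le> j then \<i> * of_real ((y T)\<^sup>2 * H T j t) else 0)) n)"
    by (intro sym_mult sym_cmult sym_power sym_inverse_sqrt yc b) auto
  then have "sym l (\<lambda>T. (1 / \<kappa> T ^ 2) ^ n) (\<lambda>T t. ((m n / fact n * inverse (csqrt (of_real (H T 2 t))) ^ Suc n) * of_real ((1 / y T) ^ n)) *
     bconv (\<lambda>j. V T j t) (exp_seq (\<lambda>j. if 3 \<le> j then \<i> * of_real ((y T)\<^sup>2 * H T j t) else 0)) n)"
  proof (rule sym_mono)
    fix T assume T: "T \<in> F"
    have "(1 * (1 / y T) ^ n) * \<theta> T ^ n = ((1 / y T) * \<theta> T) ^ n" by (simp only: power_mult_distrib mult_1)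
    also have "(1 / y T) * \<theta> T = 1 / \<kappa> T ^ 2" using y_pos[OF T] by (simp add: \<theta>_def)
    finally show "(1 * (1 / y T) ^ n) * \<theta> T ^ n \<le> (1 / \<kappa> T ^ 2) ^ n" by simp
  qed
  then show "sym l (\<lambda>T. (1 / \<kappa> T ^ 2) ^ n) (coef m n)"
  proof (rule sym_cong)
    fix T t assume T: "T \<in> F" and t: "t \<in> convex_set T"
    have "inverse (csqrt (complex_of_real (H T 2 t))) = of_real (1 / sqrt (H T 2 t))"
      using H2_pos[OF T t] by (simp add: divide_inverse)
    then have "m n / fact n * inverse (csqrt (of_real (H T 2 t))) ^ Suc n * of_real ((1 / y T) ^ n) = m n / fact n * of_real ((1 / sqrt (H T 2 t)) ^ Suc n * (1 / y T) ^ n)"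
      by (simp only: of_real_mult of_real_power mult.assoc)
    then show "((m n / fact n * inverse (csqrt (of_real (H T 2 t))) ^ Suc n) * of_real ((1 / y T) ^ n)) *
     bconv (\<lambda>j. V T j t) (exp_seq (\<lambda>j. if 3 \<le> j then \<i> * of_real ((y T)\<^sup>2 * H T j t) else 0)) n = coef m n T t"
      unfolding coef_def stationary_term_def by (simp only:)
  qed
next
  fix T z assume T: "T \<in> F" and z: "z \<in> convex_set T - K T"
  have "V T j z = 0" for j
  proof -
    have "foldr partial_deriv (replicate j 1) (w T) z = 0" by (rule foldr_partial_deriv_off_support) (use z in simp)
    then show ?thesis by (simp only: V_def mult_zero_right)
  qed
  then show "coef m n T z = 0" unfolding coef_def stationary_term_def bconv_def by simp
qed

end

section \<open>Borel summation\<close>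

lemma foldr_partial_deriv_sum:
  assumes "\<And>n. n \<in> S \<Longrightarrow> smooth_fun I (g n)" "ks \<in> lists I"
  shows "foldr partial_deriv ks (\<lambda>t. \<Sum>n\<in>S. g n t) = (\<lambda>t. \<Sum>n\<in>S. foldr partial_deriv ks (g n) t)"
  using assms(2)
proof (induction ks)
  case (Cons k ks)
  have "partial_deriv k (\<lambda>t. \<Sum>n\<in>S. foldr partial_deriv ks (g n) t) t = (\<Sum>n\<in>S. partial_deriv k (foldr partial_deriv ks (g n)) t)" for t
  proof (rule partial_derivI)
    show "((\<lambda>s. \<Sum>n\<in>S. foldr partial_deriv ks (g n) (t(k := s))) has_vector_derivative
        (\<Sum>n\<in>S. partial_deriv k (foldr partial_deriv ks (g n)) t)) (at (t k))"
    proof (rule has_vector_derivative_sum)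
      fix n assume n: "n \<in> S"
      have "((\<lambda>s. foldr partial_deriv ks (g n) (t(k := s))) has_vector_derivative
          partial_deriv k (foldr partial_deriv ks (g n)) (t(k := t k))) (at (t k))"
        by (rule smooth_fun_line[OF smooth_fun_foldr[OF assms(1)[OF n]]]) (use Cons in auto)
      then show "((\<lambda>s. foldr partial_deriv ks (g n) (t(k := s))) has_vector_derivative
          partial_deriv k (foldr partial_deriv ks (g n)) t) (at (t k))" by simp
    qed
  qed
  then show ?case using Cons by auto
qed simp

lemma smooth_fun_sum:
  assumes g: "\<And>n. n \<in> S \<Longrightarrow> smooth_fun I (g n)"
  shows "smooth_fun I (\<lambda>t. \<Sum>n\<in>S. g n t)"
  unfolding smooth_fun_def
proof (intro conjI ballI allI)
  have "depends_only_on I (g n)" if "n \<in> S" for n using g[OF that] by (simp add: smooth_fun_def)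
  then show "depends_only_on I (\<lambda>t. \<Sum>n\<in>S. g n t)"
    unfolding depends_only_on_def by (intro allI impI sum.cong) blast+
  fix ks assume ks: "ks \<in> lists I"
  have s: "smooth_fun I (foldr partial_deriv ks (g n))" if "n \<in> S" for n by (rule smooth_fun_foldr[OF g[OF that] ks])
  have eq: "foldr partial_deriv ks (\<lambda>t. \<Sum>n\<in>S. g n t) = (\<lambda>t. \<Sum>n\<in>S. foldr partial_deriv ks (g n) t)"
    by (rule foldr_partial_deriv_sum[OF g ks])
  show "continuous_on UNIV (foldr partial_deriv ks (\<lambda>t. \<Sum>n\<in>S. g n t))"
    unfolding eq by (intro continuous_on_sum smooth_fun_continuous[OF s])
  fix i x assume i: "i \<in> I"
  have "((\<lambda>s. \<Sum>n\<in>S. foldr partial_deriv ks (g n) (x(i := s))) has_vector_derivative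
      (\<Sum>n\<in>S. partial_deriv i (foldr partial_deriv ks (g n)) (x(i := x i)))) (at (x i))"
    by (intro has_vector_derivative_sum smooth_fun_line[OF s i])
  then show "(\<lambda>s. foldr partial_deriv ks (\<lambda>t. \<Sum>n\<in>S. g n t) (x(i := s))) differentiable at (x i)"
    unfolding eq by (rule differentiableI_vector)
qed

lemma sum_inverse_power2_le: "(\<Sum>n\<in>{a..<b}. (1/2::real) ^ n) \<le> 2"
proof -
  have "(\<Sum>n\<in>{a..<b}. (1/2::real) ^ n) \<le> (\<Sum>n. (1/2) ^ n)"
    by (rule sum_le_suminf) (auto intro: summable_geometric)
  then show ?thesis by (simp add: suminf_geometric)
qed

text \<open>The choice behind Borel summation: the divergent series \<open>\<Sum>n. k n ks / \<kappa>\<^sup>2\<^sup>n\<close> is cut off at an index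
  that grows so slowly with \<open>\<kappa>\<close> that the partial sums stay bounded.\<close>

lemma borel_truncation:
  fixes k :: "nat \<Rightarrow> 'a list \<Rightarrow> real"
  assumes "finite J" and k: "\<And>n ks. 0 \<le> k n ks"
  shows "\<exists>D \<rho>. \<forall>\<kappa>\<ge>1. \<exists>N. (\<forall>ks\<in>lists J. (\<Sum>n<N. k n ks * (1 / \<kappa>\<^sup>2) ^ n) \<le> D ks) \<and>
     (\<forall>M\<ge>1. (N < M \<longrightarrow> \<kappa> \<le> \<rho> M) \<and> (\<Sum>n\<in>{M..<N}. k n [] * (1 / \<kappa>\<^sup>2) ^ n) \<le> 2 / \<kappa> ^ M)"
proof -
  define A where "A n = {ks \<in> lists J. length ks \<le> n}" for n :: nat
  have fin: "finite (A n)" for n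
    using finite_lists_length_le[OF assms(1), of n] by (simp add: A_def lists_eq_set)
  \<comment> \<open>Twice the constants of all lists of length at most n, a finite set because
    \<open>J\<close> is finite; the summand 2 makes the thresholds \<rho> grow without
    bound.\<close>
  define q where "q n = 2 + 2 * (\<Sum>ks\<in>A n. k n ks)" for n
  define \<rho> where "\<rho> n = (\<Sum>j\<le>n. q j)" for n
  have q2: "2 \<le> q n" for n using k by (simp add: q_def sum_nonneg)
  have \<rho>_mono: "\<rho> i \<le> \<rho> j" if "i \<le> j" for i j
    unfolding \<rho>_def using that order_trans[OF _ q2] by (intro sum_mono2) auto
  have "q n \<le> \<rho> n" for n
    unfolding \<rho>_def by (rule member_le_sum) (use order_trans[OF _ q2] in auto)
  then have \<rho>2: "2 \<le> \<rho> n" and \<rho>k: "ks \<in> A n \<Longrightarrow> 2 * k n ks \<le> \<rho> n" for n ks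
  proof -
    show "2 \<le> \<rho> n" using q2[of n] \<open>q n \<le> \<rho> n\<close> by linarith
    assume "ks \<in> A n"
    then have "k n ks \<le> (\<Sum>ks\<in>A n. k n ks)" by (rule member_le_sum[OF _ k fin])
    then show "2 * k n ks \<le> \<rho> n" using \<open>q n \<le> \<rho> n\<close> unfolding q_def by linarith
  qed
  have \<rho>_large: "real n < \<rho> n" for n
  proof (induction n)
    case 0
    then show ?case using \<rho>2[of 0] by simp
  next
    case (Suc n)
    then show ?case using q2[of "Suc n"] by (simp add: \<rho>_def)
  qed
  \<comment> \<open>Once \<kappa> passes the n-th threshold, one factor \<kappa> pays for twice
    \<open>k n ks\<close> and n - 1 further ones for 2^(n-1). The remaining n factors are the
    gain.\<close>
  have term_le: "k n ks * (1 / \<kappa>\<^sup>2) ^ n \<le> (1/2) ^ n / \<kappa> ^ n" if "1 \<le> n" "ks \<in> A n" "\<rho> n \<le> \<kappa>" for n ks \<kappa>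
  proof -
    have k2: "2 \<le> \<kappa>" and kk: "2 * k n ks \<le> \<kappa>" using \<rho>2[of n] \<rho>k[OF that(2)] that(3) by linarith+
    have "2 ^ (n - 1) \<le> \<kappa> ^ (n - 1)" using k2 by (intro power_mono) auto
    then have "(2 * k n ks) * 2 ^ (n - 1) \<le> \<kappa> * \<kappa> ^ (n - 1)" using kk k[of n ks] k2 by (intro mult_mono) auto
    then have "k n ks * 2 ^ n \<le> \<kappa> ^ n" using that(1) by (cases n) (auto simp: mult_ac)
    then have "k n ks * 2 ^ n * \<kappa> ^ n \<le> \<kappa> ^ n * \<kappa> ^ n" using k2 by (intro mult_right_mono) auto
    then show ?thesis
      using k2 by (simp add: power_divide power_even_eq[symmetric] power2_eq_square power_mult_distrib field_simps)
  qed
  show ?thesis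
  \<comment> \<open>Terms with n up to \<open>length ks\<close> are counted in full, as the
    thresholds control a list only from its length on; the later terms add up to at most 2.\<close>
  proof (intro exI[of _ "\<lambda>ks. (\<Sum>n\<le>length ks. k n ks) + 2"] exI[of _ \<rho>] allI impI)
    fix \<kappa> :: real assume \<kappa>: "1 \<le> \<kappa>"
    \<comment> \<open>The first threshold above \<kappa>: for n < N the terms are controlled, and N
      < M means that \<kappa> lies below \<rho> M.\<close>
    define N where "N = (LEAST n. \<kappa> < \<rho> n)"
    have "\<kappa> < \<rho> (nat \<lceil>\<kappa>\<rceil>)"
      using \<rho>_large[of "nat \<lceil>\<kappa>\<rceil>"] real_nat_ceiling_ge[of \<kappa>] by linarith
    then have N: "\<kappa> < \<rho> N" unfolding N_def by (rule LeastI)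
    have below: "\<rho> n \<le> \<kappa>" if "n < N" for n using not_less_Least[of n "\<lambda>n. \<kappa> < \<rho> n"] that unfolding N_def by simp
    have p1: "(1 / \<kappa>\<^sup>2) ^ n \<le> 1" "0 \<le> (1 / \<kappa>\<^sup>2) ^ n" for n using \<kappa> by (auto intro!: power_le_one)
    have tail: "(\<Sum>n\<in>{M..<N}. k n ks * (1 / \<kappa>\<^sup>2) ^ n) \<le> 2 / \<kappa> ^ M" if M: "1 \<le> M" "length ks \<le> M" "ks \<in> lists J" for M ks
    proof -
      have "k n ks * (1 / \<kappa>\<^sup>2) ^ n \<le> (1/2) ^ n * (1 / \<kappa> ^ M)" if n: "n \<in> {M..<N}" for n
      proof -
        have "k n ks * (1 / \<kappa>\<^sup>2) ^ n \<le> (1/2) ^ n / \<kappa> ^ n" by (rule term_le[OF _ _ below]) (use n M in \<open>auto simp: A_def\<close>)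
        also have "\<dots> \<le> (1/2) ^ n / \<kappa> ^ M" using n \<kappa> by (intro divide_left_mono power_increasing) auto
        finally show ?thesis by simp
      qed
      then have "(\<Sum>n\<in>{M..<N}. k n ks * (1 / \<kappa>\<^sup>2) ^ n) \<le> (\<Sum>n\<in>{M..<N}. (1/2) ^ n) * (1 / \<kappa> ^ M)"
        unfolding sum_distrib_right by (rule sum_mono)
      also have "\<dots> \<le> 2 * (1 / \<kappa> ^ M)" using \<kappa> by (intro mult_right_mono sum_inverse_power2_le) auto
      finally show ?thesis by simp
    qed
    show "\<exists>N. (\<forall>ks\<in>lists J. (\<Sum>n<N. k n ks * (1 / \<kappa>\<^sup>2) ^ n) \<le> (\<Sum>n\<le>length ks. k n ks) + 2) \<and>
     (\<forall>M\<ge>1. (N < M \<longrightarrow> \<kappa> \<le> \<rho> M) \<and> (\<Sum>n\<in>{M..<N}. k n [] * (1 / \<kappa>\<^sup>2) ^ n) \<le> 2 / \<kappa> ^ M)"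
    proof (intro exI[of _ N] conjI ballI allI impI)
      fix ks assume ks: "ks \<in> lists J"
      have "(\<Sum>n<N. k n ks * (1 / \<kappa>\<^sup>2) ^ n) \<le> (\<Sum>n\<in>{..length ks} \<union> {Suc (length ks)..<N}. k n ks * (1 / \<kappa>\<^sup>2) ^ n)"
        using k p1 by (intro sum_mono2) auto
      also have "\<dots> = (\<Sum>n\<le>length ks. k n ks * (1 / \<kappa>\<^sup>2) ^ n) + (\<Sum>n\<in>{Suc (length ks)..<N}. k n ks * (1 / \<kappa>\<^sup>2) ^ n)"
        by (rule sum.union_disjoint) auto
      also have "\<dots> \<le> (\<Sum>n\<le>length ks. k n ks) + 2 / \<kappa> ^ Suc (length ks)"
        using k p1 by (intro add_mono sum_mono tail ks mult_left_le) auto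
      also have "2 / \<kappa> ^ Suc (length ks) \<le> 2" using one_le_power[OF \<kappa>, of "Suc (length ks)"] by (simp add: divide_le_eq del: power_Suc)
      finally show "(\<Sum>n<N. k n ks * (1 / \<kappa>\<^sup>2) ^ n) \<le> (\<Sum>n\<le>length ks. k n ks) + 2" by simp
    next
      fix M :: nat assume "N < M"
      then show "\<kappa> \<le> \<rho> M" using N \<rho>_mono[of N M] by simp
    next
      fix M :: nat assume "1 \<le> M"
      then show "(\<Sum>n\<in>{M..<N}. k n [] * (1 / \<kappa>\<^sup>2) ^ n) \<le> 2 / \<kappa> ^ M" by (rule tail) auto
    qed
  qed
qed

context phase_family
begin

lemma Y_over_X_sq: "T \<in> F \<Longrightarrow> Y T / (X T)\<^sup>2 = \<kappa> T ^ 12"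
  using X[of T] Y[of T] by (simp add: power_mult_distrib power_mult[symmetric])

text \<open>W is the expansion cut at an index N that depends on \<kappa>. For an error
  \<kappa>^(-M) with M \<le> N, the terms from M to N form a tail controlled by
  \<open>borel_truncation\<close>. For M > N, \<kappa> is at most \<rho> M, so \<kappa>^(-M) is
  bounded below and a trivial estimate suffices.\<close>

theorem inert_stationary_phase:
  "\<exists>D E. \<forall>T\<in>F. \<exists>W. smooth_fun (I - {1}) W \<and> (\<forall>t. t(1 := t0 T t) \<notin> K T \<longrightarrow> W t = 0) \<and>
     (\<forall>ks\<in>lists (I - {1}). \<forall>t. prod_list (map (L T) ks) * norm (foldr partial_deriv ks W t) \<le> D ks * X T ^ length ks) \<and>
     (\<forall>A>0. \<forall>t. norm ((LINT s|lborel. exp (\<i> * complex_of_real (\<phi> T (t(1 := s)))) * w T (t(1 := s)))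
        - complex_of_real (L T 1 / y T) * exp (\<i> * complex_of_real (\<phi> T (t(1 := t0 T t)))) * W t)
       \<le> E A * (L T 1 * (Y T / (X T)\<^sup>2) powr (- A)))"
proof (rule expansion)
  fix m
  assume exp: "\<And>N. \<exists>E\<ge>0. \<forall>T\<in>F. \<forall>t.
     norm ((LINT s|lborel. exp (\<i> * complex_of_real (\<phi> T (t(1 := s)))) * w T (t(1 := s)))
        - complex_of_real (L T 1 / y T) * exp (\<i> * complex_of_real (\<phi> T (t(1 := t0 T t)))) * (\<Sum>n<N. lft T (coef m n T) t))
     \<le> E * L T 1 / \<kappa> T ^ N"
  define J where "J T t = (LINT s|lborel. exp (\<i> * complex_of_real (\<phi> T (t(1 := s)))) * w T (t(1 := s)))" for T t
  define P where "P T t = complex_of_real (L T 1 / y T) * exp (\<i> * complex_of_real (\<phi> T (t(1 := t0 T t))))" for T t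
  have "\<forall>N. \<exists>E\<ge>0. \<forall>T\<in>F. \<forall>t. norm (J T t - P T t * (\<Sum>n<N. lft T (coef m n T) t)) \<le> E * L T 1 / \<kappa> T ^ N"
    using exp unfolding J_def P_def by blast
  then obtain E where E: "\<And>N. 0 \<le> E N"
    "\<And>N T t. T \<in> F \<Longrightarrow> norm (J T t - P T t * (\<Sum>n<N. lft T (coef m n T) t)) \<le> E N * L T 1 / \<kappa> T ^ N" by metis
  have \<kappa>0: "0 \<le> (1 / (\<kappa> T)\<^sup>2) ^ n" for T n by simp
  \<comment> \<open>Constants are chosen for every list, those outside
    \<open>lists (I - {1})\<close> being merely non-negative, since \<open>borel_truncation\<close>
    takes a total function.\<close>
  define Q where "Q n ks k \<longleftrightarrow> 0 \<le> k \<and> (ks \<in> lists (I - {1}) \<longrightarrow> (\<forall>T\<in>F. \<forall>t. prod_list (map (L T) ks) * norm (foldr partial_deriv ks (lft T (coef m n T)) t)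
     \<le> k * (X T ^ length ks * (1 / (\<kappa> T)\<^sup>2) ^ n)))" for n ks k
  have "\<exists>k. Q n ks k" for n ks
  proof (cases "ks \<in> lists (I - {1})")
    case True
    show ?thesis unfolding Q_def using lft_derivs_bound[OF True symbol_coef[of n m] \<kappa>0] by blast
  qed (auto simp: Q_def)
  then obtain k where Q: "\<And>n ks. Q n ks (k n ks)" by metis
  have k: "\<And>n ks. 0 \<le> k n ks"
    "\<And>n ks T t. ks \<in> lists (I - {1}) \<Longrightarrow> T \<in> F \<Longrightarrow> prod_list (map (L T) ks) * norm (foldr partial_deriv ks (lft T (coef m n T)) t)
     \<le> k n ks * (X T ^ length ks * (1 / (\<kappa> T)\<^sup>2) ^ n)" using Q unfolding Q_def by blast+
  have fJ: "finite (I - {1})" using finite_I by simp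
  obtain D \<rho> where D: "\<forall>\<kappa>\<ge>1. \<exists>N. (\<forall>ks\<in>lists (I - {1}). (\<Sum>n<N. k n ks * (1 / \<kappa>\<^sup>2) ^ n) \<le> D ks) \<and>
     (\<forall>M\<ge>1. (N < M \<longrightarrow> \<kappa> \<le> \<rho> M) \<and> (\<Sum>n\<in>{M..<N}. k n [] * (1 / \<kappa>\<^sup>2) ^ n) \<le> 2 / \<kappa> ^ M)"
    using borel_truncation[where k = k, OF fJ k(1)] by (elim exE)
  \<comment> \<open>\<open>E M + 2\<close> serves the case M \<le> N, the last summand the case M >
    N.\<close>
  define E' where "E' M = E M + 2 + (E 0 + \<bar>D []\<bar>) * \<bar>\<rho> M\<bar> ^ M" for M
  show ?thesis
  proof (intro exI[of _ D] exI[of _ "\<lambda>A. E' (Suc (nat \<lceil>12 * A\<rceil>))"] ballI)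
    fix T assume T: "T \<in> F"
    obtain N where N': "(\<forall>ks\<in>lists (I - {1}). (\<Sum>n<N. k n ks * (1 / (\<kappa> T)\<^sup>2) ^ n) \<le> D ks) \<and>
      (\<forall>M\<ge>1. (N < M \<longrightarrow> \<kappa> T \<le> \<rho> M) \<and> (\<Sum>n\<in>{M..<N}. k n [] * (1 / (\<kappa> T)\<^sup>2) ^ n) \<le> 2 / \<kappa> T ^ M)"
      using D[rule_format, OF \<kappa>[OF T]] by (elim exE)
    have N: "\<And>ks. ks \<in> lists (I - {1}) \<Longrightarrow> (\<Sum>n<N. k n ks * (1 / (\<kappa> T)\<^sup>2) ^ n) \<le> D ks"
      "\<And>M. 1 \<le> M \<Longrightarrow> N < M \<Longrightarrow> \<kappa> T \<le> \<rho> M"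
      "\<And>M. 1 \<le> M \<Longrightarrow> (\<Sum>n\<in>{M..<N}. k n [] * (1 / (\<kappa> T)\<^sup>2) ^ n) \<le> 2 / \<kappa> T ^ M"
      using N' by simp_all
    define l where "l n = lft T (coef m n T)" for n
    define W where "W t = (\<Sum>n<N. l n t)" for t
    have ls: "smooth_fun (I - {1}) (l n)" for n
      unfolding l_def by (rule lft_smooth[OF symbol_coef \<kappa>0 T depends_only_on_coef[OF T]])
    have lb: "norm (l n t) \<le> k n [] * (1 / (\<kappa> T)\<^sup>2) ^ n" for n t
      using k(2)[of "[]" T n t] T by (simp add: l_def)
    have norm_P: "norm (P T t) \<le> L T 1" for t
      using y_ge_1[OF T] L1[OF T] by (simp add: P_def norm_mult norm_divide divide_le_eq mult_le_cancel_left1)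
    have bound: "norm (J T t - P T t * W t) \<le> E' M * (L T 1 * (1 / \<kappa> T ^ M))" if M: "1 \<le> M" for M t
    proof (cases "M \<le> N")
      case True
      have "W t - (\<Sum>n<M. l n t) = (\<Sum>n\<in>{M..<N}. l n t)"
        using sum.atLeastLessThan_concat[of 0 M N "\<lambda>n. l n t"] True by (simp add: W_def atLeast0LessThan algebra_simps)
      moreover have "norm (\<Sum>n\<in>{M..<N}. l n t) \<le> (\<Sum>n\<in>{M..<N}. k n [] * (1 / (\<kappa> T)\<^sup>2) ^ n)"
        by (rule sum_norm_le) (rule lb)
      ultimately have W: "norm (W t - (\<Sum>n<M. l n t)) \<le> 2 / \<kappa> T ^ M" using N(3)[OF M] by simp
      have "J T t - P T t * W t = (J T t - P T t * (\<Sum>n<M. l n t)) - P T t * (W t - (\<Sum>n<M. l n t))"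
        by (simp add: algebra_simps)
      also have "norm \<dots> \<le> norm (J T t - P T t * (\<Sum>n<M. l n t)) + norm (P T t) * norm (W t - (\<Sum>n<M. l n t))"
        using norm_triangle_ineq4 by (metis norm_mult)
      also have "\<dots> \<le> E M * L T 1 / \<kappa> T ^ M + L T 1 * (2 / \<kappa> T ^ M)"
        using E(2)[OF T, of t M] W norm_P[of t] L1[OF T] by (intro add_mono mult_mono) (auto simp: l_def)
      also have "\<dots> = (E M + 2) * (L T 1 * (1 / \<kappa> T ^ M))" by (simp add: algebra_simps add_divide_distrib)
      also have "\<dots> \<le> E' M * (L T 1 * (1 / \<kappa> T ^ M))"
        using E(1)[of 0] L1[OF T] \<kappa>[OF T] by (intro mult_right_mono) (auto simp: E'_def)
      finally show ?thesis .
    next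
      case False
      have r: "\<kappa> T ^ M \<le> \<bar>\<rho> M\<bar> ^ M" using N(2)[OF M] False \<kappa>[OF T] by (intro power_mono) auto
      have "norm (W t) \<le> (\<Sum>n<N. k n [] * (1 / (\<kappa> T)\<^sup>2) ^ n)" unfolding W_def by (rule sum_norm_le) (rule lb)
      then have W: "norm (W t) \<le> \<bar>D []\<bar>" using N(1)[of "[]"] by simp
      have "norm (J T t - P T t * W t) \<le> norm (J T t) + norm (P T t) * norm (W t)"
        using norm_triangle_ineq4 by (metis norm_mult)
      also have "\<dots> \<le> E 0 * L T 1 + L T 1 * \<bar>D []\<bar>"
        using E(2)[OF T, of t 0] W norm_P[of t] L1[OF T] by (intro add_mono mult_mono) auto
      also have "\<dots> = (E 0 + \<bar>D []\<bar>) * L T 1 * (\<kappa> T ^ M / \<kappa> T ^ M)" using \<kappa>[OF T] by (simp add: algebra_simps)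
      also have "\<dots> \<le> (E 0 + \<bar>D []\<bar>) * L T 1 * (\<bar>\<rho> M\<bar> ^ M / \<kappa> T ^ M)"
        using r E(1)[of 0] L1[OF T] \<kappa>[OF T] by (intro mult_left_mono divide_right_mono) auto
      also have "\<dots> = ((E 0 + \<bar>D []\<bar>) * \<bar>\<rho> M\<bar> ^ M) * (L T 1 * (1 / \<kappa> T ^ M))" by simp
      also have "\<dots> \<le> E' M * (L T 1 * (1 / \<kappa> T ^ M))"
        using E(1)[of M] L1[OF T] \<kappa>[OF T] by (intro mult_right_mono) (auto simp: E'_def)
      finally show ?thesis .
    qed
    show "\<exists>W. smooth_fun (I - {1}) W \<and> (\<forall>t. t(1 := t0 T t) \<notin> K T \<longrightarrow> W t = 0) \<and>
     (\<forall>ks\<in>lists (I - {1}). \<forall>t. prod_list (map (L T) ks) * norm (foldr partial_deriv ks W t) \<le> D ks * X T ^ length ks) \<and>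
     (\<forall>A>0. \<forall>t. norm ((LINT s|lborel. exp (\<i> * complex_of_real (\<phi> T (t(1 := s)))) * w T (t(1 := s)))
        - complex_of_real (L T 1 / y T) * exp (\<i> * complex_of_real (\<phi> T (t(1 := t0 T t)))) * W t)
       \<le> E' (Suc (nat \<lceil>12 * A\<rceil>)) * (L T 1 * (Y T / (X T)\<^sup>2) powr (- A)))"
      unfolding J_def[symmetric] P_def[symmetric]
    proof (intro exI[of _ W] conjI ballI allI impI)
      show "smooth_fun (I - {1}) W" unfolding W_def by (rule smooth_fun_sum) (rule ls)
      show "W t = 0" if "t(1 := t0 T t) \<notin> K T" for t
        unfolding W_def l_def lft_def using that by (simp only: if_False sum.neutral_const)
    next
      fix ks t assume ks: "ks \<in> lists (I - {1})"
      have pos: "0 \<le> prod_list (map (L T) ks)" by (rule less_imp_le[OF prod_list_L_pos[OF T]]) (use ks in auto)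
      have "norm (foldr partial_deriv ks W t) \<le> (\<Sum>n<N. norm (foldr partial_deriv ks (l n) t))"
        unfolding W_def foldr_partial_deriv_sum[where g = l and I = "I - {1}", OF ls ks] by (rule norm_sum)
      then have "prod_list (map (L T) ks) * norm (foldr partial_deriv ks W t) \<le> (\<Sum>n<N. prod_list (map (L T) ks) * norm (foldr partial_deriv ks (l n) t))"
        using pos unfolding sum_distrib_left[symmetric] by (rule mult_left_mono)
      also have "\<dots> \<le> (\<Sum>n<N. k n ks * (1 / (\<kappa> T)\<^sup>2) ^ n * X T ^ length ks)"
        by (rule sum_mono) (use k(2)[OF ks T] in \<open>simp add: l_def mult_ac\<close>)
      also have "\<dots> \<le> D ks * X T ^ length ks"
        unfolding sum_distrib_right[symmetric] using N(1)[OF ks] X[OF T] by (intro mult_right_mono) auto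
      finally show "prod_list (map (L T) ks) * norm (foldr partial_deriv ks W t) \<le> D ks * X T ^ length ks" .
    next
      fix A :: real and t assume A: "0 < A"
      \<comment> \<open>The factor 12 reflects Y/X^2 = \<kappa>^12; the successor ensures M \<ge> 1,
        as the tail estimate asks.\<close>
      define M where "M = Suc (nat \<lceil>12 * A\<rceil>)"
      have "12 * A \<le> real M" unfolding M_def by linarith
      then have "\<kappa> T powr (- real M) \<le> \<kappa> T powr (- (12 * A))" using \<kappa>[OF T] by (intro powr_mono) auto
      moreover have "(Y T / (X T)\<^sup>2) powr (- A) = \<kappa> T powr (- (12 * A))"
        unfolding Y_over_X_sq[OF T] using \<kappa>[OF T] by (simp add: powr_powr powr_numeral[symmetric] del: powr_numeral)
      moreover have "\<kappa> T powr (- real M) = 1 / \<kappa> T ^ M"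
        using \<kappa>[OF T] by (simp add: powr_minus_divide powr_realpow)
      ultimately have le: "1 / \<kappa> T ^ M \<le> (Y T / (X T)\<^sup>2) powr (- A)" by simp
      have "norm (J T t - P T t * W t) \<le> E' M * (L T 1 * (1 / \<kappa> T ^ M))" by (rule bound) (simp add: M_def)
      also have "\<dots> \<le> E' M * (L T 1 * (Y T / (X T)\<^sup>2) powr (- A))"
        using le L1[OF T] E(1)[of M] E(1)[of 0] by (intro mult_left_mono) (auto simp: E'_def)
      finally show "norm (J T t - P T t * W t) \<le> E' (Suc (nat \<lceil>12 * A\<rceil>)) * (L T 1 * (Y T / (X T)\<^sup>2) powr (- A))"
        by (simp only: M_def)
    qed
  qed
qed

end

section \<open>Passage to inert families\<close>

lemma closed_coordinate_box: "closed {x :: nat \<Rightarrow> real. \<forall>i\<in>J. a i \<le> x i \<and> x i \<le> b i}"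
proof -
  have "closed (\<Inter>i\<in>J. {x :: nat \<Rightarrow> real. a i \<le> x i} \<inter> {x. x i \<le> b i})"
    by (intro closed_INT ballI closed_Int closed_Collect_le continuous_on_const continuous_on_product_coordinates)
  also have "(\<Inter>i\<in>J. {x :: nat \<Rightarrow> real. a i \<le> x i} \<inter> {x. x i \<le> b i}) = {x. \<forall>i\<in>J. a i \<le> x i \<and> x i \<le> b i}" by blast
  finally show ?thesis .
qed

text \<open>On the support t_i \<ge> \<alpha> L_i, so a monomial of degree n in the lengths is at
  most \<alpha>^(-n) times the monomial in t that the inert constant measures. Off the support all
  derivatives vanish.\<close>

lemma inert_family_bound:
  assumes w: "inert_family I F X w" and T: "T \<in> F" and "finite I" and "0 < \<alpha>" and ks: "ks \<in> lists I"
    and L: "\<And>i. i \<in> I \<Longrightarrow> 0 < L i" and supp: "\<And>t i. t \<in> fun_support (w T) \<Longrightarrow> i \<in> I \<Longrightarrow> \<alpha> * L i \<le> t i"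
  shows "prod_list (map L ks) * norm (foldr partial_deriv ks (w T) t)
    \<le> enn2real (inert_const I F X w (count (mset ks))) * (1 / \<alpha>) ^ length ks * X T ^ length ks"
proof (cases "t \<in> fun_support (w T)")
  case False
  have "foldr partial_deriv ks (w T) t = 0" by (rule foldr_partial_deriv_off_support[OF False])
  then show ?thesis using w T \<open>0 < \<alpha>\<close> by (auto simp: inert_family_def intro!: mult_nonneg_nonneg intro: order_trans[OF zero_le_one])
next
  case True
  define a where "a = count (mset ks)"
  have X: "1 \<le> X T" and sm: "smooth_fun I (w T)" and fin: "inert_const I F X w a < \<infinity>"
    using w T by (auto simp: inert_family_def)
  have len: "length ks = (\<Sum>i\<in>I. a i)" unfolding a_def by (rule length_eq_sum_count[OF \<open>finite I\<close> ks])
  have t: "0 < t i" if "i \<in> I" for i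
    using supp[OF True that] L[OF that] \<open>0 < \<alpha>\<close> by (meson less_le_trans mult_pos_pos)
  define r where "r = norm ((\<Prod>i\<in>I. t i ^ a i) *\<^sub>R mixed_deriv I a (w T) t) / X T ^ (\<Sum>i\<in>I. a i)"
  have r0: "0 \<le> r" using X by (simp add: r_def)
  have "ennreal r \<le> inert_const I F X w a"
    unfolding inert_const_def r_def by (intro SUP_upper2[OF T] SUP_upper) (use t in simp)
  then have "enn2real (ennreal r) \<le> enn2real (inert_const I F X w a)" using fin by (intro enn2real_mono) auto
  then have r: "r \<le> enn2real (inert_const I F X w a)" using r0 by simp
  have "\<alpha> ^ length ks * prod_list (map L ks) = (\<Prod>i\<in>I. (\<alpha> * L i) ^ a i)"
    unfolding len prod_list_map_eq_prod_count[OF \<open>finite I\<close> ks] a_def[symmetric] power_mult_distrib prod.distrib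
    by (simp add: power_sum)
  also have "\<dots> \<le> (\<Prod>i\<in>I. t i ^ a i)"
    using supp[OF True] L \<open>0 < \<alpha>\<close> by (intro prod_mono conjI power_mono zero_le_power) (auto intro: less_imp_le)
  finally have "\<alpha> ^ length ks * prod_list (map L ks) * norm (mixed_deriv I a (w T) t) \<le> (\<Prod>i\<in>I. t i ^ a i) * norm (mixed_deriv I a (w T) t)"
    by (intro mult_right_mono) auto
  also have "\<dots> = r * X T ^ length ks"
    using X prod_nonneg[of I "\<lambda>i. t i ^ a i"] t by (simp add: r_def len abs_of_nonneg less_imp_le)
  also have "\<dots> \<le> enn2real (inert_const I F X w a) * X T ^ length ks" using r X by (intro mult_right_mono) auto
  finally show ?thesis
    using \<open>0 < \<alpha>\<close> unfolding foldr_partial_deriv_eq_mixed_deriv[OF sm \<open>finite I\<close> ks] a_def[symmetric]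
    by (simp add: field_simps)
qed

text \<open>The converse passage, from lengths to variables, by t_i \<le> \<beta> L_i on the
  support; \<open>expand_index\<close> selects the ordering of the derivatives whose constant is
  read off.\<close>

lemma inert_const_le:
  fixes L :: "'k \<Rightarrow> nat \<Rightarrow> real"
  assumes "finite I" and "0 < \<beta>" and X: "\<And>T. T \<in> F \<Longrightarrow> 1 \<le> X T" and L: "\<And>T i. T \<in> F \<Longrightarrow> i \<in> I \<Longrightarrow> 0 < L T i"
    and supp: "\<And>T t i. T \<in> F \<Longrightarrow> t \<in> fun_support (w T) \<Longrightarrow> i \<in> I \<Longrightarrow> t i \<le> \<beta> * L T i"
    and bound: "\<And>T ks t. T \<in> F \<Longrightarrow> ks \<in> lists I \<Longrightarrow> prod_list (map (L T) ks) * norm (foldr partial_deriv ks (w T) t) \<le> D ks * X T ^ length ks"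
  shows "inert_const I F X w j \<le> ennreal (\<bar>D (expand_index I j)\<bar> * \<beta> ^ (\<Sum>i\<in>I. j i))"
  unfolding inert_const_def
proof (intro SUP_least)
  fix T and x :: "nat \<Rightarrow> real" assume T: "T \<in> F" and "x \<in> {x. \<forall>i\<in>I. 0 < x i}"
  then have x: "\<And>i. i \<in> I \<Longrightarrow> 0 < x i" by auto
  define ks where "ks = expand_index I j"
  have ks: "ks \<in> lists I" unfolding ks_def by (rule expand_index_in_lists[OF assms(1)])
  have count: "count (mset ks) i = j i" if "i \<in> I" for i using that by (simp add: ks_def count_expand_index[OF assms(1)])
  have len: "length ks = (\<Sum>i\<in>I. j i)" unfolding length_eq_sum_count[OF assms(1) ks] by (rule sum.cong) (auto simp: count)
  have pl: "prod_list (map g ks) = (\<Prod>i\<in>I. g i ^ j i)" for g :: "nat \<Rightarrow> real"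
    unfolding prod_list_map_eq_prod_count[OF assms(1) ks] by (rule prod.cong) (auto simp: count)
  have "norm ((\<Prod>i\<in>I. x i ^ j i) *\<^sub>R mixed_deriv I j (w T) x) \<le> (\<bar>D ks\<bar> * \<beta> ^ length ks) * X T ^ length ks"
  proof (cases "x \<in> fun_support (w T)")
    case False
    have "mixed_deriv I j (w T) x = 0" unfolding mixed_deriv_eq_foldr by (rule foldr_partial_deriv_off_support[OF False])
    then show ?thesis using X[OF T] assms(2) by (simp add: order_trans[OF zero_le_one])
  next
    case True
    have "(\<Prod>i\<in>I. x i ^ j i) \<le> (\<Prod>i\<in>I. (\<beta> * L T i) ^ j i)"
      using supp[OF T True] x by (intro prod_mono conjI power_mono zero_le_power) (auto intro: less_imp_le)
    also have "\<dots> = \<beta> ^ length ks * prod_list (map (L T) ks)" unfolding pl len power_mult_distrib prod.distrib by (simp add: power_sum)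
    finally have "norm ((\<Prod>i\<in>I. x i ^ j i) *\<^sub>R mixed_deriv I j (w T) x) \<le> \<beta> ^ length ks * prod_list (map (L T) ks) * norm (foldr partial_deriv ks (w T) x)"
      using prod_nonneg[of I "\<lambda>i. x i ^ j i"] x
      by (auto simp: mixed_deriv_eq_foldr ks_def[symmetric] less_imp_le intro!: mult_right_mono)
    also have "\<dots> = \<beta> ^ length ks * (prod_list (map (L T) ks) * norm (foldr partial_deriv ks (w T) x))" by (simp only: mult.assoc)
    also have "\<dots> \<le> \<beta> ^ length ks * (D ks * X T ^ length ks)" using bound[OF T ks] assms(2) by (intro mult_left_mono) auto
    also have "\<dots> \<le> \<beta> ^ length ks * (\<bar>D ks\<bar> * X T ^ length ks)" using X[OF T] assms(2) by (intro mult_left_mono mult_right_mono) auto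
    finally show ?thesis by (simp only: mult_ac)
  qed
  then show "ennreal (norm ((\<Prod>i\<in>I. x i ^ j i) *\<^sub>R mixed_deriv I j (w T) x) / X T ^ (\<Sum>i\<in>I. j i))
     \<le> ennreal (\<bar>D (expand_index I j)\<bar> * \<beta> ^ (\<Sum>i\<in>I. j i))"
    using X[OF T] by (intro ennreal_leI) (simp add: len ks_def[symmetric] divide_le_eq)
qed

text \<open>Uniformity over all families at once comes from taking every admissible datum as an index.\<close>

lemma uniform_stationary_phase:
  fixes A B :: "nat list \<Rightarrow> real" and \<alpha> \<beta> c :: real
  assumes "finite I" and "1 \<in> I" and "\<alpha> \<le> \<beta>" and "0 < c" and "c \<le> 1" and "\<And>ks. 1 \<le> A ks" and "\<And>ks. 1 \<le> B ks"
  shows "\<exists>D E. \<forall>X Y \<kappa> L w \<phi> t0.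
     phase_family I {()} (\<lambda>_. X) (\<lambda>_. Y) (\<lambda>_. \<kappa>) (\<lambda>_. L) (\<lambda>_. w) (\<lambda>_. \<phi>) (\<lambda>_. t0) A B \<alpha> \<beta> c \<longrightarrow>
     (\<exists>W. smooth_fun (I - {1}) W \<and> (\<forall>t. t(1 := t0 t) \<notin> fun_support w \<longrightarrow> W t = 0) \<and>
       (\<forall>ks\<in>lists (I - {1}). \<forall>t. prod_list (map L ks) * norm (foldr partial_deriv ks W t) \<le> D ks * X ^ length ks) \<and>
       (\<forall>A>0. \<forall>t. norm ((LINT s|lborel. exp (\<i> * complex_of_real (\<phi> (t(1 := s)))) * w (t(1 := s)))
          - complex_of_real (L 1 / (X * \<kappa> ^ 6)) * exp (\<i> * complex_of_real (\<phi> (t(1 := t0 t)))) * W t)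
         \<le> E A * (L 1 * (Y / X\<^sup>2) powr (- A))))"
proof -
  \<comment> \<open>The index is the whole tuple of data, so one application of the locale theorem
    to this single family gives \<open>D\<close> and \<open>E\<close> independent of the
    tuple.\<close>
  define G where "G = {(X, Y, \<kappa>, L, w, \<phi>, t0).
    phase_family I {()} (\<lambda>_. X) (\<lambda>_. Y) (\<lambda>_. \<kappa>) (\<lambda>_. L) (\<lambda>_. w) (\<lambda>_. \<phi>) (\<lambda>_. t0) A B \<alpha> \<beta> c}"
  interpret phase_family I G "\<lambda>(X, Y, \<kappa>, L, w, \<phi>, t0). X" "\<lambda>(X, Y, \<kappa>, L, w, \<phi>, t0). Y" "\<lambda>(X, Y, \<kappa>, L, w, \<phi>, t0). \<kappa>"
    "\<lambda>(X, Y, \<kappa>, L, w, \<phi>, t0). L" "\<lambda>(X, Y, \<kappa>, L, w, \<phi>, t0). w" "\<lambda>(X, Y, \<kappa>, L, w, \<phi>, t0). \<phi>" "\<lambda>(X, Y, \<kappa>, L, w, \<phi>, t0). t0"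
    A B \<alpha> \<beta> c
    using assms unfolding phase_family_def G_def by (intro conjI allI impI) (auto split: prod.splits)
  obtain D E where DE: "\<forall>T\<in>G. case T of (X, Y, \<kappa>, L, w, \<phi>, t0) \<Rightarrow>
     (\<exists>W. smooth_fun (I - {1}) W \<and> (\<forall>t. t(1 := t0 t) \<notin> fun_support w \<longrightarrow> W t = 0) \<and>
       (\<forall>ks\<in>lists (I - {1}). \<forall>t. prod_list (map L ks) * norm (foldr partial_deriv ks W t) \<le> D ks * X ^ length ks) \<and>
       (\<forall>A>0. \<forall>t. norm ((LINT s|lborel. exp (\<i> * complex_of_real (\<phi> (t(1 := s)))) * w (t(1 := s)))
          - complex_of_real (L 1 / (X * \<kappa> ^ 6)) * exp (\<i> * complex_of_real (\<phi> (t(1 := t0 t)))) * W t)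
         \<le> E A * (L 1 * (Y / X\<^sup>2) powr (- A))))"
    using inert_stationary_phase unfolding y_def by (auto simp only: case_prod_unfold)
  show ?thesis
    by (rule exI[of _ D], rule exI[of _ E]) (use DE in \<open>auto simp only: G_def mem_Collect_eq prod.case Ball_def split_paired_All\<close>)
qed

text \<open>Choosing \<open>D\<close> and \<open>E\<close> before the family expresses that the
  implied constants depend only on d, on the inert constants \<open>C\<close> and on the explicit
  constants \<open>B\<close>, \<alpha>, \<beta>, c of the hypotheses. The bound by \<open>D\<close>
  makes the inertness of W uniform in the same sense.\<close>

theorem mainTheorem1:
  fixes d :: nat
    and C :: "(nat \<Rightarrow> nat) \<Rightarrow> ennreal"
    and B :: "(nat \<Rightarrow> nat) \<Rightarrow> real"
    and \<alpha> \<beta> c :: real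
  assumes "1 \<le> d" and "0 < \<alpha>" and "0 < \<beta>" and "0 < c"
  shows "\<exists>(D :: (nat \<Rightarrow> nat) \<Rightarrow> real) (E :: real \<Rightarrow> real).
    \<forall>(F :: 'i set) (X :: 'i \<Rightarrow> real) (Y :: 'i \<Rightarrow> real) (Z :: 'i \<Rightarrow> real) (R :: 'i \<Rightarrow> real)
      (Xs :: 'i \<Rightarrow> nat \<Rightarrow> real)
      (w :: 'i \<Rightarrow> (nat \<Rightarrow> real) \<Rightarrow> complex)
      (\<phi> :: 'i \<Rightarrow> (nat \<Rightarrow> real) \<Rightarrow> real)
      (t0 :: 'i \<Rightarrow> (nat \<Rightarrow> real) \<Rightarrow> real).
      inert_family {1..d} F X w \<longrightarrow>
      inert_const {1..d} F X w = C \<longrightarrow>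
      (\<forall>T\<in>F. 0 < Y T \<and> 0 < Z T \<and> (\<forall>i\<in>{2..d}. 0 < Xs T i)) \<longrightarrow>
      (\<forall>T\<in>F. \<forall>t\<in>fun_support (w T).
         \<alpha> * Z T \<le> t 1 \<and> t 1 \<le> \<beta> * Z T \<and>
         (\<forall>i\<in>{2..d}. \<alpha> * Xs T i \<le> t i \<and> t i \<le> \<beta> * Xs T i)) \<longrightarrow>
      (\<forall>T\<in>F. smooth_fun {1..d} (\<phi> T)) \<longrightarrow>
      (\<forall>T\<in>F. \<forall>t\<in>fun_support (w T). \<forall>a.
         \<bar>mixed_deriv {1..d} a (\<phi> T) t\<bar>
           \<le> B a * (Y T / Z T ^ a 1 * (1 / (\<Prod>i\<in>{2..d}. Xs T i ^ a i)))) \<longrightarrow>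
      (\<forall>T\<in>F. \<forall>t\<in>fun_support (w T).
         c * (Y T / Z T ^ 2) \<le> partial_deriv 1 (partial_deriv 1 (\<phi> T)) t) \<longrightarrow>
      (\<forall>T\<in>F. \<forall>t. (\<exists>s. t(1 := s) \<in> fun_support (w T)) \<longrightarrow>
         partial_deriv 1 (\<phi> T) (t(1 := t0 T t)) = 0 \<and>
         (\<forall>s. t(1 := s) \<in> fun_support (w T) \<and> partial_deriv 1 (\<phi> T) (t(1 := s)) = 0
              \<longrightarrow> s = t0 T t)) \<longrightarrow>
      (\<forall>T\<in>F. depends_only_on {2..d} (t0 T)) \<longrightarrow>
      (\<forall>T\<in>F. R T \<le> Y T / X T ^ 2 \<and> 1 \<le> R T) \<longrightarrow>
      (\<exists>W :: 'i \<Rightarrow> (nat \<Rightarrow> real) \<Rightarrow> complex.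
         inert_family {2..d} F X W \<and>
         (\<forall>j. inert_const {2..d} F X W j \<le> ennreal (D j)) \<and>
         (\<forall>A>0. \<forall>T\<in>F. \<forall>t.
            norm ((LINT s|lborel. exp (\<i> * complex_of_real (\<phi> T (t(1 := s)))) * w T (t(1 := s)))
                  - complex_of_real (Z T / sqrt (Y T))
                    * exp (\<i> * complex_of_real (\<phi> T (t(1 := t0 T t)))) * W T t)
              \<le> E A * (Z T * R T powr (- A))))"
proof -
  define I where "I = {1..d}"
  define J where "J = {2..d}"
  have fin: "finite I" "finite J" and one: "1 \<in> I" and IJ: "I - {1} = J" "I = insert 1 J" "1 \<notin> J"
    using \<open>1 \<le> d\<close> by (auto simp: I_def J_def)
  \<comment> \<open>The power of 1/\<alpha> passes from variables to lengths; adding 1 meets the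
    normalisation \<open>1 \<le> A' ks\<close>.\<close>
  define A' where "A' ks = 1 + enn2real (C (count (mset ks))) * (1 / \<alpha>) ^ length ks" for ks
  define B' where "B' ks = 1 + \<bar>B (count (mset ks))\<bar>" for ks
  \<comment> \<open>The uniform result asks for \<alpha> \<le> \<beta>', whereas \<alpha> \<le>
    \<beta> follows from the hypotheses only when some support is nonempty.\<close>
  define \<beta>' where "\<beta>' = max \<alpha> \<beta>"
  define c' where "c' = min c 1"
  have A'1: "1 \<le> A' ks" and B'1: "1 \<le> B' ks" for ks using \<open>0 < \<alpha>\<close> by (auto simp: A'_def B'_def)
  have "\<alpha> \<le> \<beta>'" "0 < c'" "c' \<le> 1" using \<open>0 < c\<close> by (auto simp: \<beta>'_def c'_def)
  from uniform_stationary_phase[where A = A' and B = B', OF fin(1) one this A'1 B'1]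
  obtain D E where DE: "\<forall>X Y \<kappa> L w \<phi> t0.
     phase_family I {()} (\<lambda>_. X) (\<lambda>_. Y) (\<lambda>_. \<kappa>) (\<lambda>_. L) (\<lambda>_. w) (\<lambda>_. \<phi>) (\<lambda>_. t0) A' B' \<alpha> \<beta>' c' \<longrightarrow>
     (\<exists>W. smooth_fun J W \<and> (\<forall>t. t(1 := t0 t) \<notin> fun_support w \<longrightarrow> W t = 0) \<and>
       (\<forall>ks\<in>lists J. \<forall>t. prod_list (map L ks) * norm (foldr partial_deriv ks W t) \<le> D ks * X ^ length ks) \<and>
       (\<forall>A>0. \<forall>t. norm ((LINT s|lborel. exp (\<i> * complex_of_real (\<phi> (t(1 := s)))) * w (t(1 := s)))
          - complex_of_real (L 1 / (X * \<kappa> ^ 6)) * exp (\<i> * complex_of_real (\<phi> (t(1 := t0 t)))) * W t)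
         \<le> E A * (L 1 * (Y / X\<^sup>2) powr (- A))))"
    unfolding IJ(1) by (elim exE)
  show ?thesis
    unfolding I_def[symmetric] J_def[symmetric]
  \<comment> \<open>The power of \<beta> converts bounds in terms of the lengths into bounds in
    terms of the variables, as in \<open>inert_const_le\<close>.\<close>
  proof (intro exI[of _ "\<lambda>j. \<bar>D (expand_index J j)\<bar> * \<beta> ^ (\<Sum>i\<in>J. j i)"] exI[of _ "\<lambda>A. \<bar>E A\<bar>"] allI impI)
    fix F :: "'i set" and X Y Z R :: "'i \<Rightarrow> real" and Xs :: "'i \<Rightarrow> nat \<Rightarrow> real"
      and w :: "'i \<Rightarrow> (nat \<Rightarrow> real) \<Rightarrow> complex" and \<phi> t0
    assume inert: "inert_family I F X w" and C: "inert_const I F X w = C"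
      and pos: "\<forall>T\<in>F. 0 < Y T \<and> 0 < Z T \<and> (\<forall>i\<in>J. 0 < Xs T i)"
      and supp: "\<forall>T\<in>F. \<forall>t\<in>fun_support (w T). \<alpha> * Z T \<le> t 1 \<and> t 1 \<le> \<beta> * Z T \<and>
         (\<forall>i\<in>J. \<alpha> * Xs T i \<le> t i \<and> t i \<le> \<beta> * Xs T i)"
      and \<phi>: "\<forall>T\<in>F. smooth_fun I (\<phi> T)"
      and bound: "\<forall>T\<in>F. \<forall>t\<in>fun_support (w T). \<forall>a.
         \<bar>mixed_deriv I a (\<phi> T) t\<bar> \<le> B a * (Y T / Z T ^ a 1 * (1 / (\<Prod>i\<in>J. Xs T i ^ a i)))"
      and conv: "\<forall>T\<in>F. \<forall>t\<in>fun_support (w T). c * (Y T / Z T ^ 2) \<le> partial_deriv 1 (partial_deriv 1 (\<phi> T)) t"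
      and crit: "\<forall>T\<in>F. \<forall>t. (\<exists>s. t(1 := s) \<in> fun_support (w T)) \<longrightarrow>
         partial_deriv 1 (\<phi> T) (t(1 := t0 T t)) = 0 \<and>
         (\<forall>s. t(1 := s) \<in> fun_support (w T) \<and> partial_deriv 1 (\<phi> T) (t(1 := s)) = 0 \<longrightarrow> s = t0 T t)"
      and dep: "\<forall>T\<in>F. depends_only_on J (t0 T)"
      and R: "\<forall>T\<in>F. R T \<le> Y T / X T ^ 2 \<and> 1 \<le> R T"
    define L where "L T i = (if i = 1 then Z T else Xs T i)" for T and i :: nat
    \<comment> \<open>The twelfth root of Y/X^2, so that X \<kappa>^6 = sqrt Y; from Y/X^2 \<ge> R
      \<ge> 1 it is at least 1.\<close>
    define \<kappa> where "\<kappa> T = root 6 (sqrt (Y T) / X T)" for T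
    have L: "0 < L T i" if "T \<in> F" "i \<in> I" for T i using pos that by (auto simp: L_def IJ(2))
    have X: "1 \<le> X T" if "T \<in> F" for T using inert that by (simp add: inert_family_def)
    have L_supp: "\<alpha> * L T i \<le> t i \<and> t i \<le> \<beta> * L T i" if "T \<in> F" "t \<in> fun_support (w T)" "i \<in> I" for T t i
      using supp that by (auto simp: L_def IJ(2))
    have \<kappa>6: "X T * \<kappa> T ^ 6 = sqrt (Y T)" if T: "T \<in> F" for T
    proof -
      have "0 \<le> sqrt (Y T) / X T" using X[OF T] pos T by (simp add: less_imp_le)
      then have "\<kappa> T ^ 6 = sqrt (Y T) / X T" by (simp add: \<kappa>_def)
      then show ?thesis using X[OF T] by simp
    qed
    have family: "phase_family I {()} (\<lambda>_. X T) (\<lambda>_. Y T) (\<lambda>_. \<kappa> T) (\<lambda>_. L T) (\<lambda>_. w T) (\<lambda>_. \<phi> T) (\<lambda>_. t0 T) A' B' \<alpha> \<beta>' c'"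
      if T: "T \<in> F" for T
    proof
      have YZ: "0 < Y T" "0 < Z T" using pos T by auto
      show "Y T = (X T * \<kappa> T ^ 6)\<^sup>2" unfolding \<kappa>6[OF T] using YZ by simp
      show "1 \<le> \<kappa> T"
      proof -
        have "1 \<le> Y T / (X T)\<^sup>2" using R T order_trans by blast
        then have "(X T)\<^sup>2 \<le> Y T" using X[OF T] by (simp add: le_divide_eq split: if_splits)
        then have "X T \<le> sqrt (Y T)" by (rule real_le_rsqrt)
        then show ?thesis using X[OF T] by (simp add: \<kappa>_def)
      qed
      show "smooth_fun I (w T)" using inert T by (simp add: inert_family_def)
      show "prod_list (map (L T) ks) * norm (foldr partial_deriv ks (w T) t) \<le> A' ks * X T ^ length ks"
        if ks: "ks \<in> lists I" for ks t
      proof -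
        have "prod_list (map (L T) ks) * norm (foldr partial_deriv ks (w T) t) \<le> enn2real (C (count (mset ks))) * (1 / \<alpha>) ^ length ks * X T ^ length ks"
          unfolding C[symmetric] by (rule inert_family_bound[OF inert T fin(1) \<open>0 < \<alpha>\<close> ks L[OF T]]) (use L_supp[OF T] in auto)
        also have "\<dots> \<le> A' ks * X T ^ length ks" using X[OF T] by (intro mult_right_mono) (auto simp: A'_def)
        finally show ?thesis .
      qed
      show "prod_list (map (L T) ks) * \<bar>foldr partial_deriv ks (\<phi> T) t\<bar> \<le> B' ks * Y T"
        if ks: "ks \<in> lists I" and t: "t \<in> fun_support (w T)" for ks t
      proof -
        define a where "a = count (mset ks)"
        have "(\<Prod>i\<in>J. L T i ^ a i) = (\<Prod>i\<in>J. Xs T i ^ a i)" using IJ(3) by (intro prod.cong) (auto simp: L_def)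
        then have P: "prod_list (map (L T) ks) = Z T ^ a 1 * (\<Prod>i\<in>J. Xs T i ^ a i)"
          unfolding prod_list_map_eq_prod_count[OF fin(1) ks] IJ(2) a_def[symmetric]
          using fin(2) IJ(3) by (subst prod.insert) (auto simp: L_def)
        have p: "0 < Z T ^ a 1" "0 < (\<Prod>i\<in>J. Xs T i ^ a i)" using pos T by (auto intro!: prod_pos)
        have \<phi>T: "smooth_fun I (\<phi> T)" using \<phi> T by blast
        have "\<bar>foldr partial_deriv ks (\<phi> T) t\<bar> \<le> B a * (Y T / Z T ^ a 1 * (1 / (\<Prod>i\<in>J. Xs T i ^ a i)))"
          unfolding foldr_partial_deriv_eq_mixed_deriv[OF \<phi>T fin(1) ks] a_def[symmetric]
          using bound T t by blast
        then have "prod_list (map (L T) ks) * \<bar>foldr partial_deriv ks (\<phi> T) t\<bar>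
            \<le> prod_list (map (L T) ks) * (B a * (Y T / Z T ^ a 1 * (1 / (\<Prod>i\<in>J. Xs T i ^ a i))))"
          unfolding P using p by (intro mult_left_mono) auto
        also have "\<dots> = B a * Y T" unfolding P using p YZ by (simp add: field_simps)
        also have "\<dots> \<le> B' ks * Y T" using YZ by (intro mult_right_mono) (auto simp: B'_def a_def)
        finally show ?thesis .
      qed
      show "\<alpha> * L T 1 \<le> t 1 \<and> t 1 \<le> \<beta>' * L T 1" if "t \<in> fun_support (w T)" for t
      proof -
        have "\<beta> * L T 1 \<le> \<beta>' * L T 1" using L[OF T one] by (intro mult_right_mono) (auto simp: \<beta>'_def)
        then show ?thesis using L_supp[OF T that one] by linarith
      qed
      show "c' * Y T \<le> L T 1 ^ 2 * partial_deriv 1 (partial_deriv 1 (\<phi> T)) t" if t: "t \<in> fun_support (w T)" for t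
      proof -
        have "c' * Y T \<le> c * Y T" using YZ by (intro mult_right_mono) (auto simp: c'_def)
        also have "\<dots> = Z T ^ 2 * (c * (Y T / Z T ^ 2))" using YZ by simp
        also have "\<dots> \<le> Z T ^ 2 * partial_deriv 1 (partial_deriv 1 (\<phi> T)) t" using conv T t by (intro mult_left_mono) auto
        finally show ?thesis by (simp only: L_def simp_thms if_True)
      qed
      show "partial_deriv 1 (\<phi> T) (t(1 := t0 T t)) = 0" if "t(1 := s) \<in> fun_support (w T)" for t s
        using crit T that by blast
      show "s = t0 T t" if "t(1 := s) \<in> fun_support (w T)" "partial_deriv 1 (\<phi> T) (t(1 := s)) = 0" for t s
        using crit T that by blast
      show "depends_only_on (I - {1}) (t0 T)" unfolding IJ(1) using dep T by blast
    qed (use fin one \<open>\<alpha> \<le> \<beta>'\<close> \<open>0 < c'\<close> \<open>c' \<le> 1\<close> A'1 B'1 X[OF T] L[OF T] \<phi> T in blast)+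
    have "\<forall>T. \<exists>W. T \<in> F \<longrightarrow> smooth_fun J W \<and> (\<forall>t. t(1 := t0 T t) \<notin> fun_support (w T) \<longrightarrow> W t = 0) \<and>
       (\<forall>ks\<in>lists J. \<forall>t. prod_list (map (L T) ks) * norm (foldr partial_deriv ks W t) \<le> D ks * X T ^ length ks) \<and>
       (\<forall>A>0. \<forall>t. norm ((LINT s|lborel. exp (\<i> * complex_of_real (\<phi> T (t(1 := s)))) * w T (t(1 := s)))
          - complex_of_real (L T 1 / (X T * \<kappa> T ^ 6)) * exp (\<i> * complex_of_real (\<phi> T (t(1 := t0 T t)))) * W t)
         \<le> E A * (L T 1 * (Y T / (X T)\<^sup>2) powr (- A)))" (is "\<forall>T. \<exists>W. ?P T W")
    proof
      fix T
      show "\<exists>W. ?P T W"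
      proof (cases "T \<in> F")
        case True
        from DE[rule_format, OF family[OF True]] show ?thesis by blast
      qed simp
    qed
    then have "\<exists>W. \<forall>T. ?P T (W T)" by (rule choice)
    then obtain W where W: "\<forall>T. ?P T (W T)" ..
    have W_supp: "t(1 := t0 T t) \<in> fun_support (w T)" if "T \<in> F" "W T t \<noteq> 0" for T t using W that by blast
    \<comment> \<open>W is nonzero only over fibres whose critical point lies in the support of w.
      That point shares the coordinates in \<open>J\<close> with t, so a closed box in these
      coordinates that contains the support of w also contains that of W.\<close>
    have W_box: "fun_support (W T) \<subseteq> {x. \<forall>i\<in>J. a i \<le> x i \<and> x i \<le> b i}"
      if T: "T \<in> F" and box: "\<And>t. t \<in> fun_support (w T) \<Longrightarrow> \<forall>i\<in>J. a i \<le> t i \<and> t i \<le> b i" for T a b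
      unfolding fun_support_def[of "W T"]
    proof (rule closure_minimal[OF _ closed_coordinate_box], rule subsetI)
      fix t assume "t \<in> {x. W T x \<noteq> 0}"
      then have "\<forall>i\<in>J. a i \<le> (t(1 := t0 T t)) i \<and> (t(1 := t0 T t)) i \<le> b i" by (intro box W_supp[OF T]) simp
      then show "t \<in> {x. \<forall>i\<in>J. a i \<le> x i \<and> x i \<le> b i}" using IJ(3) by (auto split: if_splits)
    qed
    have const: "inert_const J F X W j \<le> ennreal (\<bar>D (expand_index J j)\<bar> * \<beta> ^ (\<Sum>i\<in>J. j i))" for j
    proof (rule inert_const_le[OF fin(2) \<open>0 < \<beta>\<close> X, where L = L])
      show "0 < L T i" if "T \<in> F" "i \<in> J" for T i using L that by (simp add: IJ(2))
      show "t i \<le> \<beta> * L T i" if T: "T \<in> F" and t: "t \<in> fun_support (W T)" and i: "i \<in> J" for T t i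
      proof -
        have "fun_support (W T) \<subseteq> {x. \<forall>i\<in>J. \<alpha> * L T i \<le> x i \<and> x i \<le> \<beta> * L T i}"
          by (rule W_box[OF T]) (use L_supp[OF T] in \<open>simp add: IJ(2)\<close>)
        then show ?thesis using t i by blast
      qed
      show "prod_list (map (L T) ks) * norm (foldr partial_deriv ks (W T) t) \<le> D ks * X T ^ length ks"
        if "T \<in> F" "ks \<in> lists J" for T ks t using W that by blast
    qed
    show "\<exists>W. inert_family J F X W \<and>
         (\<forall>j. inert_const J F X W j \<le> ennreal (\<bar>D (expand_index J j)\<bar> * \<beta> ^ (\<Sum>i\<in>J. j i))) \<and>
         (\<forall>A>0. \<forall>T\<in>F. \<forall>t.
            norm ((LINT s|lborel. exp (\<i> * complex_of_real (\<phi> T (t(1 := s)))) * w T (t(1 := s)))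
                  - complex_of_real (Z T / sqrt (Y T))
                    * exp (\<i> * complex_of_real (\<phi> T (t(1 := t0 T t)))) * W T t)
              \<le> \<bar>E A\<bar> * (Z T * R T powr (- A)))"
    proof (rule exI[of _ W], intro conjI allI impI ballI)
      show "inert_family J F X W"
        unfolding inert_family_def
      proof (intro conjI ballI allI)
        fix T assume T: "T \<in> F"
        show "1 \<le> X T" by (rule X[OF T])
        show "smooth_fun J (W T)" using W T by blast
        from inert T obtain a where a: "\<forall>i\<in>I. 0 < a i" and box: "fun_support (w T) \<subseteq> {x. \<forall>i\<in>I. a i \<le> x i \<and> x i \<le> 2 * a i}"
          unfolding inert_family_def by blast
        have "fun_support (W T) \<subseteq> {x. \<forall>i\<in>J. a i \<le> x i \<and> x i \<le> 2 * a i}"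
          by (rule W_box[OF T]) (use box in \<open>auto simp: IJ(2)\<close>)
        then show "\<exists>a. (\<forall>i\<in>J. 0 < a i) \<and> fun_support (W T) \<subseteq> {x. \<forall>i\<in>J. a i \<le> x i \<and> x i \<le> 2 * a i}"
          using a by (intro exI[of _ a]) (simp add: IJ(2))
      next
        fix j
        show "inert_const J F X W j < \<infinity>" using le_less_trans[OF const[of j] ennreal_less_top] by simp
      qed
      show "inert_const J F X W j \<le> ennreal (\<bar>D (expand_index J j)\<bar> * \<beta> ^ (\<Sum>i\<in>J. j i))" for j by (rule const)
    next
      fix A :: real and T t assume A: "0 < A" and T: "T \<in> F"
      have Z: "0 < Z T" and RT: "R T \<le> Y T / (X T)\<^sup>2" "1 \<le> R T" using pos R T by auto
      have LZ: "L T 1 = Z T" by (simp add: L_def)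
      have le: "(Y T / (X T)\<^sup>2) powr (- A) \<le> R T powr (- A)" using RT A by (intro powr_mono2') auto
      have "norm ((LINT s|lborel. exp (\<i> * complex_of_real (\<phi> T (t(1 := s)))) * w T (t(1 := s)))
          - complex_of_real (L T 1 / (X T * \<kappa> T ^ 6)) * exp (\<i> * complex_of_real (\<phi> T (t(1 := t0 T t)))) * W T t)
         \<le> E A * (L T 1 * (Y T / (X T)\<^sup>2) powr (- A))"
        using W T A by blast
      also have "\<dots> \<le> \<bar>E A\<bar> * (L T 1 * R T powr (- A))"
        using le Z unfolding LZ by (intro mult_mono) auto
      finally show "norm ((LINT s|lborel. exp (\<i> * complex_of_real (\<phi> T (t(1 := s)))) * w T (t(1 := s)))
          - complex_of_real (Z T / sqrt (Y T)) * exp (\<i> * complex_of_real (\<phi> T (t(1 := t0 T t)))) * W T t)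
        \<le> \<bar>E A\<bar> * (Z T * R T powr (- A))"
        unfolding LZ \<kappa>6[OF T] .
    qed
  qed
qed

end
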